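(* Let $s\in(0,1)$, $m\ge 2$, $T>0$, let $v_0:\mathbb{R}\to\mathbb{R}$ be nondecreasing, and let the weights of the discretization satisfy $(A_c)$ and $(A_m)$. Let $\{V_h\}_{h>0}$ be the family of solutions of the scheme with mesh sizes $h$ and $\tau=\tau(h)$ and initial data $V_i^0=v_0(x_i)$, and let $\overline V_h:\overline{Q_T}\to\mathbb{R}$ be the corresponding interpolants (all as described in the context). (a) (Continuous case) Assume $v_0\in BUC(\mathbb{R})$ and (CFL1) (respectively $v_0\in W^{1,\infty}(\mathbb{R})$ and (CFL2)). Then: (i) (Convergence) There exists a limit $v\in BUC(\overline{Q_T})$ (respectively $v\in C([0,T];W^{1,\infty}(\mathbb{R}))$) such that $\overline V_h\to v$ locally uniformly in $\overline{Q_T}$ as $h\to0$. (ii) (Limit) The limit $v$ from (i) is the unique viscosity solution of (IP)–(IC$_v$). (b) (Jump discontinuity) Assume (CFL1) and that, for some $M>0$ and $a\in\mathbb{R}$, $v_0(x)=0$ for $x<a$ and $v_0(x)=M$ for $x\ge a$. Then: (i) (Convergence) There exists a limit $v\in C_b(\overline{Q_T}\setminus\{(a,0)\})$ such that $\overline V_h\to v$ locally uniformly in $\overline{Q_T}\setminus\{(a,0)\}$ as $h\to0$. (ii) (Limit) The limit $v$ from (i) is the unique discontinuous viscosity solution of (IP)–(IC$_v$).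
   Context: **Equation.** $Q_T=\mathbb{R}\times(0,T)$, $\overline{Q_T}=\mathbb{R}\times[0,T]$. The problem (IP)–(IC$_v$) is $$\partial_t v+|\partial_x v|^{m-1}(-\Delta)^s v=0\ \text{ in } Q_T,\qquad v(\cdot,0)=v_0\ \text{ in }\mathbb{R},$$ with $(-\Delta)^s\phi(x)=c_{1,s}\,\mathrm{P.V.}\int_{|y|>0}(\phi(x)-\phi(x+y))\frac{dy}{|y|^{1+2s}}$ (in the $x$ variable), $c_{1,s}=\frac{2^{2s}\Gamma(\frac{1+2s}{2})}{\pi^{1/2}|\Gamma(-s)|}$. $BUC$ = bounded uniformly continuous functions, $C_b$ = bounded continuous functions. **Viscosity solutions.** For locally bounded $f$, $f^*(\xi)=\limsup_{\eta\to\xi}f(\eta)$, $f_*(\xi)=\liminf_{\eta\to\xi}f(\eta)$. A bounded upper (resp. lower) semicontinuous $v:\overline{Q_T}\to\mathbb{R}$ is a viscosity subsolution (resp. supersolution) of (IP)–(IC$_v$) if: (i) for every $\phi\in C^2\cap C_b(Q_T)$ and every global maximum (resp. minimum) point $(x_0,t_0)$ in $Q_T$ of $v-\phi$: $\phi_t(x_0,t_0)+|\phi_x(x_0,t_0)|^{m-1}(-\Delta)^s\phi(x_0,t_0)\le0$ (resp. $\ge0$); (ii) for every $\phi\in C^2\cap C_b(\overline{Q_T})$ and every global maximum (resp. minimum) point over $\overline{Q_T}$ of $v-\phi$ of the form $(x_0,0)$: $\min\{v(x_0,0)-(v_0)^*(x_0),\ \phi_t(x_0,0)+|\phi_x(x_0,0)|^{m-1}(-\Delta)^s\phi(x_0,0)\}\le0$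 (resp. $\max\{v(x_0,0)-(v_0)_*(x_0),\ \phi_t(x_0,0)+|\phi_x(x_0,0)|^{m-1}(-\Delta)^s\phi(x_0,0)\}\ge0$). A viscosity solution is a $v\in C_b(\overline{Q_T})$ that is both sub- and supersolution. A bounded function $v$ is a discontinuous viscosity solution if $v^*$ is a viscosity subsolution and $v_*$ is a viscosity supersolution. **Scheme.** $h>0$; $\tau=\tau(h)=T/J$ with $J=J(h)\in\mathbb{N}$; $x_i=ih$ ($i\in\mathbb{Z}$), $t_j=j\tau$. For each $h$ there are weights $\omega_k=\omega_k(h)$, $k\in\mathbb{Z}\setminus\{0\}$, with $\omega_k=\omega_{-k}\ge0$. For functions $\phi:\mathbb{R}\to\mathbb{R}$, $(-\Delta)^s_h\phi(x)=\sum_{k\ne0}(\phi(x)-\phi(x+x_k))\omega_k$; for grid functions $\phi=(\phi_i)_{i\in\mathbb{Z}}$, $$(-\Delta)_h^s\phi_i=\sum_{k\neq0}(\phi_i-\phi_{i+k})\omega_k,\qquad D_h\phi_i=\begin{cases}\frac{\phi_{i+1}-\phi_i}{h}&\text{if }(-\Delta)^s_h\phi_i\le0,\\ \frac{\phi_i-\phi_{i-1}}{h}&\text{if }(-\Delta)^s_h\phi_i>0,\end{cases}\qquad L^s_h[\phi]_i=-\max\{D_h\phi_i,0\}^{m-1}(-\Delta)^s_h\phi_i.$$ The scheme is $V_i^{j+1}=V_i^j+\tau L_h^s[V^j_\cdot]_i$, $V_i^0=v_0(x_i)$. Interpolant: $\overline V_h(x,t)=\frac{x_i-x}{h}V^j_{i-1}+\frac{x-x_{i-1}}{h}V_i^j$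 for $(x,t)\in[x_{i-1},x_i)\times[t_j,t_{j+1})$. **Assumptions.** $(A_c)$: for every $\phi\in C^2\cap C_b(\mathbb{R})$, $(-\Delta)^s_h\phi\to(-\Delta)^s\phi$ locally uniformly as $h\to0^+$. $(A_m)$: there is $C_s>0$ with $\sum_{k\ne0}\omega_k\le C_sh^{-2s}$, $\sum_{|kh|>1}\omega_k\le C_s$, and $\sum_{0<|kh|\le1}|hk|\omega_k\le C_s\rho_s(h)$, where $\rho_s(h)=h^{1-2s}$ if $s>\frac12$, $|\log h|$ if $s=\frac12$, $1$ if $s<\frac12$. (CFL1): $\|v_0\|_\infty\le M$ and $\tau\le C_1h^{2s+m-1}$ with $C_1^{-1}=C_sm(2M)^{m-1}$. (CFL2): $\|v_0\|_\infty\le M$, $\|\partial_xv_0\|_\infty\le L$ and $\tau\le C_2h^{\max\{2s,1\}}f_s(h)$ with $C_2^{-1}=C_smL^{m-2}\max\{L,2M\}$, where $f_s(h)=1$ if $s\neq\frac12$ and $f_s(h)=1/|\log h|$ if $s=\frac12$. Here $M,L$ are constants.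
   Formalization: In (a), C([0,T];W^{1,∞}) means v sup-norm continuous in t with v_x bounded and weak-* continuous in t (norm continuity fails when v_0' jumps); in (b), uniqueness is away from (a,0), and at t=T only where the competing solution is continuous. *)

theory Defs
  imports "HOL-Analysis.Analysis"
begin

section \<open>Function spaces\<close>

definition BUC_on :: "'a::metric_space set \<Rightarrow> ('a \<Rightarrow> real) \<Rightarrow> bool" where
  "BUC_on S f \<longleftrightarrow> bounded (f ` S) \<and> uniformly_continuous_on S f"

definition Cb_on :: "'a::topological_space set \<Rightarrow> ('a \<Rightarrow> real) \<Rightarrow> bool" where
  "Cb_on S f \<longleftrightarrow> bounded (f ` S) \<and> continuous_on S f"

definition C2_real :: "(real \<Rightarrow> real) \<Rightarrow> bool" where
  "C2_real f \<longleftrightarrow> (\<exists>f1 f2. (\<forall>x. (f has_real_derivative f1 x) (at x)) \<and>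
     (\<forall>x. (f1 has_real_derivative f2 x) (at x)) \<and> continuous_on UNIV f2)"

text \<open>For the open strip this is the usual \<open>C\<^sup>2\<close>; for the closed strip, where the derivatives are
  relative to \<open>S\<close>, it is \<open>C\<^sup>2\<close> up to the boundary.\<close>

definition C2_on :: "(real \<times> real) set \<Rightarrow> (real \<times> real \<Rightarrow> real) \<Rightarrow> bool" where
  "C2_on S f \<longleftrightarrow> (\<exists>fx ft fxx fxt ftx ftt.
     (\<forall>p\<in>S. (f has_derivative (\<lambda>(u, w). fx p * u + ft p * w)) (at p within S) \<and>
            (fx has_derivative (\<lambda>(u, w). fxx p * u + fxt p * w)) (at p within S) \<and>
            (ft has_derivative (\<lambda>(u, w). ftx p * u + ftt p * w)) (at p within S)) \<and>
     continuous_on S fxx \<and> continuous_on S fxt \<and> continuous_on S ftx \<and> continuous_on S ftt)"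

definition Linf :: "(real \<Rightarrow> real) \<Rightarrow> bool" where
  "Linf f \<longleftrightarrow> f \<in> borel_measurable borel \<and> (\<exists>C. AE x in lborel. \<bar>f x\<bar> \<le> C)"

definition test_fun :: "(real \<Rightarrow> real) \<Rightarrow> bool" where
  "test_fun \<phi> \<longleftrightarrow> (\<forall>x. \<phi> differentiable (at x)) \<and> continuous_on UNIV (deriv \<phi>) \<and>
     (\<exists>R. \<forall>x. \<bar>x\<bar> > R \<longrightarrow> \<phi> x = 0)"

text \<open>\<open>f \<in> W\<^sup>1\<^sup>,\<^sup>\<infinity>(\<real>)\<close> with weak derivative \<open>g\<close>, tested against \<open>C\<^sup>1\<close> functions with compact support.\<close>

definition W1inf_deriv :: "(real \<Rightarrow> real) \<Rightarrow> (real \<Rightarrow> real) \<Rightarrow> bool" where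
  "W1inf_deriv f g \<longleftrightarrow> Linf f \<and> Linf g \<and>
     (\<forall>\<phi>. test_fun \<phi> \<longrightarrow> (LINT x|lborel. f x * deriv \<phi> x) = - (LINT x|lborel. g x * \<phi> x))"

definition W1inf :: "(real \<Rightarrow> real) \<Rightarrow> bool" where
  "W1inf f \<longleftrightarrow> (\<exists>g. W1inf_deriv f g)"

text \<open>\<open>C([0,T]; W\<^sup>1\<^sup>,\<^sup>\<infinity>(\<real>))\<close>, where \<open>v(\<cdot>,t)\<close> varies continuously in the supremum norm and its weak
  derivative, bounded uniformly in \<open>t\<close>, varies continuously in the weak-star topology of
  \<open>L\<^sup>\<infinity> = (L\<^sup>1)*\<close>. The norm topology cannot be meant for the derivative: for \<open>m = 2\<close> the derivative
  of the solution solves a porous medium equation with fractional pressure and is continuous for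
  positive times, hence does not converge in \<open>L\<^sup>\<infinity>\<close> to a discontinuous initial derivative.\<close>

definition C_W1inf :: "real \<Rightarrow> (real \<times> real \<Rightarrow> real) \<Rightarrow> bool" where
  "C_W1inf T v \<longleftrightarrow>
     (\<forall>t0\<in>{0..T}. uniform_limit UNIV (\<lambda>t x. v (x, t)) (\<lambda>x. v (x, t0)) (at t0 within {0..T})) \<and>
     (\<exists>vx C. (\<forall>t\<in>{0..T}. W1inf_deriv (\<lambda>x. v (x, t)) (\<lambda>x. vx (x, t)) \<and>
                          (AE x in lborel. \<bar>vx (x, t)\<bar> \<le> C)) \<and>
       (\<forall>g. integrable lborel g \<longrightarrow> continuous_on {0..T} (\<lambda>t. LINT x|lborel. g x * vx (x, t))))"


section \<open>The equation\<close>

definition Q :: "real \<Rightarrow> (real \<times> real) set" where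
  "Q T = UNIV \<times> {0<..<T}"

definition Qbar :: "real \<Rightarrow> (real \<times> real) set" where
  "Qbar T = UNIV \<times> {0..T}"

definition c1 :: "real \<Rightarrow> real" where
  "c1 s = 2 powr (2 * s) * Gamma ((1 + 2 * s) / 2) / (pi powr (1 / 2) * \<bar>Gamma (- s)\<bar>)"

definition frac_lap :: "real \<Rightarrow> (real \<Rightarrow> real) \<Rightarrow> real \<Rightarrow> real" where
  "frac_lap s \<phi> x = c1 s * Lim (at_right 0)
     (\<lambda>\<epsilon>. LINT y:{y. \<bar>y\<bar> > \<epsilon>}|lborel. (\<phi> x - \<phi> (x + y)) / \<bar>y\<bar> powr (1 + 2 * s))"

text \<open>The time derivative is one-sided at \<open>t = 0\<close> and \<open>t = T\<close>.\<close>

definition dt :: "real \<Rightarrow> (real \<times> real \<Rightarrow> real) \<Rightarrow> real \<Rightarrow> real \<Rightarrow> real" where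
  "dt T \<phi> x t = vector_derivative (\<lambda>r. \<phi> (x, r)) (at t within {0..T})"

definition dx :: "(real \<times> real \<Rightarrow> real) \<Rightarrow> real \<Rightarrow> real \<Rightarrow> real" where
  "dx \<phi> x t = deriv (\<lambda>y. \<phi> (y, t)) x"

definition eq_op :: "real \<Rightarrow> real \<Rightarrow> real \<Rightarrow> (real \<times> real \<Rightarrow> real) \<Rightarrow> real \<Rightarrow> real \<Rightarrow> real" where
  "eq_op m s T \<phi> x t = dt T \<phi> x t + \<bar>dx \<phi> x t\<bar> powr (m - 1) * frac_lap s (\<lambda>y. \<phi> (y, t)) x"


section \<open>Viscosity solutions\<close>

definition usc_on :: "'a::topological_space set \<Rightarrow> ('a \<Rightarrow> real) \<Rightarrow> bool" where
  "usc_on S f \<longleftrightarrow> (\<forall>p\<in>S. \<forall>c>f p. \<forall>\<^sub>F q in at p within S. f q < c)"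

definition lsc_on :: "'a::topological_space set \<Rightarrow> ('a \<Rightarrow> real) \<Rightarrow> bool" where
  "lsc_on S f \<longleftrightarrow> (\<forall>p\<in>S. \<forall>c<f p. \<forall>\<^sub>F q in at p within S. c < f q)"

text \<open>Semicontinuous envelopes of a locally bounded function on \<open>S\<close>; the point \<open>p\<close> itself takes
  part in the limits, so that \<open>f\<^sub>* \<le> f \<le> f\<^sup>*\<close> on \<open>S\<close>.\<close>

definition usc_env :: "'a::topological_space set \<Rightarrow> ('a \<Rightarrow> real) \<Rightarrow> 'a \<Rightarrow> real" where
  "usc_env S f p = real_of_ereal (Limsup (inf (nhds p) (principal S)) (\<lambda>q. ereal (f q)))"

definition lsc_env :: "'a::topological_space set \<Rightarrow> ('a \<Rightarrow> real) \<Rightarrow> 'a \<Rightarrow> real" where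
  "lsc_env S f p = real_of_ereal (Liminf (inf (nhds p) (principal S)) (\<lambda>q. ereal (f q)))"

definition max_point :: "'a set \<Rightarrow> ('a \<Rightarrow> real) \<Rightarrow> 'a \<Rightarrow> bool" where
  "max_point S f p \<longleftrightarrow> p \<in> S \<and> (\<forall>q\<in>S. f q \<le> f p)"

definition min_point :: "'a set \<Rightarrow> ('a \<Rightarrow> real) \<Rightarrow> 'a \<Rightarrow> bool" where
  "min_point S f p \<longleftrightarrow> p \<in> S \<and> (\<forall>q\<in>S. f p \<le> f q)"

definition visc_subsol ::
    "real \<Rightarrow> real \<Rightarrow> real \<Rightarrow> (real \<Rightarrow> real) \<Rightarrow> (real \<times> real \<Rightarrow> real) \<Rightarrow> bool" where
  "visc_subsol m s T v0 v \<longleftrightarrow> bounded (v ` Qbar T) \<and> usc_on (Qbar T) v \<and>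
     (\<forall>\<phi> x0 t0. C2_on (Q T) \<phi> \<and> Cb_on (Q T) \<phi> \<and> max_point (Q T) (\<lambda>p. v p - \<phi> p) (x0, t0) \<longrightarrow>
        eq_op m s T \<phi> x0 t0 \<le> 0) \<and>
     (\<forall>\<phi> x0. C2_on (Qbar T) \<phi> \<and> Cb_on (Qbar T) \<phi> \<and> max_point (Qbar T) (\<lambda>p. v p - \<phi> p) (x0, 0) \<longrightarrow>
        min (v (x0, 0) - usc_env UNIV v0 x0) (eq_op m s T \<phi> x0 0) \<le> 0)"

definition visc_supersol ::
    "real \<Rightarrow> real \<Rightarrow> real \<Rightarrow> (real \<Rightarrow> real) \<Rightarrow> (real \<times> real \<Rightarrow> real) \<Rightarrow> bool" where
  "visc_supersol m s T v0 v \<longleftrightarrow> bounded (v ` Qbar T) \<and> lsc_on (Qbar T) v \<and>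
     (\<forall>\<phi> x0 t0. C2_on (Q T) \<phi> \<and> Cb_on (Q T) \<phi> \<and> min_point (Q T) (\<lambda>p. v p - \<phi> p) (x0, t0) \<longrightarrow>
        eq_op m s T \<phi> x0 t0 \<ge> 0) \<and>
     (\<forall>\<phi> x0. C2_on (Qbar T) \<phi> \<and> Cb_on (Qbar T) \<phi> \<and> min_point (Qbar T) (\<lambda>p. v p - \<phi> p) (x0, 0) \<longrightarrow>
        max (v (x0, 0) - lsc_env UNIV v0 x0) (eq_op m s T \<phi> x0 0) \<ge> 0)"

definition visc_sol ::
    "real \<Rightarrow> real \<Rightarrow> real \<Rightarrow> (real \<Rightarrow> real) \<Rightarrow> (real \<times> real \<Rightarrow> real) \<Rightarrow> bool" where
  "visc_sol m s T v0 v \<longleftrightarrow>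
     Cb_on (Qbar T) v \<and> visc_subsol m s T v0 v \<and> visc_supersol m s T v0 v"

definition disc_visc_sol ::
    "real \<Rightarrow> real \<Rightarrow> real \<Rightarrow> (real \<Rightarrow> real) \<Rightarrow> (real \<times> real \<Rightarrow> real) \<Rightarrow> bool" where
  "disc_visc_sol m s T v0 v \<longleftrightarrow> bounded (v ` Qbar T) \<and>
     visc_subsol m s T v0 (usc_env (Qbar T) v) \<and> visc_supersol m s T v0 (lsc_env (Qbar T) v)"


section \<open>The scheme\<close>

text \<open>Throughout, \<open>w k\<close> is the weight with index \<open>k \<noteq> 0\<close> for one mesh size; \<open>w 0\<close> is not used.\<close>

definition lap_h :: "(int \<Rightarrow> real) \<Rightarrow> real \<Rightarrow> (real \<Rightarrow> real) \<Rightarrow> real \<Rightarrow> real" where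
  "lap_h w h \<phi> x = (\<Sum>\<^sub>\<infinity>k\<in>UNIV - {0}. (\<phi> x - \<phi> (x + of_int k * h)) * w k)"

definition lap_grid :: "(int \<Rightarrow> real) \<Rightarrow> (int \<Rightarrow> real) \<Rightarrow> int \<Rightarrow> real" where
  "lap_grid w u i = (\<Sum>\<^sub>\<infinity>k\<in>UNIV - {0}. (u i - u (i + k)) * w k)"

definition D_h :: "(int \<Rightarrow> real) \<Rightarrow> real \<Rightarrow> (int \<Rightarrow> real) \<Rightarrow> int \<Rightarrow> real" where
  "D_h w h u i =
     (if lap_grid w u i \<le> 0 then (u (i + 1) - u i) / h else (u i - u (i - 1)) / h)"

definition L_h :: "real \<Rightarrow> (int \<Rightarrow> real) \<Rightarrow> real \<Rightarrow> (int \<Rightarrow> real) \<Rightarrow> int \<Rightarrow> real" where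
  "L_h m w h u i = - (max (D_h w h u i) 0 powr (m - 1)) * lap_grid w u i"

primrec scheme ::
    "real \<Rightarrow> (int \<Rightarrow> real) \<Rightarrow> real \<Rightarrow> real \<Rightarrow> (real \<Rightarrow> real) \<Rightarrow> nat \<Rightarrow> int \<Rightarrow> real" where
  "scheme m w h \<tau> v0 0 = (\<lambda>i. v0 (of_int i * h))"
| "scheme m w h \<tau> v0 (Suc j) =
     (\<lambda>i. scheme m w h \<tau> v0 j i + \<tau> * L_h m w h (scheme m w h \<tau> v0 j) i)"

definition interpolant :: "real \<Rightarrow> real \<Rightarrow> (nat \<Rightarrow> int \<Rightarrow> real) \<Rightarrow> real \<times> real \<Rightarrow> real" where
  "interpolant h \<tau> V = (\<lambda>(x, t).
     let i = \<lfloor>x / h\<rfloor> + 1; j = nat \<lfloor>t / \<tau>\<rfloor>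
     in (of_int i * h - x) / h * V j (i - 1) + (x - of_int (i - 1) * h) / h * V j i)"

definition loc_unif_conv ::
    "'a::topological_space set \<Rightarrow> (real \<Rightarrow> 'a \<Rightarrow> real) \<Rightarrow> ('a \<Rightarrow> real) \<Rightarrow> bool" where
  "loc_unif_conv S f l \<longleftrightarrow> (\<forall>K. compact K \<and> K \<subseteq> S \<longrightarrow> uniform_limit K f l (at_right 0))"


section \<open>Assumptions on the discretization\<close>

definition A_c :: "real \<Rightarrow> (real \<Rightarrow> int \<Rightarrow> real) \<Rightarrow> bool" where
  "A_c s \<omega> \<longleftrightarrow> (\<forall>\<phi>. C2_real \<phi> \<and> Cb_on UNIV \<phi> \<longrightarrow>
     loc_unif_conv UNIV (\<lambda>h. lap_h (\<omega> h) h \<phi>) (frac_lap s \<phi>))"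

definition rho :: "real \<Rightarrow> real \<Rightarrow> real" where
  "rho s h = (if s > 1/2 then h powr (1 - 2 * s) else if s = 1/2 then \<bar>ln h\<bar> else 1)"

definition f_cfl :: "real \<Rightarrow> real \<Rightarrow> real" where
  "f_cfl s h = (if s = 1/2 then 1 / \<bar>ln h\<bar> else 1)"

text \<open>The bounds in this section are asymptotic ones for \<open>h \<rightarrow> 0\<close>, so they are required for all
  sufficiently small \<open>h\<close>; at \<open>h = 1\<close> the functions \<open>rho (1/2)\<close> and \<open>f_cfl (1/2)\<close> degenerate.
  Summability is explicit since an infinite sum without it is \<open>0\<close>; the last sum below is finite.\<close>

definition A_m :: "real \<Rightarrow> real \<Rightarrow> (real \<Rightarrow> int \<Rightarrow> real) \<Rightarrow> bool" where
  "A_m s Cs \<omega> \<longleftrightarrow> Cs > 0 \<and> (\<forall>\<^sub>F h in at_right 0.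
     \<omega> h summable_on (UNIV - {0}) \<and>
     (\<Sum>\<^sub>\<infinity>k\<in>UNIV - {0}. \<omega> h k) \<le> Cs * h powr (- (2 * s)) \<and>
     (\<Sum>\<^sub>\<infinity>k\<in>{k. \<bar>of_int k * h\<bar> > 1}. \<omega> h k) \<le> Cs \<and>
     (\<Sum>k\<in>{k. 0 < \<bar>of_int k * h\<bar> \<and> \<bar>of_int k * h\<bar> \<le> 1}. \<bar>h * of_int k\<bar> * \<omega> h k) \<le> Cs * rho s h)"

text \<open>The inequalities \<open>\<tau> \<le> C\<^sub>i \<dots>\<close> are multiplied by \<open>1 / C\<^sub>i\<close>, which avoids a division by zero
  for constant data. The case distinction makes \<open>L\<close> to the power \<open>m - 2\<close> equal to \<open>1\<close> for \<open>m = 2\<close>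
  also if \<open>L = 0\<close>, where \<open>powr\<close> would give \<open>0\<close>.\<close>

definition CFL1 ::
    "real \<Rightarrow> real \<Rightarrow> real \<Rightarrow> real \<Rightarrow> (real \<Rightarrow> real) \<Rightarrow> (real \<Rightarrow> real) \<Rightarrow> bool" where
  "CFL1 m s Cs M v0 \<tau> \<longleftrightarrow> (\<forall>x. \<bar>v0 x\<bar> \<le> M) \<and>
     (\<forall>\<^sub>F h in at_right 0. (Cs * m * (2 * M) powr (m - 1)) * \<tau> h \<le> h powr (2 * s + m - 1))"

definition CFL2 ::
    "real \<Rightarrow> real \<Rightarrow> real \<Rightarrow> real \<Rightarrow> real \<Rightarrow> (real \<Rightarrow> real) \<Rightarrow> (real \<Rightarrow> real) \<Rightarrow> bool" where
  "CFL2 m s Cs M L v0 \<tau> \<longleftrightarrow> (\<forall>x. \<bar>v0 x\<bar> \<le> M) \<and>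
     (\<exists>g. W1inf_deriv v0 g \<and> (AE x in lborel. \<bar>g x\<bar> \<le> L)) \<and>
     (\<forall>\<^sub>F h in at_right 0.
        (Cs * m * (if m = 2 then 1 else L powr (m - 2)) * max L (2 * M)) * \<tau> h
          \<le> h powr (max (2 * s) 1) * f_cfl s h)"

end

theory Submission
  imports Defs
begin

text \<open>Under either CFL condition the scheme is monotone on nondecreasing grid functions, so it commutes
 with translations and preserves bounds and one-sided slopes. Comparison with smoothed data gives
 equicontinuity up to the mesh size, and limits of the scheme are viscosity solutions because at a grid
 maximum the sign of the discrete Laplacian selects the one-sided slope that consistency needs.
 Doubling of variables, with test functions of the form \<open>f x + g t\<close>, gives comparison,
 hence the convergence of the whole family and uniqueness.

 For jump data let \<open>W eps\<close> be the solution whose data is a ramp of width \<open>eps\<close>. The scheme lies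
 asymptotically between \<open>W eps\<close> and its translate by \<open>eps\<close>, so everything follows once both have the same
 limit away from \<open>(a, 0)\<close>, that is, once the infimum of the \<open>W eps\<close> has no jump at a positive time. This
 infimum is self-similar, which replaces a bound on its time derivative, and at a jump a
 steep test function would have an arbitrarily large nonlocal term.\<close>

text \<open>Test functions must be globally C2, so no truncated nonlocal operator is available in
  the doubling argument. Instead both solutions are touched by functions that are affine plus
  quadratic near the touching point, with one common slope, and follow one and the same smoothed
  slice of \<open>W\<close> far away. The degenerate coefficients then agree up to a penalty, and
  the nonlocal terms differ only by what a cutoff of width \<open>dl\<close> sees, of order
  \<open>dl powr (2 - 2 * s)\<close>. The scheme contains the positive part of the slope and the
  equation its absolute value; the two are reconciled by the monotonicity of the grid functions,
  which a test function inherits where it touches. Monotonicity of a time step needs a bound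
  \<open>Lam\<close> on grid slopes: \<open>L\<close> for Lipschitz data, but only
  \<open>2 * M / h\<close> for bounded data, which is the difference between the two CFL conditions.
  Comparison reaches all times below \<open>T\<close> but not \<open>T\<close> itself, which the
  open strip does not see. There continuity is used, and for discontinuous solutions it becomes a
  condition in the statement.\<close>

abbreviation near0 :: "(real => bool) => bool" (binder "NEAR " 10) where
 "near0 P \<equiv> eventually P (at_right 0)"

abbreviation has_jet :: "(real \<times> real) set => _" where
 "has_jet S f fx ft fxx fxt ftx ftt \<equiv> \<forall>p\<in>S. (f has_derivative (%(u, w). fx p*u + ft p*w)) (at p within S) \<and>
  (fx has_derivative (%(u, w). fxx p*u + fxt p*w)) (at p within S) \<and>
  (ft has_derivative (%(u, w). ftx p*u + ftt p*w)) (at p within S)"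

abbreviation ell1 :: "real => real => real => real => real" where
 "ell1 x y t r \<equiv> \<bar>x - y\<bar> + \<bar>t - r\<bar>"

section \<open>The fractional Laplacian of smooth functions\<close>

text \<open>The derivatives are arguments rather than existentially bound, because bounds on them
  and their values at touching points have to be tracked.\<close>

definition C2d :: "(real => real) => (real => real) => (real => real) => bool" where
 "C2d f f1 f2 \<longleftrightarrow> (\<forall>x. (f has_real_derivative f1 x) (at x)) &
  (\<forall>x. (f1 has_real_derivative f2 x) (at x)) & continuous_on UNIV f2"

lemma C2_real_iff: "C2_real f \<longleftrightarrow> (\<exists>f1 f2. C2d f f1 f2)" unfolding C2_real_def C2d_def by blast

lemma C2d_cont:
 assumes "C2d f f1 f2" shows "continuous_on UNIV f" "continuous_on UNIV f1" "continuous_on UNIV f2" using assms unfolding C2d_def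
 by (auto intro!: continuous_at_imp_continuous_on DERIV_isCont)

lemma C2_real_cont: "C2_real f ==> continuous_on UNIV f" using C2d_cont(1) C2_real_iff by blast

lemma C2d_const: "C2d (%x. c) (%x. 0) (%x. 0)" unfolding C2d_def by (auto intro!: continuous_intros derivative_eq_intros)

lemma C2d_add:
 assumes "C2d f f1 f2" "C2d g g1 g2" shows "C2d (%x. f x+g x) (%x. f1 x+g1 x) (%x. f2 x+g2 x)"
 using assms unfolding C2d_def by (auto intro!: continuous_intros derivative_eq_intros)

lemma C2d_cmult:
 assumes "C2d f f1 f2" shows "C2d (%x. c*f x) (%x. c*f1 x) (%x. c*f2 x)" using assms unfolding C2d_def
 by (auto intro!: continuous_intros derivative_eq_intros)

lemma C2d_mult:
 assumes "C2d f f1 f2" "C2d g g1 g2" shows "C2d (%x. f x*g x) (%x. f1 x*g x+f x*g1 x)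
  (%x. f2 x*g x+2*f1 x*g1 x+f x*g2 x)" unfolding C2d_def
proof (intro conjI allI)
 fix x
 have d: "(f has_real_derivative f1 x) (at x)" "(f1 has_real_derivative f2 x) (at x)"
  "(g has_real_derivative g1 x) (at x)" "(g1 has_real_derivative g2 x) (at x)" using assms unfolding C2d_def by blast+
 show "((%x. f x*g x) has_real_derivative f1 x*g x+f x*g1 x) (at x)" using DERIV_mult[OF d(1,3)] by (simp add: mult.commute)
 show "((%x. f1 x*g x+f x*g1 x) has_real_derivative
  f2 x*g x+2*f1 x*g1 x+f x*g2 x) (at x)" using DERIV_add[OF DERIV_mult[OF d(2,3)] DERIV_mult[OF d(1,4)]] by (simp add: algebra_simps)
 show "continuous_on UNIV (%x. f2 x*g x+2*f1 x*g1 x+f x*g2 x)" by (intro continuous_intros C2d_cont[OF assms(1)] C2d_cont[OF assms(2)])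
qed

lemma DERIV_affine:
 fixes g :: "real => real"
 assumes "(g has_real_derivative D) (at (a*x+b))" shows "((%x. g (a*x+b)) has_real_derivative a*D) (at x)"
proof -
 have "((%x. a*x+b) has_real_derivative a) (at x)" using DERIV_add[OF DERIV_cmult_Id DERIV_const] by simp
 from DERIV_chain2[OF assms this] show ?thesis by (simp only: mult.commute)
qed

lemma C2d_affine:
 assumes "C2d f f1 f2" shows "C2d (%x. f (a*x+b)) (%x. a*f1 (a*x+b)) (%x. a\<^sup>2*f2 (a*x+b))" unfolding C2d_def
proof (intro conjI allI)
 fix x
 have d: "(f has_real_derivative f1 y) (at y)" "(f1 has_real_derivative f2 y) (at y)" for y using assms unfolding C2d_def by auto
 show "((%x. f (a*x+b)) has_real_derivative a*f1 (a*x+b)) (at x)" by (rule DERIV_affine[OF d(1)])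
 show "((%x. a*f1 (a*x+b)) has_real_derivative a\<^sup>2*f2 (a*x+b)) (at x)"
  using DERIV_cmult[OF DERIV_affine[OF d(2)], of a] by (simp add: power2_eq_square mult.assoc)
 show "continuous_on UNIV (%x. a\<^sup>2*f2 (a*x+b))"
  by (intro continuous_intros continuous_on_compose2[OF C2d_cont(3)[OF assms]]) auto
qed

lemma C2d_poly2: "C2d (%x. a+b*x+c*x\<^sup>2) (%x. b+2 * c*x) (%x. 2 * c)"
 unfolding C2d_def by (auto intro!: continuous_intros derivative_eq_intros)

lemma C2d_inverse:
 assumes "C2d f f1 f2" "!!x. f x ~= 0" shows "C2d (%x. inverse (f x)) (%x. - f1 x/(f x)\<^sup>2)
  (%x. - f2 x/(f x)\<^sup>2+2*(f1 x)\<^sup>2/(f x) ^ 3)"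
proof -
 have 1: "((%x. inverse (f x)) has_real_derivative - f1 x/(f x)\<^sup>2) (at x)" for x
 proof -
  have "(f has_real_derivative f1 x) (at x)" using assms(1) unfolding C2d_def by blast
  from DERIV_inverse_fun[OF this assms(2)] show ?thesis by (simp add: divide_inverse power2_eq_square mult.commute)
 qed
 have 2: "((%x. - f1 x/(f x)\<^sup>2) has_real_derivative
  - f2 x/(f x)\<^sup>2+2*(f1 x)\<^sup>2/(f x) ^ 3) (at x)" for x
 proof -
  have a: "(f has_real_derivative f1 x) (at x)" "(f1 has_real_derivative f2 x) (at x)" using assms unfolding C2d_def by auto
  have "((%x. - f1 x/(f x)\<^sup>2) has_real_derivative
  ((- f2 x)*(f x)\<^sup>2 - (- f1 x)*(2*f x*f1 x))/((f x)\<^sup>2*(f x)\<^sup>2)) (at x)"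
  proof (rule DERIV_divide)
  show "((%x. - f1 x) has_real_derivative - f2 x) (at x)" using a(2) by (rule DERIV_minus)
  show "((%x. (f x)\<^sup>2) has_real_derivative 2*f x*f1 x) (at x)" using a(1) by (auto intro!: derivative_eq_intros)
  qed (use assms(2) in auto)
  moreover have "((- f2 x)*(f x)\<^sup>2 - (- f1 x)*(2*f x*f1 x))/((f x)\<^sup>2*(f x)\<^sup>2)
  = - f2 x/(f x)\<^sup>2+2*(f1 x)\<^sup>2/(f x) ^ 3" using assms(2)[of x] by (simp add: field_simps power2_eq_square power3_eq_cube)
  ultimately show ?thesis by simp
 qed
 show ?thesis unfolding C2d_def
 proof (intro conjI allI 1 2)
  show "continuous_on UNIV (%x. - f2 x/(f x)\<^sup>2+2*(f1 x)\<^sup>2/(f x) ^ 3)"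
  by (intro continuous_intros C2d_cont[OF assms(1)]) (simp_all add: assms(2))
 qed
qed

lemma C2_realI: "C2d f f1 f2 ==> C2_real f" unfolding C2_real_iff by (intro exI)

lemma C2_realE: assumes "C2_real f" obtains f1 f2 where "C2d f f1 f2" using assms unfolding C2_real_iff by (elim exE)

lemma C2_real_const: "C2_real (%x. c)" by (rule C2_realI, rule C2d_const)

lemma C2_real_add: "C2_real f ==> C2_real g ==> C2_real (%x. f x+g x)" by (elim C2_realE, rule C2_realI, rule C2d_add)

lemma C2_real_affine: "C2_real f ==> C2_real (%x. f (a*x+b))" by (elim C2_realE, rule C2_realI, rule C2d_affine)

text \<open>Two applications of the mean value theorem: to the increment
  \<open>y \<mapsto> f (y+h) - f y\<close>, and then to \<open>f1\<close>.\<close>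

lemma second_difference_mvt:
 fixes f :: "real => real"
 assumes "!!x. (f has_real_derivative f1 x) (at x)" "!!x. (f1 has_real_derivative f2 x) (at x)" and "0 < h"
 shows "\<exists>z\<in>{x..x+2*h}. f (x+2*h) - 2*f (x+h)+f x = h\<^sup>2*f2 z"
proof -
 have d: "((%y. f (y+h) - f y) has_real_derivative f1 (y+h) - f1 y) (at y)" for y
  using DERIV_shift[of f "f1 (y+h)" y h] assms(1) by (auto intro!: DERIV_diff)
 obtain z1 where z1: "x < z1" "z1 < x+h"
  "(f (x+h+h) - f (x+h)) - (f (x+h) - f x) = h*(f1 (z1+h) - f1 z1)"
  using MVT2[of x "x+h" "%y. f (y+h) - f y" "%y. f1 (y+h) - f1 y"] d assms(3) by auto
 obtain z2 where z2: "z1 < z2" "z2 < z1+h" "f1 (z1+h) - f1 z1 = h*f2 z2" using MVT2[of z1 "z1+h" f1 f2] assms(2,3) by auto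
 have "f (x+2*h) - 2*f (x+h)+f x = h*(f1 (z1+h) - f1 z1)" using z1(3) by (simp add: algebra_simps)
 with z2 z1 show ?thesis by (intro bexI[of _ z2]) (auto simp: power2_eq_square)
qed

section \<open>Symmetric second differences and the singular kernel\<close>

definition sdiff :: "(real => real) => real => real => real" where
 "sdiff phi x y = 2*phi x - phi (x+y) - phi (x - y)"

lemma sdiff_bound_C2:
 assumes "C2d f f1 f2" "!!z. z \<in> {x - \<bar>y\<bar>..x+\<bar>y\<bar>} ==> \<bar>f2 z\<bar> <= C"
 shows "\<bar>sdiff f x y\<bar> <= C*y\<^sup>2"
proof (cases "y = 0")
 case False
 define h where "h = \<bar>y\<bar>"
 have h: "h > 0" using False by (simp add: h_def)
 obtain z where z: "z \<in> {x - h..x - h+2*h}"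
  "f (x - h+2*h) - 2*f (x - h+h)+f (x - h) = h\<^sup>2*f2 z"
  using second_difference_mvt[of f f1 f2 h "x - h"] h assms(1) unfolding C2d_def by auto
 have "sdiff f x y = - (h\<^sup>2*f2 z)" using z(2) unfolding sdiff_def h_def by (cases "y \<ge> 0") (auto simp: algebra_simps)
 moreover have "\<bar>f2 z\<bar> <= C" using assms(2) z(1) by (simp add: h_def)
 then have "h\<^sup>2*\<bar>f2 z\<bar> <= h\<^sup>2 * C" by (simp add: mult_left_mono)
 ultimately show ?thesis by (simp add: abs_mult h_def mult.commute)
qed (simp add: sdiff_def)

definition kern :: "real => real => real" where
 "kern s y = 1/\<bar>y\<bar> powr (1+2 * s)"

lemma kern_nonneg: "0 <= kern s y" by (simp add: kern_def)
lemma kern_minus [simp]: "kern s (- y) = kern s y" by (simp add: kern_def)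
lemma kern_meas [measurable]: "kern s \<in> borel_measurable borel" unfolding kern_def by measurable

lemma kern_scale: "0 < c ==> kern s (c*y) = kern s y * c powr (- (1+2 * s))"
 unfolding kern_def by (simp only: abs_mult powr_mult powr_minus divide_inverse inverse_mult_distrib) simp

text \<open>At the origin the integrand is \<open>y powr (1 - 2 * s)\<close>, integrable because
  \<open>s < 1\<close>; at infinity it is \<open>y powr (- (1 + 2 * s))\<close>, integrable because
  \<open>0 < s\<close>.\<close>

lemma integrable_min_kern:
 assumes "0 < s" "s < 1" shows "integrable lborel (%y. min 1 (y\<^sup>2) * kern s y)"
proof -
 define f where "f = (%y. min 1 (y\<^sup>2) * kern s y)"
 have fm [measurable]: "f \<in> borel_measurable borel" unfolding f_def by measurable
 have f0: "0 <= f y" for y by (simp add: f_def kern_nonneg)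
 have int: "integrable lborel (%y. indicator S y*f y)"
  if "g integrable_on S" "S \<in> sets borel" "!!y. y \<in> S ==> g y = f y" for S g
 proof -
  have "f integrable_on S" using that(1,3) integrable_cong by blast
  then have "f absolutely_integrable_on S" by (rule nonnegative_absolutely_integrable_1) (rule f0)
  then have "integrable lebesgue (%y. indicator S y*f y)" unfolding set_integrable_def by simp
  then show ?thesis by (subst (asm) integrable_completion) (use that in auto)
 qed
 have 1: "integrable lborel (%y. indicator {0..1} y*f y)"
 proof (rule int)
  show "(%y. y powr (1 - 2 * s)) integrable_on {0..1}" using integrable_on_powr_from_0[of "1 - 2 * s" 1] assms by auto
  fix y :: real assume y: "y \<in> {0..1}"
  then have "y\<^sup>2 <= 1" by (simp add: power_le_one)
  then show "y powr (1 - 2 * s) = f y" using y powr_diff[of y 2 "1+2 * s"]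
  by (cases "y = 0") (auto simp: f_def kern_def min_def divide_inverse)
 qed auto
 have 2: "integrable lborel (%y. indicator {1..} y*f y)"
 proof (rule int)
  show "(%y. y powr (- (1+2 * s))) integrable_on {1..}"
  using has_integral_powr_to_inf[of "- (1+2 * s)" 1] assms by (auto simp: integrable_on_def)
  fix y :: real assume y: "y \<in> {1..}"
  then have "1 <= y\<^sup>2" by (simp add: one_le_power)
  then show "y powr (- (1+2 * s)) = f y" using y by (simp only: f_def kern_def powr_minus divide_inverse) simp
 qed auto
 have 3: "integrable lborel (%y. indicator {0..1} y*f y+indicator {1..} y*f y)" using 1 2 by (rule Bochner_Integration.integrable_add)
 have 4: "integrable lborel (%y. indicator {0..1} (-y)*f (-y)+indicator {1..} (-y)*f (-y))"
  using lborel_integrable_real_affine[OF 3, of "-1" 0] by simp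
 have "integrable lborel f"
 proof (rule Bochner_Integration.integrable_bound[OF Bochner_Integration.integrable_add[OF 3 4]])
  have fe: "f (-y) = f y" for y by (simp add: f_def)
  show "AE y in lborel. norm (f y) <= norm (indicator {0..1} y*f y+indicator {1..} y*f y +
  (indicator {0..1} (-y)*f (-y)+indicator {1..} (-y)*f (-y)))" using f0 by (auto simp: fe indicator_def)
 qed simp
 then show ?thesis by (simp add: f_def)
qed

definition kint :: "real => (real => real) => bool" where
 "kint s g \<longleftrightarrow> integrable lborel (%y. g y * kern s y)"

text \<open>The functional takes a profile in the increment \<open>y\<close>, not a function of
  \<open>x\<close>. Applied to \<open>sdiff phi x\<close>, which is of order
  \<open>y\<^sup>2\<close> at 0, it involves no principal value; the factor 1/2 undoes the pairing
  of \<open>y\<close> with \<open>- y\<close>. Being linear and monotone in the profile, it reduces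
  later estimates to pointwise ones.\<close>

definition fl :: "real => (real => real) => real" where
 "fl s g = c1 s/2*(LINT y|lborel. g y * kern s y)"

lemma c1_pos: assumes "0 < s" "s < 1" shows "0 < c1 s"
proof -
 \<comment> \<open>\<open>Gamma\<close> is 0 at its poles by convention, so \<open>- s\<close> has
   to be kept away from the non-positive integers.\<close>
 have "Gamma (- s) ~= 0"
 proof (subst Gamma_eq_zero_iff)
  show "- s \<notin> \<int>\<^sub>\<le>\<^sub>0"
  proof
  assume "- s \<in> \<int>\<^sub>\<le>\<^sub>0"
  then obtain n where "- s = of_int n" by (auto elim!: nonpos_Ints_cases)
  with assms have "n < 0" "n > -1" by linarith+
  then show False by simp
  qed
 qed
 then show ?thesis using assms unfolding c1_def by (intro divide_pos_pos mult_pos_pos) (auto intro!: Gamma_real_pos)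
qed

lemma kint_bound:
 assumes "0 < s" "s < 1" "g \<in> borel_measurable borel" "!!y. \<bar>g y\<bar> <= C*min 1 (y\<^sup>2)" shows "kint s g"
 unfolding kint_def
proof (rule Bochner_Integration.integrable_bound)
 show "integrable lborel (%y. C*(min 1 (y\<^sup>2) * kern s y))" using integrable_min_kern[OF assms(1,2)] by simp
 show "(%y. g y * kern s y) \<in> borel_measurable lborel" using assms(3) by simp
 show "AE y in lborel. norm (g y * kern s y) <= norm (C*(min 1 (y\<^sup>2) * kern s y))"
 proof (rule AE_I2)
  fix y :: real
  have "\<bar>g y\<bar> <= \<bar>C*min 1 (y\<^sup>2)\<bar>" using assms(4)[of y] by linarith
  then show "norm (g y * kern s y) <= norm (C*(min 1 (y\<^sup>2) * kern s y))"
  by (simp add: abs_mult mult_right_mono kern_nonneg mult.assoc[symmetric])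
 qed
qed

lemma kint_add: "kint s f ==> kint s g ==> kint s (%y. f y+g y)" and kint_diff: "kint s f ==> kint s g ==> kint s (%y. f y - g y)"
 and kint_cmult: "kint s f ==> kint s (%y. c*f y)" and kint_minus: "kint s f ==> kint s (%y. - f y)" unfolding kint_def
 by (simp_all add: ring_distribs left_diff_distrib mult.assoc)

lemma fl_add: "kint s f ==> kint s g ==> fl s (%y. f y+g y) = fl s f+fl s g" unfolding kint_def fl_def by (simp add: ring_distribs)
lemma fl_diff: "kint s f ==> kint s g ==> fl s (%y. f y - g y) = fl s f - fl s g"
 unfolding kint_def fl_def by (simp add: left_diff_distrib right_diff_distrib)
lemma fl_cmult: "fl s (%y. c*f y) = c*fl s f" unfolding fl_def by (simp add: mult.assoc)
lemma fl_minus: "fl s (%y. - f y) = - fl s f" using fl_cmult[of s "-1" f] by simp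

lemma fl_mono:
 assumes "0 < s" "s < 1" "kint s f" "kint s g" "!!y. f y <= g y" shows "fl s f <= fl s g" unfolding fl_def
 by (intro mult_left_mono integral_mono)
  (use assms c1_pos[of s] in \<open>auto simp: kint_def intro!: mult_right_mono kern_nonneg\<close>)

lemma kint_scale:
 assumes "kint s g" "0 < c" shows "kint s (%y. g (c*y))"
proof -
 have "integrable lborel (%y. g (0+c*y) * kern s (0+c*y))"
  using lborel_integrable_real_affine[of "%y. g y * kern s y" c 0] assms unfolding kint_def by auto
 then have "integrable lborel (%y. (g (c*y) * kern s y) * c powr (- (1+2 * s)))"
  using kern_scale[OF assms(2), of s] by (simp add: mult.assoc)
 then show ?thesis unfolding kint_def using assms(2) by simp
qed

text \<open>The kernel contributes \<open>1 + 2 * s\<close> powers of \<open>c\<close> and the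
  substitution takes one away. This homogeneity fixes the power of every length scale below.\<close>

lemma fl_scale:
 assumes "0 < c" shows "fl s (%y. g (c*y)) = c powr (2 * s)*fl s g"
proof -
 have "(LINT y|lborel. g y * kern s y) = c*(LINT y|lborel. g (c*y) * kern s (c*y))"
  using lborel_integral_real_affine[of c "%y. g y * kern s y" 0] assms by simp
 also have "... = c * c powr (- (1+2 * s))*(LINT y|lborel. g (c*y) * kern s y)"
  using kern_scale[OF assms, of s] by (simp add: mult.assoc[symmetric])
 also have "c * c powr (- (1+2 * s)) = c powr (- (2 * s))" using assms by (simp add: powr_mult_base)
 finally show ?thesis unfolding fl_def using assms by (simp add: powr_minus field_simps)
qed

lemma sdiff_min_bound:
 assumes "C2d f f1 f2" "!!x. \<bar>f x\<bar> <= B" "!!z. z \<in> {x - 1..x+1} ==> \<bar>f2 z\<bar> <= C"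
 shows "\<bar>sdiff f x y\<bar> <= max (4*B) C*min 1 (y\<^sup>2)"
proof (cases "\<bar>y\<bar> <= 1")
 case True
 then have y2: "y\<^sup>2 <= 1" by (simp add: abs_square_le_1)
 have "\<bar>sdiff f x y\<bar> <= C*y\<^sup>2" by (rule sdiff_bound_C2[OF assms(1)]) (use True assms(3) in auto)
 also have "... <= max (4*B) C*y\<^sup>2" by (intro mult_right_mono) auto
 finally show ?thesis using y2 by (simp add: min_def)
next
 case False
 then have y2: "1 <= y\<^sup>2" using abs_square_le_1[of y] by linarith
 have "\<bar>sdiff f x y\<bar> <= 4*B" using assms(2)[of x] assms(2)[of "x+y"] assms(2)[of "x - y"] unfolding sdiff_def by linarith
 then show ?thesis using y2 by (simp add: min_def)
qed

lemma sdiff_meas: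
 assumes "continuous_on UNIV f" shows "sdiff f x \<in> borel_measurable borel" unfolding sdiff_def
 by (intro borel_measurable_continuous_onI continuous_intros continuous_on_compose2[OF assms]) auto

lemma kint_sdiff:
 assumes "0 < s" "s < 1" "C2_real f" "bounded (range f)" shows "kint s (sdiff f x)"
proof -
 obtain f1 f2 where f: "C2d f f1 f2" using assms(3) C2_real_iff by blast
 obtain B where B: "!!x. \<bar>f x\<bar> <= B" using assms(4) unfolding bounded_iff by auto
 have "compact (f2 ` {x - 1..x+1})" using C2d_cont(3)[OF f] by (intro compact_continuous_image) (auto intro: continuous_on_subset)
 then obtain C where "!!z. z \<in> {x - 1..x+1} ==> \<bar>f2 z\<bar> <= C"
  using compact_imp_bounded bounded_iff by (metis imageI real_norm_def)
 from sdiff_min_bound[OF f B this] show ?thesis by (intro kint_bound[OF assms(1,2) sdiff_meas[OF C2d_cont(1)[OF f]]])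
qed

text \<open>Away from the origin the integrand is integrable, and averaging it with its reflection
  turns it into half of the second difference. That one is integrable up to the origin, so the
  truncation is removed by dominated convergence.\<close>

lemma frac_lap_eq:
 assumes "0 < s" "s < 1" "C2_real phi" "bounded (range phi)" shows "frac_lap s phi x = fl s (sdiff phi x)"
proof -
 define I where "I eps = (LINT y:{y. \<bar>y\<bar> > eps}|lborel. (phi x - phi (x+y))/\<bar>y\<bar> powr (1+2 * s))" for eps
 define g where "g y = sdiff phi x y * kern s y" for y
 have gi: "integrable lborel g" using kint_sdiff[OF assms, of x] unfolding kint_def g_def .
 have cont: "continuous_on UNIV phi" using C2_real_cont assms by blast
 have [measurable]: "phi \<in> borel_measurable borel" using cont by (rule borel_measurable_continuous_onI)
 obtain B where B: "!!x. \<bar>phi x\<bar> <= B" using assms(4) unfolding bounded_iff by auto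
 have eq: "I eps = (LINT y|lborel. indicator {y. \<bar>y\<bar> > eps} y*g y)/2" if e: "eps > 0" for eps
 proof -
  define k where "k y = indicator {y. \<bar>y\<bar> > eps} y*((phi x - phi (x+y)) * kern s y)" for y
  have ki: "integrable lborel k"
  proof (rule Bochner_Integration.integrable_bound)
  show "integrable lborel (%y. (2*B/min 1 (eps\<^sup>2))*(min 1 (y\<^sup>2) * kern s y))"
  using integrable_min_kern[OF assms(1,2)] by simp
  show "k \<in> borel_measurable lborel" unfolding k_def by measurable
  show "AE y in lborel. norm (k y) <= norm ((2*B/min 1 (eps\<^sup>2))*(min 1 (y\<^sup>2) * kern s y))"
  proof (rule AE_I2)
  fix y :: real
  show "norm (k y) <= norm ((2*B/min 1 (eps\<^sup>2))*(min 1 (y\<^sup>2) * kern s y))"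
  proof (cases "\<bar>y\<bar> > eps")
  case True
  then have "eps\<^sup>2 <= y\<^sup>2" using e by (metis abs_of_pos abs_le_square_iff less_imp_le)
  then have m: "min 1 (eps\<^sup>2) <= min 1 (y\<^sup>2)" by simp
  have m0: "min 1 (eps\<^sup>2) > 0" using e by simp
  have B0: "0 <= B" using B[of 0] by linarith
  have "\<bar>phi x - phi (x+y)\<bar> <= 2*B" using B[of x] B[of "x+y"] by linarith
  also have "... <= 2*B/min 1 (eps\<^sup>2)*min 1 (y\<^sup>2)"
  proof -
  have "2*B*min 1 (eps\<^sup>2) <= 2*B*min 1 (y\<^sup>2)" using m B0 by (intro mult_left_mono) auto
  then show ?thesis using m0 by (simp add: pos_le_divide_eq)
  qed
  finally have "\<bar>phi x - phi (x+y)\<bar> * kern s y <= 2*B/min 1 (eps\<^sup>2)*min 1 (y\<^sup>2) * kern s y"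
  by (intro mult_right_mono kern_nonneg)
  then show ?thesis using True kern_nonneg[of s y] B0 by (simp add: k_def abs_mult mult.assoc)
  next
  case False
  then show ?thesis by (simp add: k_def)
  qed
  qed
  qed
  have Ik: "I eps = (LINT y|lborel. k y)" unfolding I_def set_lebesgue_integral_def k_def kern_def
  by (intro Bochner_Integration.integral_cong) auto
  have Ik2: "(LINT y|lborel. k y) = (LINT y|lborel. k (- y))" using lborel_integral_real_affine[of "-1" k 0] by simp
  have "2*I eps = (LINT y|lborel. k y+k (- y))" using Ik Ik2 ki lborel_integrable_real_affine[OF ki, of "-1" 0] by simp
  also have "... = (LINT y|lborel. indicator {y. \<bar>y\<bar> > eps} y*g y)" by (intro Bochner_Integration.integral_cong)
  (auto simp: k_def g_def sdiff_def indicator_def algebra_simps)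
  finally show ?thesis by simp
 qed
 have "((%eps. (LINT y|lborel. indicator {y. \<bar>y\<bar> > eps} y*g y)/2) \<longlongrightarrow> (LINT y|lborel. g y)/2) (at_right 0)"
 proof (rule tendsto_at_right_sequentially[of 0 1])
  fix S :: "nat => real" assume S: "!!n. 0 < S n" "S \<longlonglongrightarrow> 0"
  have "(%n. LINT y|lborel. indicator {y. \<bar>y\<bar> > S n} y*g y) \<longlonglongrightarrow> (LINT y|lborel. g y)"
  proof (rule integral_dominated_convergence[where w = "%y. \<bar>g y\<bar>"])
  show "AE y in lborel. (%n. indicator {y. \<bar>y\<bar> > S n} y*g y) \<longlonglongrightarrow> g y"
  proof (rule AE_I2)
  fix y :: real
  show "(%n. indicator {y. \<bar>y\<bar> > S n} y*g y) \<longlonglongrightarrow> g y"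
  proof (cases "y = 0")
  case True then show ?thesis by (simp add: g_def sdiff_def)
  next
  case False
  then have "\<forall>\<^sub>F n in sequentially. S n < \<bar>y\<bar>" using order_tendstoD(2)[OF S(2)] by simp
  then have "\<forall>\<^sub>F n in sequentially. indicator {y. \<bar>y\<bar> > S n} y*g y = g y" by eventually_elim simp
  then show ?thesis by (rule tendsto_eventually)
  qed
  qed
  show "AE y in lborel. norm (indicator {y. \<bar>y\<bar> > S n} y*g y) <= \<bar>g y\<bar>" for n by (auto simp: indicator_def)
  show "g \<in> borel_measurable lborel" using gi by simp
  show "(%y. indicator {y. \<bar>y\<bar> > S n} y*g y) \<in> borel_measurable lborel" for n using gi by measurable
  qed (use gi in auto)
  then show "(%n. (LINT y|lborel. indicator {y. \<bar>y\<bar> > S n} y*g y)/2) \<longlonglongrightarrow> (LINT y|lborel. g y)/2"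
  by (intro tendsto_intros) auto
 qed simp
 then have "(I \<longlongrightarrow> (LINT y|lborel. g y)/2) (at_right 0)" by (rule Lim_transform_eventually)
  (auto simp: eventually_at_right_field eq intro!: exI[of _ 1])
 then have "Lim (at_right 0) I = (LINT y|lborel. g y)/2" by (intro tendsto_Lim) (auto simp: trivial_limit_at_right_real)
 then show ?thesis unfolding frac_lap_def fl_def I_def[symmetric] g_def by simp
qed

text \<open>A smooth even profile between \<open>min 1 (z\<^sup>2) / 2\<close> and
  \<open>min 1 (z\<^sup>2)\<close>. It plays three parts: penalty at infinity, weight of a cutoff,
  and majorant for second differences and tails.\<close>

definition qf :: "real => real" where "qf z = z\<^sup>2/(1+z\<^sup>2)"

lemma one_plus_sq_pos: "(0::real) < 1+z\<^sup>2" by (simp add: add_pos_nonneg)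
lemma one_plus_sq_nz: "1+z\<^sup>2 ~= (0::real)" using one_plus_sq_pos[of z] by linarith

lemma qf_simps [simp]: "qf 0 = 0" "qf (- z) = qf z" by (simp_all add: qf_def)
lemma qf_nonneg: "0 <= qf z" by (simp add: qf_def)
lemma qf_less1: "qf z < 1" using one_plus_sq_pos[of z] by (simp add: qf_def)
lemma qf_le_min: "qf z <= min 1 (z\<^sup>2)" using one_plus_sq_pos[of z] by (simp add: qf_def field_simps)
lemma min_le_qf: "min 1 (z\<^sup>2) <= 2*qf z"
proof (cases "z\<^sup>2 <= 1")
 case True
 then have "z\<^sup>2*z\<^sup>2 <= z\<^sup>2*1" by (intro mult_left_mono) auto
 then have "z\<^sup>2 <= 2*qf z" unfolding qf_def using one_plus_sq_pos[of z] by (simp add: field_simps)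
 then show ?thesis by linarith
next
 case False
 then have "1 <= 2*qf z" unfolding qf_def using one_plus_sq_pos[of z] by (simp add: field_simps)
 then show ?thesis by linarith
qed

lemma C2d_qf: "\<exists>q2. C2d qf (%z. 2*z/(1+z\<^sup>2)\<^sup>2) q2 & (\<forall>z. \<bar>q2 z\<bar> <= 8)"
proof -
 define q2 where "q2 = (%z::real. (2 - 6*z\<^sup>2)/(1+z\<^sup>2) ^ 3)"
 have d1: "(qf has_real_derivative 2*z/(1+z\<^sup>2)\<^sup>2) (at z)" for z unfolding qf_def using one_plus_sq_nz[of z]
  by (auto intro!: derivative_eq_intros simp: field_simps power2_eq_square)
 have d2: "((%z. 2*z/(1+z\<^sup>2)\<^sup>2) has_real_derivative q2 z) (at z)" for z
 proof -
  define w where "w = 1+z\<^sup>2"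
  have w: "w ~= 0" using one_plus_sq_nz[of z] by (simp add: w_def)
  have "((%z. 2*z/(1+z\<^sup>2)\<^sup>2) has_real_derivative
  (2*w\<^sup>2 - 2*z*(2*w*(2*z)))/(w\<^sup>2*w\<^sup>2)) (at z)" using w unfolding w_def
  by (auto intro!: derivative_eq_intros simp: power2_eq_square)
  moreover have "(2*w\<^sup>2 - 2*z*(2*w*(2*z)))/(w\<^sup>2*w\<^sup>2) = (2*w - 8*z\<^sup>2)/w ^ 3"
  using w by (simp add: field_simps power2_eq_square power3_eq_cube)
  moreover have "2*w - 8*z\<^sup>2 = 2 - 6*z\<^sup>2" by (simp add: w_def)
  ultimately show ?thesis by (simp add: q2_def w_def)
 qed
 have c: "continuous_on UNIV q2" unfolding q2_def using one_plus_sq_nz by (intro continuous_intros) auto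
 have "\<bar>q2 z\<bar> <= 8" for z
 proof -
  have "1+z\<^sup>2 <= (1+z\<^sup>2) ^ 3" using self_le_power[of "1+z\<^sup>2" 3] by simp
  moreover have "\<bar>2 - 6*z\<^sup>2\<bar> <= 8*(1+z\<^sup>2)" by (simp add: abs_le_iff)
  ultimately have "\<bar>2 - 6*z\<^sup>2\<bar> <= 8*(1+z\<^sup>2) ^ 3" by (meson mult_left_mono order_trans zero_le_numeral)
  then show ?thesis using one_plus_sq_pos[of z] by (simp add: q2_def pos_divide_le_eq)
 qed
 then show ?thesis unfolding C2d_def using d1 d2 c by blast
qed

lemma C2_real_qf: "C2_real qf" using C2d_qf C2_real_iff by blast
lemma bounded_qf: "bounded (range qf)" unfolding bounded_iff using qf_less1 qf_nonneg by (auto intro!: exI[of _ 1] simp: less_imp_le)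

lemma qf_meas [measurable]: "qf \<in> borel_measurable borel" by (intro borel_measurable_continuous_onI C2_real_cont C2_real_qf)

lemma kint_qf: assumes "0 < s" "s < 1" shows "kint s qf"
 by (rule kint_bound[OF assms qf_meas, of 1]) (use qf_le_min qf_nonneg in \<open>simp add: abs_of_nonneg\<close>)

lemma fl_qf_nonneg: assumes "0 < s" "s < 1" shows "0 <= fl s qf" using fl_mono[OF assms _ kint_qf[OF assms], of "%y. 0"] qf_nonneg
 by (simp add: kint_def fl_def)

text \<open>Since \<open>min 1 (y\<^sup>2) <= 2 * qf y\<close>, monotonicity reduces all bounds to
  the single number \<open>fl s qf\<close>.\<close>

lemma fl_bound:
 assumes "0 < s" "s < 1" "g \<in> borel_measurable borel" "!!y. \<bar>g y\<bar> <= C*min 1 (y\<^sup>2)"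
 shows "\<bar>fl s g\<bar> <= 2 * C*fl s qf"
proof -
 have k: "kint s g" using assms by (rule kint_bound)
 have C0: "0 <= C" using assms(4)[of 1] by simp
 have b: "\<bar>g y\<bar> <= 2 * C*qf y" for y using assms(4)[of y] mult_left_mono[OF min_le_qf[of y] C0] by linarith
 have kq: "kint s (%y. (2 * C)*qf y)" "kint s (%y. (- 2 * C)*qf y)" using kint_cmult[OF kint_qf[OF assms(1,2)]] by blast+
 have "fl s g <= fl s (%y. (2 * C)*qf y)"
 proof (rule fl_mono[OF assms(1,2) k kq(1)])
  show "g y <= 2 * C*qf y" for y using b[of y] by linarith
 qed
 moreover have "fl s (%y. (- 2 * C)*qf y) <= fl s g"
 proof (rule fl_mono[OF assms(1,2) kq(2) k])
  show "- 2 * C*qf y <= g y" for y using b[of y] by linarith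
 qed
 ultimately show ?thesis unfolding fl_cmult by (simp add: abs_le_iff)
qed

section \<open>Comparison\<close>

lemma antiderivative_exists:
 fixes f :: "real => real"
 assumes "continuous_on UNIV f" shows "\<exists>F. \<forall>x. (F has_real_derivative f x) (at x)"
proof (intro exI allI)
 fix x :: real
 define a b where "a = - \<bar>x\<bar> - 1" and "b = \<bar>x\<bar>+1"
 have "((%u. LBINT y=0..u. f y) has_vector_derivative f x) (at x within {a..b})"
  using interval_integral_FTC2[of a 0 b f x] continuous_on_subset[OF assms] by (auto simp: a_def b_def zero_ereal_def)
 moreover have "at x within {a..b} = at x" by (rule at_within_interior) (auto simp: interior_cbox a_def b_def)
 ultimately show "((%u. LBINT y=0..u. f y) has_real_derivative f x) (at x)"
  by (simp add: has_real_derivative_iff_has_vector_derivative)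
qed

text \<open>The smoothing is the second difference quotient of a second antiderivative, i.e. a double
 moving average.\<close>

lemma smoothing:
 fixes f :: "real => real"
 assumes f: "continuous_on UNIV f" and "0 < eta"
 obtains G G1 G2 where "C2d G G1 G2"
  "!!x. \<exists>xi\<in>{x..x+2*eta}. G x = f xi"
  "!!x c. \<exists>xi\<in>{x..x+2*eta}. G (x+c) - G x = f (xi+c) - f xi"
  "!!B. (!!x. \<bar>f x\<bar> <= B) ==> \<exists>C. \<forall>x. \<bar>G1 x\<bar> <= C & \<bar>G2 x\<bar> <= C"
proof -
 obtain F1 where F1: "!!x. (F1 has_real_derivative f x) (at x)" using antiderivative_exists[OF f] by metis
 have "continuous_on UNIV F1" using F1 by (auto intro!: continuous_at_imp_continuous_on DERIV_isCont)
 then obtain F2 where F2: "!!x. (F2 has_real_derivative F1 x) (at x)" using antiderivative_exists by metis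
 define D where "D k x = (k (x+2*eta) - 2 * k (x+eta)+k x)/eta\<^sup>2" for k :: "real => real" and x
 have der: "(D k has_real_derivative D k' x) (at x)"
  if "!!x. (k has_real_derivative k' x) (at x)" for k k' x
 proof -
  have sh: "((%y. k (y+c)) has_real_derivative k' (x+c)) (at x)" for c using DERIV_affine[of k "k' (x+c)" 1 x c] that by simp
  have "((%x. k (x+2*eta) - 2 * k (x+eta)+k x) has_real_derivative
  (k' (x+2*eta) - 2 * k' (x+eta)+k' x)) (at x)" by (intro DERIV_add DERIV_diff DERIV_cmult sh that)
  then show ?thesis unfolding D_def by (rule DERIV_cdivide)
 qed
 have mv: "\<exists>xi\<in>{x..x+2*eta}. D k x = k'' xi"
  if k: "!!x. (k has_real_derivative k' x) (at x)" "!!x. (k' has_real_derivative k'' x) (at x)"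
  for k k' k'' x using second_difference_mvt[OF k assms(2), of x] assms(2) unfolding D_def by auto
 show ?thesis
 proof (rule that[of "D F2" "D F1" "D f"])
  show "C2d (D F2) (D F1) (D f)" unfolding C2d_def
  proof (intro conjI allI der F1 F2)
  show "continuous_on UNIV (D f)" unfolding D_def using assms(2) by (intro continuous_intros continuous_on_compose2[OF f]) auto
  qed
  show "\<exists>xi\<in>{x..x+2*eta}. D F2 x = f xi" for x by (rule mv[OF F2 F1])
  show "\<exists>xi\<in>{x..x+2*eta}. D F2 (x+c) - D F2 x = f (xi+c) - f xi" for x c
  proof -
  have sh: "((%y. k (y+c) - k y) has_real_derivative k' (y+c) - k' y) (at y)"
  if "!!x. (k has_real_derivative k' x) (at x)" for k k' y using DERIV_affine[of k "k' (y+c)" 1 y c] that by (auto intro!: DERIV_diff)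
  have "\<exists>xi\<in>{x..x+2*eta}. D (%y. F2 (y+c) - F2 y) x = f (xi+c) - f xi" by (rule mv) (rule sh, rule F2, rule sh, rule F1)
  moreover have "D (%y. F2 (y+c) - F2 y) x = D F2 (x+c) - D F2 x"
  unfolding D_def by (simp add: diff_divide_distrib[symmetric] algebra_simps)
  ultimately show ?thesis by simp
  qed
  show "\<exists>C. \<forall>x. \<bar>D F1 x\<bar> <= C & \<bar>D f x\<bar> <= C" if B: "!!x. \<bar>f x\<bar> <= B" for B
  proof (intro exI allI conjI)
  fix x
  have F1B: "\<bar>F1 (y+eta) - F1 y\<bar> <= B*eta" for y
  proof -
  obtain z where "F1 (y+eta) - F1 y = (y+eta - y)*f z" using MVT2[of y "y+eta" F1 f] F1 assms(2) by auto
  then show ?thesis using B[of z] assms(2) by (simp add: abs_mult mult.commute mult_left_mono)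
  qed
  have "D F1 x = ((F1 (x+eta+eta) - F1 (x+eta)) - (F1 (x+eta) - F1 x))/eta\<^sup>2" unfolding D_def by (simp add: algebra_simps)
  moreover have "\<bar>(F1 (x+eta+eta) - F1 (x+eta)) - (F1 (x+eta) - F1 x)\<bar> <= 2*B*eta"
  using F1B[of x] F1B[of "x+eta"] by linarith
  ultimately have "\<bar>D F1 x\<bar> <= 2*B*eta/eta\<^sup>2" using assms(2) by (simp add: divide_right_mono)
  then show "\<bar>D F1 x\<bar> <= max (2*B*eta/eta\<^sup>2) (4*B/eta\<^sup>2)" by linarith
  have "\<bar>f (x+2*eta) - 2*f (x+eta)+f x\<bar> <= 4*B" using B[of x] B[of "x+eta"] B[of "x+2*eta"] by linarith
  then have "\<bar>D f x\<bar> <= 4*B/eta\<^sup>2" unfolding D_def by (simp add: divide_right_mono)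
  then show "\<bar>D f x\<bar> <= max (2*B*eta/eta\<^sup>2) (4*B/eta\<^sup>2)" by linarith
  qed
 qed
qed

text \<open>The smoothing has to stay inside the class of data that the scheme admits: through the
  last conclusion \<open>G\<close> inherits from \<open>f\<close> both monotonicity and the bound on
  mesh increments.\<close>

lemma smoothing_UC:
 fixes f :: "real => real"
 assumes "uniformly_continuous_on UNIV f" "0 < gam" and B: "!!x. \<bar>f x\<bar> <= B"
 obtains G G1 G2 C where "C2d G G1 G2" "!!x. \<bar>G x - f x\<bar> <= gam" "!!x. \<bar>G x\<bar> <= B"
  "!!x. \<bar>G1 x\<bar> <= C" "!!x. \<bar>G2 x\<bar> <= C"
  "!!x c. \<exists>xi. G (x+c) - G x = f (xi+c) - f xi"
proof -
 obtain d where d: "d > 0" "!!x y. \<bar>y - x\<bar> < d ==> \<bar>f y - f x\<bar> < gam"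
  using assms(1,2) unfolding uniformly_continuous_on_def dist_real_def by (metis UNIV_I)
 have cf: "continuous_on UNIV f" using assms(1) by (rule uniformly_continuous_imp_continuous)
 have d3: "0 < d/3" using d(1) by simp
 show ?thesis
 proof (rule smoothing[OF cf d3])
  fix G G1 G2
  assume G: "C2d G G1 G2"
  "!!x. \<exists>xi\<in>{x..x+2*(d/3)}. G x = f xi"
  "!!x c. \<exists>xi\<in>{x..x+2*(d/3)}. G (x+c) - G x = f (xi+c) - f xi"
  "!!B. (!!x. \<bar>f x\<bar> <= B) ==> \<exists>C. \<forall>x. \<bar>G1 x\<bar> <= C & \<bar>G2 x\<bar> <= C"
  obtain C where C: "!!x. \<bar>G1 x\<bar> <= C & \<bar>G2 x\<bar> <= C" using G(4)[OF B] by auto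
  show ?thesis
  proof (rule that[of G G1 G2 C])
  show "\<bar>G x - f x\<bar> <= gam" for x
  proof -
  obtain xi where "xi \<in> {x..x+2*(d/3)}" "G x = f xi" using G(2)[of x] by blast
  then show ?thesis using d(2)[of xi x] d(1) by (simp add: less_imp_le)
  qed
  show "\<bar>G x\<bar> <= B" for x using G(2)[of x] B by auto
  show "\<exists>xi. G (x+c) - G x = f (xi+c) - f xi" for x c using G(3)[of x c] by blast
  qed (use G C in auto)
 qed
qed

lemma powr_diff_le:
 fixes a b L e :: real
 assumes "0 <= a" "a <= b" "b <= L" "1 <= e" shows "b powr e - a powr e <= e*L powr (e - 1)*(b - a)"
proof (cases "a = b")
 case False
 then have ab: "a < b" using assms by simp
 show ?thesis
 proof (cases "a = 0")
  \<comment> \<open>The derivative rule for real exponents needs a positive base. At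
    \<open>a = 0\<close> the factorisation \<open>b * b powr (e - 1)\<close> does the same because
    \<open>1 <= e\<close>.\<close>
  case True
  have "b powr e = b*b powr (e - 1)" using ab True by (simp add: powr_mult_base)
  also have "... <= b*(e*L powr (e - 1))"
  proof (intro mult_left_mono)
  have "b powr (e - 1) <= L powr (e - 1)" using assms by (intro powr_mono2) auto
  also have "... <= e*L powr (e - 1)" using mult_right_mono[OF assms(4), of "L powr (e - 1)"] by simp
  finally show "b powr (e - 1) <= e*L powr (e - 1)" .
  qed (use ab True in auto)
  finally show ?thesis using True by (simp add: mult.commute)
 next
  case False
  then have a0: "0 < a" using assms by simp
  have "\<exists>z>a. z < b & b powr e - a powr e = (b - a)*(e*z powr (e - 1))"
  by (rule MVT2[OF ab]) (use a0 in \<open>auto intro!: derivative_eq_intros\<close>)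
  then obtain z where z: "a < z" "z < b" "b powr e - a powr e = (b - a)*(e*z powr (e - 1))" by blast
  have "z powr (e - 1) <= L powr (e - 1)" using z a0 assms by (intro powr_mono2) auto
  then have "(b - a)*(e*z powr (e - 1)) <= (b - a)*(e*L powr (e - 1))" using assms ab by (intro mult_left_mono) auto
  with z(3) show ?thesis by (simp add: algebra_simps)
 qed
qed simp

lemma powr_abs_diff_le:
 fixes a b L e :: real
 assumes "0 <= a" "0 <= b" "a <= L" "b <= L" "1 <= e" shows "\<bar>b powr e - a powr e\<bar> <= e*L powr (e - 1)*\<bar>b - a\<bar>"
proof (cases "a <= b")
 case True
 then show ?thesis using powr_diff_le[of a b L e] powr_mono2[of e a b] assms by auto
next
 case False
 then show ?thesis using powr_diff_le[of b a L e] powr_mono2[of e b a] assms by auto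
qed

section \<open>Upper semicontinuous functions\<close>

lemma usc_on_iff:
 "usc_on S f \<longleftrightarrow> (\<forall>p\<in>S. \<forall>c>f p. \<exists>U. open U & p \<in> U & (\<forall>q\<in>U \<inter> S. f q < c))"
 unfolding usc_on_def eventually_at_topological by (metis IntE IntI)

lemma usc_onD:
 assumes "usc_on S f" "p \<in> S" "f p < c"
 obtains U where "open U" "p \<in> U" "!!q. q \<in> U ==> q \<in> S ==> f q < c" using assms unfolding usc_on_iff by (meson IntI)

lemma usc_on_subset: "usc_on S f ==> S' \<subseteq> S ==> usc_on S' f" unfolding usc_on_def
proof (intro ballI allI impI)
 fix p c
 assume a: "\<forall>p\<in>S. \<forall>c>f p. \<forall>\<^sub>F q in at p within S. f q < c" "S' \<subseteq> S" "p \<in> S'" "f p < c"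
 then have "\<forall>\<^sub>F q in at p within S. f q < c" by auto
 then show "\<forall>\<^sub>F q in at p within S'. f q < c" by (rule filter_leD[OF at_le[OF a(2)]])
qed

lemma usc_on_compose:
 assumes "usc_on S f" "continuous_on S' g" "g ` S' \<subseteq> S" shows "usc_on S' (%p. f (g p))" unfolding usc_on_iff
proof (intro ballI allI impI)
 fix p c assume p: "p \<in> S'" "c > f (g p)"
 then obtain U where U: "open U" "g p \<in> U" "!!q. q \<in> U ==> q \<in> S ==> f q < c"
  using usc_onD[OF assms(1)] assms(3) by (metis image_subset_iff)
 from assms(2) U(1,2) p(1) obtain A where "open A" "p \<in> A" "\<forall>y\<in>S'. y \<in> A --> g y \<in> U"
  unfolding continuous_on_topological by metis
 then show "\<exists>U. open U & p \<in> U & (\<forall>q\<in>U \<inter> S'. f (g q) < c)"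
  using U(3) assms(3) by (intro exI[of _ A]) (auto simp: image_subset_iff)
qed

lemma usc_on_add_cont:
 assumes "usc_on S f" "continuous_on S g" shows "usc_on S (%p. f p+g p)" unfolding usc_on_iff
proof (intro ballI allI impI)
 fix p c assume p: "p \<in> S" "c > f p+g p"
 define e where "e = (c - f p - g p)/2"
 have e: "e > 0" using p by (simp add: e_def)
 have "f p < f p+e" using e by simp
 from usc_onD[OF assms(1) p(1) this]
 obtain U where U: "open U" "p \<in> U" "!!q. q \<in> U ==> q \<in> S ==> f q < f p+e" by blast
 have "open {..<g p+e}" "g p \<in> {..<g p+e}" using e by simp_all
 with assms(2) p(1) obtain A where
  A: "open A" "p \<in> A" "\<forall>y\<in>S. y \<in> A --> g y \<in> {..<g p+e}" unfolding continuous_on_topological by blast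
 show "\<exists>U. open U & p \<in> U & (\<forall>q\<in>U \<inter> S. f q+g q < c)"
 proof (intro exI[of _ "U \<inter> A"] conjI ballI)
  fix q assume "q \<in> U \<inter> A \<inter> S"
  then have "f q < f p+e" "g q < g p+e" using U(3) A(3) by auto
  then show "f q+g q < c" unfolding e_def by (simp add: field_simps)
 qed (use U A in auto)
qed

text \<open>If every point were beaten by some \<open>b p\<close>, the open sets where
  \<open>f < f (b p)\<close> would cover \<open>K\<close>; among finitely many of them, the one with
  the largest \<open>f (b p)\<close> leads to a contradiction.\<close>

lemma usc_attains_max:
 assumes "compact K" "K ~= {}" "usc_on K f" shows "\<exists>p\<in>K. \<forall>q\<in>K. f q <= f p"
proof (rule ccontr)
 assume "\<not> ?thesis"
 then have "\<forall>p\<in>K. \<exists>q\<in>K. f p < f q" by (auto simp: not_le)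
 then obtain b where b: "!!p. p \<in> K ==> b p \<in> K & f p < f (b p)" by metis
 have "\<exists>U. open U & p \<in> U & (\<forall>q\<in>U \<inter> K. f q < f (b p))" if "p \<in> K" for p
  using assms(3) b[OF that] that unfolding usc_on_iff by blast
 then obtain U where U: "!!p. p \<in> K ==> open (U p) & p \<in> U p & (\<forall>q\<in>U p \<inter> K. f q < f (b p))" by metis
 obtain C where C: "C \<subseteq> K" "finite C" "K \<subseteq> (\<Union>p\<in>C. U p)"
 proof (rule compactE_image[OF assms(1), of K U])
  show "open (U p)" if "p \<in> K" for p using U[OF that] by simp
  show "K \<subseteq> (\<Union>p\<in>K. U p)" using U by blast
 qed (rule that)
 then have "C ~= {}" using assms(2) by auto
 have "finite ((%p. f (b p)) ` C)" "(%p. f (b p)) ` C ~= {}" using C \<open>C ~= {}\<close> by auto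
 then obtain p where p: "p \<in> C" "f (b p) = Max ((%p. f (b p)) ` C)" using Max_in by (metis (no_types, lifting) imageE)
 have "b p \<in> K" using p C b by auto
 then obtain p' where p': "p' \<in> C" "b p \<in> U p'" using C by auto
 then have "f (b p) < f (b p')" using U C \<open>b p \<in> K\<close> by auto
 moreover have "f (b p') <= f (b p)" using p p' C by (simp add: Max_ge)
 ultimately show False by simp
qed

text \<open>The interior condition alone, without boundedness, semicontinuity or initial data: this
  much passes to limits of the scheme, to rescalings and, with the sign changed, to
  negatives.\<close>

definition int_sub :: "real => real => real => (real \<times> real => real) => bool" where
 "int_sub m s T u \<longleftrightarrow> (\<forall>phi x0 t0. C2_on (Q T) phi & Cb_on (Q T) phi &
  max_point (Q T) (%p. u p - phi p) (x0, t0) --> eq_op m s T phi x0 t0 <= 0)"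

definition int_super :: "real => real => real => (real \<times> real => real) => bool" where
 "int_super m s T u \<longleftrightarrow> (\<forall>phi x0 t0. C2_on (Q T) phi & Cb_on (Q T) phi &
  min_point (Q T) (%p. u p - phi p) (x0, t0) --> eq_op m s T phi x0 t0 \<ge> 0)"

section \<open>Test functions that split into space and time\<close>

lemma has_derivative_fst_comp:
 fixes f :: "real => real"
 assumes "(f has_real_derivative D) (at (fst p))" shows "((%p. f (fst p)) has_derivative (%(u, w). D*u+0*w)) (at p within S)"
proof -
 have "(f has_derivative (*) D) (at (fst p))" using assms unfolding has_field_derivative_def .
 from has_derivative_compose[OF has_derivative_fst[OF has_derivative_ident] this]
 show ?thesis by (simp add: case_prod_unfold has_derivative_at_withinI)
qed

lemma has_derivative_snd_comp:
 fixes f :: "real => real"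
 assumes "(f has_real_derivative D) (at (snd p))" shows "((%p. f (snd p)) has_derivative (%(u, w). 0*u+D*w)) (at p within S)"
proof -
 have "(f has_derivative (*) D) (at (snd p))" using assms unfolding has_field_derivative_def .
 from has_derivative_compose[OF has_derivative_snd[OF has_derivative_ident] this]
 show ?thesis by (simp add: case_prod_unfold has_derivative_at_withinI)
qed

lemma C2_on_split:
 assumes "C2d f f1 f2" "C2d g g1 g2" shows "C2_on S (%p. f (fst p)+g (snd p))" unfolding C2_on_def
proof (intro exI conjI ballI)
 fix p assume "p \<in> S"
 have d: "(f has_real_derivative f1 x) (at x)" "(f1 has_real_derivative f2 x) (at x)"
  "(g has_real_derivative g1 x) (at x)" "(g1 has_real_derivative g2 x) (at x)" for x using assms unfolding C2d_def by blast+
 show "((%p. f (fst p)+g (snd p)) has_derivative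
  (%(u, w). f1 (fst p)*u+g1 (snd p)*w)) (at p within S)"
  using has_derivative_add[OF has_derivative_fst_comp[OF d(1)] has_derivative_snd_comp[OF d(3)]] by (simp add: case_prod_unfold)
 show "((%p. f1 (fst p)) has_derivative (%(u, w). f2 (fst p)*u+0*w)) (at p within S)" by (rule has_derivative_fst_comp[OF d(2)])
 show "((%p. g1 (snd p)) has_derivative (%(u, w). 0*u+g2 (snd p)*w)) (at p within S)" by (rule has_derivative_snd_comp[OF d(4)])
next
 show "continuous_on S (%p. f2 (fst p))" "continuous_on S (%p. g2 (snd p))"
  by (intro continuous_on_compose2[OF C2d_cont(3)[OF assms(1)]]
  continuous_on_compose2[OF C2d_cont(3)[OF assms(2)]] continuous_intros; auto)+
qed auto

lemma Cb_on_split: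
 assumes "continuous_on UNIV f" "bounded (range f)" "continuous_on UNIV g" "S \<subseteq> Qbar T"
 shows "Cb_on S (%p. f (fst p)+g (snd p))" unfolding Cb_on_def
proof
 obtain B where B: "!!x. \<bar>f x\<bar> <= B" using assms(2) unfolding bounded_iff by auto
 have "compact (g ` {0..T})" using assms(3) by (intro compact_continuous_image) (auto intro: continuous_on_subset)
 then obtain C where C: "!!t. t \<in> {0..T} ==> \<bar>g t\<bar> <= C"
  using compact_imp_bounded bounded_iff by (metis imageI real_norm_def)
 show "bounded ((%p. f (fst p)+g (snd p)) ` S)" unfolding bounded_iff
 proof (intro exI[of _ "B+C"] ballI)
  fix y assume "y \<in> (%p. f (fst p)+g (snd p)) ` S"
  then obtain p where p: "p \<in> S" "y = f (fst p)+g (snd p)" by blast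
  then have "snd p \<in> {0..T}" using assms(4) by (auto simp: Qbar_def)
  then show "norm y <= B+C" using B[of "fst p"] C[of "snd p"] p(2) by (simp add: abs_le_iff)
 qed
 show "continuous_on S (%p. f (fst p)+g (snd p))"
  by (intro continuous_intros continuous_on_compose2[OF assms(1)] continuous_on_compose2[OF assms(3)]) auto
qed

lemma eq_op_split:
 assumes "0 < s" "s < 1" "0 < T" "t \<in> {0..T}" and f: "C2d f f1 f2" "bounded (range f)" and g: "(g has_real_derivative g') (at t)"
 shows "eq_op m s T (%p. f (fst p)+g (snd p)) x t = g'+\<bar>f1 x\<bar> powr (m - 1)*fl s (sdiff f x)"
proof -
 have "((%r. f x+g r) has_vector_derivative g') (at t within {0..T})"
  using has_field_derivative_at_within[OF DERIV_add[OF DERIV_const g, of "f x"]]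
  unfolding has_real_derivative_iff_has_vector_derivative by simp
 then have 1: "dt T (%p. f (fst p)+g (snd p)) x t = g'"
  unfolding dt_def using vector_derivative_within_closed_interval[OF assms(3,4)] by simp
 have "(f has_real_derivative f1 x) (at x)" using f(1) unfolding C2d_def by blast
 then have "((%y. f y+g t) has_real_derivative f1 x) (at x)" using DERIV_add[OF _ DERIV_const] by fastforce
 then have 2: "dx (%p. f (fst p)+g (snd p)) x t = f1 x" unfolding dx_def by (simp add: DERIV_imp_deriv)
 have c: "C2_real (%y. f y+g t)" by (rule C2_real_add[OF C2_realI[OF f(1)] C2_real_const])
 have b: "bounded (range (%y. f y+g t))" by (rule bounded_plus_comp[OF f(2)]) (simp add: image_constant_conv)
 have "sdiff (%y. f y+g t) x = sdiff f x" by (rule ext) (simp add: sdiff_def)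
 then have "frac_lap s (%y. f y+g t) x = fl s (sdiff f x)" using frac_lap_eq[OF assms(1,2) c b] by simp
 then show ?thesis unfolding eq_op_def 1 2 by simp
qed

text \<open>With a split test function only the slope of \<open>g\<close> and a one-variable
  nonlocal term appear. Contact is normalised to equality at the point, which absorbs the value of
  the maximum into \<open>g\<close>.\<close>

lemma int_sub_split:
 assumes "0 < s" "s < 1" "int_sub m s T u" "C2d f f1 f2" "bounded (range f)" "C2d g g1 g2"
  and t0: "0 < t0" "t0 < T" and eq: "u (x0, t0) = f x0+g t0" and le: "!!x t. 0 < t ==> t < T ==> u (x, t) <= f x+g t"
 shows "g1 t0+\<bar>f1 x0\<bar> powr (m - 1)*fl s (sdiff f x0) <= 0"
proof -
 define phi where "phi = (%p. f (fst p)+g (snd p))"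
 have "C2_on (Q T) phi" "Cb_on (Q T) phi" unfolding phi_def by (rule C2_on_split[OF assms(4,6)])
  (rule Cb_on_split[OF C2d_cont(1)[OF assms(4)] assms(5) C2d_cont(1)[OF assms(6)], of _ T],
  auto simp: Q_def Qbar_def)
 moreover have "max_point (Q T) (%p. u p - phi p) (x0, t0)" unfolding max_point_def phi_def using t0 eq le by (auto simp: Q_def)
 ultimately have "eq_op m s T phi x0 t0 <= 0" using assms(3) unfolding int_sub_def by blast
 moreover have "(g has_real_derivative g1 t0) (at t0)" using assms(6) by (simp add: C2d_def)
 ultimately show ?thesis using eq_op_split[OF assms(1,2) _ _ assms(4,5), of T t0 g "g1 t0" m x0] t0 unfolding phi_def by simp
qed

lemma int_super_split:
 assumes "0 < s" "s < 1" "int_super m s T u" "C2d f f1 f2" "bounded (range f)" "C2d g g1 g2"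
  and t0: "0 < t0" "t0 < T" and eq: "u (x0, t0) = f x0+g t0" and le: "!!x t. 0 < t ==> t < T ==> f x+g t <= u (x, t)"
 shows "0 <= g1 t0+\<bar>f1 x0\<bar> powr (m - 1)*fl s (sdiff f x0)"
proof -
 define phi where "phi = (%p. f (fst p)+g (snd p))"
 have "C2_on (Q T) phi" "Cb_on (Q T) phi" unfolding phi_def by (rule C2_on_split[OF assms(4,6)])
  (rule Cb_on_split[OF C2d_cont(1)[OF assms(4)] assms(5) C2d_cont(1)[OF assms(6)], of _ T],
  auto simp: Q_def Qbar_def)
 moreover have "min_point (Q T) (%p. u p - phi p) (x0, t0)" unfolding min_point_def phi_def using t0 eq le by (auto simp: Q_def)
 ultimately have "eq_op m s T phi x0 t0 \<ge> 0" using assms(3) unfolding int_super_def by blast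
 moreover have "(g has_real_derivative g1 t0) (at t0)" using assms(6) by (simp add: C2d_def)
 ultimately show ?thesis using eq_op_split[OF assms(1,2) _ _ assms(4,5), of T t0 g "g1 t0" m x0] t0 unfolding phi_def by simp
qed

lemma visc_subsol_split_0:
 assumes "0 < s" "s < 1" "0 < T" "visc_subsol m s T v0 u" and "C2d f f1 f2" "bounded (range f)" "C2d g g1 g2"
  and eq: "u (x0, 0) = f x0+g 0" and le: "!!x t. 0 <= t ==> t <= T ==> u (x, t) <= f x+g t"
 shows "u (x0, 0) <= usc_env UNIV v0 x0 | g1 0+\<bar>f1 x0\<bar> powr (m - 1)*fl s (sdiff f x0) <= 0"
proof -
 define phi where "phi = (%p. f (fst p)+g (snd p))"
 have "C2_on (Qbar T) phi" "Cb_on (Qbar T) phi" unfolding phi_def by (rule C2_on_split[OF assms(5,7)])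
  (rule Cb_on_split[OF C2d_cont(1)[OF assms(5)] assms(6) C2d_cont(1)[OF assms(7)], of _ T], auto)
 moreover have "max_point (Qbar T) (%p. u p - phi p) (x0, 0)"
  unfolding max_point_def phi_def using eq le assms(3) by (auto simp: Qbar_def)
 ultimately have "min (u (x0, 0) - usc_env UNIV v0 x0) (eq_op m s T phi x0 0) <= 0" using assms(4) unfolding visc_subsol_def by blast
 moreover have "(g has_real_derivative g1 0) (at 0)" using assms(7) by (simp add: C2d_def)
 ultimately show ?thesis using eq_op_split[OF assms(1,2,3) _ assms(5,6), of 0 g "g1 0" m x0] assms(3) unfolding phi_def
  by (auto simp: min_le_iff_disj)
qed

lemma bounded_rangeI: "(!!x. \<bar>f x\<bar> <= B) ==> bounded (range (f :: 'a => real))" unfolding bounded_iff by auto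

lemma sdiff_add: "sdiff (%x. f x+g x) x y = sdiff f x y+sdiff g x y" by (simp add: sdiff_def algebra_simps)

lemma C2d_cong1: "C2d f f1 f2 ==> (!!x. f x = g x) ==> (!!x. f1 x = g1 x) ==> C2d g g1 f2"
proof -
 assume a: "C2d f f1 f2" "!!x. f x = g x" "!!x. f1 x = g1 x"
 then have "f = g" "f1 = g1" by auto
 with a show ?thesis by simp
qed

section \<open>Penalties in time and at infinity\<close>

lemma C2d_power: "C2d (%t. t ^ Suc n) (%t. real (Suc n)*t ^ n) (%t. real (Suc n)*(real n*t ^ (n - 1)))" unfolding C2d_def
proof (intro conjI allI)
 fix x :: real
 show "((%t. t ^ Suc n) has_real_derivative real (Suc n)*x ^ n) (at x)" using DERIV_pow[of "Suc n" x UNIV] by simp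
 show "((%t. real (Suc n)*t ^ n) has_real_derivative real (Suc n)*(real n*x ^ (n - 1))) (at x)"
  using DERIV_cmult[OF DERIV_pow[of n x UNIV], of "real (Suc n)"] by simp
 show "continuous_on UNIV (%t::real. real (Suc n)*(real n*t ^ (n - 1)))" by (intro continuous_intros)
qed

text \<open>The power of \<open>t/T\<close> keeps maxima away from the final time: it is 1 at
  \<open>T\<close> and, for large \<open>N\<close>, negligible at a fixed earlier time. A term such
  as \<open>1/(T - t)\<close> would not be bounded on the strip. The power is increasing, so a lower
  bound on \<open>g1\<close> is enough.\<close>

lemma C2d_penalty:
 assumes "0 < T" "0 <= K" shows "\<exists>g1 g2. C2d (%t. c0+a*t+c*t\<^sup>2+K*(t/T) ^ Suc N) g1 g2 &
  (\<forall>t\<ge>0. a+2 * c*t <= g1 t)"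
proof -
 have "C2d (%t. (c0+a*t+c*t\<^sup>2)+K*((1/T)*t+0) ^ Suc N)
  (%t. (a+2 * c*t)+K*((1/T)*(real (Suc N)*((1/T)*t+0) ^ N)))
  (%t. (2 * c)+K*((1/T)\<^sup>2*(real (Suc N)*(real N*((1/T)*t+0) ^ (N - 1)))))"
  by (rule C2d_add[OF C2d_poly2 C2d_cmult[OF C2d_affine[OF C2d_power]]])
 then have "C2d (%t. c0+a*t+c*t\<^sup>2+K*(t/T) ^ Suc N)
  (%t. (a+2 * c*t)+K*((1/T)*(real (Suc N)*((1/T)*t+0) ^ N)))
  (%t. (2 * c)+K*((1/T)\<^sup>2*(real (Suc N)*(real N*((1/T)*t+0) ^ (N - 1)))))" by (rule C2d_cong1) simp_all
 moreover have "\<forall>t\<ge>0. a+2 * c*t <= (a+2 * c*t)+K*((1/T)*(real (Suc N)*((1/T)*t+0) ^ N))"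
  using assms by (auto intro!: mult_nonneg_nonneg)
 ultimately show ?thesis by (intro exI conjI)
qed

lemma C2d_qf_scaled:
 assumes "0 < kap" "0 <= K"
 shows "\<exists>b1 b2. C2d (%x. K*qf (kap*x)) b1 b2 & (\<forall>x. \<bar>b1 x\<bar> <= K * kap) & (\<forall>x. \<bar>b2 x\<bar> <= 8*K * kap\<^sup>2)"
proof -
 obtain q2 where q2: "C2d qf (%z. 2*z/(1+z\<^sup>2)\<^sup>2) q2" "!!z. \<bar>q2 z\<bar> <= 8" using C2d_qf by blast
 define q1 where "q1 = (%z::real. 2*z/(1+z\<^sup>2)\<^sup>2)"
 have q1: "\<bar>q1 z\<bar> <= 1" for z
 proof -
  have "2*\<bar>z\<bar> <= 1+z\<^sup>2"
  using sum_squares_bound[of 1 "\<bar>z\<bar>"] by (simp add: power2_eq_square abs_mult[symmetric])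
  also have "... <= (1+z\<^sup>2)\<^sup>2" using self_le_power[of "1+z\<^sup>2" 2] by simp
  finally show ?thesis unfolding q1_def using one_plus_sq_pos[of z] by (simp add: abs_mult divide_le_eq)
 qed
 have "C2d (%x. K*qf (kap*x+0)) (%x. K*(kap*q1 (kap*x+0))) (%x. K*(kap\<^sup>2*q2 (kap*x+0)))"
  unfolding q1_def by (rule C2d_cmult[OF C2d_affine[OF q2(1)]])
 then have "C2d (%x. K*qf (kap*x)) (%x. K*(kap*q1 (kap*x))) (%x. K*(kap\<^sup>2*q2 (kap*x)))" by simp
 moreover have "\<bar>K*(kap*q1 (kap*x))\<bar> <= K * kap" for x
 proof -
  have "K * kap*\<bar>q1 (kap*x)\<bar> <= K * kap*1" using q1 assms by (intro mult_left_mono) auto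
  then show ?thesis using assms by (simp add: abs_mult mult.assoc)
 qed
 moreover have "\<bar>K*(kap\<^sup>2*q2 (kap*x))\<bar> <= 8*K * kap\<^sup>2" for x
 proof -
  have "K * kap\<^sup>2*\<bar>q2 (kap*x)\<bar> <= K * kap\<^sup>2*8" using q2(2) assms by (intro mult_left_mono) auto
  then show ?thesis using assms by (simp add: abs_mult mult_ac)
 qed
 ultimately show ?thesis by (intro exI conjI allI)
qed

text \<open>Stretching the profile by \<open>1/kap\<close> makes its nonlocal term of size
  \<open>kap powr (2 * s)\<close>, uniformly in \<open>x\<close>, so the penalty at infinity costs
  nothing in the limit of small \<open>kap\<close>.\<close>

lemma fl_qf_scaled:
 assumes "0 < s" "s < 1" "0 < kap" "0 <= K" shows "kint s (sdiff (%x. K*qf (kap*x)) x)"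
  and "\<bar>fl s (sdiff (%x. K*qf (kap*x)) x)\<bar> <= 16*K * kap powr (2 * s)*fl s qf"
proof -
 have eq: "sdiff (%x. K*qf (kap*x)) x = (%y. K * sdiff qf (kap*x) (kap*y))" by (rule ext) (simp add: sdiff_def algebra_simps)
 show "kint s (sdiff (%x. K*qf (kap*x)) x)" unfolding eq by (intro kint_cmult kint_scale kint_sdiff assms C2_real_qf bounded_qf)
 obtain q2 where q2: "C2d qf (%z. 2*z/(1+z\<^sup>2)\<^sup>2) q2" "!!z. \<bar>q2 z\<bar> <= 8" using C2d_qf by blast
 have q1: "\<bar>qf z\<bar> <= 1" for z using qf_nonneg[of z] qf_less1[of z] by simp
 have "\<bar>fl s (sdiff qf (kap*x))\<bar> <= 2*8*fl s qf"
 proof (rule fl_bound[OF assms(1,2)])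
  show "sdiff qf (kap*x) \<in> borel_measurable borel" by (rule sdiff_meas[OF C2_real_cont[OF C2_real_qf]])
  show "\<bar>sdiff qf (kap*x) y\<bar> <= 8*min 1 (y\<^sup>2)" for y using sdiff_min_bound[OF q2(1) q1 q2(2), of "kap*x" y] by simp
 qed
 then have "K * kap powr (2 * s)*\<bar>fl s (sdiff qf (kap*x))\<bar> <= K * kap powr (2 * s)*(2*8*fl s qf)"
  using assms by (intro mult_left_mono) auto
 then show "\<bar>fl s (sdiff (%x. K*qf (kap*x)) x)\<bar> <= 16*K * kap powr (2 * s)*fl s qf"
  unfolding eq fl_cmult fl_scale[OF assms(3)] using assms(4) by (simp add: abs_mult mult_ac)
qed

lemma small_penalty:
 fixes t1 T K e :: real
 assumes "0 <= t1" "t1 < T" "0 < e" shows "\<exists>N. K*(t1/T) ^ Suc N < e"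
proof -
 have "(%n. K*(t1/T) ^ Suc n) \<longlonglongrightarrow> K*0" using assms by (intro tendsto_intros LIMSEQ_Suc LIMSEQ_realpow_zero) auto
 then have "\<forall>\<^sub>F n in sequentially. K*(t1/T) ^ Suc n < e" using assms(3) by (auto dest: order_tendstoD(2))
 then show ?thesis by (auto dest: eventually_happens)
qed

lemma small_qf:
 fixes x K e :: real
 assumes "0 <= K" "0 < e" shows "\<exists>kap0>0. kap0 <= 1 & (\<forall>kap. 0 < kap & kap <= kap0 --> K*qf (kap*x) < e)"
proof -
 define D where "D = K*x\<^sup>2+1"
 have D: "D > 0" "K*x\<^sup>2 < D" using assms by (auto simp: D_def add_nonneg_pos)
 define kap0 where "kap0 = min 1 (e/D)"
 have "K*qf (kap*x) < e" if k: "0 < kap" "kap <= kap0" for kap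
 proof -
  have "qf (kap*x) <= (kap*x)\<^sup>2" using qf_le_min[of "kap*x"] by simp
  also have "... = kap * kap*x\<^sup>2" by (simp add: power2_eq_square)
  also have "... <= kap*1*x\<^sup>2" using k by (intro mult_right_mono mult_left_mono) (auto simp: kap0_def)
  finally have "K*qf (kap*x) <= K*(kap*x\<^sup>2)" using assms(1) by (simp add: mult_left_mono)
  also have "... = kap*(K*x\<^sup>2)" by simp
  also have "... < kap*D" using k D by simp
  also have "... <= (e/D)*D" using k D by (intro mult_right_mono) (auto simp: kap0_def)
  finally show ?thesis using D by simp
 qed
 moreover have "kap0 > 0" "kap0 <= 1" using D assms by (auto simp: kap0_def)
 ultimately show ?thesis by blast
qed

lemma qf_far:
 fixes x K kap :: real
 assumes "0 <= K" "0 < kap" "(K+1)/kap <= \<bar>x\<bar>" shows "K - 1 <= K*qf (kap*x)"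
proof -
 define z where "z = kap*x"
 have "K+1 <= \<bar>z\<bar>" using assms by (simp add: z_def abs_mult pos_divide_le_eq mult.commute)
 then have "(K+1)\<^sup>2 <= \<bar>z\<bar>\<^sup>2" using assms(1) by (intro power_mono) auto
 then have "K <= z\<^sup>2" using assms(1) by (simp add: power2_eq_square algebra_simps)
  (smt (verit) mult_nonneg_nonneg)
 then show ?thesis using one_plus_sq_pos[of z] unfolding z_def[symmetric] qf_def by (simp add: field_simps)
qed

section \<open>Control at the initial time and doubling of variables\<close>

lemma visc_subsolD:
 assumes "visc_subsol m s T v0 u" shows "bounded (u ` Qbar T)" "usc_on (Qbar T) u" "int_sub m s T u"
 using assms unfolding visc_subsol_def int_sub_def by blast+

text \<open>For large \<open>A\<close> the function \<open>G x + A * t\<close> is a strict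
  supersolution, since slope and nonlocal term of \<open>G\<close> are bounded. The penalties
  localise a point where \<open>u\<close> would exceed it; at \<open>t = 0\<close> strictness rules
  out the equation, and the datum, which is below \<open>G\<close>, decides.\<close>

lemma barrier:
 assumes s: "0 < s" "s < 1" and T: "0 < T" and m: "m \<ge> 2" and u: "visc_subsol m s T v0 u"
  and G: "C2d G G1 G2" "!!x. \<bar>G x\<bar> <= B0" "!!x. \<bar>G1 x\<bar> <= B1" "!!x. \<bar>G2 x\<bar> <= B1"
  and above: "!!x. usc_env UNIV v0 x <= G x" shows "\<exists>A\<ge>0. \<forall>x. \<forall>t\<in>{0..<T}. u (x, t) <= G x+A*t"
proof -
 obtain C0 where C0: "!!p. p \<in> Qbar T ==> \<bar>u p\<bar> <= C0" using visc_subsolD(1)[OF u] unfolding bounded_iff by auto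
 have uC0: "\<bar>u (x, t)\<bar> <= C0" if "0 <= t" "t <= T" for x t using C0 that by (auto simp: Qbar_def)
 have B: "0 <= B0" "0 <= B1" using G(2)[of 0] G(3)[of 0] by linarith+
 have C00: "0 <= C0" using uC0[of 0 0] T by force
 \<comment> \<open>Larger by 1 than any value of \<open>u - G\<close>, so that either penalty, once
   fully developed, makes \<open>Psi\<close> at most 0.\<close>
 define K where "K = C0+B0+1"
 have K: "K \<ge> 1" using B C00 by (simp add: K_def)
 define D where "D = 2*max (4*(B0+K)) (B1+8*K)*fl s qf"
 have D: "D \<ge> 0" unfolding D_def using fl_qf_nonneg[OF s] B K by (intro mult_nonneg_nonneg) auto
 \<comment> \<open>The first summand bounds the nonlocal part for the penalised test function,
   uniformly in \<open>kap <= 1\<close>; the 1 makes the contradiction strict.\<close>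
 define A where "A = (B1+K) powr (m - 1)*D+1"
 have A: "A \<ge> 1" using D by (simp add: A_def)
 have "u (x1, t1) <= G x1+A*t1" if t1: "0 <= t1" "t1 < T" for x1 t1
 proof (rule ccontr)
  assume neg: "\<not> u (x1, t1) <= G x1+A*t1"
  define d where "d = u (x1, t1) - G x1 - A*t1"
  have d: "d > 0" using neg by (simp add: d_def)
  obtain N where N: "K*(t1/T) ^ Suc N < d/3" using small_penalty[OF t1, of "d/3"] d by auto
  obtain kap where kap: "0 < kap" "kap <= 1" "K*qf (kap*x1) < d/3" using small_qf[of K "d/3" x1] d K by auto
  define f where "f = (%x. G x+K*qf (kap*x))"
  obtain b1 b2 where b: "C2d (%x. K*qf (kap*x)) b1 b2" "!!x. \<bar>b1 x\<bar> <= K * kap" "!!x. \<bar>b2 x\<bar> <= 8*K * kap\<^sup>2"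
  using C2d_qf_scaled[of kap K] kap(1) K by auto
  define f1 where "f1 = (%x. G1 x+b1 x)"
  define f2 where "f2 = (%x. G2 x+b2 x)"
  have f: "C2d f f1 f2" unfolding f_def f1_def f2_def by (rule C2d_add[OF G(1) b(1)])
  have fb: "\<bar>f x\<bar> <= B0+K" for x
  proof -
  have "0 <= K*qf (kap*x)" "K*qf (kap*x) <= K*1" using qf_nonneg qf_less1[of "kap*x"] K by (auto intro!: mult_left_mono)
  then show ?thesis using G(2)[of x] unfolding f_def by linarith
  qed
  have f1b: "\<bar>f1 x\<bar> <= B1+K" for x
  proof -
  have "K * kap <= K" using K kap by (simp add: mult_left_le)
  then show ?thesis using G(3)[of x] b(2)[of x] unfolding f1_def by linarith
  qed
  have f2b: "\<bar>f2 x\<bar> <= B1+8*K" for x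
  proof -
  have "kap\<^sup>2 <= 1" using kap by (simp add: power_le_one)
  then have "8*K * kap\<^sup>2 <= 8*K*1" using K by (intro mult_left_mono) auto
  then show ?thesis using G(4)[of x] b(3)[of x] unfolding f2_def by linarith
  qed
  have flb: "\<bar>fl s (sdiff f x)\<bar> <= D" for x unfolding D_def by (rule fl_bound[OF s sdiff_meas[OF C2d_cont(1)[OF f]]])
  (rule sdiff_min_bound[OF f fb f2b])
  define g where "g = (%t. A*t+K*(t/T) ^ Suc N)"
  define Psi where "Psi = (%p. u p+(- (f (fst p)+g (snd p))))"
  define R where "R = max ((K+1)/kap) \<bar>x1\<bar>"
  have pen0: "0 <= K*(t/T) ^ Suc N" if "0 <= t" for t using that T K by simp
  have far: "Psi (x, t) <= 0" if "R <= \<bar>x\<bar>" "0 <= t" "t <= T" for x t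
  proof -
  have "(K+1)/kap <= \<bar>x\<bar>" using that(1) by (simp add: R_def)
  from qf_far[OF _ kap(1) this] have "K - 1 <= K*qf (kap*x)" using K by simp
  moreover have "0 <= A*t" using A that by simp
  ultimately show ?thesis using uC0[OF that(2,3), of x] G(2)[of x] pen0[OF that(2)]
  unfolding Psi_def f_def g_def K_def fst_conv snd_conv by linarith
  qed
  have "Psi (x1, t1) = d - K*qf (kap*x1) - K*(t1/T) ^ Suc N" by (simp only: Psi_def f_def g_def d_def fst_conv snd_conv algebra_simps)
  moreover have "d/3+d/3 < d" using d by simp
  ultimately have Psi1: "Psi (x1, t1) > 0" using N kap(3) by linarith
  define KK where "KK = {- R..R} \<times> {0..T}"
  have KK: "compact KK" "KK \<subseteq> Qbar T" "(x1, t1) \<in> KK"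
  using t1 by (auto simp: KK_def Qbar_def R_def compact_Times max_def)
  have gc: "continuous_on UNIV g" unfolding g_def by (intro continuous_intros) (use T in auto)
  have "usc_on KK Psi" unfolding Psi_def by (intro usc_on_add_cont usc_on_subset[OF visc_subsolD(2)[OF u] KK(2)] continuous_intros
  continuous_on_compose2[OF C2d_cont(1)[OF f]] continuous_on_compose2[OF gc]) auto
  then obtain pb where pb: "pb \<in> KK" "!!q. q \<in> KK ==> Psi q <= Psi pb" using usc_attains_max[OF KK(1)] KK(3) by blast
  obtain xb tb where xt: "pb = (xb, tb)" by (cases pb)
  have tb: "0 <= tb" "tb <= T" using pb(1) xt by (auto simp: KK_def)
  have Pb: "Psi (xb, tb) > 0" using Psi1 pb(2)[OF KK(3)] xt by simp
  have gl: "Psi (x, t) <= Psi (xb, tb)" if "0 <= t" "t <= T" for x t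
  proof (cases "\<bar>x\<bar> <= R")
  case True then show ?thesis using pb(2)[of "(x, t)"] that xt by (auto simp: KK_def abs_le_iff)
  next
  case False then show ?thesis using far[of x t] that Pb by simp
  qed
  have q0: "0 <= K*qf (kap*x)" for x using qf_nonneg K by simp
  have "tb ~= T"
  proof
  assume "tb = T"
  then have "g tb \<ge> K" using T A by (simp add: g_def)
  then show False using Pb uC0[OF tb, of xb] G(2)[of xb] q0[of xb] unfolding Psi_def f_def K_def fst_conv snd_conv by linarith
  qed
  then have tbT: "tb < T" using tb by simp
  define c where "c = Psi (xb, tb)"
  obtain g1 g2 where g: "C2d (%t. c+A*t+0*t\<^sup>2+K*(t/T) ^ Suc N) g1 g2"
  "!!t. 0 <= t ==> A+2*0*t <= g1 t" using C2d_penalty[OF T, of K c A 0 N] K by auto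
  have ge: "c+A*t+0*t\<^sup>2+K*(t/T) ^ Suc N = c+g t" for t by (simp add: g_def)
  have eqb: "u (xb, tb) = f xb+(c+g tb)" by (simp add: c_def Psi_def)
  have leb: "u (x, t) <= f x+(c+g t)" if "0 <= t" "t <= T" for x t using gl[OF that, of x] by (simp add: c_def Psi_def)
  have bf: "bounded (range f)" by (rule bounded_rangeI[OF fb])
  have contra: "0 < g1 tb+\<bar>f1 xb\<bar> powr (m - 1)*fl s (sdiff f xb)"
  proof -
  have "\<bar>f1 xb\<bar> powr (m - 1)*\<bar>fl s (sdiff f xb)\<bar> <= (B1+K) powr (m - 1)*D"
  using m f1b flb D by (intro mult_mono powr_mono2) auto
  then have "- ((B1+K) powr (m - 1)*D) <= \<bar>f1 xb\<bar> powr (m - 1)*fl s (sdiff f xb)"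
  using abs_ge_minus_self[of "\<bar>f1 xb\<bar> powr (m - 1)*fl s (sdiff f xb)"] unfolding abs_mult by simp
  then show ?thesis using g(2)[OF tb(1)] by (simp add: A_def)
  qed
  show False
  proof (cases "tb = 0")
  case False
  then have "0 < tb" using tb by simp
  from int_sub_split[OF s visc_subsolD(3)[OF u] f bf g(1) this tbT, of xb]
  show False using contra eqb leb unfolding ge by force
  next
  case True
  have "u (xb, 0) <= usc_env UNIV v0 xb | g1 0+\<bar>f1 xb\<bar> powr (m - 1)*fl s (sdiff f xb) <= 0"
  by (rule visc_subsol_split_0[OF s T u f bf g(1)]; unfold ge)
  (use eqb leb True in blast)+
  then have "u (xb, 0) <= G xb" using contra True above[of xb] by auto
  then show False using Pb True q0[of xb] by (simp add: Psi_def f_def g_def)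
  qed
 qed
 then show ?thesis using A by (intro exI[of _ A]) auto
qed

text \<open>The rate \<open>A\<close> may blow up as \<open>gam\<close> tends to 0; what matters is
  that it does not depend on \<open>x\<close>, because \<open>doubling_max\<close> fixes
  \<open>eps\<close> before it is known where the maximum lies.\<close>

lemma initial_control:
 assumes s: "0 < s" "s < 1" and T: "0 < T" and m: "m \<ge> 2" and u: "visc_subsol m s T v0 u"
  and w: "uniformly_continuous_on UNIV w" "!!x. \<bar>w x\<bar> <= B" and above: "!!x. usc_env UNIV v0 x <= w x" and "0 < gam"
 shows "\<exists>A\<ge>0. \<forall>x. \<forall>t\<in>{0..<T}. u (x, t) <= w x+gam+A*t"
proof -
 have g2: "0 < gam/2" using assms by simp
 obtain G G1 G2 C where G: "C2d G G1 G2" "!!x. \<bar>G x - w x\<bar> <= gam/2" "!!x. \<bar>G x\<bar> <= B"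
  "!!x. \<bar>G1 x\<bar> <= C" "!!x. \<bar>G2 x\<bar> <= C" using smoothing_UC[OF w(1) g2 w(2)] by (metis (no_types, lifting))
 have "C2d (%x. G x+gam/2) (%x. G1 x+0) (%x. G2 x+0)" by (rule C2d_add[OF G(1) C2d_const])
 then have "\<exists>A\<ge>0. \<forall>x. \<forall>t\<in>{0..<T}. u (x, t) <= (G x+gam/2)+A*t"
 proof (rule barrier[OF s T m u])
  show "\<bar>G x+gam/2\<bar> <= B+gam/2" for x using G(3)[of x] assms(9) by linarith
  show "\<bar>G1 x+0\<bar> <= C" "\<bar>G2 x+0\<bar> <= C" for x using G by auto
  show "usc_env UNIV v0 x <= G x+gam/2" for x using above[of x] G(2)[of x] by linarith
 qed
 then obtain A where A: "A \<ge> 0" "!!x t. t \<in> {0..<T} ==> u (x, t) <= (G x+gam/2)+A*t" by blast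
 have "u (x, t) <= w x+gam+A*t" if "t \<in> {0..<T}" for x t using A(2)[OF that, of x] G(2)[of x] by linarith
 then show ?thesis using A(1) by blast
qed

text \<open>The quantifiers follow the order in which limits are taken later: everything but
  \<open>kap\<close> is fixed first. \<open>kap\<close> gives compactness in space, the power of
  \<open>t/T\<close> keeps the maximum from the final time and \<open>init\<close> from the initial
  time, and \<open>eta\<close> makes the final inequality strict.\<close>

lemma doubling_max:
 assumes T: "0 < T" and u: "usc_on (Qbar T) u" and W: "uniformly_continuous_on (Qbar T) W"
  and uC: "!!x t. 0 <= t ==> t <= T ==> \<bar>u (x, t)\<bar> <= C0" and WC: "!!x t. 0 <= t ==> t <= T ==> \<bar>W (x, t)\<bar> <= C0"
  and init: "!!gam. 0 < gam ==> \<exists>A\<ge>0. \<forall>x. \<forall>t\<in>{0..<T}. u (x, t) <= W (x, 0)+gam+A*t"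
  and t1: "0 <= t1" "t1 < T" and less: "W (x1, t1) < u (x1, t1)"
 shows "\<exists>eta eps K N kap0. 0 < eta & 0 < eps & 0 <= K & 0 < kap0 & kap0 <= 1 &
  (\<forall>kap. 0 < kap & kap <= kap0 --> (\<exists>xb tb yb rb. 0 < tb & tb < T & 0 < rb & rb < T & \<bar>xb - yb\<bar> <= 1 &
  (\<forall>x y t r. 0 <= t & t <= T & 0 <= r & r <= T -->
  u (x, t) - W (y, r) - ((x - y)\<^sup>2+(t - r)\<^sup>2)/eps - (eta*t+K*(t/T) ^ Suc N) - K*qf (kap*x)
  <= u (xb, tb) - W (yb, rb) - ((xb - yb)\<^sup>2+(tb - rb)\<^sup>2)/eps
  - (eta*tb+K*(tb/T) ^ Suc N) - K*qf (kap*xb))))"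
proof -
 define d where "d = u (x1, t1) - W (x1, t1)"
 have d: "d > 0" using less by (simp add: d_def)
 have C0: "0 <= C0" using uC[of 0 0] T by force
 define K where "K = 2 * C0+1"
 have K: "K \<ge> 1" using C0 by (simp add: K_def)
 \<comment> \<open>Each of the three penalties costs at most \<open>d/8\<close> at
   \<open>(x1, t1)\<close>, which leaves more than \<open>d/2\<close>.\<close>
 define eta where "eta = d/(8*T)"
 have eta: "eta > 0" using d T by (simp add: eta_def)
 have etat: "eta*t1 <= d/8"
 proof -
  have "eta*t1 <= eta*T" using eta t1 by (intro mult_left_mono) auto
  also have "... = d/8" using T by (simp add: eta_def)
  finally show ?thesis .
 qed
 obtain N where N: "K*(t1/T) ^ Suc N < d/8" using small_penalty[OF t1, of "d/8"] d by auto
 obtain kap0 where kap0: "0 < kap0" "kap0 <= 1" "!!kap. 0 < kap ==> kap <= kap0 ==> K*qf (kap*x1) < d/8"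
  using small_qf[of K "d/8" x1] d K by auto
 have d8: "0 < d/8" using d by simp
 obtain ro where ro: "ro > 0" "!!p q. p \<in> Qbar T ==> q \<in> Qbar T ==> dist p q < ro ==> dist (W p) (W q) < d/8"
  using W d8 unfolding uniformly_continuous_on_def by metis
 obtain A where A: "A \<ge> 0" "!!x t. t \<in> {0..<T} ==> u (x, t) <= W (x, 0)+d/8+A*t" using init[OF d8] by blast
 \<comment> \<open>The admissible distance of the doubled points. The entries of the minimum serve,
   in order, the bound \<open>\<bar>xb - yb\<bar> <= 1\<close>, the continuity of \<open>W\<close>
   at time 0, the growth rate \<open>A\<close> of the initial control, and the distance from the
   final time.\<close>
 define bet where "bet = Min {1, ro/4, d/(16*(A+1)), T/((real N+2)*(K+1))}"
 have bpos: "0 < ro/4" "0 < d/(16*(A+1))" "0 < T/((real N+2)*(K+1))" using ro d A T K by (auto intro!: divide_pos_pos mult_pos_pos)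
 have bet0: "0 < bet" unfolding bet_def using bpos by (subst Min_gr_iff) auto
 have bet: "bet <= 1" "bet <= ro/4" "bet <= d/(16*(A+1))" "bet <= T/((real N+2)*(K+1))" unfolding bet_def by (rule Min_le; simp)+
 note bet = bet0 this
 have Abet: "A*bet <= d/16"
 proof -
  have "A*bet <= (A+1)*(d/(16*(A+1)))" using bet A by (intro mult_mono) auto
  also have "... = d/16" using A by (simp add: field_simps)
  finally show ?thesis .
 qed
 \<comment> \<open>Separation by \<open>bet\<close> then costs \<open>2 * C0 + 1\<close>, more than
   \<open>u - W\<close> can reach.\<close>
 define eps where "eps = bet\<^sup>2/(2 * C0+1)"
 have eps: "eps > 0" using bet C0 by (simp add: eps_def)
 have big: "2 * C0 < z\<^sup>2/eps" if "bet <= \<bar>z\<bar>" for z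
 proof -
  have "bet\<^sup>2 <= z\<^sup>2" using that bet(1) by (metis abs_le_square_iff abs_of_pos)
  then have "bet\<^sup>2/eps <= z\<^sup>2/eps" using eps by (simp add: divide_right_mono)
  moreover have "bet\<^sup>2/eps = 2 * C0+1" using bet C0 by (simp add: eps_def)
  ultimately show ?thesis by linarith
 qed
 have "\<exists>xb tb yb rb. 0 < tb & tb < T & 0 < rb & rb < T & \<bar>xb - yb\<bar> <= 1 &
  (\<forall>x y t r. 0 <= t & t <= T & 0 <= r & r <= T -->
  u (x, t) - W (y, r) - ((x - y)\<^sup>2+(t - r)\<^sup>2)/eps - (eta*t+K*(t/T) ^ Suc N) - K*qf (kap*x)
  <= u (xb, tb) - W (yb, rb) - ((xb - yb)\<^sup>2+(tb - rb)\<^sup>2)/eps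
  - (eta*tb+K*(tb/T) ^ Suc N) - K*qf (kap*xb))" if kap: "0 < kap" "kap <= kap0" for kap
 proof -
  define Psi where "Psi x t y r = u (x, t) - W (y, r) - ((x - y)\<^sup>2+(t - r)\<^sup>2)/eps
  - (eta*t+K*(t/T) ^ Suc N) - K*qf (kap*x)" for x t y r
  define F where "F = (%p::(real \<times> real) \<times> (real \<times> real). u (fst p) +
  (- W (snd p) - ((fst (fst p) - fst (snd p))\<^sup>2+(snd (fst p) - snd (snd p))\<^sup>2)/eps
  - (eta * snd (fst p)+K*(snd (fst p)/T) ^ Suc N) - K*qf (kap*fst (fst p))))"
  have FPsi: "F ((x, t), (y, r)) = Psi x t y r" for x t y r by (simp add: F_def Psi_def)
  define R where "R = max ((K+1)/kap) \<bar>x1\<bar>"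
  have pen0: "0 <= eta*t+K*(t/T) ^ Suc N" if "0 <= t" for t using that T K eta by (auto intro!: add_nonneg_nonneg mult_nonneg_nonneg)
  have q0: "0 <= K*qf (kap*x)" for x using qf_nonneg K by simp
  have sq0: "0 <= ((x - y)\<^sup>2+(t - r)\<^sup>2)/eps" for x y t r :: real using eps by simp
  have far1: "Psi x t y r <= 0" if "R <= \<bar>x\<bar>" "0 <= t" "t <= T" "0 <= r" "r <= T" for x t y r
  proof -
  have "(K+1)/kap <= \<bar>x\<bar>" using that(1) by (simp add: R_def)
  from qf_far[OF _ kap(1) this] have "2 * C0 <= K*qf (kap*x)" using K by (simp add: K_def)
  then show ?thesis using uC[OF that(2,3), of x] WC[OF that(4,5), of y] pen0[OF that(2)] sq0[of x y t r] unfolding Psi_def by linarith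
  qed
  have far2: "Psi x t y r <= 0" if "bet <= \<bar>x - y\<bar> | bet <= \<bar>t - r\<bar>" "0 <= t" "t <= T" "0 <= r" "r <= T" for x t y r
  proof -
  have "2 * C0 < ((x - y)\<^sup>2+(t - r)\<^sup>2)/eps"
  proof -
  have "(x - y)\<^sup>2/eps <= ((x - y)\<^sup>2+(t - r)\<^sup>2)/eps" "(t - r)\<^sup>2/eps <= ((x - y)\<^sup>2+(t - r)\<^sup>2)/eps"
  using eps by (simp_all add: divide_right_mono)
  then show ?thesis using that(1) big[of "x - y"] big[of "t - r"] by linarith
  qed
  then show ?thesis using uC[OF that(2,3), of x] WC[OF that(4,5), of y] pen0[OF that(2)] q0[of x] unfolding Psi_def by linarith
  qed
  have "Psi x1 t1 x1 t1 = d - (eta*t1+K*(t1/T) ^ Suc N) - K*qf (kap*x1)" unfolding Psi_def d_def by simp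
  moreover have "d/8+d/8+d/8 < d - d/2" using d by simp
  ultimately have Psi1: "Psi x1 t1 x1 t1 > d/2" using N kap0(3)[OF kap] etat by linarith
  define KK where "KK = ({- R..R} \<times> {0..T}) \<times> ({- (R+1)..R+1} \<times> {0..T})"
  have KK: "compact KK" "((x1, t1), (x1, t1)) \<in> KK" using t1 by (auto simp: KK_def R_def compact_Times max_def)
  have KKQ: "fst ` KK \<subseteq> Qbar T" "snd ` KK \<subseteq> Qbar T" by (auto simp: KK_def Qbar_def)
  have Wc: "continuous_on (Qbar T) W" using W by (rule uniformly_continuous_imp_continuous)
  have "usc_on KK F" unfolding F_def by (intro usc_on_add_cont usc_on_compose[OF u _ KKQ(1)] continuous_intros
  continuous_on_compose2[OF Wc _ KKQ(2)]
  continuous_on_compose2[OF C2_real_cont[OF C2_real_qf]]) (use eps T in auto)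
  then obtain pb where pb: "pb \<in> KK" "!!q. q \<in> KK ==> F q <= F pb" using usc_attains_max[OF KK(1)] KK(2) by blast
  obtain xb tb yb rb where xt: "pb = ((xb, tb), (yb, rb))" by (metis prod.collapse)
  have tb: "0 <= tb" "tb <= T" "0 <= rb" "rb <= T" using pb(1) xt by (auto simp: KK_def)
  have Pb: "Psi xb tb yb rb > d/2" using Psi1 pb(2)[OF KK(2)] xt FPsi by simp
  have gl: "Psi x t y r <= Psi xb tb yb rb" if "0 <= t" "t <= T" "0 <= r" "r <= T" for x t y r
  proof (cases "\<bar>x\<bar> <= R & \<bar>x - y\<bar> < bet")
  case True
  then have "((x, t), (y, r)) \<in> KK" using that bet(2) by (auto simp: KK_def)
  then show ?thesis using pb(2) xt FPsi by metis
  next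
  case False
  then have "Psi x t y r <= 0" using far1[of x t r y] far2[of x y t r] that by fastforce
  then show ?thesis using Pb d by linarith
  qed
  have xy: "\<bar>xb - yb\<bar> < bet" "\<bar>tb - rb\<bar> < bet" using far2[of xb yb tb rb] tb Pb d by fastforce+
  have Kt: "K*(tb/T) ^ Suc N < K - 1"
  proof -
  have "0 <= eta*tb" using eta tb by simp
  then show ?thesis using Pb d uC[OF tb(1,2), of xb] WC[OF tb(3,4), of yb] sq0[of xb yb tb rb] q0[of xb]
  unfolding Psi_def K_def by linarith
  qed
  \<comment> \<open>By Bernoulli's inequality \<open>T - bet <= tb\<close> would give a penalty of
    at least \<open>K - 1\<close>, which \<open>Kt\<close> excludes. The margin \<open>bet\<close>
    serves \<open>rb\<close>, which is only known to be within \<open>bet\<close> of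
    \<open>tb\<close>.\<close>
  have tbT: "tb < T - bet"
  proof (rule ccontr)
  assume "\<not> tb < T - bet"
  then have "(T - bet)/T <= tb/T" using T by (intro divide_right_mono) auto
  then have "1 - bet/T <= tb/T" using T by (simp add: diff_divide_distrib)
  moreover have bT: "bet/T <= 1/((real N+2)*(K+1))" using bet(5) T by (simp add: field_simps)
  have "(real N+2)*(K+1) \<ge> 1*1" using K by (intro mult_mono) auto
  then have le1: "bet/T <= 1" using bT by (smt (verit) divide_le_eq_1)
  ultimately have "(1 - bet/T) ^ Suc N <= (tb/T) ^ Suc N" by (intro power_mono) auto
  moreover have "1+real (Suc N)*(- (bet/T)) <= (1+(- (bet/T))) ^ Suc N" using le1 by (intro Bernoulli_inequality) auto
  moreover have "real (Suc N)*(bet/T) <= 1/(K+1)"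
  proof -
  have "real (Suc N)*(bet/T) <= (real N+2)*(1/((real N+2)*(K+1)))" using bT bet(1) T by (intro mult_mono) auto
  also have "... = 1/(K+1)" using K by simp
  finally show ?thesis .
  qed
  ultimately have "1 - 1/(K+1) <= (tb/T) ^ Suc N" by simp
  then have "K*(1 - 1/(K+1)) <= K*(tb/T) ^ Suc N" using K by (intro mult_left_mono) auto
  moreover have "K*(1 - 1/(K+1)) \<ge> K - 1" using K by (simp add: field_simps)
  ultimately show False using Kt by linarith
  qed
  \<comment> \<open>If one of the times were 0, both would be at most \<open>bet\<close>; initial
    control and continuity of \<open>W\<close> then bound \<open>u - W\<close> by
    \<open>5/16 * d\<close>, which is less than \<open>d/2\<close>.\<close>
  have pos: "0 < tb & 0 < rb"
  proof (rule ccontr)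
  assume "\<not> (0 < tb & 0 < rb)"
  then have sm: "tb <= bet" "rb <= bet" using xy tb by auto
  have "u (xb, tb) <= W (xb, 0)+d/8+A*tb" using A(2)[of tb xb] tb tbT bet(1) by auto
  moreover have "A*tb <= A*bet" using A(1) sm by (intro mult_left_mono) auto
  moreover have "dist (W (xb, 0)) (W (yb, rb)) < d/8"
  proof (rule ro(2))
  have "dist (xb, 0) (yb, rb) <= dist xb yb+dist 0 rb"
  unfolding dist_Pair_Pair using sqrt_sum_squares_le_sum[of "dist xb yb" "dist 0 rb"] by simp
  also have "... < ro" using xy(1) sm bet(3) tb ro(1) by (simp add: dist_real_def)
  finally show "dist (xb, 0) (yb, rb) < ro" .
  qed (use tb T in \<open>auto simp: Qbar_def\<close>)
  ultimately have "u (xb, tb) - W (yb, rb) < d/2" using Abet d unfolding dist_real_def by linarith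
  then show False using Pb sq0[of xb yb tb rb] pen0[OF tb(1)] q0[of xb] unfolding Psi_def by linarith
  qed
  have "rb < T" "tb < T" using tbT xy(2) bet(1) by auto
  moreover have "\<bar>xb - yb\<bar> <= 1" using xy(1) bet(2) by simp
  ultimately show ?thesis using pos by (intro exI[of _ xb] exI[of _ tb] exI[of _ yb] exI[of _ rb] conjI allI impI
  gl[unfolded Psi_def]) auto
 qed
 then show ?thesis using eta eps K kap0 by (intro exI[of _ eta] exI[of _ eps] exI[of _ K] exI[of _ N] exI[of _ kap0]) auto
qed

section \<open>Test functions that are quadratic near a point and prescribed far away\<close>

definition rf :: "real => real" where "rf z = z/(1+z\<^sup>2)"

lemma C2d_rf: "\<exists>r1 r2. C2d rf r1 r2 & r1 0 = 1"
proof -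
 have "C2d (%z. (0+1*z+0*z\<^sup>2)*inverse (1+0*z+1*z\<^sup>2))
  (%z. (1+2*0*z)*inverse (1+0*z+1*z\<^sup>2)
  + (0+1*z+0*z\<^sup>2)*(- (0+2*1*z)/(1+0*z+1*z\<^sup>2)\<^sup>2))
  (%z. 2*0*inverse (1+0*z+1*z\<^sup>2)
  + 2*(1+2*0*z)*(- (0+2*1*z)/(1+0*z+1*z\<^sup>2)\<^sup>2)
  + (0+1*z+0*z\<^sup>2)*(- (2*1)/(1+0*z+1*z\<^sup>2)\<^sup>2
  + 2*(0+2*1*z)\<^sup>2/(1+0*z+1*z\<^sup>2) ^ 3))"
  by (rule C2d_mult[OF C2d_poly2 C2d_inverse[OF C2d_poly2]]) (use one_plus_sq_nz in simp)
 moreover define r1 :: "real => real" where "r1 = (%z. (1+2*0*z)*inverse (1+0*z+1*z\<^sup>2)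
  + (0+1*z+0*z\<^sup>2)*(- (0+2*1*z)/(1+0*z+1*z\<^sup>2)\<^sup>2))"
 ultimately obtain r2 where "C2d (%z. (0+1*z+0*z\<^sup>2)*inverse (1+0*z+1*z\<^sup>2)) r1 r2" by (simp only: )
 then have "C2d rf r1 r2" by (rule C2d_cong1) (simp_all add: rf_def divide_inverse)
 moreover have "r1 0 = 1" by (simp add: r1_def)
 ultimately show ?thesis by (intro exI[of _ r1] exI[of _ r2] conjI)
qed

lemma rf_minus [simp]: "rf (- z) = - rf z" by (simp add: rf_def)
lemma rf_bound: "\<bar>rf z\<bar> <= 1"
proof -
 have "\<bar>z\<bar> <= 1+z\<^sup>2" using sum_squares_bound[of 1 "\<bar>z\<bar>"] by (simp add: power2_eq_square abs_mult[symmetric])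
 then show ?thesis using one_plus_sq_pos[of z] unfolding rf_def by (simp add: abs_mult)
qed

text \<open>A test function that is affine plus quadratic near \<open>x0\<close> and close to a translate of \<open>G\<close>
 away from \<open>x0\<close>; the cutoff is \<open>1 - qf (z/dl)\<close>, for which
 \<open>(1 - qf (z/dl)) z\<^sup>2 = dl\<^sup>2 qf (z/dl)\<close>.\<close>

definition ltest :: "real => real => real => real => real => (real => real) => real => real => real" where
 "ltest c p dl d x0 G e x = c+p*dl*rf ((x - x0)/dl)+qf ((x - x0)/dl)*(d+G (x+e))"

lemma abs_add3_le:
 fixes a b c :: real shows "\<bar>a\<bar> <= A ==> \<bar>b\<bar> <= B ==> \<bar>c\<bar> <= C ==> \<bar>a+b+c\<bar> <= A+B+C"
 by linarith

lemma C2d_ltest: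
 assumes G: "C2d G G1 G2" "!!x. \<bar>G x\<bar> <= B" and dl: "0 < dl"
 shows "\<exists>F1 F2. C2d (ltest c p dl d x0 G e) F1 F2 & F1 x0 = p" and "bounded (range (ltest c p dl d x0 G e))"
proof -
 obtain r1 r2 where r: "C2d rf r1 r2" "r1 0 = 1" using C2d_rf by blast
 obtain q2 where q2: "C2d qf (%z. 2*z/(1+z\<^sup>2)\<^sup>2) q2" using C2d_qf by blast
 define q1 where "q1 = (%z::real. 2*z/(1+z\<^sup>2)\<^sup>2)"
 define l where "l x = (1/dl)*x+(- x0/dl)" for x
 have l: "(x - x0)/dl = l x" for x by (simp add: l_def diff_divide_distrib)
 have "\<exists>F2. C2d (%x. (c+(p*dl)*rf (l x))+qf (l x)*(d+G (1*x+e)))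
  (%x. (0+(p*dl)*((1/dl)*r1 (l x)))
  + (((1/dl)*q1 (l x))*(d+G (1*x+e))+qf (l x)*(0+1*G1 (1*x+e)))) F2" unfolding l_def q1_def
  by (rule exI, rule C2d_add[OF C2d_add[OF C2d_const C2d_cmult[OF C2d_affine[OF r(1)]]]
  C2d_mult[OF C2d_affine[OF q2] C2d_add[OF C2d_const C2d_affine[OF G(1)]]]])
 then obtain F2 where "C2d (%x. (c+(p*dl)*rf (l x))+qf (l x)*(d+G (1*x+e)))
  (%x. (0+(p*dl)*((1/dl)*r1 (l x)))
  + (((1/dl)*q1 (l x))*(d+G (1*x+e))+qf (l x)*(0+1*G1 (1*x+e)))) F2" by (elim exE)
 from C2d_cong1[OF this, of "ltest c p dl d x0 G e", OF _ refl]
 have F: "C2d (ltest c p dl d x0 G e) (%x. (0+(p*dl)*((1/dl)*r1 (l x)))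
  + (((1/dl)*q1 (l x))*(d+G (1*x+e))+qf (l x)*(0+1*G1 (1*x+e)))) F2" unfolding ltest_def l by simp
 have "l x0 = 0" by (simp add: l[symmetric])
 moreover define F1 where "F1 = (%x. (0+(p*dl)*((1/dl)*r1 (l x)))
  + (((1/dl)*q1 (l x))*(d+G (1*x+e))+qf (l x)*(0+1*G1 (1*x+e))))"
 ultimately have "F1 x0 = p" using dl r(2) by (simp add: q1_def)
 moreover have "C2d (ltest c p dl d x0 G e) F1 F2" using F unfolding F1_def .
 ultimately show "\<exists>F1 F2. C2d (ltest c p dl d x0 G e) F1 F2 & F1 x0 = p" by (intro exI[of _ F1] exI[of _ F2] conjI)
 show "bounded (range (ltest c p dl d x0 G e))"
 proof (rule bounded_rangeI)
  fix x
  have "\<bar>p*dl*rf ((x - x0)/dl)\<bar> <= \<bar>p*dl\<bar>*1" unfolding abs_mult[of "p*dl"] by (intro mult_left_mono rf_bound) auto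
  moreover have "\<bar>qf ((x - x0)/dl)*(d+G (x+e))\<bar> <= 1*(\<bar>d\<bar>+B)"
  unfolding abs_mult using qf_nonneg qf_less1[of "(x - x0)/dl"] G(2)[of "x+e"]
  by (intro mult_mono) (auto simp: less_imp_le abs_of_nonneg)
  ultimately show "\<bar>ltest c p dl d x0 G e x\<bar> <= \<bar>c\<bar>+\<bar>p*dl\<bar>+(\<bar>d\<bar>+B)"
  unfolding ltest_def by (intro abs_add3_le) auto
 qed
qed

text \<open>In the second form \<open>qf (z/dl)\<close> is the weight of a convex combination, so
  that a near and a far inequality combine into one on the whole line. In the third the linear part
  is gone because \<open>rf\<close> is odd, and the quadratic part, hidden in the offset as
  \<open>a*dl\<^sup>2\<close>, has become a multiple of the same weight.\<close>

lemma ltest_simps: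
 assumes "0 < dl" shows "ltest c p dl d x0 G e x0 = c" and "ltest c p dl (a*dl\<^sup>2+d) x0 G e (x0+z) =
  c+(1 - qf (z/dl))*(p*z+a*z\<^sup>2)+qf (z/dl)*(d+G (x0+e+z))"
  and "sdiff (ltest c p dl d x0 G e) x0 z = - (qf (z/dl)*(2*d+G (x0+e+z)+G (x0+e - z)))"
proof -
 show "ltest c p dl d x0 G e x0 = c" by (simp add: ltest_def rf_def)
 define w where "w = 1+(z/dl)\<^sup>2"
 have w: "w > 0" using one_plus_sq_pos unfolding w_def .
 have 1: "1 - qf (z/dl) = 1/w" using w unfolding qf_def w_def[symmetric] by (simp add: field_simps) (simp add: w_def power_divide)
 have 2: "dl*rf (z/dl) = z/w" unfolding rf_def w_def[symmetric] using assms by simp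
 have 3: "dl\<^sup>2*qf (z/dl) = z\<^sup>2/w" unfolding qf_def w_def[symmetric] using assms by (simp add: power_divide)
 have "ltest c p dl (a*dl\<^sup>2+d) x0 G e (x0+z)
  = c+p*(dl*rf (z/dl))+a*(dl\<^sup>2*qf (z/dl))+qf (z/dl)*(d+G (x0+e+z))" unfolding ltest_def by (simp add: algebra_simps)
 also have "... = c+(1/w)*(p*z+a*z\<^sup>2)+qf (z/dl)*(d+G (x0+e+z))" unfolding 2 3 by (simp add: algebra_simps add_divide_distrib)
 finally show "ltest c p dl (a*dl\<^sup>2+d) x0 G e (x0+z) =
  c+(1 - qf (z/dl))*(p*z+a*z\<^sup>2)+qf (z/dl)*(d+G (x0+e+z))" unfolding 1 .
 show "sdiff (ltest c p dl d x0 G e) x0 z = - (qf (z/dl)*(2*d+G (x0+e+z)+G (x0+e - z)))"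
  unfolding sdiff_def ltest_def by (simp add: algebra_simps rf_def)
qed

lemma convex_comb_le:
 fixes a b c q :: real
 assumes "a <= b" "a <= c" "0 <= q" "q <= 1" shows "a <= (1 - q)*b+q * c"
proof -
 have "(1 - q)*a+q*a <= (1 - q)*b+q * c" using assms by (intro add_mono mult_left_mono) auto
 then show ?thesis by (simp add: algebra_simps)
qed

lemma UC_slice:
 fixes W :: "real \<times> real => real"
 assumes "uniformly_continuous_on (Qbar T) W" "r \<in> {0..T}" shows "uniformly_continuous_on UNIV (%x. W (x, r))"
 unfolding uniformly_continuous_on_def
proof (intro allI impI)
 fix e :: real assume "0 < e"
 then obtain d where d: "d > 0" "!!p q. p \<in> Qbar T ==> q \<in> Qbar T ==> dist q p < d ==> dist (W q) (W p) < e"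
  using assms(1) unfolding uniformly_continuous_on_def by metis
 show "\<exists>d>0. \<forall>x\<in>UNIV. \<forall>x'\<in>UNIV. dist x' x < d --> dist (W (x', r)) (W (x, r)) < e"
  using d assms(2) by (intro exI[of _ d]) (auto simp: Qbar_def dist_Pair_Pair)
qed

text \<open>Below the scale of uniform continuity the error \<open>gam\<close> suffices, above it
  the parabola exceeds the oscillation of \<open>W\<close>. This gives a smooth minorant in time for
  a function that is only continuous.\<close>

lemma UC_time:
 assumes "uniformly_continuous_on (Qbar T) W" "0 < gam" and WC: "!!x t. 0 <= t ==> t <= T ==> \<bar>W (x, t)\<bar> <= C0"
 shows "\<exists>C\<ge>0. \<forall>y. \<forall>t\<in>{0..T}. \<forall>r\<in>{0..T}. W (y, r) - gam - C*(t - r)\<^sup>2 <= W (y, t)"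
proof -
 obtain d where d: "d > 0" "!!p q. p \<in> Qbar T ==> q \<in> Qbar T ==> dist q p < d ==> dist (W q) (W p) < gam"
  using assms(1,2) unfolding uniformly_continuous_on_def by metis
 define C where "C = 2*\<bar>C0\<bar>/d\<^sup>2"
 have C: "C \<ge> 0" by (simp add: C_def)
 have "W (y, r) - gam - C*(t - r)\<^sup>2 <= W (y, t)" if "t \<in> {0..T}" "r \<in> {0..T}" for y t r
 proof (cases "\<bar>t - r\<bar> < d")
  case True
  then have "dist (W (y, t)) (W (y, r)) < gam" using that by (intro d(2)) (auto simp: Qbar_def dist_Pair_Pair dist_real_def)
  moreover have "0 <= C*(t - r)\<^sup>2" using C by simp
  ultimately show ?thesis unfolding dist_real_def by linarith
 next
  case False
  then have "d\<^sup>2 <= (t - r)\<^sup>2" using d(1) by (metis abs_le_square_iff abs_of_pos not_less)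
  then have "C*d\<^sup>2 <= C*(t - r)\<^sup>2" using C by (intro mult_left_mono)
  moreover have "C*d\<^sup>2 = 2*\<bar>C0\<bar>" using d(1) by (simp add: C_def)
  ultimately show ?thesis using WC[of t y] WC[of r y] that assms(2) by (auto simp: abs_le_iff)
 qed
 then show ?thesis using C by blast
qed

text \<open>Maximality is used twice for \<open>u\<close>: with \<open>y = yb\<close> it yields a
  quadratic majorant, and with \<open>x\<close> and \<open>y\<close> moved together it yields a
  translate of \<open>W\<close> at time \<open>rb\<close>. For \<open>W\<close> the quadratic
  minorant comes from \<open>x = xb\<close>, and its own slice serves far away. Since both test
  functions use the same smoothing \<open>G\<close>, subtracting the two viscosity inequalities
  cancels \<open>G\<close> and the time slope \<open>a\<close>, and the coefficients differ only
  through the penalty in space.\<close>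

lemma doubling_estimate:
 assumes s: "0 < s" "s < 1" and m: "m \<ge> 2" and T: "0 < T"
  and u: "int_sub m s T u" and W: "int_super m s T W" and WU: "uniformly_continuous_on (Qbar T) W"
  and WC: "!!x t. 0 <= t ==> t <= T ==> \<bar>W (x, t)\<bar> <= C0"
  and tb: "0 < tb" "tb < T" "0 < rb" "rb < T" and xy: "\<bar>xb - yb\<bar> <= 1"
  and eps: "0 < eps" and K: "0 <= K" and kap: "0 < kap" "kap <= 1" and dl: "0 < dl" and gam: "0 < gam"
  and mx: "!!x y t r. 0 <= t ==> t <= T ==> 0 <= r ==> r <= T ==>
  u (x, t) - W (y, r) - ((x - y)\<^sup>2+(t - r)\<^sup>2)/eps - (eta*t+K*(t/T) ^ Suc N) - K*qf (kap*x)
  <= u (xb, tb) - W (yb, rb) - ((xb - yb)\<^sup>2+(tb - rb)\<^sup>2)/eps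
  - (eta*tb+K*(tb/T) ^ Suc N) - K*qf (kap*xb)" and Lp: "Lp = 2/eps+K" and qdl: "qdl = (1/dl) powr (2 * s)*fl s qf"
 shows "eta <= (m - 1)*Lp powr (m - 2)*(K * kap)*((2*dl\<^sup>2/eps+4 * C0+6*gam)*qdl)
  + Lp powr (m - 1)*((4*dl\<^sup>2/eps+8*gam)*qdl+16*K * kap powr (2 * s)*fl s qf)"
proof -
 define p where "p = 2*(xb - yb)/eps"
 define a where "a = 2*(tb - rb)/eps"
 define Wb where "Wb = W (yb, rb)"
 define ub where "ub = u (xb, tb)"
 have Wb: "\<bar>Wb\<bar> <= C0" using WC[of rb yb] tb by (simp add: Wb_def)
 have rbT: "rb \<in> {0..T}" using tb by simp
 obtain G G1 G2 C where G: "C2d G G1 G2" "!!x. \<bar>G x - W (x, rb)\<bar> <= gam" "!!x. \<bar>G x\<bar> <= C0"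
  using smoothing_UC[OF UC_slice[OF WU rbT] gam, of C0] WC[of rb] tb by (metis less_imp_le)
 \<comment> \<open>The offsets move the far parts to the correct side. In \<open>f\<close> one
   \<open>gam\<close> pays for the smoothing; in \<open>k\<close> one pays for the smoothing and two
   for the time dependence of \<open>W\<close> and the linear term of \<open>l\<close>.\<close>
 define f where "f = ltest ub p dl (1/eps*dl\<^sup>2+(gam - Wb)) xb G (yb - xb)"
 define k where "k = ltest Wb p dl (- (1/eps)*dl\<^sup>2+(- 3*gam - Wb)) yb G 0"
 obtain f1 f2 where f: "C2d f f1 f2" "f1 xb = p" using C2d_ltest(1)[OF G(1,3) dl] unfolding f_def by blast
 obtain k1 k2 where k: "C2d k k1 k2" "k1 yb = p" using C2d_ltest(1)[OF G(1,3) dl] unfolding k_def by blast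
 have fb: "bounded (range f)" and kb: "bounded (range k)" unfolding f_def k_def by (rule C2d_ltest(2)[OF G(1,3) dl])+
 have q01: "0 <= qf z" "qf z <= 1" for z using qf_nonneg qf_less1[of z] by auto
 define bq where "bq = (%x. K*qf (kap*x))"
 obtain b1 b2 where b: "C2d bq b1 b2" "!!x. \<bar>b1 x\<bar> <= K * kap" using C2d_qf_scaled[OF kap(1) K] unfolding bq_def by blast
 have bqb: "bounded (range bq)"
 proof (rule bounded_rangeI)
  show "\<bar>bq x\<bar> <= K*1" for x unfolding bq_def abs_mult using q01 K by (intro mult_mono) auto
 qed

 define pen where "pen t = eta*t+K*(t/T) ^ Suc N" for t
 define g where "g t = - bq xb - pen tb - (tb - rb)\<^sup>2/eps+(t - rb)\<^sup>2/eps+pen t" for t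
 obtain g1 g2 where g: "C2d (%t. (- bq xb - pen tb - (tb - rb)\<^sup>2/eps+rb\<^sup>2/eps)+(eta - 2*rb/eps)*t+(1/eps)*t\<^sup>2
  + K*(t/T) ^ Suc N) g1 g2"
  "!!t. 0 <= t ==> (eta - 2*rb/eps)+2*(1/eps)*t <= g1 t" using C2d_penalty[OF T K] by blast
 have "C2d g g1 g2" by (rule C2d_cong1[OF g(1) _ refl])
  (simp add: g_def pen_def power2_eq_square diff_divide_distrib add_divide_distrib algebra_simps)
 note gC = this
 have g1tb: "eta+a <= g1 tb" using g(2)[of tb] tb by (simp add: a_def algebra_simps diff_divide_distrib)

 have upper: "u (x, t) <= (f x+bq x)+g t" if t: "0 <= t" "t <= T" for x t
 proof -
  define z where "z = x - xb"
  define E where "E = bq x - bq xb+pen t - pen tb+((t - rb)\<^sup>2 - (tb - rb)\<^sup>2)/eps"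
  have quad: "((x - yb)\<^sup>2 - (xb - yb)\<^sup>2)/eps = p*z+1/eps*z\<^sup>2"
  using eps unfolding p_def z_def by (simp add: field_simps power2_eq_square)
  have 1: "u (x, t) - E - ub <= p*z+1/eps*z\<^sup>2"
  using mx[OF t, of rb x yb] tb unfolding quad[symmetric] E_def ub_def pen_def bq_def
  by (simp add: add_divide_distrib diff_divide_distrib)
  have "u (x, t) - E - ub <= W (yb+z, rb) - Wb" using mx[OF t, of rb x "yb+z"] tb unfolding E_def ub_def Wb_def pen_def bq_def z_def
  by (simp add: add_divide_distrib diff_divide_distrib)
  then have 2: "u (x, t) - E - ub <= (gam - Wb)+G (yb+z)" using G(2)[of "yb+z"] by linarith
  have "u (x, t) - E - ub <= (1 - qf (z/dl))*(p*z+1/eps*z\<^sup>2)+qf (z/dl)*((gam - Wb)+G (yb+z))"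
  by (rule convex_comb_le[OF 1 2 q01])
  moreover have "f x = ub+(1 - qf (z/dl))*(p*z+1/eps*z\<^sup>2)+qf (z/dl)*((gam - Wb)+G (yb+z))"
  using ltest_simps(2)[OF dl, of ub p "1/eps" "gam - Wb" xb G "yb - xb" z] unfolding f_def z_def by simp
  ultimately have "u (x, t) - E <= f x" by linarith
  then show ?thesis unfolding E_def g_def by (simp add: diff_divide_distrib)
 qed
 have fxb: "f xb = ub" unfolding f_def by (rule ltest_simps(1)[OF dl])
 have kyb: "k yb = Wb" unfolding k_def by (rule ltest_simps(1)[OF dl])
 have ueq: "u (xb, tb) = (f xb+bq xb)+g tb" by (simp add: fxb g_def ub_def)
 have fbC: "C2d (%x. f x+bq x) (%x. f1 x+b1 x) (%x. f2 x+b2 x)" by (rule C2d_add[OF f(1) b(1)])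
 have fbb: "bounded (range (%x. f x+bq x))" by (rule bounded_plus_comp[OF fb bqb])
 have h1: "g1 tb+\<bar>f1 xb+b1 xb\<bar> powr (m - 1)*fl s (sdiff (%x. f x+bq x) xb) <= 0"
  by (rule int_sub_split[OF s u fbC fbb gC tb(1,2) ueq]) (rule upper; simp)

 obtain Cgam where Cgam: "Cgam \<ge> 0"
  "!!y t r. t \<in> {0..T} ==> r \<in> {0..T} ==> W (y, r) - gam - Cgam*(t - r)\<^sup>2 <= W (y, t)"
  using UC_time[OF WU gam WC] by blast
 \<comment> \<open>The parabola has to absorb the time modulus of \<open>W\<close>, the square
   completed from the linear term \<open>a*(r - rb)\<close>, and the quadratic term of the
   doubling.\<close>
 define Cc where "Cc = Cgam+a\<^sup>2/(4*gam)+1/eps"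
 define l where "l r = (- a*rb - Cc*rb\<^sup>2)+(a+2 * Cc*rb)*r+(- Cc)*r\<^sup>2" for r
 have lC: "C2d l (%r. (a+2 * Cc*rb)+2*(- Cc)*r) (%r. 2*(- Cc))" unfolding l_def by (rule C2d_poly2)
 have l: "l r = a*(r - rb) - Cc*(r - rb)\<^sup>2" for r by (simp add: l_def power2_eq_square algebra_simps)
 have lower: "k y+l r <= W (y, r)" if r: "0 <= r" "r <= T" for y r
 proof -
  define z where "z = y - yb"
  have sq0: "0 <= (r - rb)\<^sup>2" by simp
  have quad: "((xb - y)\<^sup>2 - (xb - yb)\<^sup>2)/eps = - (p*z - 1/eps*z\<^sup>2)"
  using eps unfolding p_def z_def by (simp add: field_simps power2_eq_square)
  have quad2: "((tb - r)\<^sup>2 - (tb - rb)\<^sup>2)/eps = - (a*(r - rb) - 1/eps*(r - rb)\<^sup>2)"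
  using eps unfolding a_def by (simp add: field_simps power2_eq_square)
  have "W (y, r) \<ge> Wb - ((xb - y)\<^sup>2 - (xb - yb)\<^sup>2)/eps - ((tb - r)\<^sup>2 - (tb - rb)\<^sup>2)/eps"
  using mx[OF _ _ r, of tb xb y] tb unfolding Wb_def by (simp add: add_divide_distrib diff_divide_distrib)
  then have "Wb+(p*z - 1/eps*z\<^sup>2)+(a*(r - rb) - 1/eps*(r - rb)\<^sup>2) <= W (y, r)" unfolding quad quad2 by linarith
  moreover have "1/eps*(r - rb)\<^sup>2 <= Cc*(r - rb)\<^sup>2" using Cgam(1) gam unfolding Cc_def by (intro mult_right_mono) auto
  ultimately have 1: "l r - W (y, r)+Wb <= - (p*z+- (1/eps)*z\<^sup>2)" unfolding l by (simp add: algebra_simps)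
  have "a*(r - rb) <= gam+a\<^sup>2/(4*gam)*(r - rb)\<^sup>2"
  proof -
  have "0 <= (2*gam - a*(r - rb))\<^sup>2/(4*gam)" using gam by simp
  also have "... = gam - a*(r - rb)+a\<^sup>2/(4*gam)*(r - rb)\<^sup>2" using gam by (simp add: field_simps power2_eq_square)
  finally show ?thesis by linarith
  qed
  moreover have "W (y, rb) - gam - Cgam*(r - rb)\<^sup>2 <= W (y, r)" using Cgam(2)[of r rb y] r tb by auto
  moreover have "Cc*(r - rb)\<^sup>2 = Cgam*(r - rb)\<^sup>2+a\<^sup>2/(4*gam)*(r - rb)\<^sup>2+1/eps*(r - rb)\<^sup>2"
  unfolding Cc_def by (simp add: algebra_simps)
  moreover have "0 <= 1/eps*(r - rb)\<^sup>2" using eps by simp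
  ultimately have "l r - W (y, r) <= 2*gam - W (y, rb)" unfolding l by linarith
  then have 2: "l r - W (y, r)+Wb <= - ((- 3*gam - Wb)+G (yb+z))" using G(2)[of y] unfolding z_def by (simp add: abs_le_iff)
  have "l r - W (y, r)+Wb <= (1 - qf (z/dl))*(- (p*z+- (1/eps)*z\<^sup>2))+qf (z/dl)*(- ((- 3*gam - Wb)+G (yb+z)))"
  by (rule convex_comb_le[OF 1 2 q01])
  moreover have "k y = Wb+(1 - qf (z/dl))*(p*z+- (1/eps)*z\<^sup>2)+qf (z/dl)*((- 3*gam - Wb)+G (yb+z))"
  using ltest_simps(2)[OF dl, of Wb p "- (1/eps)" "- 3*gam - Wb" yb G 0 z] unfolding k_def z_def by simp
  ultimately show ?thesis by (simp only: mult_minus_right)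
 qed
 have weq: "W (yb, rb) = k yb+l rb" by (simp add: kyb l Wb_def)
 have h2: "0 <= ((a+2 * Cc*rb)+2*(- Cc)*rb)+\<bar>k1 yb\<bar> powr (m - 1)*fl s (sdiff k yb)"
  by (rule int_super_split[OF s W k(1) kb lC tb(3,4) weq lower]) simp_all

 define q where "q z = qf ((1/dl)*z)" for z
 have kq: "kint s q" unfolding q_def by (rule kint_scale[OF kint_qf[OF s]]) (use dl in simp)
 have fq: "fl s q = qdl" unfolding q_def qdl by (rule fl_scale) (use dl in simp)
 define S where "S z = G (yb+z)+G (yb - z) - 2*Wb" for z
 have sk: "sdiff k yb z = - (q z*(- (2*dl\<^sup>2/eps) - 6*gam+S z))" for z unfolding k_def ltest_simps(3)[OF dl] q_def S_def by simp
 \<comment> \<open>\<open>G\<close> and \<open>Wb\<close> enter both second differences in the same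
   way. What remains is \<open>2*dl\<^sup>2/eps + 2*gam\<close> against
   \<open>- 2*dl\<^sup>2/eps - 6*gam\<close>.\<close>
 have sf: "sdiff (%x. f x+bq x) xb z = sdiff k yb z - (4*dl\<^sup>2/eps+8*gam)*q z+sdiff bq xb z" for z
  unfolding sdiff_add sk f_def ltest_simps(3)[OF dl] q_def S_def by (simp add: algebra_simps)
 define F1 where "F1 = fl s (sdiff k yb)"
 define FB where "FB = fl s (sdiff bq xb)"
 define D where "D = 2*dl\<^sup>2/eps+4 * C0+6*gam"
 have kk: "kint s (sdiff k yb)" by (rule kint_sdiff[OF s C2_realI[OF k(1)] kb])
 have kB: "kint s (sdiff bq xb)" by (rule kint_sdiff[OF s C2_realI[OF b(1)] bqb])
 have FBb: "\<bar>FB\<bar> <= 16*K * kap powr (2 * s)*fl s qf" unfolding FB_def bq_def by (rule fl_qf_scaled(2)[OF s kap(1) K])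
 have Feq: "fl s (sdiff (%x. f x+bq x) xb) = F1 - (4*dl\<^sup>2/eps+8*gam)*qdl+FB"
 proof -
  have "sdiff (%x. f x+bq x) xb = (%z. (sdiff k yb z - (4*dl\<^sup>2/eps+8*gam)*q z)+sdiff bq xb z)" by (rule ext) (rule sf)
  then show ?thesis unfolding F1_def FB_def fq[symmetric]
  by (simp only: fl_add[OF kint_diff[OF kk kint_cmult[OF kq]] kB] fl_diff[OF kk kint_cmult[OF kq]] fl_cmult)
 qed
 have F1b: "\<bar>F1\<bar> <= D*qdl"
 proof -
  have Sb: "\<bar>sdiff k yb z\<bar> <= D*q z" for z
  proof -
  have "\<bar>S z\<bar> <= 4 * C0" using G(3)[of "yb+z"] G(3)[of "yb - z"] Wb unfolding S_def by linarith
  moreover have "0 <= 2*dl\<^sup>2/eps" using eps by simp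
  ultimately have "\<bar>- (2*dl\<^sup>2/eps) - 6*gam+S z\<bar> <= D" using gam unfolding D_def by linarith
  then have "q z*\<bar>- (2*dl\<^sup>2/eps) - 6*gam+S z\<bar> <= q z*D" using q01 unfolding q_def by (intro mult_left_mono)
  then show ?thesis unfolding sk using q01 by (simp add: abs_mult q_def mult.commute)
  qed
  have "F1 <= fl s (%z. D*q z)" unfolding F1_def by (rule fl_mono[OF s kk kint_cmult[OF kq]]) (use Sb abs_le_iff in blast)
  moreover have "fl s (%z. (- D)*q z) <= F1" unfolding F1_def
  proof (rule fl_mono[OF s kint_cmult[OF kq] kk])
  show "- D*q z <= sdiff k yb z" for z using Sb[of z] by (simp add: abs_le_iff)
  qed
  ultimately show ?thesis unfolding fl_cmult fq by (simp add: abs_le_iff)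
 qed
 have pb: "\<bar>p\<bar> <= 2/eps" unfolding p_def using xy eps by (simp add: abs_mult divide_right_mono)
 define P where "P = \<bar>p\<bar> powr (m - 1)"
 define P' where "P' = \<bar>p+b1 xb\<bar> powr (m - 1)"
 have Kk: "K * kap <= K" using K kap by (simp add: mult_left_le)
 have L1: "\<bar>p\<bar> <= Lp" "\<bar>p+b1 xb\<bar> <= Lp" using pb b(2)[of xb] Kk K unfolding Lp by linarith+
 have PP: "\<bar>P - P'\<bar> <= (m - 1)*Lp powr (m - 2)*(K * kap)"
 proof -
  have "\<bar>P - P'\<bar> <= (m - 1)*Lp powr (m - 1 - 1)*\<bar>\<bar>p\<bar> - \<bar>p+b1 xb\<bar>\<bar>"
  unfolding P_def P'_def using L1 m by (intro powr_abs_diff_le) auto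
  also have "... <= (m - 1)*Lp powr (m - 1 - 1)*(K * kap)" using b(2)[of xb] m by (intro mult_left_mono) (auto simp: abs_le_iff)
  finally show ?thesis by simp
 qed
 have P'0: "0 <= P'" "P' <= Lp powr (m - 1)" unfolding P'_def using L1 m by (auto intro!: powr_mono2)
 define er where "er = (4*dl\<^sup>2/eps+8*gam)*qdl"
 have er: "0 <= er" unfolding er_def qdl using eps gam fl_qf_nonneg[OF s] by simp
 have "eta+a+P'*(F1 - er+FB) <= 0" using h1 g1tb unfolding Feq f(2) P'_def er_def by linarith
 moreover have "0 <= a+P*F1" using h2 unfolding k(2) P_def F1_def by simp
 ultimately have "eta <= (P - P')*F1+P'*(er - FB)" by (simp add: algebra_simps)
 also have "... <= \<bar>P - P'\<bar>*\<bar>F1\<bar>+P'*(er+\<bar>FB\<bar>)"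
  by (intro add_mono mult_left_mono P'0) (auto simp: abs_mult[symmetric])
 also have "... <= (m - 1)*Lp powr (m - 2)*(K * kap)*(D*qdl)+Lp powr (m - 1)*(er+16*K * kap powr (2 * s)*fl s qf)"
  using PP F1b P'0 FBb er m K kap by (intro add_mono mult_mono) auto
 finally show ?thesis unfolding D_def er_def .
qed

text \<open>The parameters in the bound on the fixed \<open>eta\<close> are sent to 0 in turn:
  \<open>kap\<close> removes the penalty in space, \<open>gam\<close> the smoothing error, and
  \<open>dl\<close> leaves \<open>dl powr (2 - 2 * s)\<close>, which tends to 0 because
  \<open>s < 1\<close>. Continuity is asked of \<open>W\<close> alone; \<open>u\<close> may be any
  subsolution, which the uniqueness of discontinuous solutions relies on.\<close>

theorem comparison:
 assumes s: "0 < s" "s < 1" and m: "m \<ge> 2" and T: "0 < T"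
  and u: "visc_subsol m s T v0 u" and W: "int_super m s T W" and WB: "BUC_on (Qbar T) W"
  and init: "!!x. usc_env UNIV v0 x <= W (x, 0)" and t1: "0 <= t1" "t1 < T" shows "u (x1, t1) <= W (x1, t1)"
proof (rule ccontr)
 assume neg: "\<not> u (x1, t1) <= W (x1, t1)"
 have WU: "uniformly_continuous_on (Qbar T) W" using WB by (simp add: BUC_on_def)
 obtain C1 C2 where C: "!!p. p \<in> Qbar T ==> \<bar>u p\<bar> <= C1" "!!p. p \<in> Qbar T ==> \<bar>W p\<bar> <= C2"
  using visc_subsolD(1)[OF u] WB unfolding bounded_iff BUC_on_def by auto
 define C0 where "C0 = max C1 C2"
 have uC: "\<bar>u (x, t)\<bar> <= C0" and WC: "\<bar>W (x, t)\<bar> <= C0" if "0 <= t" "t <= T" for x t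
  using C[of "(x, t)"] that by (auto simp: Qbar_def C0_def)
 have w0: "uniformly_continuous_on UNIV (%x. W (x, 0))" by (rule UC_slice[OF WU]) (use T in simp)
 have "\<exists>A\<ge>0. \<forall>x. \<forall>t\<in>{0..<T}. u (x, t) <= W (x, 0)+gam+A*t" if "0 < gam" for gam
  by (rule initial_control[OF s T m u w0 _ init that, of C0]) (use WC T in auto)
 note init' = this
 have less: "W (x1, t1) < u (x1, t1)" using neg by simp
 have "\<exists>eta eps K N kap0. 0 < eta & 0 < eps & 0 <= K & 0 < kap0 & kap0 <= 1 &
  (\<forall>kap. 0 < kap & kap <= kap0 --> (\<exists>xb tb yb rb. 0 < tb & tb < T & 0 < rb & rb < T & \<bar>xb - yb\<bar> <= 1 &
  (\<forall>x y t r. 0 <= t & t <= T & 0 <= r & r <= T -->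
  u (x, t) - W (y, r) - ((x - y)\<^sup>2+(t - r)\<^sup>2)/eps - (eta*t+K*(t/T) ^ Suc N) - K*qf (kap*x)
  <= u (xb, tb) - W (yb, rb) - ((xb - yb)\<^sup>2+(tb - rb)\<^sup>2)/eps
  - (eta*tb+K*(tb/T) ^ Suc N) - K*qf (kap*xb))))" by (rule doubling_max[OF T visc_subsolD(2)[OF u] WU uC WC init' t1 less])
 then
 obtain eta eps K N kap0 where eta: "0 < eta" and eps: "0 < eps" and K: "0 <= K" and kap0: "0 < kap0" "kap0 <= 1"
  and mx: "\<forall>kap. 0 < kap & kap <= kap0 --> (\<exists>xb tb yb rb. 0 < tb & tb < T & 0 < rb & rb < T & \<bar>xb - yb\<bar> <= 1 &
  (\<forall>x y t r. 0 <= t & t <= T & 0 <= r & r <= T -->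
  u (x, t) - W (y, r) - ((x - y)\<^sup>2+(t - r)\<^sup>2)/eps - (eta*t+K*(t/T) ^ Suc N) - K*qf (kap*x)
  <= u (xb, tb) - W (yb, rb) - ((xb - yb)\<^sup>2+(tb - rb)\<^sup>2)/eps
  - (eta*tb+K*(tb/T) ^ Suc N) - K*qf (kap*xb)))" by (elim exE conjE) (rule that)
 define Lp where "Lp = 2/eps+K"
 define qdl where "qdl dl = (1/dl) powr (2 * s)*fl s qf" for dl
 have est: "eta <= (m - 1)*Lp powr (m - 2)*(K * kap)*((2*dl\<^sup>2/eps+4 * C0+6*gam)*qdl dl)
  + Lp powr (m - 1)*((4*dl\<^sup>2/eps+8*gam)*qdl dl+16*K * kap powr (2 * s)*fl s qf)"
  if h: "0 < kap" "kap <= kap0" "0 < dl" "0 < gam" for kap dl gam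
 proof -
  from mx[rule_format, of kap] h obtain xb tb yb rb where b: "0 < tb" "tb < T" "0 < rb" "rb < T" "\<bar>xb - yb\<bar> <= 1"
  and mx': "!!x y t r. 0 <= t ==> t <= T ==> 0 <= r ==> r <= T ==>
  u (x, t) - W (y, r) - ((x - y)\<^sup>2+(t - r)\<^sup>2)/eps - (eta*t+K*(t/T) ^ Suc N) - K*qf (kap*x)
  <= u (xb, tb) - W (yb, rb) - ((xb - yb)\<^sup>2+(tb - rb)\<^sup>2)/eps
  - (eta*tb+K*(tb/T) ^ Suc N) - K*qf (kap*xb)" by blast
  have "kap <= 1" using h kap0 by simp
  from doubling_estimate[OF s m T visc_subsolD(3)[OF u] W WU WC b eps K h(1) this h(3,4) mx' Lp_def qdl_def]
  show ?thesis .
 qed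
 have est2: "eta <= Lp powr (m - 1)*((4*dl\<^sup>2/eps+8*gam)*qdl dl)" if h: "0 < dl" "0 < gam" for dl gam
 proof -
  have "((%kap. (m - 1)*Lp powr (m - 2)*(K * kap)*((2*dl\<^sup>2/eps+4 * C0+6*gam)*qdl dl)
  + Lp powr (m - 1)*((4*dl\<^sup>2/eps+8*gam)*qdl dl+16*K * kap powr (2 * s)*fl s qf)) \<longlongrightarrow>
  (m - 1)*Lp powr (m - 2)*(K*0)*((2*dl\<^sup>2/eps+4 * C0+6*gam)*qdl dl)
  + Lp powr (m - 1)*((4*dl\<^sup>2/eps+8*gam)*qdl dl+16*K*0*fl s qf)) (at_right 0)"
  by (intro tendsto_intros tendsto_zero_powrI[where b = "2 * s"])
  (use s in \<open>auto simp: eventually_at_right_field intro!: exI[of _ 1]\<close>)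
  moreover have "\<forall>\<^sub>F kap in at_right 0. eta <= (m - 1)*Lp powr (m - 2)*(K * kap)*((2*dl\<^sup>2/eps+4 * C0+6*gam)*qdl dl)
  + Lp powr (m - 1)*((4*dl\<^sup>2/eps+8*gam)*qdl dl+16*K * kap powr (2 * s)*fl s qf)"
  unfolding eventually_at_right_field using kap0 h by (intro exI[of _ kap0] conjI allI impI est) auto
  ultimately show ?thesis by (simp add: tendsto_lowerbound[OF _ _ trivial_limit_at_right_real])
 qed
 have est3: "eta <= Lp powr (m - 1)*((4*dl\<^sup>2/eps+8*0)*qdl dl)" if h: "0 < dl" for dl
 proof (rule tendsto_lowerbound[of _ _ "at_right 0"])
  show "((%gam. Lp powr (m - 1)*((4*dl\<^sup>2/eps+8*gam)*qdl dl)) \<longlongrightarrow>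
  Lp powr (m - 1)*((4*dl\<^sup>2/eps+8*0)*qdl dl)) (at_right 0)" by (intro tendsto_intros)
  show "\<forall>\<^sub>F gam in at_right 0. eta <= Lp powr (m - 1)*((4*dl\<^sup>2/eps+8*gam)*qdl dl)"
  unfolding eventually_at_right_field using est2 h by (intro exI[of _ 1]) auto
 qed (rule trivial_limit_at_right_real)
 have "eta <= Lp powr (m - 1)*(4/eps*0*fl s qf)"
 proof (rule tendsto_lowerbound[of _ _ "at_right 0"])
  show "((%dl. Lp powr (m - 1)*(4/eps*dl powr (2 - 2 * s)*fl s qf)) \<longlongrightarrow>
  Lp powr (m - 1)*(4/eps*0*fl s qf)) (at_right 0)" by (intro tendsto_intros tendsto_zero_powrI[where b = "2 - 2 * s"])
  (use s in \<open>auto simp: eventually_at_right_field intro!: exI[of _ 1]\<close>)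
  have "eta <= Lp powr (m - 1)*(4/eps*dl powr (2 - 2 * s)*fl s qf)" if h: "0 < dl" for dl
  proof -
  have "dl\<^sup>2*(1/dl) powr (2 * s) = dl powr (2 - 2 * s)" using h by (simp add: powr_diff powr_divide)
  moreover have "(4*dl\<^sup>2/eps+8*0)*qdl dl = 4/eps*(dl\<^sup>2*(1/dl) powr (2 * s))*fl s qf" unfolding qdl_def by simp
  ultimately have "(4*dl\<^sup>2/eps+8*0)*qdl dl = 4/eps*dl powr (2 - 2 * s)*fl s qf" by (simp only: )
  then show ?thesis using est3[OF h] by (simp only: )
  qed
  then show "\<forall>\<^sub>F dl in at_right 0. eta <= Lp powr (m - 1)*(4/eps*dl powr (2 - 2 * s)*fl s qf)"
  unfolding eventually_at_right_field by (intro exI[of _ 1]) auto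
 qed (rule trivial_limit_at_right_real)
 then show False using eta by simp
qed

section \<open>The monotone scheme\<close>

definition weights :: "(int => real) => bool" where
 "weights w \<longleftrightarrow> (\<forall>k. k ~= 0 --> w k = w (- k) & 0 <= w k) & w summable_on (UNIV - {0})"

definition wsum :: "(int => real) => real" where
 "wsum w = (\<Sum>\<^sub>\<infinity>k\<in>UNIV - {0}. w k)"

lemma weightsD:
 assumes "weights w" shows "w summable_on (UNIV - {0})" "k ~= 0 ==> 0 <= w k" "k ~= 0 ==> w (- k) = w k"
 using assms unfolding weights_def by metis+

lemma wsum_nonneg: "weights w ==> 0 <= wsum w" unfolding wsum_def by (intro infsum_nonneg) (simp add: weightsD)

lemma weights_summable:
 assumes "weights w" "!!k. \<bar>c k\<bar> <= B" shows "(%k. c k*w k) summable_on (UNIV - {0})"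
proof -
 have "(%k. B*w k) summable_on (UNIV - {0})" using weightsD(1)[OF assms(1)] by (rule summable_on_cmult_right)
 then have "(%k. norm (c k*w k)) summable_on (UNIV - {0})"
 proof (rule Infinite_Sum.abs_summable_on_comparison_test')
  fix k :: int assume "k \<in> UNIV - {0}"
  then show "norm (c k*w k) <= B*w k" using assms(2)[of k] weightsD(2)[OF assms(1), of k] by (simp add: abs_mult mult_right_mono)
 qed
 then show ?thesis by (rule abs_summable_summable)
qed

lemma lap_summable:
 assumes "weights w" "!!i. \<bar>u i\<bar> <= B" shows "(%k. (u i - u (i+k))*w k) summable_on (UNIV - {0})"
proof (rule weights_summable[OF assms(1)])
 show "\<bar>u i - u (i+k)\<bar> <= 2*B" for k using assms(2)[of i] assms(2)[of "i+k"] by linarith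
qed

lemma lap_grid_le:
 assumes w: "weights w" and u: "!!i. \<bar>u i\<bar> <= B" and v: "!!i. \<bar>v i\<bar> <= B'"
  and le: "!!k. u i - u (i+k) <= v i' - v (i'+k)+g" shows "lap_grid w u i <= lap_grid w v i'+g*wsum w"
proof -
 have sw: "(%k. g*w k) summable_on (UNIV - {0})" using weightsD(1)[OF w] by (rule summable_on_cmult_right)
 have "lap_grid w u i <= (\<Sum>\<^sub>\<infinity>k\<in>UNIV - {0}. (v i' - v (i'+k))*w k+g*w k)" unfolding lap_grid_def
 proof (rule infsum_mono[OF lap_summable[OF w u] summable_on_add[OF lap_summable[OF w v] sw]])
  fix k :: int assume "k \<in> UNIV - {0}"
  then have "0 <= w k" using weightsD(2)[OF w] by simp
  then have "(u i - u (i+k))*w k <= (v i' - v (i'+k)+g)*w k" using le[of k] by (rule mult_right_mono[rotated])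
  then show "(u i - u (i+k))*w k <= (v i' - v (i'+k))*w k+g*w k" by (simp add: distrib_right)
 qed
 also have "... = lap_grid w v i'+g*wsum w" unfolding lap_grid_def wsum_def
  by (subst infsum_add[OF lap_summable[OF w v] sw]) (simp add: infsum_cmult_right')
 finally show ?thesis .
qed

lemma lap_grid_const [simp]: "lap_grid w (%i. c) i = 0" by (simp add: lap_grid_def)

lemma lap_grid_add_const [simp]: "lap_grid w (%i. u i+c) i = lap_grid w u i" by (simp add: lap_grid_def)

lemma lap_grid_shift: "lap_grid w (%i. u (i+n)) i = lap_grid w u (i+n)" by (simp add: lap_grid_def algebra_simps)

text \<open>Reflection of space and of values keeps a grid function nondecreasing and reverses the
  sign of its Laplacian, so lower bounds for a step follow from upper ones.\<close>

definition refl :: "(int => real) => int => real" where "refl u i = - u (- i)"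

lemma lap_grid_refl:
 assumes "weights w" shows "lap_grid w (refl u) i = - lap_grid w u (- i)"
proof -
 have bij: "bij_betw uminus (UNIV - {0::int}) (UNIV - {0})" by (rule bij_betwI[where g = uminus]) auto
 have "lap_grid w (refl u) i = (\<Sum>\<^sub>\<infinity>k\<in>UNIV - {0}. - ((u (- i) - u (- i+- k))*w (- k)))"
  unfolding lap_grid_def refl_def
 proof (rule infsum_cong)
  fix k :: int assume "k \<in> UNIV - {0}"
  then have "w (- k) = w k" using weightsD(3)[OF assms] by simp
  then show "(- u (- i) - - u (- (i+k)))*w k = - ((u (- i) - u (- i+- k))*w (- k))" by (simp add: algebra_simps)
 qed
 also have "... = - (\<Sum>\<^sub>\<infinity>k\<in>UNIV - {0}. (u (- i) - u (- i+- k))*w (- k))" by (rule infsum_uminus)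
 also have "(\<Sum>\<^sub>\<infinity>k\<in>UNIV - {0}. (u (- i) - u (- i+- k))*w (- k)) = lap_grid w u (- i)" unfolding lap_grid_def
  using infsum_reindex_bij_betw[OF bij, of "%k. (u (- i) - u (- i+k))*w k"] by simp
 finally show ?thesis .
qed

section \<open>One step of the scheme and its monotonicity\<close>

definition ppow :: "real => real => real" where "ppow m D = max D 0 powr (m - 1)"

lemma ppow_nonneg: "0 <= ppow m D" by (simp add: ppow_def)

lemma ppow_le: "1 <= m ==> a <= L ==> 0 <= L ==> ppow m a <= L powr (m - 1)" unfolding ppow_def by (intro powr_mono2) auto

lemma ppow_diff:
 assumes "2 <= m" "a <= L" "0 <= L" "a - b <= e" "0 <= e" shows "ppow m a - ppow m b <= (m - 1)*L powr (m - 2)*e"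
proof (cases "max a 0 <= max b 0")
 case True
 then have "ppow m a <= ppow m b" unfolding ppow_def using assms by (intro powr_mono2) auto
 moreover have "0 <= (m - 1)*L powr (m - 2)*e" using assms by simp
 ultimately show ?thesis by linarith
next
 case False
 have "ppow m a - ppow m b <= (m - 1)*L powr (m - 1 - 1)*(max a 0 - max b 0)"
  unfolding ppow_def using assms False by (intro powr_diff_le) auto
 also have "... <= (m - 1)*L powr (m - 1 - 1)*e" using assms by (intro mult_left_mono) auto
 finally show ?thesis by simp
qed

definition gclass :: "real => real => real => (int => real) set" where
 "gclass Lam M h = {u. \<forall>i. u i <= u (i+1) & u (i+1) - u i <= Lam*h & \<bar>u i\<bar> <= M}"

text \<open>The CFL condition in the form used by the monotonicity proof: the first term bounds the
  effect of a change of slope, the second that of a change of the Laplacian. \<open>Lam\<close> will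
  be \<open>L\<close> or \<open>2 * M / h\<close>.\<close>

definition cfl :: "real => (int => real) => real => real => real => real => bool" where
 "cfl m w h tau Lam M \<longleftrightarrow> 0 < h & 0 < tau & 0 <= Lam & weights w &
  (\<forall>u\<in>gclass Lam M h. \<forall>i. tau*((m - 1)*Lam powr (m - 2)*\<bar>lap_grid w u i\<bar>/h
  + Lam powr (m - 1)*wsum w) <= 1)"

definition step :: "real => (int => real) => real => real => (int => real) => int => real" where
 "step m w h tau u i = u i+tau*L_h m w h u i"

lemma step_eq: "step m w h tau u i = u i - tau*ppow m (D_h w h u i)*lap_grid w u i" by (simp add: step_def L_h_def ppow_def)

lemma scheme_eq: "scheme m w h tau v0 j = (step m w h tau ^^ j) (%i. v0 (of_int i*h))"
proof (induction j)
 case (Suc j)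
 have "scheme m w h tau v0 (Suc j) = step m w h tau (scheme m w h tau v0 j)" by (rule ext) (simp add: step_def)
 then show ?case by (simp add: Suc)
qed simp

lemma gclassD:
 assumes "u \<in> gclass Lam M h" shows "u i <= u (i+1)" "u (i+1) - u i <= Lam*h" "\<bar>u i\<bar> <= M"
 using assms by (auto simp: gclass_def)

lemma gclass_pred:
 assumes "u \<in> gclass Lam M h" shows "u (i - 1) <= u i" "u i - u (i - 1) <= Lam*h" using gclassD[OF assms, of "i - 1"] by auto

lemma gclass_D_h:
 assumes "u \<in> gclass Lam M h" "0 < h" shows "0 <= D_h w h u i" "D_h w h u i <= Lam"
 using gclassD[OF assms(1), of i] gclass_pred[OF assms(1), of i] assms(2) by (auto simp: D_h_def divide_le_eq)

text \<open>\<open>U\<close> is arbitrary because test functions on the grid need not be monotone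
  nor have slopes below \<open>Lam\<close>; cutting its slope at \<open>Lam\<close> keeps the power
  in the range where its Lipschitz constant is under control. The gap \<open>g\<close> at the node
  \<open>i\<close> pays for everything.\<close>

lemma step_le:
 assumes m: "2 <= m" and c: "cfl m w h tau Lam M" and V: "V \<in> gclass Lam M h"
  and le: "!!k. V k <= U k" and U: "!!k. \<bar>U k\<bar> <= B"
 shows "step m w h tau V i <= U i - tau*ppow m (min (D_h w h U i) Lam)*lap_grid w U i"
proof -
 have h: "0 < h" "0 < tau" "0 <= Lam" "weights w" using c by (auto simp: cfl_def)
 define g where "g = U i - V i"
 have g: "0 <= g" using le[of i] by (simp add: g_def)
 define a where "a = lap_grid w V i"
 define b where "b = lap_grid w U i"
 define dv where "dv = D_h w h V i"
 define du where "du = min (D_h w h U i) Lam"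
 define S where "S = wsum w"
 define LL where "LL = Lam powr (m - 1)"
 define LM where "LM = (m - 1)*Lam powr (m - 2)"
 have S: "0 <= S" using wsum_nonneg[OF h(4)] by (simp add: S_def)
 have LM: "0 <= LM" "0 <= LL" using m by (auto simp: LM_def LL_def)
 have ab: "b <= a+g*S" unfolding a_def b_def S_def
 proof (rule lap_grid_le[OF h(4) U gclassD(3)[OF V]])
  show "U i - U (i+k) <= V i - V (i+k)+g" for k using le[of "i+k"] by (simp add: g_def)
 qed
 have CFL: "tau*(LM*\<bar>a\<bar>/h+LL*S) <= 1" using c V unfolding cfl_def a_def S_def LL_def LM_def by blast
 have pu: "0 <= ppow m du" "ppow m du <= LL" unfolding LL_def du_def using m h by (auto intro!: ppow_nonneg ppow_le)
 have pv: "0 <= ppow m dv" "ppow m dv <= LL" unfolding LL_def dv_def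
  using m h gclass_D_h[OF V h(1)] by (auto intro!: ppow_nonneg ppow_le)
 have LLg: "ppow m du*(g*S) <= LL*(g*S)" using pu g S by (intro mult_right_mono) auto
 have main: "ppow m du*b - ppow m dv*a <= LM*(g/h)*\<bar>a\<bar>+LL*(g*S)"
 proof -
  have nn: "0 <= LM*(g/h)*\<bar>a\<bar>" "0 <= LL*(g*S)" using LM g h S by auto
  \<comment> \<open>Upwinding picks the neighbour at which \<open>V <= U\<close> bounds the slope
    difference by \<open>g/h\<close> in the harmful direction. If the signs of the Laplacians
    differ, the slopes are not compared: either \<open>b - a <= g*S\<close> suffices or both terms
    have the favourable sign.\<close>
  consider "a <= 0" "b <= 0" | "a <= 0" "0 < b" | "0 < a" "b <= 0" | "0 < a" "0 < b" by linarith
  then show ?thesis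
  proof cases
  case 1
  have dd: "dv = (V (i+1) - V i)/h" "du = min ((U (i+1) - U i)/h) Lam" using 1 by (auto simp: dv_def du_def D_h_def a_def b_def)
  have "dv - du <= g/h"
  proof (cases "(U (i+1) - U i)/h <= Lam")
  case True
  have "((V (i+1) - V i) - (U (i+1) - U i))/h <= g/h" using h le[of "i+1"] by (intro divide_right_mono) (auto simp: g_def)
  then show ?thesis using True by (simp add: dd diff_divide_distrib)
  next
  case False
  have "dv <= Lam" unfolding dv_def by (rule gclass_D_h(2)[OF V h(1)])
  then have "dv - Lam <= 0" by simp
  also have "0 <= g/h" using g h by simp
  finally show ?thesis using False by (simp add: dd(2))
  qed
  then have "ppow m dv - ppow m du <= LM*(g/h)" unfolding LM_def
  using m h gclass_D_h[OF V h(1)] g by (intro ppow_diff) (auto simp: dv_def)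
  then have "(ppow m dv - ppow m du)*\<bar>a\<bar> <= LM*(g/h)*\<bar>a\<bar>" by (intro mult_right_mono) auto
  moreover have "ppow m du*b <= ppow m du*(a+g*S)" using ab pu by (intro mult_left_mono)
  ultimately show ?thesis using 1 LLg by (simp add: algebra_simps)
  next
  case 2
  have "ppow m du*b <= LL*b" using 2 pu by (intro mult_right_mono) auto
  moreover have "ppow m dv*(- a) <= LL*(- a)" using 2 pv by (intro mult_right_mono) auto
  moreover have "LL*(b - a) <= LL*(g*S)" using ab LM by (intro mult_left_mono) auto
  ultimately show ?thesis using nn by (simp add: algebra_simps)
  next
  case 3
  have "ppow m du*b <= 0" using 3 pu by (simp add: mult_nonneg_nonpos)
  moreover have "0 <= ppow m dv*a" using 3 pv by simp
  ultimately show ?thesis using nn by linarith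
  next
  case 4
  have dd: "dv = (V i - V (i - 1))/h" "du = min ((U i - U (i - 1))/h) Lam" using 4 by (auto simp: dv_def du_def D_h_def a_def b_def)
  have "((U i - U (i - 1)) - (V i - V (i - 1)))/h <= g/h" using h le[of "i - 1"] by (intro divide_right_mono) (auto simp: g_def)
  then have "du - dv <= g/h" by (simp add: dd diff_divide_distrib)
  then have "ppow m du - ppow m dv <= LM*(g/h)" unfolding LM_def using m h g by (intro ppow_diff) (auto simp: du_def)
  then have "(ppow m du - ppow m dv)*\<bar>a\<bar> <= LM*(g/h)*\<bar>a\<bar>" by (intro mult_right_mono) auto
  moreover have "ppow m du*b <= ppow m du*(a+g*S)" using ab pu by (intro mult_left_mono)
  ultimately show ?thesis using 4 LLg by (simp add: algebra_simps)
  qed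
 qed
 have "tau*(ppow m du*b - ppow m dv*a) <= tau*(LM*(g/h)*\<bar>a\<bar>+LL*(g*S))" using main h by (intro mult_left_mono) auto
 also have "... = g*(tau*(LM*\<bar>a\<bar>/h+LL*S))" by (simp add: algebra_simps)
 also have "... <= g*1" using CFL g by (intro mult_left_mono)
 finally have "tau*(ppow m du*b - ppow m dv*a) <= g" by simp
 then show ?thesis unfolding step_eq g_def a_def b_def dv_def du_def by (simp add: algebra_simps)
qed

lemma refl_gclass: "u \<in> gclass Lam M h ==> refl u \<in> gclass Lam M h"
proof -
 assume u: "u \<in> gclass Lam M h"
 have "refl u i <= refl u (i+1)" "refl u (i+1) - refl u i <= Lam*h" "\<bar>refl u i\<bar> <= M" for i
  using gclassD(1,2)[OF u, of "- i - 1"] gclassD(3)[OF u, of "- i"] by (auto simp: refl_def)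
 then show ?thesis by (simp add: gclass_def)
qed

lemma D_h_refl:
 assumes "weights w" "lap_grid w u (- i) ~= 0" shows "D_h w h (refl u) i = D_h w h u (- i)"
proof -
 have e: "- (i+1) = - i - 1" "- (i - 1) = - i+1" by simp_all
 show ?thesis using assms(2) unfolding D_h_def lap_grid_refl[OF assms(1)] refl_def e by auto
qed

lemma step_refl:
 assumes "weights w" shows "step m w h tau (refl u) i = - step m w h tau u (- i)"
proof (cases "lap_grid w u (- i) = 0")
 \<comment> \<open>When the Laplacian vanishes, the choice of side in \<open>D_h\<close> does not
   commute with the reflection, but the slope is then multiplied by 0.\<close>
 case True
 then show ?thesis unfolding step_eq lap_grid_refl[OF assms] by (simp add: refl_def)
next
 case False
 then show ?thesis unfolding step_eq lap_grid_refl[OF assms] D_h_refl[OF assms False] by (simp add: refl_def)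
qed

lemma step_ge:
 assumes m: "2 <= m" and c: "cfl m w h tau Lam M" and V: "V \<in> gclass Lam M h"
  and le: "!!k. U k <= V k" and U: "!!k. \<bar>U k\<bar> <= B"
 shows "U i - tau*ppow m (min (D_h w h U i) Lam)*lap_grid w U i <= step m w h tau V i"
proof -
 have w: "weights w" using c by (simp add: cfl_def)
 have "step m w h tau (refl V) (- i) <= refl U (- i) - tau*ppow m (min (D_h w h (refl U) (- i)) Lam)*lap_grid w (refl U) (- i)"
  by (rule step_le[OF m c refl_gclass[OF V]]) (use le U in \<open>auto simp: refl_def\<close>)
 then show ?thesis unfolding step_refl[OF w] lap_grid_refl[OF w] using D_h_refl[OF w, of U "- i" h]
  by (cases "lap_grid w U i = 0") (auto simp: refl_def)
qed

lemma step_comparison: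
 assumes m: "2 <= m" and c: "cfl m w h tau Lam M" and V: "V \<in> gclass Lam M h" and U: "U \<in> gclass Lam M h"
  and le: "!!k. V k <= U k+c'" shows "step m w h tau V i <= step m w h tau U i+c'"
proof -
 have h: "0 < h" using c by (simp add: cfl_def)
 have "step m w h tau V i <= (U i+c') - tau*ppow m (min (D_h w h (%i. U i+c') i) Lam)*lap_grid w (%i. U i+c') i"
 proof (rule step_le[OF m c V le])
  show "\<bar>U k+c'\<bar> <= M+\<bar>c'\<bar>" for k using gclassD(3)[OF U, of k] by linarith
 qed
 moreover have "D_h w h (%i. U i+c') i = D_h w h U i" by (simp add: D_h_def)
 moreover have "D_h w h U i <= Lam" by (rule gclass_D_h(2)[OF U h])
 ultimately show ?thesis by (simp add: step_eq min_def)
qed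

lemma shift_gclass: "u \<in> gclass Lam M h ==> (%i. u (i+n)) \<in> gclass Lam M h"
 unfolding gclass_def by (auto simp: algebra_simps) (metis add.assoc add.commute)+

lemma step_shift: "step m w h tau (%i. u (i+n)) i = step m w h tau u (i+n)"
 unfolding step_eq lap_grid_shift D_h_def by (simp add: algebra_simps)

text \<open>Each part of the class is a comparison: with the translate by one node, with the
  function raised by \<open>Lam*h\<close>, and with constants.\<close>

lemma step_gclass:
 assumes m: "2 <= m" and c: "cfl m w h tau Lam M" and V: "V \<in> gclass Lam M h" shows "step m w h tau V \<in> gclass Lam M h"
proof -
 have h: "0 < h" using c by (simp add: cfl_def)
 note sV = shift_gclass[OF V, of 1]
 have "step m w h tau V i <= step m w h tau V (i+1)" for i
  using step_comparison[OF m c V sV, of 0 i] gclassD(1)[OF V] by (simp add: step_shift)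
 moreover have "step m w h tau V (i+1) <= step m w h tau V i+Lam*h" for i
 proof -
  have "V (k+1) <= V k+Lam*h" for k using gclassD(2)[OF V, of k] by linarith
  from step_comparison[OF m c sV V this, of i] show ?thesis by (simp add: step_shift)
 qed
 moreover have "\<bar>step m w h tau V i\<bar> <= M" for i
 proof -
  have V': "V k <= M" "- M <= V k" for k using gclassD(3)[OF V, of k] by linarith+
  have "step m w h tau V i <= M" using step_le[OF m c V, of "%k. M" "\<bar>M\<bar>" i] V' by simp
  moreover have "- M <= step m w h tau V i" using step_ge[OF m c V, of "%k. - M" "\<bar>M\<bar>" i] V' by simp
  ultimately show ?thesis by simp
 qed
 ultimately show ?thesis by (simp add: gclass_def algebra_simps)
qed

lemma iter_gclass:
 assumes "2 <= m" "cfl m w h tau Lam M" "V \<in> gclass Lam M h" shows "(step m w h tau ^^ j) V \<in> gclass Lam M h"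
 by (induction j) (use assms step_gclass in auto)

lemma iter_comparison:
 assumes "2 <= m" "cfl m w h tau Lam M" "V \<in> gclass Lam M h" "U \<in> gclass Lam M h" and "!!k. V k <= U k+c"
 shows "(step m w h tau ^^ j) V i <= (step m w h tau ^^ j) U i+c"
proof (induction j arbitrary: i)
 case (Suc j)
 then show ?case using step_comparison[OF assms(1,2) iter_gclass[OF assms(1,2,3), of j] iter_gclass[OF assms(1,2,4), of j]] by simp
qed (use assms in simp)

lemma iter_shift: "(step m w h tau ^^ j) (%i. u (i+n)) = (%i. (step m w h tau ^^ j) u (i+n))" by (induction j) (auto simp: step_shift)

text \<open>The evolution from \<open>V\<close> is compared with the one from its first step, so the
  size of the first step bounds that of all later ones.\<close>

lemma iter_time:
 assumes "2 <= m" "cfl m w h tau Lam M" "V \<in> gclass Lam M h" and "!!k. \<bar>step m w h tau V k - V k\<bar> <= c"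
 shows "\<bar>(step m w h tau ^^ (j+n)) V i - (step m w h tau ^^ j) V i\<bar> <= real n * c"
proof (induction n)
 case (Suc n)
 note sV = step_gclass[OF assms(1-3)]
 have a: "step m w h tau V k <= V k+c" "V k <= step m w h tau V k+c" for k using assms(4)[of k] by linarith+
 have "(step m w h tau ^^ (j+n)) (step m w h tau V) i <= (step m w h tau ^^ (j+n)) V i+c"
  "(step m w h tau ^^ (j+n)) V i <= (step m w h tau ^^ (j+n)) (step m w h tau V) i+c"
  by (rule iter_comparison[OF assms(1,2) sV assms(3) a(1)], rule iter_comparison[OF assms(1,2,3) sV a(2)])
 moreover have "(step m w h tau ^^ (j+Suc n)) V i = (step m w h tau ^^ (j+n)) (step m w h tau V) i" by (simp add: funpow_swap1)
 moreover have "real (Suc n) * c = real n * c+c" by (simp add: algebra_simps)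
 ultimately show ?case using Suc by linarith
qed simp

section \<open>Interpolants\<close>

lemma interpolant_eq:
 assumes "0 < h" shows "interpolant h tau V (x, t) =
  (1 - frac (x/h))*V (nat \<lfloor>t/tau\<rfloor>) \<lfloor>x/h\<rfloor>+frac (x/h)*V (nat \<lfloor>t/tau\<rfloor>) (\<lfloor>x/h\<rfloor>+1)"
proof -
 have e: "(of_int (\<lfloor>x/h\<rfloor>+1)*h - x)/h = 1 - frac (x/h)"
  "(x - of_int \<lfloor>x/h\<rfloor>*h)/h = frac (x/h)" using assms by (auto simp: frac_def field_simps)
 show ?thesis by (simp only: interpolant_def Let_def prod.case add_diff_cancel_right' e)
qed

lemma frac_conv: "0 <= frac (x :: real)" "0 <= 1 - frac x" using frac_lt_1[of x] by (auto simp: frac_ge_0)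

lemma interpolant_le:
 assumes "0 < h" "!!j i. V j i <= U j i+c" shows "interpolant h tau V p <= interpolant h tau U p+c"
proof (cases p)
 case (Pair x t)
 define f where "f = frac (x/h)"
 define j where "j = nat \<lfloor>t/tau\<rfloor>"
 define i where "i = \<lfloor>x/h\<rfloor>"
 have f: "0 <= f" "0 <= 1 - f" unfolding f_def by (rule frac_conv)+
 have "(1 - f)*V j i+f*V j (i+1) <= (1 - f)*(U j i+c)+f*(U j (i+1)+c)" using f assms(2) by (intro add_mono mult_left_mono) auto
 then show ?thesis unfolding Pair interpolant_eq[OF assms(1)] f_def[symmetric] j_def[symmetric] i_def[symmetric]
  by (simp add: algebra_simps)
qed

lemma interpolant_between:
 assumes "0 < h" "!!i. V (nat \<lfloor>t/tau\<rfloor>) i <= V (nat \<lfloor>t/tau\<rfloor>) (i+1)"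
 shows "V (nat \<lfloor>t/tau\<rfloor>) \<lfloor>x/h\<rfloor> <= interpolant h tau V (x, t)"
  and "interpolant h tau V (x, t) <= V (nat \<lfloor>t/tau\<rfloor>) (\<lfloor>x/h\<rfloor>+1)"
proof -
 define f where "f = frac (x/h)"
 define a where "a = V (nat \<lfloor>t/tau\<rfloor>) \<lfloor>x/h\<rfloor>"
 define b where "b = V (nat \<lfloor>t/tau\<rfloor>) (\<lfloor>x/h\<rfloor>+1)"
 have f: "0 <= f" "0 <= 1 - f" unfolding f_def by (rule frac_conv)+
 have "a <= b" using assms(2) unfolding a_def b_def by blast
 then have "f*a <= f*b" "(1 - f)*a <= (1 - f)*b" using f by (auto intro: mult_left_mono)
 then have "a <= (1 - f)*a+f*b" "(1 - f)*a+f*b <= b" by (auto simp: algebra_simps)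
 then show "V (nat \<lfloor>t/tau\<rfloor>) \<lfloor>x/h\<rfloor> <= interpolant h tau V (x, t)"
  "interpolant h tau V (x, t) <= V (nat \<lfloor>t/tau\<rfloor>) (\<lfloor>x/h\<rfloor>+1)"
  unfolding interpolant_eq[OF assms(1)] a_def b_def f_def by auto
qed

text \<open>The slack \<open>2*h\<close> and \<open>tau\<close> is rounding: the interpolant is
  bounded above by the right node of one cell and below by the left node of another.\<close>

lemma interpolant_Lipschitz:
 assumes h: "0 < h" "0 < tau" and mono: "!!j i. V j i <= V j (i+1)" and xl: "!!j i. V j (i+1) - V j i <= l*h" and l: "0 <= l" "0 <= C"
  and tl: "!!j n i. \<bar>V (j+n) i - V j i\<bar> <= real n*(C*tau)" and t: "0 <= t" "0 <= r"
 shows "interpolant h tau V (x, t) <= interpolant h tau V (y, r)+l*(\<bar>x - y\<bar>+2*h)+C*(\<bar>t - r\<bar>+tau)"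
proof -
 define j where "j = nat \<lfloor>t/tau\<rfloor>"
 define k where "k = nat \<lfloor>r/tau\<rfloor>"
 define a where "a = \<lfloor>x/h\<rfloor>"
 define b where "b = \<lfloor>y/h\<rfloor>"
 have mono': "V j i <= V j (i+int n)" for j i n
 proof (induction n)
  case (Suc n)
  have "V j (i+int n) <= V j (i+int n+1)" by (rule mono)
  also have "i+int n+1 = i+int (Suc n)" by simp
  finally show ?case using Suc by linarith
 qed simp
 have up: "V j (i+int n) <= V j i+real n*(l*h)" for j i n
 proof (induction n)
  case (Suc n)
  have "V j (i+int n+1) <= V j (i+int n)+l*h" using xl[of j "i+int n"] by linarith
  then show ?case using Suc by (simp add: algebra_simps)
 qed simp
 have "V j (a+1) <= V j b+l*(\<bar>x - y\<bar>+2*h)"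
 proof (cases "a+1 <= b")
  case True
  then have "V j (a+1) <= V j b" using mono'[of j "a+1" "nat (b - a - 1)"] by simp
  moreover have "0 <= l*(\<bar>x - y\<bar>+2*h)" using l h by simp
  ultimately show ?thesis by linarith
 next
  case False
  define n where "n = nat (a+1 - b)"
  have n: "a+1 = b+int n" using False by (simp add: n_def)
  have "real n = of_int a+1 - of_int b" using False by (simp add: n_def)
  also have "... <= x/h - y/h+2" unfolding a_def b_def by linarith
  finally have "real n*h <= (x/h - y/h+2)*h" using h by (intro mult_right_mono) auto
  also have "... = (x - y)+2*h" using h by (simp add: field_simps)
  also have "... <= \<bar>x - y\<bar>+2*h" by simp
  finally have "l*(real n*h) <= l*(\<bar>x - y\<bar>+2*h)" using l by (intro mult_left_mono)
  then show ?thesis using up[of j b n] unfolding n by (simp add: algebra_simps)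
 qed
 moreover have "V j b <= V k b+C*(\<bar>t - r\<bar>+tau)"
 proof -
  have fl: "real j = of_int \<lfloor>t/tau\<rfloor>" "real k = of_int \<lfloor>r/tau\<rfloor>" using t h by (simp_all add: j_def k_def)
  have "\<bar>real j - real k\<bar> <= \<bar>t/tau - r/tau\<bar>+1" unfolding fl by linarith
  then have "\<bar>real j - real k\<bar>*tau <= (\<bar>t/tau - r/tau\<bar>+1)*tau" using h by (intro mult_right_mono) auto
  also have "... = \<bar>t - r\<bar>+tau" using h by (simp add: diff_divide_distrib[symmetric] distrib_right)
  finally have jk: "C*(\<bar>real j - real k\<bar>*tau) <= C*(\<bar>t - r\<bar>+tau)" using l by (intro mult_left_mono)
  show ?thesis
  proof (cases "j <= k")
  case True
  then show ?thesis using tl[of j "k - j" b] jk by (simp add: of_nat_diff algebra_simps)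
  next
  case False
  then show ?thesis using tl[of k "j - k" b] jk by (simp add: of_nat_diff algebra_simps)
  qed
 qed
 moreover have "interpolant h tau V (x, t) <= V j (a+1)" "V k b <= interpolant h tau V (y, r)"
  unfolding j_def k_def a_def b_def using interpolant_between[OF h(1), where V = V] mono by blast+
 ultimately show ?thesis by linarith
qed

section \<open>Consistency and half-relaxed limits\<close>

lemma open_Q: "open (Q T)" unfolding Q_def by (intro open_Times) auto

lemma C2_onE:
 assumes "C2_on S f"
 obtains fx ft fxx fxt ftx ftt where
  "has_jet S f fx ft fxx fxt ftx ftt"
  "continuous_on S fxx" "continuous_on S fxt" "continuous_on S ftx" "continuous_on S ftt"
 using assms unfolding C2_on_def by (elim exE conjE) (rule that)

lemma C2_on_Q:
 assumes "C2_on (Q T) phi"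
 obtains fx ft fxx where
  "!!x t. 0 < t ==> t < T ==> C2d (%y. phi (y, t)) (%y. fx (y, t)) (%y. fxx (y, t))"
  "!!x t. 0 < t ==> t < T ==> ((%r. phi (x, r)) has_real_derivative ft (x, t)) (at t)"
  "continuous_on (Q T) phi" "continuous_on (Q T) fx" "continuous_on (Q T) ft" "continuous_on (Q T) fxx"
proof -
 obtain fx ft fxx fxt ftx ftt where
  dd: "has_jet (Q T) phi fx ft fxx fxt ftx ftt" and c: "continuous_on (Q T) fxx" using assms by (rule C2_onE)
 note d = dd[THEN bspec, THEN conjunct1] dd[THEN bspec, THEN conjunct2, THEN conjunct1]
  dd[THEN bspec, THEN conjunct2, THEN conjunct2]
 have at: "at p within Q T = at p" if "p \<in> Q T" for p using open_Q that by (rule at_within_open[rotated])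
 have slice_x: "((%y. k (y, t)) has_real_derivative a) (at x)"
  if "(k has_derivative (%(u, w). a*u+b*w)) (at (x, t) within Q T)" "0 < t" "t < T" for k a b x t
 proof -
  have p: "(x, t) \<in> Q T" using that by (simp add: Q_def)
  have "((%y. (y, t)) has_derivative (%u. (u, 0))) (at x)" by (auto intro!: derivative_eq_intros)
  from has_derivative_compose[OF this, of k "%(u, w). a*u+b*w"] that(1)
  have "((%y. k (y, t)) has_derivative (%u. a*u)) (at x)" unfolding at[OF p] by simp
  then show ?thesis unfolding has_field_derivative_def .
 qed
 have slice_t: "((%r. k (x, r)) has_real_derivative b) (at t)"
  if "(k has_derivative (%(u, w). a*u+b*w)) (at (x, t) within Q T)" "0 < t" "t < T" for k a b x t
 proof -
  have p: "(x, t) \<in> Q T" using that by (simp add: Q_def)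
  have "((%r. (x, r)) has_derivative (%w. (0, w))) (at t)" by (auto intro!: derivative_eq_intros)
  from has_derivative_compose[OF this, of k "%(u, w). a*u+b*w"] that(1)
  have "((%r. k (x, r)) has_derivative (%u. b*u)) (at t)" unfolding at[OF p] by simp
  then show ?thesis unfolding has_field_derivative_def .
 qed
 have inQ: "(x, t) \<in> Q T" if "0 < t" "t < T" for x t using that by (simp add: Q_def)
 have C: "C2d (%y. phi (y, t)) (%y. fx (y, t)) (%y. fxx (y, t))" if t: "0 < t" "t < T" for t unfolding C2d_def
 proof (intro conjI allI)
  show "((%y. phi (y, t)) has_real_derivative fx (x, t)) (at x)" for x by (rule slice_x[OF d(1)[OF inQ[OF t]] t])
  show "((%y. fx (y, t)) has_real_derivative fxx (x, t)) (at x)" for x by (rule slice_x[OF d(2)[OF inQ[OF t]] t])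
  show "continuous_on UNIV (%y. fxx (y, t))" by (intro continuous_on_compose2[OF c] continuous_intros) (use inQ[OF t] in auto)
 qed
 show ?thesis
 proof (rule that[of fx fxx ft])
  show "((%r. phi (x, r)) has_real_derivative ft (x, t)) (at t)" if "0 < t" "t < T" for x t
  by (rule slice_t[OF d(1)[OF inQ[OF that]] that])
  show "continuous_on (Q T) phi" "continuous_on (Q T) fx" "continuous_on (Q T) ft" by (rule has_derivative_continuous_on, erule d)+
 qed (use C c in auto)
qed

lemma eq_op_C2:
 assumes s: "0 < s" "s < 1" and t: "0 < t" "t < T" and C: "C2d (%y. phi (y, t)) fx fxx" and B: "bounded (range (%y. phi (y, t)))"
  and d: "((%r. phi (x, r)) has_real_derivative ft) (at t)"
 shows "eq_op m s T phi x t = ft+\<bar>fx x\<bar> powr (m - 1)*fl s (sdiff (%y. phi (y, t)) x)"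
proof -
 have "((%r. phi (x, r)) has_vector_derivative ft) (at t within {0..T})"
  using has_field_derivative_at_within[OF d] unfolding has_real_derivative_iff_has_vector_derivative .
 then have 1: "dt T phi x t = ft" unfolding dt_def using vector_derivative_within_closed_interval[of 0 T t] t by simp
 have "((%y. phi (y, t)) has_real_derivative fx x) (at x)" using C unfolding C2d_def by blast
 then have 2: "dx phi x t = fx x" unfolding dx_def by (rule DERIV_imp_deriv)
 show ?thesis unfolding eq_op_def 1 2 frac_lap_eq[OF s C2_realI[OF C] B] ..
qed

text \<open>The slope enters only through its absolute value, so \<open>eq_op\<close> is odd in the
  test function.\<close>

lemma int_super_iff: "int_super m s T u \<longleftrightarrow> int_sub m s T (%p. - u p)" if s: "0 < s" "s < 1" for m s T u
proof -
 have C2: "C2_on S (%p. - phi p)" if C2': "C2_on S phi" for phi S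
 proof -
  obtain fx ft fxx fxt ftx ftt where
  dd: "has_jet S phi fx ft fxx fxt ftx ftt"
  and c: "continuous_on S fxx" "continuous_on S fxt" "continuous_on S ftx" "continuous_on S ftt" using C2' by (rule C2_onE)
  note d = dd[THEN bspec, THEN conjunct1] dd[THEN bspec, THEN conjunct2, THEN conjunct1]
  dd[THEN bspec, THEN conjunct2, THEN conjunct2]
  have n: "((%p. - k p) has_derivative (%(u, w). (- a)*u+(- b)*w)) (at p within S)"
  if "(k has_derivative (%(u, w). a*u+b*w)) (at p within S)" for k a b p
  using has_derivative_minus[OF that] by (simp add: case_prod_unfold)
  show ?thesis unfolding C2_on_def by (rule exI[of _ "%p. - fx p"], rule exI[of _ "%p. - ft p"], rule exI[of _ "%p. - fxx p"],
  rule exI[of _ "%p. - fxt p"], rule exI[of _ "%p. - ftx p"], rule exI[of _ "%p. - ftt p"])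
  (intro conjI ballI n d continuous_on_minus c)
 qed
 have Cb: "Cb_on S (%p. - phi p)" if "Cb_on S phi" for phi and S :: "(real \<times> real) set"
 proof -
  have "(%p. - phi p) ` S = uminus ` (phi ` S)" by auto
  then show ?thesis using that unfolding Cb_on_def by (auto intro!: continuous_on_minus bounded_uminus[THEN iffD2])
 qed
 have op: "eq_op m s T (%p. - phi p) x t = - eq_op m s T phi x t"
  if "C2_on (Q T) phi" "Cb_on (Q T) phi" "0 < t" "t < T" for phi x t
 proof (rule C2_on_Q[OF that(1)])
  fix fx ft fxx
  assume a: "!!x t. 0 < t ==> t < T ==> C2d (%y. phi (y, t)) (%y. fx (y, t)) (%y. fxx (y, t))"
  "!!x t. 0 < t ==> t < T ==> ((%r. phi (x, r)) has_real_derivative ft (x, t)) (at t)"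
  note t = that(3,4)
  have b: "bounded (range (%y. phi (y, t)))"
  by (rule bounded_subset[of "phi ` Q T"]) (use that in \<open>auto simp: Cb_on_def Q_def\<close>)
  have b': "bounded (range (%y. - phi (y, t)))" using b unfolding bounded_iff by auto
  have C': "C2d (%y. - phi (y, t)) (%y. - fx (y, t)) (%y. - fxx (y, t))" using C2d_cmult[OF a(1)[OF t], of "-1"] by simp
  have "sdiff (%y. - phi (y, t)) x = (%y. - sdiff (%y. phi (y, t)) x y)" by (rule ext) (simp add: sdiff_def)
  then show ?thesis using eq_op_C2[where phi = phi, OF s t a(1)[OF t] b a(2)[OF t], of m x]
  eq_op_C2[where phi = "%p. - phi p", OF s t C' b' DERIV_minus[OF a(2)[OF t]], of m x] by (simp add: fl_minus)
 qed
 have mm: "max_point (Q T) (%p. - u p - - phi p) q = min_point (Q T) (%p. u p - phi p) q"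
  "min_point (Q T) (%p. u p - - phi p) q = max_point (Q T) (%p. - u p - phi p) q" for phi q
  unfolding max_point_def min_point_def by (auto simp: algebra_simps)
 have inQ: "0 < t & t < T" if "max_point (Q T) f (x, t) | min_point (Q T) f (x, t)" for f x t
  using that by (auto simp: max_point_def min_point_def Q_def)
 show ?thesis
 proof
  assume S: "int_super m s T u"
  show "int_sub m s T (%p. - u p)" unfolding int_sub_def
  proof (intro allI impI, elim conjE)
  fix phi x0 t0
  assume a: "C2_on (Q T) phi" "Cb_on (Q T) phi" "max_point (Q T) (%p. - u p - phi p) (x0, t0)"
  then have "0 <= eq_op m s T (%p. - phi p) x0 t0" using S C2[OF a(1)] Cb[OF a(2)] unfolding int_super_def mm(2)[symmetric] by blast
  moreover have "0 < t0 & t0 < T" using inQ a(3) by blast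
  ultimately show "eq_op m s T phi x0 t0 <= 0" using op[OF a(1,2), of t0 x0] by simp
  qed
 next
  assume S: "int_sub m s T (%p. - u p)"
  show "int_super m s T u" unfolding int_super_def
  proof (intro allI impI, elim conjE)
  fix phi x0 t0
  assume a: "C2_on (Q T) phi" "Cb_on (Q T) phi" "min_point (Q T) (%p. u p - phi p) (x0, t0)"
  then have "eq_op m s T (%p. - phi p) x0 t0 <= 0" using S C2[OF a(1)] Cb[OF a(2)] unfolding int_sub_def mm(1)[symmetric] by blast
  moreover have "0 < t0 & t0 < T" using inQ a(3) by blast
  ultimately show "0 <= eq_op m s T phi x0 t0" using op[OF a(1,2), of t0 x0] by simp
  qed
 qed
qed

section \<open>The discrete Laplacian of smooth functions\<close>

lemma lap_h_grid: "lap_h w h phi (of_int i*h) = lap_grid w (%k. phi (of_int k*h)) i"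
 unfolding lap_h_def lap_grid_def by (simp add: algebra_simps)

lemma lap_h_sdiff:
 assumes w: "weights w" and B: "!!x. \<bar>phi x\<bar> <= B"
 shows "lap_h w h phi x = (\<Sum>\<^sub>\<infinity>k\<in>UNIV - {0}. sdiff phi x (of_int k*h)*w k)/2"
  and "(%k. sdiff phi x (of_int k*h)*w k) summable_on (UNIV - {0})"
proof -
 have bij: "bij_betw uminus (UNIV - {0::int}) (UNIV - {0})" by (rule bij_betwI[where g = uminus]) auto
 define f where "f k = (phi x - phi (x + of_int k*h))*w k" for k
 have sf: "f summable_on (UNIV - {0})" unfolding f_def
 proof (rule weights_summable[OF w])
  show "\<bar>phi x - phi (x + of_int k*h)\<bar> <= 2*B" for k using B[of x] B[of "x + of_int k*h"] by linarith
 qed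
 have sf': "(%k. f (- k)) summable_on (UNIV - {0})" using sf summable_on_reindex_bij_betw[OF bij, of f] by simp
 have e: "f k+f (- k) = sdiff phi x (of_int k*h)*w k" if "k \<in> UNIV - {0}" for k
  using weightsD(3)[OF w, of k] that unfolding f_def sdiff_def by (simp add: algebra_simps)
 show "(%k. sdiff phi x (of_int k*h)*w k) summable_on (UNIV - {0})"
 proof -
  have "((%k. f k+f (- k)) summable_on (UNIV - {0}))
  = ((%k. sdiff phi x (of_int k*h)*w k) summable_on (UNIV - {0}))" by (rule summable_on_cong) (rule e)
  then show ?thesis using summable_on_add[OF sf sf'] by (rule iffD1)
 qed
 have "(\<Sum>\<^sub>\<infinity>k\<in>UNIV - {0}. sdiff phi x (of_int k*h)*w k) = (\<Sum>\<^sub>\<infinity>k\<in>UNIV - {0}. f k+f (- k))"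
  using e by (intro infsum_cong) simp
 also have "... = infsum f (UNIV - {0})+infsum f (UNIV - {0})" unfolding infsum_add[OF sf sf'] infsum_reindex_bij_betw[OF bij, of f] ..
 finally show "lap_h w h phi x = (\<Sum>\<^sub>\<infinity>k\<in>UNIV - {0}. sdiff phi x (of_int k*h)*w k)/2"
  unfolding lap_h_def f_def by simp
qed

text \<open>The weights tested with \<open>qf\<close> at scale \<open>R\<close>: a second moment for
  increments below \<open>R\<close> and a mass beyond. With \<open>R = 1\<close> it controls local
  errors, with large \<open>R\<close> the tails.\<close>

definition qsum :: "(int => real) => real => real => real" where
 "qsum w h R = (\<Sum>\<^sub>\<infinity>k\<in>UNIV - {0}. qf (of_int k*h/R)*w k)"

lemma qsum_summable: "weights w ==> (%k. qf (of_int k*h/R)*w k) summable_on (UNIV - {0})"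
 by (rule weights_summable[of _ _ 1]) (auto simp: abs_of_nonneg qf_nonneg less_imp_le qf_less1)

lemma infsum_qsum_bound:
 assumes w: "weights w" and f: "(%k. f k*w k) summable_on (UNIV - {0})" and le: "!!k. f k <= A*qf (of_int k*h)+B*qf (of_int k*h/R)"
 shows "(\<Sum>\<^sub>\<infinity>k\<in>UNIV - {0}. f k*w k) <= A*qsum w h 1+B*qsum w h R"
proof -
 have s1: "(%k. A*(qf (of_int k*h/1)*w k)) summable_on (UNIV - {0})" and s2: "(%k. B*(qf (of_int k*h/R)*w k)) summable_on (UNIV - {0})"
  by (rule summable_on_cmult_right[OF qsum_summable[OF w]])+
 have "(\<Sum>\<^sub>\<infinity>k\<in>UNIV - {0}. f k*w k) <=
  (\<Sum>\<^sub>\<infinity>k\<in>UNIV - {0}. A*(qf (of_int k*h/1)*w k)+B*(qf (of_int k*h/R)*w k))"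
 proof (rule infsum_mono[OF f summable_on_add[OF s1 s2]])
  fix k :: int assume "k \<in> UNIV - {0}"
  then have "0 <= w k" using weightsD(2)[OF w] by simp
  then have "f k*w k <= (A*qf (of_int k*h)+B*qf (of_int k*h/R))*w k" using le[of k] by (rule mult_right_mono[rotated])
  then show "f k*w k <= A*(qf (of_int k*h/1)*w k)+B*(qf (of_int k*h/R)*w k)" by (simp add: algebra_simps)
 qed
 also have "... = A*qsum w h 1+B*qsum w h R" unfolding infsum_add[OF s1 s2] qsum_def by (simp add: infsum_cmult_right')
 finally show ?thesis .
qed

lemma lap_h_diff_bound:
 assumes w: "weights w" and phi: "!!x. \<bar>phi x\<bar> <= B1" and psi: "!!x. \<bar>psi x\<bar> <= B2"
  and le: "!!y. \<bar>sdiff phi x y - sdiff psi x' y\<bar> <= A*qf y+B*qf (y/R)"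
 shows "\<bar>lap_h w h phi x - lap_h w h psi x'\<bar> <= A*qsum w h 1+B*qsum w h R"
proof -
 note s1 = lap_h_sdiff(2)[OF w phi, where h = h and x = x] and s2 = lap_h_sdiff(2)[OF w psi, where h = h and x = x']
 have s2': "(%k. - (sdiff psi x' (of_int k*h)*w k)) summable_on (UNIV - {0})" unfolding summable_on_uminus by (rule s2)
 define d where "d k = sdiff phi x (of_int k*h) - sdiff psi x' (of_int k*h)" for k
 have sd: "(%k. d k*w k) summable_on (UNIV - {0})" using summable_on_add[OF s1 s2'] unfolding d_def by (simp add: left_diff_distrib)
 have sd': "(%k. - d k*w k) summable_on (UNIV - {0})" using sd by (simp add: summable_on_uminus)
 have eq: "2*(lap_h w h phi x - lap_h w h psi x') = (\<Sum>\<^sub>\<infinity>k\<in>UNIV - {0}. d k*w k)"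
 proof -
  have "(\<Sum>\<^sub>\<infinity>k\<in>UNIV - {0}. d k*w k)
  = (\<Sum>\<^sub>\<infinity>k\<in>UNIV - {0}. sdiff phi x (of_int k*h)*w k+- (sdiff psi x' (of_int k*h)*w k))"
  by (intro infsum_cong) (simp add: d_def left_diff_distrib)
  then show ?thesis unfolding lap_h_sdiff(1)[OF w phi] lap_h_sdiff(1)[OF w psi] infsum_add[OF s1 s2'] infsum_uminus by simp
 qed
 have b: "d k <= A*qf (of_int k*h)+B*qf (of_int k*h/R)"
  "- d k <= A*qf (of_int k*h)+B*qf (of_int k*h/R)" for k using le[of "of_int k*h"] unfolding d_def by linarith+
 have "(\<Sum>\<^sub>\<infinity>k\<in>UNIV - {0}. d k*w k) <= A*qsum w h 1+B*qsum w h R" by (rule infsum_qsum_bound[OF w sd b(1)])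
 moreover have "(\<Sum>\<^sub>\<infinity>k\<in>UNIV - {0}. - d k*w k) <= A*qsum w h 1+B*qsum w h R"
  by (rule infsum_qsum_bound[OF w sd' b(2)])
 moreover have "(\<Sum>\<^sub>\<infinity>k\<in>UNIV - {0}. - d k*w k) = - (\<Sum>\<^sub>\<infinity>k\<in>UNIV - {0}. d k*w k)"
  using infsum_uminus[of "%k. d k*w k" "UNIV - {0}"] by simp
 ultimately have "- (\<Sum>\<^sub>\<infinity>k\<in>UNIV - {0}. d k*w k) <= A*qsum w h 1+B*qsum w h R"
  "(\<Sum>\<^sub>\<infinity>k\<in>UNIV - {0}. d k*w k) <= A*qsum w h 1+B*qsum w h R" by simp_all
 moreover have "2*x = y ==> - y <= z ==> y <= z ==> \<bar>x\<bar> <= z" for x y z :: real by linarith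
 ultimately show ?thesis using eq by blast
qed

locale discretization =
 fixes s m Cs :: real and om :: "real => int => real"
 assumes s0: "0 < s" and s1: "s < 1" and m2: "2 <= m" and sym: "!!h k. 0 < h ==> k ~= 0 ==> om h k = om h (- k) & 0 <= om h k"
  and Ac: "A_c s om" and Am: "A_m s Cs om"
begin

lemmas s01 = s0 s1

lemma ev_weights: "NEAR h. 0 < h & weights (om h)"
proof -
 have "NEAR h. om h summable_on (UNIV - {0})" using Am unfolding A_m_def by (auto elim: eventually_mono)
 moreover have "\<forall>\<^sub>F h in at_right (0::real). 0 < h" by (rule eventually_at_right_less)
 ultimately show ?thesis
 proof eventually_elim
  case (elim h)
  then show ?case unfolding weights_def using sym by blast
 qed
qed

lemma consistency:
 assumes "C2_real phi" "bounded (range phi)" shows "((%h. lap_h (om h) h phi x) \<longlongrightarrow> fl s (sdiff phi x)) (at_right 0)"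
proof -
 have "loc_unif_conv UNIV (%h. lap_h (om h) h phi) (frac_lap s phi)" using Ac assms C2_real_cont unfolding A_c_def Cb_on_def by blast
 from this[unfolded loc_unif_conv_def, THEN spec, of "{x}"]
 have "uniform_limit {x} (%h. lap_h (om h) h phi) (frac_lap s phi) (at_right 0)" by (rule mp) simp
 from tendsto_uniform_limitI[OF this, of x] show ?thesis unfolding frac_lap_eq[OF s01 assms] by simp
qed

text \<open>The second difference at 0 of an even function vanishing there is \<open>- 2\<close>
  times the function, so \<open>qsum\<close> is minus the discrete Laplacian at 0 of a rescaled
  \<open>qf\<close>, to which \<open>A_c\<close> applies.\<close>

lemma qsum_tendsto:
 assumes "0 < R" shows "((%h. qsum (om h) h R) \<longlongrightarrow> 2*(1/R) powr (2 * s)*fl s qf) (at_right 0)"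
proof -
 define phi where "phi = (%x. 1*qf ((1/R)*x))"
 have C: "C2_real phi" using C2_real_affine[OF C2_real_qf, of "1/R" 0] by (simp add: phi_def)
 have "\<bar>phi x\<bar> <= 1" for x using qf_nonneg qf_less1[of "(1/R)*x"] by (simp add: phi_def less_imp_le)
 note b = bounded_rangeI[OF this] and B = this
 have sd: "sdiff phi 0 = (%y. (- 2)*qf ((1/R)*y))" by (rule ext) (simp add: sdiff_def phi_def)
 have "fl s (sdiff phi 0) = - 2*((1/R) powr (2 * s)*fl s qf)" unfolding sd fl_cmult using fl_scale[of "1/R" s qf] assms by simp
 with tendsto_minus[OF consistency[OF C b, of 0]]
 have "((%h. - lap_h (om h) h phi 0) \<longlongrightarrow> 2*(1/R) powr (2 * s)*fl s qf) (at_right 0)" by (simp add: mult.assoc)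
 then show ?thesis
 proof (rule Lim_transform_eventually)
  show "NEAR h. - lap_h (om h) h phi 0 = qsum (om h) h R" using ev_weights
  proof eventually_elim
  case (elim h)
  have "(\<Sum>\<^sub>\<infinity>k\<in>UNIV - {0}. sdiff phi 0 (of_int k*h) * om h k) = (\<Sum>\<^sub>\<infinity>k\<in>UNIV - {0}. (- 2)*(qf (of_int k*h/R) * om h k))"
  by (intro infsum_cong) (simp add: sd)
  also have "... = - 2*qsum (om h) h R" unfolding qsum_def by (rule infsum_cmult_right')
  finally show ?case using lap_h_sdiff(1)[of "om h" phi 1 h 0] elim B by simp
  qed
 qed
qed

lemma consistency_seq:
 fixes phi :: "real \<times> real => real"
 assumes h: "filterlim hh (at_right 0) sequentially" and x: "xx \<longlonglongrightarrow> x0" and t: "tt \<longlonglongrightarrow> t0"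
  and t0: "0 < t0" "t0 < T" and B: "!!x t. 0 < t ==> t < T ==> \<bar>phi (x, t)\<bar> <= B"
  and c: "continuous_on (Q T) phi" "continuous_on (Q T) fxx"
  and C: "!!t. 0 < t ==> t < T ==> C2d (%y. phi (y, t)) (%y. fx (y, t)) (%y. fxx (y, t))"
 shows "(%n. lap_h (om (hh n)) (hh n) (%y. phi (y, tt n)) (xx n)) \<longlonglongrightarrow> fl s (sdiff (%y. phi (y, t0)) x0)"
proof -
 define L where "L = fl s qf"
 have L: "0 <= L" unfolding L_def by (rule fl_qf_nonneg[OF s01])
 have B0: "0 <= B" using B[OF t0, of 0] by linarith
 define a where "a n = lap_h (om (hh n)) (hh n) (%y. phi (y, tt n)) (xx n)" for n
 define b where "b n = lap_h (om (hh n)) (hh n) (%y. phi (y, t0)) x0" for n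
 have bb: "bounded (range (%y. phi (y, t0)))" by (rule bounded_rangeI[OF B[OF t0]])
 have b_lim: "b \<longlonglongrightarrow> fl s (sdiff (%y. phi (y, t0)) x0)" unfolding b_def
  by (rule filterlim_compose[OF consistency[OF C2_realI[OF C[OF t0]] bb] h])
 have evw: "\<forall>\<^sub>F n in sequentially. 0 < hh n & weights (om (hh n))" using h ev_weights unfolding filterlim_iff by blast
 have evt: "\<forall>\<^sub>F n in sequentially. 0 < tt n & tt n < T"
  using order_tendstoD(1)[OF t t0(1)] order_tendstoD(2)[OF t t0(2)] by eventually_elim simp
 have diff: "\<forall>\<^sub>F n in sequentially. \<bar>a n - b n\<bar> <= 8*e*qsum (om (hh n)) (hh n) 1+16*B*qsum (om (hh n)) (hh n) R"
  if e: "0 < e" and R: "1 <= R" for e R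
 proof -
  define ro where "ro = min t0 (T - t0)/2"
  have ro: "ro > 0" "ro < t0" "t0+ro < T" using t0 by (auto simp: ro_def min_def field_simps)
  define KK where "KK = {x0 - R - 1..x0 + R+1} \<times> {t0 - ro..t0+ro}"
  have KK: "compact KK" "KK \<subseteq> Q T" using ro by (auto simp: KK_def Q_def compact_Times)
  have "uniformly_continuous_on KK phi" "uniformly_continuous_on KK fxx"
  using KK c by (auto intro: compact_uniformly_continuous continuous_on_subset)
  then obtain d1 d2 where d: "d1 > 0" "d2 > 0"
  "!!p q. p \<in> KK ==> q \<in> KK ==> dist q p < d1 ==> dist (phi q) (phi p) < e"
  "!!p q. p \<in> KK ==> q \<in> KK ==> dist q p < d2 ==> dist (fxx q) (fxx p) < e"
  using e unfolding uniformly_continuous_on_def by metis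
  define d where "d = Min {d1, d2, ro, 1}"
  have dd: "0 < d" "d <= d1" "d <= d2" "d <= ro" "d <= 1" using d ro by (auto simp: d_def)
  have "(%n. (xx n, tt n)) \<longlonglongrightarrow> (x0, t0)" by (rule tendsto_Pair[OF x t])
  then have "\<forall>\<^sub>F n in sequentially. dist (xx n, tt n) (x0, t0) < d" using dd(1) by (rule tendstoD)
  with evw evt show ?thesis
  proof eventually_elim
  case (elim n)
  have xt: "\<bar>xx n - x0\<bar> < d" "\<bar>tt n - t0\<bar> < d"
  using elim(3) dist_fst_le[of "(xx n, tt n)" "(x0, t0)"] dist_snd_le[of "(xx n, tt n)" "(x0, t0)"] by (auto simp: dist_real_def)
  have sh: "(xx n+z, tt n) \<in> KK" "(x0+z, t0) \<in> KK" "dist (xx n+z, tt n) (x0+z, t0) < d"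
  if "\<bar>z\<bar> <= R" for z using xt that dd ro elim(3) by (auto simp: KK_def dist_Pair_Pair dist_real_def)
  have cl: "\<bar>phi (xx n+z, tt n) - phi (x0+z, t0)\<bar> <= e" "\<bar>fxx (xx n+z, tt n) - fxx (x0+z, t0)\<bar> <= e"
  if "\<bar>z\<bar> <= R" for z using d(3)[OF sh(2,1)[OF that]] d(4)[OF sh(2,1)[OF that]] sh(3)[OF that] dd
  by (auto simp: dist_real_def)
  define G where "G z = phi (xx n+z, tt n)+(-1)*phi (x0+z, t0)" for z
  have GC: "C2d G (%z. 1*fx (1*z+xx n, tt n)+(-1)*(1*fx (1*z+x0, t0)))
  (%z. 1\<^sup>2*fxx (1*z+xx n, tt n)+(-1)*(1\<^sup>2*fxx (1*z+x0, t0)))"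
  using C2d_add[OF C2d_affine[OF C[of "tt n"], of 1 "xx n"] C2d_cmult[OF C2d_affine[OF C[OF t0], of 1 x0], of "-1"]] elim(2)
  unfolding G_def by (simp add: add.commute)
  have sdG: "sdiff (%y. phi (y, tt n)) (xx n) y - sdiff (%y. phi (y, t0)) x0 y = sdiff G 0 y" for y
  unfolding sdiff_def G_def by (simp add: algebra_simps)
  have bnd: "\<bar>sdiff G 0 y\<bar> <= 8*e*qf y+16*B*qf (y/R)" for y
  proof -
  have qn: "0 <= e*qf y" "0 <= B*qf (y/R)" using e B0 qf_nonneg by auto
  consider "\<bar>y\<bar> <= 1" | "1 < \<bar>y\<bar>" "\<bar>y\<bar> <= R" | "R < \<bar>y\<bar>" by linarith
  then show ?thesis
  proof cases
  case 1
  have "\<bar>sdiff G 0 y\<bar> <= e*y\<^sup>2"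
  proof (rule sdiff_bound_C2[OF GC])
  fix z assume "z \<in> {0 - \<bar>y\<bar>..0+\<bar>y\<bar>}"
  then have "\<bar>z\<bar> <= R" using 1 R by auto
  from cl(2)[OF this] show "\<bar>1\<^sup>2*fxx (1*z+xx n, tt n)+-1*(1\<^sup>2*fxx (1*z+x0, t0))\<bar> <= e" by (simp add: add.commute)
  qed
  moreover have "y\<^sup>2 <= 1" using 1 by (simp add: abs_square_le_1)
  then have "e*y\<^sup>2 <= e*(2*qf y)" using min_le_qf[of y] e by (intro mult_left_mono) auto
  ultimately show ?thesis using qn by linarith
  next
  case 2
  have "\<bar>sdiff G 0 y\<bar> <= 4*e"
  using cl(1)[of 0] cl(1)[of y] cl(1)[of "- y"] 2 R unfolding sdiff_def G_def by (simp add: abs_le_iff)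
  moreover have "1 <= y\<^sup>2" using 2 abs_square_le_1[of y] by linarith
  then have "e*1 <= e*(2*qf y)" using min_le_qf[of y] e by (intro mult_left_mono) auto
  ultimately show ?thesis using qn by linarith
  next
  case 3
  have "\<bar>sdiff G 0 y\<bar> <= 8*B"
  proof -
  have "\<bar>G z\<bar> <= 2*B" for z using B[of "tt n" "xx n+z"] B[OF t0, of "x0+z"] elim(2) unfolding G_def by (simp add: abs_le_iff)
  from this[of 0] this[of y] this[of "- y"] show ?thesis unfolding sdiff_def by (simp add: abs_le_iff)
  qed
  moreover have "1 < \<bar>y/R\<bar>" using 3 R by (simp add: abs_mult)
  then have "1 <= (y/R)\<^sup>2" using abs_square_le_1[of "y/R"] by linarith
  then have "B*1 <= B*(2*qf (y/R))" using min_le_qf[of "y/R"] B0 by (intro mult_left_mono) auto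
  ultimately show ?thesis using qn by linarith
  qed
  qed
  show ?case unfolding a_def b_def by (rule lap_h_diff_bound[of _ _ B _ B]) (use elim(1,2) B t0 bnd sdG in auto)
  qed
 qed
 have "(%n. a n - b n) \<longlonglongrightarrow> 0"
 proof (rule tendstoI)
  fix eps :: real assume eps: "0 < eps"
  define e where "e = eps/(4*16*(L+1))"
  have e: "e > 0" using eps L by (simp add: e_def)
  have "((%R. 16*B*(2*(1/R) powr (2 * s)*L)) \<longlongrightarrow> 16*B*(2*0*L)) at_top"
  by (intro tendsto_intros tendsto_zero_powrI[where b = "2 * s"] tendsto_divide_0[OF tendsto_const] filterlim_at_top_imp_at_infinity filterlim_ident)
  (use s0 in \<open>auto intro: eventually_mono[OF eventually_gt_at_top[of 0]]\<close>)
  then have "\<forall>\<^sub>F R in at_top. 16*B*(2*(1/R) powr (2 * s)*L) < eps/4" by (rule order_tendstoD(2)) (use eps in simp)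
  with eventually_ge_at_top[of "1::real"]
  have "\<forall>\<^sub>F R in at_top. 1 <= R & 16*B*(2*(1/R) powr (2 * s)*L) < eps/4" by eventually_elim simp
  then obtain R where R: "1 <= R" "16*B*(2*(1/R) powr (2 * s)*L) < eps/4"
  using eventually_happens' by (metis (no_types, lifting) trivial_limit_at_top_linorder)
  have "((%h. 8*e*qsum (om h) h 1+16*B*qsum (om h) h R) \<longlongrightarrow>
  8*e*(2*(1/1) powr (2 * s)*L)+16*B*(2*(1/R) powr (2 * s)*L)) (at_right 0)"
  unfolding L_def by (intro tendsto_intros qsum_tendsto) (use R in auto)
  moreover have "8*e*(2*(1/1) powr (2 * s)*L)+16*B*(2*(1/R) powr (2 * s)*L) < eps"
  proof -
  have "8*e*(2*(1/1) powr (2 * s)*L) = 16*(e*L)" by simp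
  also have "... <= 16*(e*(L+1))" using e by simp
  also have "... = eps/4" using L by (simp add: e_def field_simps)
  finally show ?thesis using R(2) eps by linarith
  qed
  ultimately have "NEAR h. 8*e*qsum (om h) h 1+16*B*qsum (om h) h R < eps" by (rule order_tendstoD(2))
  then have "\<forall>\<^sub>F n in sequentially. 8*e*qsum (om (hh n)) (hh n) 1+16*B*qsum (om (hh n)) (hh n) R < eps"
  using h unfolding filterlim_iff by blast
  with diff[OF e R(1)] show "\<forall>\<^sub>F n in sequentially. dist (a n - b n) 0 < eps"
  by eventually_elim (simp add: dist_real_def)
 qed
 from tendsto_add[OF this b_lim] show ?thesis unfolding a_def by simp
qed

end

lemma C2_on_add:
 assumes "C2_on S f" "C2_on S g" shows "C2_on S (%p. f p+g p)"
proof (rule C2_onE[OF assms(1)], rule C2_onE[OF assms(2)])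
 fix fx ft fxx fxt ftx ftt gx gt gxx gxt gtx gtt
 assume f: "has_jet S f fx ft fxx fxt ftx ftt"
  and fc: "continuous_on S fxx" "continuous_on S fxt" "continuous_on S ftx" "continuous_on S ftt"
  and g: "has_jet S g gx gt gxx gxt gtx gtt"
  and gc: "continuous_on S gxx" "continuous_on S gxt" "continuous_on S gtx" "continuous_on S gtt"
 have a: "((%p. k p+l p) has_derivative (%(u, w). (a+a')*u+(b+b')*w)) (at p within S)"
  if "(k has_derivative (%(u, w). a*u+b*w)) (at p within S)"
  "(l has_derivative (%(u, w). a'*u+b'*w)) (at p within S)" for k l a b a' b' p
  using has_derivative_add[OF that] by (simp add: case_prod_unfold algebra_simps)
 show ?thesis unfolding C2_on_def by (rule exI[of _ "%p. fx p+gx p"], rule exI[of _ "%p. ft p+gt p"], rule exI[of _ "%p. fxx p+gxx p"],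
  rule exI[of _ "%p. fxt p+gxt p"], rule exI[of _ "%p. ftx p+gtx p"], rule exI[of _ "%p. ftt p+gtt p"])
  (intro conjI ballI a continuous_on_add fc gc
  f[THEN bspec, THEN conjunct1] f[THEN bspec, THEN conjunct2, THEN conjunct1] f[THEN bspec, THEN conjunct2, THEN conjunct2]
  g[THEN bspec, THEN conjunct1] g[THEN bspec, THEN conjunct2, THEN conjunct1] g[THEN bspec, THEN conjunct2, THEN conjunct2])
qed

lemma finite_attains_max:
 fixes f :: "'a => real"
 assumes "finite S" "S ~= {}" shows "\<exists>x\<in>S. \<forall>y\<in>S. f y <= f x"
proof -
 have "Max (f ` S) \<in> f ` S" using assms by (intro Max_in) auto
 then obtain x where "x \<in> S" "f x = Max (f ` S)" by (metis imageE)
 then show ?thesis using assms by (intro bexI[of _ x]) auto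
qed

lemma quotient_tendsto:
 fixes g :: "'b::topological_space => real => real"
 assumes h: "!!n. 0 < hh n" "hh \<longlonglongrightarrow> 0" and x: "xx \<longlonglongrightarrow> x0"
  and D: "\<forall>\<^sub>F n in sequentially. \<forall>z. xx n <= z & z <= xx n+hh n --> (f n has_real_derivative f' n z) (at z)"
  and lim: "!!zz. zz \<longlonglongrightarrow> x0 ==> (%n. f' n (zz n)) \<longlonglongrightarrow> L"
 shows "(%n. (f n (xx n+hh n) - f n (xx n))/hh n) \<longlonglongrightarrow> L"
proof -
 \<comment> \<open>Differentiability holds only eventually; for the remaining indices an arbitrary
   point of the interval is taken, so that one sequence \<open>zz\<close> exists for all
   \<open>n\<close>.\<close>
 have "\<forall>n. \<exists>z. xx n <= z & z <= xx n+hh n &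
  ((\<forall>z. xx n <= z & z <= xx n+hh n --> (f n has_real_derivative f' n z) (at z)) -->
  (f n (xx n+hh n) - f n (xx n))/hh n = f' n z)"
 proof
  fix n
  show "\<exists>z. xx n <= z & z <= xx n+hh n &
  ((\<forall>z. xx n <= z & z <= xx n+hh n --> (f n has_real_derivative f' n z) (at z)) -->
  (f n (xx n+hh n) - f n (xx n))/hh n = f' n z)"
  proof (cases "\<forall>z. xx n <= z & z <= xx n+hh n --> (f n has_real_derivative f' n z) (at z)")
  case True
  then obtain z where "xx n < z" "z < xx n+hh n" "f n (xx n+hh n) - f n (xx n) = (xx n+hh n - xx n)*f' n z"
  using MVT2[of "xx n" "xx n+hh n" "f n" "f' n"] h(1)[of n] by auto
  then show ?thesis using h(1)[of n] by (intro exI[of _ z]) auto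
  next
  case False then show ?thesis using h(1)[of n] by (intro exI[of _ "xx n"]) auto
  qed
 qed
 then obtain zz where zz: "!!n. xx n <= zz n" "!!n. zz n <= xx n+hh n"
  "!!n. (\<forall>z. xx n <= z & z <= xx n+hh n --> (f n has_real_derivative f' n z) (at z)) ==>
  (f n (xx n+hh n) - f n (xx n))/hh n = f' n (zz n)" by metis
 have "zz \<longlonglongrightarrow> x0"
 proof (rule tendsto_sandwich[of xx _ _ "%n. xx n+hh n"])
  show "(%n. xx n+hh n) \<longlonglongrightarrow> x0" using tendsto_add[OF x h(2)] by simp
 qed (use zz x in auto)
 from lim[OF this] show ?thesis by (rule Lim_transform_eventually) (use D zz(3) in \<open>auto elim!: eventually_mono\<close>)
qed

lemma ppow_tendsto:
 assumes "(f \<longlongrightarrow> a) F" "1 < m" shows "((%x. ppow m (f x)) \<longlongrightarrow> ppow m a) F" unfolding ppow_def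
 by (rule tendsto_powr'[OF tendsto_max[OF assms(1) tendsto_const] tendsto_const]) (use assms(2) in auto)

lemma interpolant_grid:
 assumes "0 < h" "0 < tau" shows "interpolant h tau V (of_int i*h, real j*tau) = V j i" using assms by (simp add: interpolant_eq)

lemma interpolant_node:
 assumes "0 < h" "c < interpolant h tau V (x, t)"
 shows "c < V (nat \<lfloor>t/tau\<rfloor>) \<lfloor>x/h\<rfloor> | c < V (nat \<lfloor>t/tau\<rfloor>) (\<lfloor>x/h\<rfloor>+1)"
proof (rule ccontr)
 define f where "f = frac (x/h)"
 define a where "a = V (nat \<lfloor>t/tau\<rfloor>) \<lfloor>x/h\<rfloor>"
 define b where "b = V (nat \<lfloor>t/tau\<rfloor>) (\<lfloor>x/h\<rfloor>+1)"
 assume "\<not> ?thesis"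
 then have "a <= c" "b <= c" by (auto simp: a_def b_def)
 moreover have f: "0 <= f" "0 <= 1 - f" unfolding f_def by (rule frac_conv)+
 ultimately have "(1 - f)*a+f*b <= (1 - f) * c+f * c" by (intro add_mono mult_left_mono) auto
 also have "... = c" by (simp add: algebra_simps)
 finally show False using assms(2) unfolding interpolant_eq[OF assms(1)] a_def b_def f_def by simp
qed

lemma lap_grid_qsum_le:
 assumes w: "weights w" and u: "!!i. \<bar>u i\<bar> <= B1" and v: "!!i. \<bar>v i\<bar> <= B2"
  and le: "!!k. u i - u (i+k) <= v i - v (i+k)+B*qf (of_int k*h/R)" shows "lap_grid w u i <= lap_grid w v i+B*qsum w h R"
proof -
 note su = lap_summable[OF w u] and sv = lap_summable[OF w v]
 have sq: "(%k. B*(qf (of_int k*h/R)*w k)) summable_on (UNIV - {0})" by (rule summable_on_cmult_right[OF qsum_summable[OF w]])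
 have "lap_grid w u i <= (\<Sum>\<^sub>\<infinity>k\<in>UNIV - {0}. (v i - v (i+k))*w k+B*(qf (of_int k*h/R)*w k))"
  unfolding lap_grid_def
 proof (rule infsum_mono[OF su summable_on_add[OF sv sq]])
  fix k :: int assume "k \<in> UNIV - {0}"
  then have "0 <= w k" using weightsD(2)[OF w] by simp
  then have "(u i - u (i+k))*w k <= (v i - v (i+k)+B*qf (of_int k*h/R))*w k" using le[of k] by (rule mult_right_mono[rotated])
  then show "(u i - u (i+k))*w k <= (v i - v (i+k))*w k+B*(qf (of_int k*h/R)*w k)" by (simp add: algebra_simps)
 qed
 also have "... = lap_grid w v i+B*qsum w h R"
  unfolding lap_grid_def qsum_def by (subst infsum_add[OF sv sq]) (simp add: infsum_cmult_right')
 finally show ?thesis .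
qed

text \<open>The properties of the scheme that make its limits subsolutions. With the sign \<open>sig = -1\<close> they
 hold for the negative of the scheme, so that supersolutions need no separate treatment.\<close>

definition grid_sub ::
  "real => real => (int => real) => real => real => real => real => (nat => int => real) => bool" where
 "grid_sub sig m w h tau Lam M V \<longleftrightarrow>
  (\<forall>j i. 0 <= sig*(V j (i+1) - V j i) & sig*(V j (i+1) - V j i) <= Lam*h & \<bar>V j i\<bar> <= M) &
  (\<forall>j i U B. (\<forall>k. \<bar>U k\<bar> <= B) & (\<forall>k. V j k <= U k) -->
  (\<exists>D\<in>{(U (i+1) - U i)/h, (U i - U (i - 1))/h}.
  V (Suc j) i <= U i - tau*ppow m (min (sig*D) Lam)*lap_grid w U i))"

text \<open>Negation reverses the rule that selects the side of the difference quotient. That is why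
  \<open>grid_sub\<close> only asserts that one of the two sides occurs; for a smooth comparison
  function both have the same limit.\<close>

lemma grid_sub_scheme:
 assumes m: "2 <= m" and c: "cfl m w h tau Lam M" and V: "V \<in> gclass Lam M h"
 shows "grid_sub 1 m w h tau Lam M (%j. (step m w h tau ^^ j) V)"
  and "grid_sub (-1) m w h tau Lam M (%j i. - (step m w h tau ^^ j) V i)"
proof -
 define W where "W = (%j. (step m w h tau ^^ j) V)"
 have W: "W j \<in> gclass Lam M h" for j unfolding W_def by (rule iter_gclass[OF m c V])
 have WS: "W (Suc j) i = step m w h tau (W j) i" for j i by (simp add: W_def)
 show "grid_sub 1 m w h tau Lam M (%j. (step m w h tau ^^ j) V)" unfolding W_def[symmetric] grid_sub_def
 proof (intro conjI allI impI)
  fix j i U B assume U: "(\<forall>k. \<bar>U k\<bar> <= B) & (\<forall>k. W j k <= U k)"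
  then have "W (Suc j) i <= U i - tau*ppow m (min (D_h w h U i) Lam)*lap_grid w U i" unfolding WS by (intro step_le[OF m c W]) auto
  moreover have "D_h w h U i \<in> {(U (i+1) - U i)/h, (U i - U (i - 1))/h}" by (simp add: D_h_def)
  ultimately show "\<exists>D\<in>{(U (i+1) - U i)/h, (U i - U (i - 1))/h}.
  W (Suc j) i <= U i - tau*ppow m (min (1*D) Lam)*lap_grid w U i" by (intro bexI[of _ "D_h w h U i"]) simp_all
 qed (use gclassD[OF W] in auto)
 show "grid_sub (-1) m w h tau Lam M (%j i. - (step m w h tau ^^ j) V i)" unfolding grid_sub_def
 proof (intro conjI allI impI)
  fix j i U B assume U: "(\<forall>k. \<bar>U k\<bar> <= B) & (\<forall>k. - (step m w h tau ^^ j) V k <= U k)"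
  define U' where "U' k = - U k" for k
  have WU: "- U' k = U k" for k by (simp add: U'_def)
  have "- W (Suc j) i <= - (U' i - tau*ppow m (min (D_h w h U' i) Lam)*lap_grid w U' i)" unfolding WS using U
  by (intro le_imp_neg_le step_ge[OF m c W]) (auto simp: U'_def W_def minus_le_iff)
  moreover have "lap_grid w U' i = - lap_grid w U i"
  proof -
  have "(%k. (U' i - U' (i+k))*w k) = (%k. - ((U i - U (i+k))*w k))" by (rule ext) (simp add: U'_def algebra_simps)
  then show ?thesis unfolding lap_grid_def by (simp only: infsum_uminus)
  qed
  ultimately have le: "- W (Suc j) i <= U i - tau*ppow m (min (D_h w h U' i) Lam)*lap_grid w U i" by (simp add: U'_def)
  have "D_h w h U' i = - ((U (i+1) - U i)/h) | D_h w h U' i = - ((U i - U (i - 1))/h)"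
  unfolding D_h_def U'_def by (auto simp: minus_divide_left)
  then show "\<exists>D\<in>{(U (i+1) - U i)/h, (U i - U (i - 1))/h}.
  - (step m w h tau ^^ Suc j) V i <= U i - tau*ppow m (min (- 1*D) Lam)*lap_grid w U i" using le by (auto simp: W_def)
 next
  fix j i
  show "0 <= - 1*(- (step m w h tau ^^ j) V (i+1) - - (step m w h tau ^^ j) V i)"
  "- 1*(- (step m w h tau ^^ j) V (i+1) - - (step m w h tau ^^ j) V i) <= Lam*h"
  "\<bar>- (step m w h tau ^^ j) V i\<bar> <= M" using gclassD[OF W, of j i] by (simp_all add: W_def)
 qed
qed

section \<open>Limits of the scheme are subsolutions\<close>

context discretization
begin

text \<open>Outside the small box, compactness and \<open>H1\<close> keep the discrete functions
  minus \<open>psi\<close> a fixed \<open>e0\<close> below the maximum \<open>m0\<close>;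
  \<open>H2\<close> supplies, for arbitrarily small \<open>h\<close>, a node inside the box above
  that level. The maximum over the finitely many nodes of the large box is thus attained in the
  small one.\<close>

lemma grid_maximum:
 assumes ev: "NEAR h. 0 < tau h" and tauz: "(tau \<longlongrightarrow> 0) (at_right 0)"
  and H1: "!!p c. p \<in> Q T ==> u p < c ==> \<exists>A. open A & p \<in> A &
  (NEAR h. \<forall>q\<in>A \<inter> Q T. interpolant h (tau h) (V h) q < c)"
  and H2: "!!p c A. p \<in> Q T ==> c < u p ==> open A ==> p \<in> A ==>
  \<exists>\<^sub>F h in at_right 0. \<exists>q\<in>A \<inter> Q T. c < interpolant h (tau h) (V h) q"
  and psi: "continuous_on (Q T) psi" and t0: "0 < t0" "t0 < T"
  and smax: "!!p. p \<in> Q T ==> p ~= (x0, t0) ==> u p - psi p < u (x0, t0) - psi (x0, t0)"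
  and R: "1 <= R" and ro: "0 < ro" "ro < t0" "t0+ro < T" and r: "0 < r" "r <= ro" "r <= 1"
 shows "\<exists>\<^sub>F h in at_right 0. \<exists>i j. \<bar>of_int i*h - x0\<bar> < r & \<bar>real (Suc j)*tau h - t0\<bar> < r &
  (\<forall>k l. \<bar>of_int k*h - x0\<bar> <= R & \<bar>real l*tau h - t0\<bar> <= ro -->
  V h l k - psi (of_int k*h, real l*tau h) <= V h (Suc j) i - psi (of_int i*h, real (Suc j)*tau h))"
proof -
 define Vb where "Vb h = interpolant h (tau h) (V h)" for h
 define m0 where "m0 = u (x0, t0) - psi (x0, t0)"
 define KK where "KK = {x0 - R..x0 + R} \<times> {t0 - ro..t0+ro}"
 define Ar where "Ar d = {x0 - d<..<x0+d} \<times> {t0 - d<..<t0+d}" for d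
 have Ar: "open (Ar d)" for d unfolding Ar_def by (intro open_Times) auto
 have KK: "compact (KK - Ar r)" "KK \<subseteq> Q T" using ro Ar by (auto simp: KK_def Q_def intro!: compact_diff compact_Times)
 have p0: "(x0, t0) \<in> Q T" using t0 by (simp add: Q_def)
 have loc: "\<exists>A e. open A & p \<in> A & 0 < e & (NEAR h. \<forall>q\<in>A \<inter> Q T. Vb h q - psi q < m0 - e)"
  if p: "p \<in> KK - Ar r" for p
 proof -
  have pQ: "p \<in> Q T" using p KK by auto
  have "p ~= (x0, t0)" using p r by (auto simp: Ar_def)
  from smax[OF pQ this] have lt: "u p - psi p < m0" by (simp add: m0_def)
  define e where "e = (m0 - (u p - psi p))/3"
  have e: "e > 0" using lt by (simp add: e_def)
  have "u p < u p+e" using e by simp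
  from H1[OF pQ this] obtain A where A: "open A" "p \<in> A"
  "NEAR h. \<forall>q\<in>A \<inter> Q T. Vb h q < u p+e" unfolding Vb_def by blast
  have "open {psi p - e<..}" "psi p \<in> {psi p - e<..}" using e by auto
  with psi pQ obtain A' where A': "open A'" "p \<in> A'" "\<forall>q\<in>Q T. q \<in> A' --> psi q \<in> {psi p - e<..}"
  unfolding continuous_on_topological by blast
  have eq: "u p+e - (psi p - e) = m0 - e" unfolding e_def by (simp add: field_simps)
  have "NEAR h. \<forall>q\<in>(A \<inter> A') \<inter> Q T. Vb h q - psi q < m0 - e" using A(3)
  proof eventually_elim
  case (elim h)
  show ?case
  proof
  fix q assume q: "q \<in> (A \<inter> A') \<inter> Q T"
  then have "Vb h q < u p+e" "psi p - e < psi q" using elim A'(3) by auto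
  then show "Vb h q - psi q < m0 - e" using eq by linarith
  qed
  qed
  then show ?thesis using A A' e by (intro exI[of _ "A \<inter> A'"] exI[of _ e]) auto
 qed
 then have "\<forall>p\<in>KK - Ar r. \<exists>A e. open A & p \<in> A & 0 < e &
  (NEAR h. \<forall>q\<in>A \<inter> Q T. Vb h q - psi q < m0 - e)" by blast
 from bchoice[OF this] obtain A where "\<forall>p\<in>KK - Ar r. \<exists>e. open (A p) & p \<in> A p & 0 < e &
  (NEAR h. \<forall>q\<in>A p \<inter> Q T. Vb h q - psi q < m0 - e)" by blast
 from bchoice[OF this] obtain e where Ae: "\<forall>p\<in>KK - Ar r. open (A p) & p \<in> A p & 0 < e p &
  (NEAR h. \<forall>q\<in>A p \<inter> Q T. Vb h q - psi q < m0 - e p)" by blast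
 obtain C where C: "C \<subseteq> KK - Ar r" "finite C" "KK - Ar r \<subseteq> (\<Union>p\<in>C. A p)"
 proof (rule compactE_image[OF KK(1), of "KK - Ar r" A])
  show "open (A p)" if "p \<in> KK - Ar r" for p using Ae that by blast
  show "KK - Ar r \<subseteq> (\<Union>p\<in>KK - Ar r. A p)" using Ae by blast
 qed (rule that)
 \<comment> \<open>The inserted 1 covers the case that the finite subcover is empty.\<close>
 define e0 where "e0 = Min (insert 1 (e ` C))"
 have e0: "0 < e0" "!!p. p \<in> C ==> e0 <= e p" using C(1,2) Ae unfolding e0_def by (auto simp: subset_iff)
 have "NEAR h. \<forall>p\<in>C. \<forall>q\<in>A p \<inter> Q T. Vb h q - psi q < m0 - e p"
  using C(1,2) Ae by (intro eventually_ball_finite) blast+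
 then have far: "NEAR h. \<forall>q\<in>KK - Ar r. Vb h q - psi q < m0 - e0"
 proof eventually_elim
  case (elim h)
  show ?case
  proof
  fix q assume q: "q \<in> KK - Ar r"
  then obtain p where p: "p \<in> C" "q \<in> A p" using C(3) by blast
  have "Vb h q - psi q < m0 - e p" using elim p q KK(2) by blast
  then show "Vb h q - psi q < m0 - e0" using e0(2)[OF p(1)] by linarith
  qed
 qed
 have "open {..<psi (x0, t0)+e0/4}" "psi (x0, t0) \<in> {..<psi (x0, t0)+e0/4}" using e0 by auto
 with psi p0 obtain A' where A': "open A'" "(x0, t0) \<in> A'" "\<forall>q\<in>Q T. q \<in> A' --> psi q \<in> {..<psi (x0, t0)+e0/4}"
  unfolding continuous_on_topological by blast
 from A'(1,2) obtain d where d: "0 < d" "ball (x0, t0) d \<subseteq> A'" using openE by blast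
 define dl where "dl = min r d/4"
 have dl: "0 < dl" "2*dl < r" "4*dl <= d" using d r by (auto simp: dl_def min_def)
 have near: "psi q < psi (x0, t0)+e0/4" if "q \<in> Ar (2*dl)" for q
 proof -
  obtain x t where q: "q = (x, t)" by (cases q)
  have xt: "\<bar>x - x0\<bar> < 2*dl" "\<bar>t - t0\<bar> < 2*dl" using that q by (auto simp: Ar_def)
  have "dist (x0, t0) q <= dist x0 x+dist t0 t"
  unfolding q dist_Pair_Pair using sqrt_sum_squares_le_sum[of "dist x0 x" "dist t0 t"] by simp
  also have "... < d" using xt dl by (simp add: dist_real_def)
  finally have "q \<in> A'" using d(2) by auto
  moreover have "q \<in> Q T" using xt dl ro r q by (auto simp: Q_def abs_less_iff)
  ultimately show ?thesis using A'(3) by auto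
 qed
 have "u (x0, t0) - e0/4 < u (x0, t0)" "(x0, t0) \<in> Ar dl" using e0 dl by (auto simp: Ar_def)
 from H2[OF p0 this(1) Ar this(2)]
 have fr: "\<exists>\<^sub>F h in at_right 0. \<exists>q\<in>Ar dl \<inter> Q T. u (x0, t0) - e0/4 < Vb h q" unfolding Vb_def .
 have "NEAR h. 0 < h & h < dl & 0 < tau h & tau h < dl"
  using eventually_at_right_less[of "0::real"] order_tendstoD(2)[OF tendsto_ident_at dl(1)]
  ev order_tendstoD(2)[OF tauz dl(1)] by eventually_elim simp
 from frequently_eventually_frequently[OF fr eventually_conj[OF this far]]
 show ?thesis
 proof (rule frequently_elim1)
  fix h
  assume "(\<exists>q\<in>Ar dl \<inter> Q T. u (x0, t0) - e0/4 < Vb h q) &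
  ((0 < h & h < dl & 0 < tau h & tau h < dl) & (\<forall>q\<in>KK - Ar r. Vb h q - psi q < m0 - e0))"
  then obtain x t where q: "(x, t) \<in> Ar dl" "(x, t) \<in> Q T" "u (x0, t0) - e0/4 < Vb h (x, t)"
  and h: "0 < h" "h < dl" "0 < tau h" "tau h < dl" and farh: "\<forall>q\<in>KK - Ar r. Vb h q - psi q < m0 - e0" by auto
  define Gd where "Gd = {(k, l). \<bar>of_int k*h - x0\<bar> <= R & \<bar>real l*tau h - t0\<bar> <= ro}"
  define f where "f = (%(k, l). V h l k - psi (of_int k*h, real l*tau h))"
  have "finite Gd"
  proof (rule finite_subset)
  show "Gd \<subseteq> {\<lfloor>(x0 - R)/h\<rfloor>..\<lceil>(x0 + R)/h\<rceil>} \<times> {..nat \<lceil>(t0+ro)/tau h\<rceil>}"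
  proof
  fix p assume "p \<in> Gd"
  then obtain k l where p: "p = (k, l)" "\<bar>of_int k*h - x0\<bar> <= R" "\<bar>real l*tau h - t0\<bar> <= ro" by (auto simp: Gd_def)
  have "(x0 - R)/h <= of_int k" "of_int k <= (x0 + R)/h" "real l <= (t0+ro)/tau h"
  using p h by (auto simp: divide_le_eq le_divide_eq abs_le_iff)
  then have "\<lfloor>(x0 - R)/h\<rfloor> <= k" "k <= \<lceil>(x0 + R)/h\<rceil>" "int l <= \<lceil>(t0+ro)/tau h\<rceil>" by linarith+
  then show "p \<in> {\<lfloor>(x0 - R)/h\<rfloor>..\<lceil>(x0 + R)/h\<rceil>} \<times> {..nat \<lceil>(t0+ro)/tau h\<rceil>}"
  using p(1) by auto
  qed
  qed auto
  have node: "\<exists>k l. (of_int k*h, real l*tau h) \<in> Ar (2*dl) & u (x0, t0) - e0/4 < V h l k"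
  proof -
  define a where "a = \<lfloor>x/h\<rfloor>"
  define l where "l = nat \<lfloor>t/tau h\<rfloor>"
  have tp: "0 < t" using q(2) by (simp add: Q_def)
  have a: "of_int a*h <= x" "x < of_int a*h+h"
  proof -
  have "of_int a <= x/h" "x/h < of_int a+1" unfolding a_def by linarith+
  then show "of_int a*h <= x" "x < of_int a*h+h" using h by (auto simp: le_divide_eq divide_less_eq algebra_simps)
  qed
  have l: "real l*tau h <= t" "t < real l*tau h+tau h"
  proof -
  have "real l = of_int \<lfloor>t/tau h\<rfloor>" using tp h by (simp add: l_def)
  then have "real l <= t/tau h" "t/tau h < real l+1" by linarith+
  then show "real l*tau h <= t" "t < real l*tau h+tau h" using h by (auto simp: le_divide_eq divide_less_eq algebra_simps)
  qed
  have "(of_int a*h, real l*tau h) \<in> Ar (2*dl)" "(of_int (a+1)*h, real l*tau h) \<in> Ar (2*dl)"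
  using a l q(1) h by (auto simp: Ar_def algebra_simps)
  moreover have "u (x0, t0) - e0/4 < V h l a | u (x0, t0) - e0/4 < V h l (a+1)"
  using interpolant_node[OF h(1)] q(3) unfolding Vb_def a_def l_def by blast
  ultimately show ?thesis by blast
  qed
  then obtain k l where kl: "(of_int k*h, real l*tau h) \<in> Ar (2*dl)" "u (x0, t0) - e0/4 < V h l k" by blast
  have klG: "(k, l) \<in> Gd" using kl(1) dl r R by (auto simp: Gd_def Ar_def abs_le_iff)
  have fkl: "m0 - e0 < f (k, l)" using near[OF kl(1)] kl(2) e0(1) unfolding f_def m0_def by simp
  obtain p where p: "p \<in> Gd" "!!q. q \<in> Gd ==> f q <= f p"
  using finite_attains_max[OF \<open>finite Gd\<close>, of f] klG by blast
  obtain i l' where il: "p = (i, l')" by (cases p)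
  have iK: "(of_int i*h, real l'*tau h) \<in> KK" using p(1) il by (auto simp: Gd_def KK_def abs_le_iff)
  have iA: "(of_int i*h, real l'*tau h) \<in> Ar r"
  proof (rule ccontr)
  assume "\<not> ?thesis"
  then have "Vb h (of_int i*h, real l'*tau h) - psi (of_int i*h, real l'*tau h) < m0 - e0" using farh iK by blast
  then have "f p < m0 - e0" unfolding Vb_def interpolant_grid[OF h(1,3)] f_def il by simp
  then show False using fkl p(2)[OF klG] by linarith
  qed
  \<comment> \<open>The scheme will be applied from the preceding time level, so the maximum must
    not lie on the initial one; its time is within \<open>r <= ro < t0\<close> of
    \<open>t0\<close>.\<close>
  have "l' ~= 0"
  proof
  assume "l' = 0"
  then show False using iA r ro by (auto simp: Ar_def)
  qed
  then obtain j where j: "l' = Suc j" using not0_implies_Suc by blast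
  show "\<exists>i j. \<bar>of_int i*h - x0\<bar> < r & \<bar>real (Suc j)*tau h - t0\<bar> < r &
  (\<forall>k l. \<bar>of_int k*h - x0\<bar> <= R & \<bar>real l*tau h - t0\<bar> <= ro -->
  V h l k - psi (of_int k*h, real l*tau h) <= V h (Suc j) i - psi (of_int i*h, real (Suc j)*tau h))"
  proof (intro exI[of _ i] exI[of _ j] conjI allI impI)
  show "\<bar>of_int i*h - x0\<bar> < r" "\<bar>real (Suc j)*tau h - t0\<bar> < r"
  using iA unfolding j by (auto simp: Ar_def abs_less_iff)
  fix k l assume "\<bar>of_int k*h - x0\<bar> <= R & \<bar>real l*tau h - t0\<bar> <= ro"
  then have "(k, l) \<in> Gd" by (simp add: Gd_def)
  from p(2)[OF this] show "V h l k - psi (of_int k*h, real l*tau h) <= V h (Suc j) i - psi (of_int i*h, real (Suc j)*tau h)"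
  unfolding f_def il j by simp
  qed
 qed
qed

end

context discretization
begin

text \<open>At a grid maximum at level \<open>Suc j\<close> the test function, shifted to touch
  there, lies above the grid function at level \<open>j\<close>; so \<open>grid_sub\<close> yields
  the inequality of the scheme for the test function, and consistency passes to the limit. Far from
  the maximum there is no touching: the bound \<open>M\<close> is used there, at a cost measured by
  \<open>qsum\<close> at scale \<open>R\<close>.\<close>

theorem half_relaxed_sub:
 assumes sig: "sig = 1 | sig = -1" and T: "0 < T"
  and ev: "NEAR h. 0 < tau h & 0 <= Lam h & grid_sub sig m (om h) h (tau h) (Lam h) M (V h)"
  and tauz: "(tau \<longlongrightarrow> 0) (at_right 0)" and H1: "!!p c. p \<in> Q T ==> u p < c ==> \<exists>A. open A & p \<in> A &
  (NEAR h. \<forall>q\<in>A \<inter> Q T. interpolant h (tau h) (V h) q < c)"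
  and H2: "!!p c A. p \<in> Q T ==> c < u p ==> open A ==> p \<in> A ==>
  \<exists>\<^sub>F h in at_right 0. \<exists>q\<in>A \<inter> Q T. c < interpolant h (tau h) (V h) q" shows "int_sub m s T u"
 unfolding int_sub_def
proof (intro allI impI, elim conjE)
 fix phi x0 t0
 assume phi: "C2_on (Q T) phi" "Cb_on (Q T) phi" "max_point (Q T) (%p. u p - phi p) (x0, t0)"
 have t0: "0 < t0" "t0 < T" using phi(3) by (auto simp: max_point_def Q_def)
 obtain B where B: "!!p. p \<in> Q T ==> \<bar>phi p\<bar> <= B" using phi(2) unfolding Cb_on_def bounded_iff by auto
 define L where "L = fl s qf"
 have L: "0 <= L" unfolding L_def by (rule fl_qf_nonneg[OF s01])
 define M' where "M' = \<bar>M\<bar>"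

 have key: "eq_op m s T phi x0 t0 - \<bar>dx phi x0 t0\<bar> powr (m - 1)*(2 * kap*L) <=
  \<bar>dx phi x0 t0\<bar> powr (m - 1)*(2*(2*(B+kap+T\<^sup>2)+2*M')*(2*(1/R) powr (2 * s)*L))"
  if kap: "0 < kap" and R: "1 <= R" for kap R
 proof -
  define C where "C = B+kap+T\<^sup>2"
  \<comment> \<open>The added terms make the maximum strict. They are flat to first order at
    \<open>(x0, t0)\<close>, so slope and time derivative are unchanged, and the nonlocal term drops
    only by \<open>2 * kap * L\<close>.\<close>
  define psi where "psi = (%p. phi p+((kap*qf (1*fst p+- x0))+(t0\<^sup>2+(- 2*t0) * snd p+1*(snd p)\<^sup>2)))"
  have psi_eq: "psi (x, t) = phi (x, t)+kap*qf (x - x0)+(t - t0)\<^sup>2" for x t by (simp add: psi_def power2_eq_square algebra_simps)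
  obtain q2 where q2: "C2d qf (%z. 2*z/(1+z\<^sup>2)\<^sup>2) q2" using C2d_qf by blast
  note CX = C2d_cmult[OF C2d_affine[OF q2, of 1 "- x0"], of kap]
  have psiC: "C2_on (Q T) psi" unfolding psi_def by (rule C2_on_add[OF phi(1) C2_on_split[OF CX C2d_poly2]])
  show ?thesis
  proof (rule C2_on_Q[OF phi(1)], rule C2_on_Q[OF psiC])
  fix fx ft fxx gx gt gxx
  assume f: "!!x t. 0 < t ==> t < T ==> C2d (%y. phi (y, t)) (%y. fx (y, t)) (%y. fxx (y, t))"
  "!!x t. 0 < t ==> t < T ==> ((%r. phi (x, r)) has_real_derivative ft (x, t)) (at t)"
  and g: "!!x t. 0 < t ==> t < T ==> C2d (%y. psi (y, t)) (%y. gx (y, t)) (%y. gxx (y, t))"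
  "!!x t. 0 < t ==> t < T ==> ((%r. psi (x, r)) has_real_derivative gt (x, t)) (at t)"
  and gc: "continuous_on (Q T) psi" "continuous_on (Q T) gx" "continuous_on (Q T) gt" "continuous_on (Q T) gxx"
  have psiB: "\<bar>psi (x, t)\<bar> <= C" if "0 < t" "t < T" for x t
  proof -
  have "0 <= kap*qf (x - x0)" "kap*qf (x - x0) <= kap*1" using kap qf_nonneg qf_less1[of "x - x0"] by (auto intro!: mult_left_mono)
  moreover have "\<bar>t - t0\<bar> <= \<bar>T\<bar>" using that t0 by linarith
  then have "(t - t0)\<^sup>2 <= T\<^sup>2" by (simp add: abs_le_square_iff)
  moreover have "\<bar>phi (x, t)\<bar> <= B" using that by (intro B) (simp add: Q_def)
  moreover have "0 <= (t - t0)\<^sup>2" by simp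
  ultimately show ?thesis unfolding psi_eq C_def by linarith
  qed
  have inQ: "(x, t) \<in> Q T" if "0 < t" "t < T" for x t using that by (simp add: Q_def)
  have gx0: "gx (x0, t0) = fx (x0, t0)"
  proof -
  have 1: "((%y. phi (y, t0)) has_real_derivative fx (x0, t0)) (at x0)" using f(1)[OF t0] unfolding C2d_def by blast
  have 2: "((%y. kap*qf (1*y+- x0)) has_real_derivative kap*(1*(2*(1*x0+- x0)/(1+(1*x0+- x0)\<^sup>2)\<^sup>2))) (at x0)"
  using CX unfolding C2d_def by blast
  have "((%y. (phi (y, t0)+kap*qf (1*y+- x0))+(t0 - t0)\<^sup>2) has_real_derivative (fx (x0, t0)+kap*(1*(2*(1*x0+- x0)/(1+(1*x0+- x0)\<^sup>2)\<^sup>2)))+0) (at x0)"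
  by (rule DERIV_add[OF DERIV_add[OF 1 2] DERIV_const])
  moreover have "(%y. (phi (y, t0)+kap*qf (1*y+- x0))+(t0 - t0)\<^sup>2) = (%y. psi (y, t0))" by (rule ext) (simp add: psi_eq)
  ultimately have "((%y. psi (y, t0)) has_real_derivative fx (x0, t0)) (at x0)" by simp
  moreover have "((%y. psi (y, t0)) has_real_derivative gx (x0, t0)) (at x0)" using g(1)[OF t0] unfolding C2d_def by blast
  ultimately show ?thesis by (rule DERIV_unique[rotated])
  qed
  have gt0: "gt (x0, t0) = ft (x0, t0)"
  proof -
  have 2: "((%r. (r - t0)\<^sup>2) has_real_derivative 2*(t0 - t0)) (at t0)" by (auto intro!: derivative_eq_intros)
  have "((%r. phi (x0, r)+(r - t0)\<^sup>2) has_real_derivative ft (x0, t0)+2*(t0 - t0)) (at t0)" by (rule DERIV_add[OF f(2)[OF t0] 2])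
  moreover have "(%r. phi (x0, r)+(r - t0)\<^sup>2) = (%r. psi (x0, r))" by (rule ext) (simp add: psi_eq)
  ultimately have "((%r. psi (x0, r)) has_real_derivative ft (x0, t0)) (at t0)" by simp
  from DERIV_unique[OF g(2)[OF t0] this] show ?thesis .
  qed
  define p where "p = fx (x0, t0)"
  have dxp: "dx phi x0 t0 = p" unfolding dx_def p_def by (rule DERIV_imp_deriv) (use f(1)[OF t0] in \<open>auto simp: C2d_def\<close>)
  have bphi: "bounded (range (%y. phi (y, t0)))" by (rule bounded_rangeI) (rule B[OF inQ[OF t0]])
  have bpsi: "bounded (range (%y. psi (y, t0)))" by (rule bounded_rangeI) (rule psiB[OF t0])
  have flpsi: "fl s (sdiff (%y. psi (y, t0)) x0) = fl s (sdiff (%y. phi (y, t0)) x0) - 2 * kap*L"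
  proof -
  have e: "sdiff (%y. psi (y, t0)) x0 = (%y. sdiff (%y. phi (y, t0)) x0 y - (2 * kap)*qf y)" by (rule ext) (simp add: sdiff_def psi_eq)
  show ?thesis unfolding e L_def by (subst fl_diff[OF kint_sdiff[OF s01 C2_realI[OF f(1)[OF t0]] bphi] kint_cmult[OF kint_qf[OF s01]]])
  (simp add: fl_cmult)
  qed
  have eqop: "eq_op m s T phi x0 t0 = ft (x0, t0)+\<bar>p\<bar> powr (m - 1)*fl s (sdiff (%y. phi (y, t0)) x0)"
  unfolding p_def by (rule eq_op_C2[OF s01 t0 f(1)[OF t0] bphi f(2)[OF t0]])

  define ro where "ro = min t0 (T - t0)/2"
  have ro: "0 < ro" "ro < t0" "t0+ro < T" using t0 by (auto simp: ro_def min_def field_simps)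
  have smax: "u p - psi p < u (x0, t0) - psi (x0, t0)" if p: "p \<in> Q T" "p ~= (x0, t0)" for p
  proof -
  obtain x t where xt: "p = (x, t)" by (cases p)
  have "u p - phi p <= u (x0, t0) - phi (x0, t0)" using phi(3) p(1) unfolding max_point_def by blast
  moreover have "0 < kap*qf (x - x0)+(t - t0)\<^sup>2"
  proof (cases "x = x0")
  case True then show ?thesis using p(2) xt by simp
  next
  case False
  then have "0 < qf (x - x0)" using one_plus_sq_pos[of "x - x0"] by (simp add: qf_def)
  then show ?thesis using kap by (simp add: add_pos_nonneg)
  qed
  ultimately show ?thesis unfolding xt psi_eq by simp
  qed
  have evtau: "NEAR h. 0 < tau h" using ev by eventually_elim simp
  \<comment> \<open>Radius \<open>R + 1\<close> and not \<open>R\<close>: the maximum node is off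
    \<open>x0\<close> by at most 1/2, and increments up to \<open>R\<close> from it, as well as its
    two neighbours, must stay inside.\<close>
  define good where "good h i j r \<longleftrightarrow> \<bar>of_int i*h - x0\<bar> < r & \<bar>real (Suc j)*tau h - t0\<bar> < r &
  (\<forall>k l. \<bar>of_int k*h - x0\<bar> <= R+1 & \<bar>real l*tau h - t0\<bar> <= ro -->
  V h l k - psi (of_int k*h, real l*tau h) <= V h (Suc j) i - psi (of_int i*h, real (Suc j)*tau h))" for h i j r
  define rr where "rr n = min ro 1/(real n+2)" for n
  have rr: "0 < rr n" "rr n <= ro/2" "rr n <= 1/2" for n
  proof -
  show "0 < rr n" using ro by (simp add: rr_def)
  have "rr n <= min ro 1/2" unfolding rr_def using ro by (intro divide_left_mono) auto
  then show "rr n <= ro/2" "rr n <= 1/2" by auto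
  qed
  have rr0: "rr \<longlonglongrightarrow> 0"
  proof -
  have "(%n. min ro 1/real (n+2)) \<longlonglongrightarrow> 0" by (rule LIMSEQ_ignore_initial_segment[OF lim_const_over_n])
  then show ?thesis by (simp add: rr_def[abs_def] add.commute)
  qed
  have "\<exists>h i j. good h i j (rr n) & 0 < h & h < rr n & tau h < ro/2 & 0 < tau h & 0 <= Lam h &
  weights (om h) & grid_sub sig m (om h) h (tau h) (Lam h) M (V h)" for n
  proof -
  have "\<exists>\<^sub>F h in at_right 0. \<exists>i j. good h i j (rr n)" unfolding good_def
  by (rule grid_maximum[OF evtau tauz H1 H2 gc(1) t0 smax _ ro rr(1)])
  (use R rr[of n] ro in auto)
  moreover have "0 < ro/2" using ro by simp
  have "NEAR h. (0 < h & weights (om h)) & h < rr n & tau h < ro/2 &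
  (0 < tau h & 0 <= Lam h & grid_sub sig m (om h) h (tau h) (Lam h) M (V h))"
  by (intro eventually_conj ev_weights ev order_tendstoD(2)[OF tauz \<open>0 < ro/2\<close>]
  order_tendstoD(2)[OF tendsto_ident_at rr(1)])
  ultimately have "\<exists>\<^sub>F h in at_right 0. (\<exists>i j. good h i j (rr n)) & (0 < h & weights (om h)) & h < rr n & tau h < ro/2 &
  (0 < tau h & 0 <= Lam h & grid_sub sig m (om h) h (tau h) (Lam h) M (V h))" by (rule frequently_eventually_frequently)
  from frequently_ex[OF this] show ?thesis by blast
  qed
  then obtain hh ii jj where S: "!!n. good (hh n) (ii n) (jj n) (rr n)" "!!n. 0 < hh n" "!!n. hh n < rr n"
  "!!n. tau (hh n) < ro/2" "!!n. 0 < tau (hh n)" "!!n. 0 <= Lam (hh n)" "!!n. weights (om (hh n))"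
  "!!n. grid_sub sig m (om (hh n)) (hh n) (tau (hh n)) (Lam (hh n)) M (V (hh n))" by metis
  define xx where "xx n = of_int (ii n)*hh n" for n
  define t' where "t' n = real (Suc (jj n))*tau (hh n)" for n
  define t where "t n = real (jj n)*tau (hh n)" for n
  have tt': "t' n = t n+tau (hh n)" for n by (simp add: t_def t'_def algebra_simps)
  have h0: "hh \<longlonglongrightarrow> 0" by (rule tendsto_sandwich[of "%n. 0" _ _ rr])
  (use S(2,3) rr0 in \<open>simp_all add: less_imp_le\<close>)
  have hF: "filterlim hh (at_right 0) sequentially"
  unfolding filterlim_at using h0 S(2) by (simp add: less_imp_le less_imp_neq[THEN not_sym])
  have tau0: "(%n. tau (hh n)) \<longlonglongrightarrow> 0" by (rule filterlim_compose[OF tauz hF])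
  have xr: "\<bar>xx n - x0\<bar> < rr n" and t'r: "\<bar>t' n - t0\<bar> < rr n" for n
  using S(1)[of n] unfolding good_def xx_def t'_def by auto
  have gm: "V (hh n) l k - psi (of_int k*hh n, real l*tau (hh n)) <= V (hh n) (Suc (jj n)) (ii n) - psi (xx n, t' n)"
  if "\<bar>of_int k*hh n - x0\<bar> <= R+1" "\<bar>real l*tau (hh n) - t0\<bar> <= ro" for n k l
  using S(1)[of n] that unfolding good_def xx_def t'_def by blast
  have xlim: "xx \<longlonglongrightarrow> x0"
  proof -
  have "(%n. xx n - x0) \<longlonglongrightarrow> 0"
  by (rule Lim_null_comparison[OF _ rr0]) (use xr in \<open>auto intro!: always_eventually less_imp_le\<close>)
  then show ?thesis by (simp add: LIM_zero_iff)
  qed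
  have t'lim: "t' \<longlonglongrightarrow> t0"
  proof -
  have "(%n. t' n - t0) \<longlonglongrightarrow> 0"
  by (rule Lim_null_comparison[OF _ rr0]) (use t'r in \<open>auto intro!: always_eventually less_imp_le\<close>)
  then show ?thesis by (simp add: LIM_zero_iff)
  qed
  have tlim: "t \<longlonglongrightarrow> t0" using tendsto_diff[OF t'lim tau0] unfolding tt' by simp
  have tr: "\<bar>t n - t0\<bar> < ro" "\<bar>t' n - t0\<bar> < ro" for n
  using t'r[of n] rr(2)[of n] S(4,5)[of n] tt'[of n] by linarith+
  have tin: "0 < t n" "t n < T" "0 < t' n" "t' n < T" for n using tr[of n] ro by linarith+

  have cont_lim: "(%n. k (a n, b n)) \<longlonglongrightarrow> k (x0, t0)"
  if k: "continuous_on (Q T) k" and ab: "a \<longlonglongrightarrow> x0" "b \<longlonglongrightarrow> t0" for k :: "real \<times> real => real" and a b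
  proof -
  have "isCont k (x0, t0)" using k inQ[OF t0] open_Q by (simp add: continuous_on_eq_continuous_at)
  from isCont_tendsto_compose[OF this tendsto_Pair[OF ab]] show ?thesis .
  qed
  have dq: "(%n. (psi (a n+hh n, b n) - psi (a n, b n))/hh n) \<longlonglongrightarrow> p"
  if a: "a \<longlonglongrightarrow> x0" and b: "b \<longlonglongrightarrow> t0" "!!n. 0 < b n" "!!n. b n < T" for a b
  proof (rule quotient_tendsto[where f' = "%n z. gx (z, b n)" and f = "%n z. psi (z, b n)", OF S(2) h0 a])
  show "\<forall>\<^sub>F n in sequentially. \<forall>z. a n <= z & z <= a n+hh n --> ((%z. psi (z, b n)) has_real_derivative gx (z, b n)) (at z)"
  using g(1)[OF b(2,3)] unfolding C2d_def by (intro always_eventually) blast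
  show "(%n. gx (zz n, b n)) \<longlonglongrightarrow> p" if "zz \<longlonglongrightarrow> x0" for zz
  unfolding p_def gx0[symmetric] by (rule cont_lim[OF gc(2) that b(1)])
  qed
  have xm: "(%n. xx n - hh n) \<longlonglongrightarrow> x0" using tendsto_diff[OF xlim h0] by simp
  define qp where "qp n = (psi (xx n+hh n, t n) - psi (xx n, t n))/hh n" for n
  define qm where "qm n = (psi (xx n, t n) - psi (xx n - hh n, t n))/hh n" for n
  define dp where "dp n = (psi (xx n+hh n, t' n) - psi (xx n, t' n))/hh n" for n
  define dm where "dm n = (psi (xx n, t' n) - psi (xx n - hh n, t' n))/hh n" for n
  have qlims: "qp \<longlonglongrightarrow> p" "qm \<longlonglongrightarrow> p" "dp \<longlonglongrightarrow> p" "dm \<longlonglongrightarrow> p"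
  using dq[OF xlim tlim tin(1,2)] dq[OF xm tlim tin(1,2)] dq[OF xlim t'lim tin(3,4)] dq[OF xm t'lim tin(3,4)]
  unfolding qp_def[abs_def] qm_def[abs_def] dp_def[abs_def] dm_def[abs_def] by simp_all
  define dtn where "dtn n = (psi (xx n, t n+tau (hh n)) - psi (xx n, t n))/tau (hh n)" for n
  have dtlim: "dtn \<longlonglongrightarrow> ft (x0, t0)" unfolding dtn_def[abs_def]
  proof (rule quotient_tendsto[where f' = "%n z. gt (xx n, z)" and f = "%n z. psi (xx n, z)", OF S(5) tau0 tlim])
  show "\<forall>\<^sub>F n in sequentially. \<forall>z. t n <= z & z <= t n+tau (hh n) --> ((%z. psi (xx n, z)) has_real_derivative gt (xx n, z)) (at z)"
  proof (intro always_eventually allI impI)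
  fix n z assume "t n <= z & z <= t n+tau (hh n)"
  then have "0 < z" "z < T" using tin[of n] tt'[of n] by auto
  then show "((%z. psi (xx n, z)) has_real_derivative gt (xx n, z)) (at z)" by (rule g(2))
  qed
  show "(%n. gt (xx n, zz n)) \<longlonglongrightarrow> ft (x0, t0)" if "zz \<longlonglongrightarrow> t0" for zz
  unfolding gt0[symmetric] by (rule cont_lim[OF gc(3) xlim that])
  qed
  have x1: "\<bar>xx n - x0\<bar> <= 1/2" "hh n < 1/2" for n using xr[of n] rr(3)[of n] S(3)[of n] by linarith+
  have nb: "of_int (ii n+1)*hh n = xx n+hh n" "of_int (ii n - 1)*hh n = xx n - hh n" for n by (simp_all add: xx_def algebra_simps)
  have nbR: "\<bar>of_int (ii n+1)*hh n - x0\<bar> <= R+1" "\<bar>of_int (ii n - 1)*hh n - x0\<bar> <= R+1" "\<bar>of_int (ii n)*hh n - x0\<bar> <= R+1" for n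
  using x1[of n] R S(2)[of n] unfolding nb unfolding xx_def by linarith+
  have GS: "0 <= sig*(V (hh n) j (i+1) - V (hh n) j i)" "sig*(V (hh n) j (i+1) - V (hh n) j i) <= Lam (hh n)*hh n"
  "\<bar>V (hh n) j i\<bar> <= M" for n j i using S(8)[of n] unfolding grid_sub_def by blast+
  have M0: "0 <= M" using GS(3)[of 0 0 0] by linarith
  text \<open>At a grid maximum the one-sided difference quotients of the test function
  inherit the sign and the bound of those of the scheme.\<close>
  have dsign: "0 <= max (sig*dp n) (sig*dm n)" "min (sig*dp n) (sig*dm n) <= Lam (hh n)" for n
  proof -
  define Vn where "Vn = V (hh n) (Suc (jj n))"
  have t'e: "real (Suc (jj n))*tau (hh n) = t' n" by (simp only: t'_def)
  have tl: "\<bar>t' n - t0\<bar> <= ro" using tr(2)[of n] by simp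
  have a: "Vn (ii n+1) - Vn (ii n) <= psi (xx n+hh n, t' n) - psi (xx n, t' n)"
  using gm[OF nbR(1)[of n], of "Suc (jj n)", unfolded nb t'e, OF tl] unfolding Vn_def by linarith
  have b: "psi (xx n, t' n) - psi (xx n - hh n, t' n) <= Vn (ii n) - Vn (ii n - 1)"
  using gm[OF nbR(2)[of n], of "Suc (jj n)", unfolded nb t'e, OF tl] unfolding Vn_def by linarith
  have c: "0 <= sig*(Vn (ii n+1) - Vn (ii n))" "sig*(Vn (ii n+1) - Vn (ii n)) <= Lam (hh n)*hh n"
  "0 <= sig*(Vn (ii n) - Vn (ii n - 1))" "sig*(Vn (ii n) - Vn (ii n - 1)) <= Lam (hh n)*hh n"
  unfolding Vn_def using GS(1,2)[where i = "ii n"] GS(1,2)[where i = "ii n - 1"] by simp_all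
  show "0 <= max (sig*dp n) (sig*dm n)" using sig a b c S(2)[of n] unfolding dp_def dm_def
  by (auto simp: le_max_iff_disj zero_le_divide_iff divide_le_0_iff)
  show "min (sig*dp n) (sig*dm n) <= Lam (hh n)" using sig a b c S(2)[of n] unfolding dp_def dm_def
  by (auto simp: min_le_iff_disj divide_le_eq minus_divide_left)
  qed
  define C0 where "C0 = 2 * C+2*M"
  have step_ineq: "\<exists>P. min (min (sig*qp n) (sig*qm n)) (min (sig*dp n) (sig*dm n)) <= P & P <= max (sig*qp n) (sig*qm n) &
  dtn n+ppow m P*(lap_h (om (hh n)) (hh n) (%y. psi (y, t n)) (xx n) - 2 * C0*qsum (om (hh n)) (hh n) R) <= 0" for n
  proof -
  define xi where "xi = V (hh n) (Suc (jj n)) (ii n) - psi (xx n, t' n)"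
  have xi: "\<bar>xi\<bar> <= C+M" using GS(3)[of n "Suc (jj n)" "ii n"] psiB[OF tin(3,4), of "xx n" n] unfolding xi_def by linarith
  \<comment> \<open>Inside the cylinder the test function is raised to touch at the maximum;
    outside, where maximality gives nothing, the a priori bound \<open>M\<close> takes over.\<close>
  define U where "U k = (if \<bar>of_int k*hh n - x0\<bar> <= R+1 then psi (of_int k*hh n, t n)+xi else M)" for k
  have UB: "\<bar>U k\<bar> <= C0" for k using xi psiB[OF tin(1,2), of "of_int k*hh n" n] M0 unfolding U_def C0_def by auto
  have VU: "V (hh n) (jj n) k <= U k" for k
  proof (cases "\<bar>of_int k*hh n - x0\<bar> <= R+1")
  case True
  have "\<bar>real (jj n)*tau (hh n) - t0\<bar> <= ro" using tr(1)[of n] unfolding t_def by simp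
  from gm[OF True this] show ?thesis using True unfolding U_def xi_def t_def by simp
  next
  case False
  then show ?thesis using GS(3)[of n "jj n" k] unfolding U_def by simp
  qed
  have "\<exists>D\<in>{(U (ii n+1) - U (ii n))/hh n, (U (ii n) - U (ii n - 1))/hh n}.
  V (hh n) (Suc (jj n)) (ii n) <= U (ii n) - tau (hh n)*ppow m (min (sig*D) (Lam (hh n)))*lap_grid (om (hh n)) U (ii n)"
  using S(8)[of n] UB VU unfolding grid_sub_def by blast
  moreover have Uq: "(U (ii n+1) - U (ii n))/hh n = qp n" "(U (ii n) - U (ii n - 1))/hh n = qm n"
  using nbR[of n] unfolding U_def qp_def qm_def nb xx_def[symmetric] by simp_all
  ultimately obtain D where D: "D = qp n | D = qm n"
  "V (hh n) (Suc (jj n)) (ii n) <= U (ii n) - tau (hh n)*ppow m (min (sig*D) (Lam (hh n)))*lap_grid (om (hh n)) U (ii n)"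
  by (metis insertE singletonD)
  define P where "P = min (sig*D) (Lam (hh n))"
  have Ui: "U (ii n) = psi (xx n, t n)+xi" using nbR(3)[of n] unfolding U_def xx_def by simp
  define Lp where "Lp = lap_h (om (hh n)) (hh n) (%y. psi (y, t n)) (xx n) - 2 * C0*qsum (om (hh n)) (hh n) R"
  have "lap_grid (om (hh n)) (%k. psi (of_int k*hh n, t n)) (ii n) <= lap_grid (om (hh n)) U (ii n)+(2 * C0)*qsum (om (hh n)) (hh n) R"
  proof (rule lap_grid_qsum_le[OF S(7) _ UB])
  show "\<bar>psi (of_int k*hh n, t n)\<bar> <= C" for k by (rule psiB[OF tin(1,2)])
  fix k
  have C00: "0 <= C0" using UB[of 0] by linarith
  show "psi (of_int (ii n)*hh n, t n) - psi (of_int (ii n+k)*hh n, t n) <= U (ii n) - U (ii n+k)+2 * C0*qf (of_int k*hh n/R)"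
  proof (cases "\<bar>of_int (ii n+k)*hh n - x0\<bar> <= R+1")
  case True
  have "0 <= 2 * C0*qf (of_int k*hh n/R)" using C00 qf_nonneg by simp
  moreover have "U (ii n+k) = psi (of_int (ii n+k)*hh n, t n)+xi" using True unfolding U_def by simp
  ultimately show ?thesis using Ui unfolding xx_def by linarith
  next
  case False
  have "of_int (ii n+k)*hh n - x0 = (xx n - x0) + of_int k*hh n" unfolding xx_def by (simp add: algebra_simps)
  then have "R < \<bar>of_int k*hh n\<bar>" using False x1(1)[of n] by linarith
  then have "1 < \<bar>of_int k*hh n/R\<bar>" using R by (simp add: abs_mult)
  then have "1 <= (of_int k*hh n/R)\<^sup>2" using abs_square_le_1[of "of_int k*hh n/R"] by linarith
  then have "1 <= 2*qf (of_int k*hh n/R)" using min_le_qf[of "of_int k*hh n/R"] by simp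
  then have "C0*1 <= C0*(2*qf (of_int k*hh n/R))" using C00 by (intro mult_left_mono)
  then have "C0 <= 2 * C0*qf (of_int k*hh n/R)" by simp
  moreover have "C0 = 2 * C+2*M" by (simp add: C0_def)
  moreover have "U (ii n+k) = M" using False unfolding U_def by simp
  moreover have "\<bar>psi (of_int (ii n+k)*hh n, t n)\<bar> <= C" by (rule psiB[OF tin(1,2)])
  ultimately show ?thesis using Ui xi unfolding xx_def by linarith
  qed
  qed
  then have Lpu: "Lp <= lap_grid (om (hh n)) U (ii n)" unfolding Lp_def xx_def lap_h_grid by simp
  have "psi (xx n, t' n)+xi <= psi (xx n, t n)+xi - tau (hh n)*ppow m P*lap_grid (om (hh n)) U (ii n)"
  using D(2) unfolding Ui P_def xi_def by simp
  moreover have "tau (hh n)*ppow m P*Lp <= tau (hh n)*ppow m P*lap_grid (om (hh n)) U (ii n)"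
  using Lpu S(5)[of n] ppow_nonneg[of m P] by (intro mult_left_mono) auto
  ultimately have "psi (xx n, t n+tau (hh n)) - psi (xx n, t n) <= (- (ppow m P*Lp))*tau (hh n)"
  unfolding tt' by (simp add: algebra_simps)
  then have "dtn n <= - (ppow m P*Lp)" unfolding dtn_def using S(5)[of n] by (simp add: divide_le_eq)
  moreover have "P <= max (sig*qp n) (sig*qm n)" "min (min (sig*qp n) (sig*qm n)) (min (sig*dp n) (sig*dm n)) <= P"
  using D(1) dsign(2)[of n] unfolding P_def by (auto simp: min_le_iff_disj le_max_iff_disj)
  ultimately show ?thesis unfolding Lp_def by (intro exI[of _ P]) auto
  qed
  then obtain P where P: "!!n. min (min (sig*qp n) (sig*qm n)) (min (sig*dp n) (sig*dm n)) <= P n"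
  "!!n. P n <= max (sig*qp n) (sig*qm n)"
  "!!n. dtn n+ppow m (P n)*(lap_h (om (hh n)) (hh n) (%y. psi (y, t n)) (xx n) - 2 * C0*qsum (om (hh n)) (hh n) R) <= 0" by metis
  \<comment> \<open>\<open>P\<close> is a slope cut at \<open>Lam\<close>, and \<open>Lam\<close>
    could be small. It cannot spoil the limit, because the smaller quotient of the test function at
    time \<open>t' n\<close> is itself at most \<open>Lam\<close>.\<close>
  have "P \<longlonglongrightarrow> sig*p"
  proof (rule tendsto_sandwich[OF always_eventually always_eventually, rule_format, OF P(1,2)])
  have "(%n. min (min (sig*qp n) (sig*qm n)) (min (sig*dp n) (sig*dm n))) \<longlonglongrightarrow> min (min (sig*p) (sig*p)) (min (sig*p) (sig*p))"
  by (intro tendsto_min tendsto_mult tendsto_const qlims)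
  then show "(%n. min (min (sig*qp n) (sig*qm n)) (min (sig*dp n) (sig*dm n))) \<longlonglongrightarrow> sig*p" by simp
  have "(%n. max (sig*qp n) (sig*qm n)) \<longlonglongrightarrow> max (sig*p) (sig*p)"
  by (intro tendsto_max tendsto_mult tendsto_const qlims)
  then show "(%n. max (sig*qp n) (sig*qm n)) \<longlonglongrightarrow> sig*p" by simp
  qed
  then have Plim: "(%n. ppow m (P n)) \<longlonglongrightarrow> ppow m (sig*p)" by (rule ppow_tendsto) (use m2 in simp)
  \<comment> \<open>In the limit the touching slope has the sign of the monotone grid functions;
    this turns the positive part in the scheme into the absolute value in the equation.\<close>
  have "(%n. max (sig*dp n) (sig*dm n)) \<longlonglongrightarrow> max (sig*p) (sig*p)"
  by (intro tendsto_max tendsto_mult tendsto_const qlims)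
  then have "0 <= max (sig*p) (sig*p)" by (rule LIMSEQ_le_const) (use dsign(1) in auto)
  then have "max (sig*p) 0 = \<bar>p\<bar>" using sig by auto
  then have pp: "ppow m (sig*p) = \<bar>p\<bar> powr (m - 1)" unfolding ppow_def by simp
  have lim1: "(%n. lap_h (om (hh n)) (hh n) (%y. psi (y, t n)) (xx n)) \<longlonglongrightarrow> fl s (sdiff (%y. psi (y, t0)) x0)"
  by (rule consistency_seq[OF hF xlim tlim t0 psiB gc(1,4) g(1)])
  have lim2: "(%n. qsum (om (hh n)) (hh n) R) \<longlonglongrightarrow> 2*(1/R) powr (2 * s)*fl s qf"
  by (rule filterlim_compose[OF qsum_tendsto hF]) (use R in simp)
  have "(%n. dtn n+ppow m (P n)*(lap_h (om (hh n)) (hh n) (%y. psi (y, t n)) (xx n) - 2 * C0*qsum (om (hh n)) (hh n) R))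
  \<longlonglongrightarrow> ft (x0, t0)+ppow m (sig*p)*(fl s (sdiff (%y. psi (y, t0)) x0) - 2 * C0*(2*(1/R) powr (2 * s)*fl s qf))"
  by (intro tendsto_add tendsto_mult tendsto_diff tendsto_const dtlim Plim lim1 lim2)
  then have "ft (x0, t0)+ppow m (sig*p)*(fl s (sdiff (%y. psi (y, t0)) x0) - 2 * C0*(2*(1/R) powr (2 * s)*fl s qf)) <= 0"
  by (rule LIMSEQ_le_const2) (use P(3) in auto)
  then show ?thesis unfolding pp flpsi eqop dxp C0_def C_def L_def[symmetric] M'_def using M0 by (simp add: algebra_simps)
  qed
 qed
 define a where "a = \<bar>dx phi x0 t0\<bar> powr (m - 1)"
 \<comment> \<open>Taking \<open>kap = 1/R\<close> leaves a single limit, \<open>R\<close> to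
   infinity.\<close>
 have bound: "eq_op m s T phi x0 t0 - a*(2*(1/R)*L) <= a*(2*(2*(B+1/R+T\<^sup>2)+2*M')*(2*(1/R) powr (2 * s)*L))"
  if "1 <= R" for R using key[of "1/R" R] that unfolding a_def by simp
 have inv0: "((%R::real. 1/R) \<longlongrightarrow> 0) at_top"
  by (intro tendsto_divide_0[OF tendsto_const] filterlim_at_top_imp_at_infinity filterlim_ident)
 have inv1: "((%R::real. (1/R) powr (2 * s)) \<longlongrightarrow> 0) at_top" by (rule tendsto_zero_powrI[OF inv0 tendsto_const])
  (use s0 in \<open>auto intro: eventually_mono[OF eventually_gt_at_top[of 0]]\<close>)
 have "((%R. a*(2*(2*(B+1/R+T\<^sup>2)+2*M')*(2*(1/R) powr (2 * s)*L))+a*(2*(1/R)*L)) \<longlongrightarrow>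
  a*(2*(2*(B+0+T\<^sup>2)+2*M')*(2*0*L))+a*(2*0*L)) at_top" by (intro tendsto_intros inv0 inv1)
 moreover have "\<forall>\<^sub>F R in at_top. eq_op m s T phi x0 t0 <= a*(2*(2*(B+1/R+T\<^sup>2)+2*M')*(2*(1/R) powr (2 * s)*L))+a*(2*(1/R)*L)"
  using eventually_ge_at_top[of "1::real"]
 proof eventually_elim
  case (elim R) show ?case using bound[OF elim] by linarith
 qed
 ultimately have "eq_op m s T phi x0 t0 <= a*(2*(2*(B+0+T\<^sup>2)+2*M')*(2*0*L))+a*(2*0*L)" by (rule tendsto_lowerbound) simp
 then show "eq_op m s T phi x0 t0 <= 0" by simp
qed

end

section \<open>Existence and uniqueness for continuous data\<close>

lemma usc_env_props:
 fixes f :: "'a::topological_space => real"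
 assumes p: "p \<in> S" and B: "!!q. q \<in> S ==> \<bar>f q\<bar> <= B" shows usc_env_ge: "f p <= usc_env S f p"
  and usc_env_less: "usc_env S f p < c ==> \<exists>U. open U & p \<in> U & (\<forall>q\<in>U \<inter> S. f q < c)"
  and usc_env_le: "open U ==> p \<in> U ==> (!!q. q \<in> U ==> q \<in> S ==> f q <= c) ==> usc_env S f p <= c"
  and lsc_env_eq: "lsc_env S f p = - usc_env S (%q. - f q) p"
proof -
 define F where "F = inf (nhds p) (principal S)"
 define g where "g = (%q. ereal (f q))"
 have F: "F ~= bot"
 proof
  assume "F = bot"
  then have "eventually (%q. False) F" by simp
  then have "\<forall>\<^sub>F q in nhds p. q \<in> S --> False" unfolding F_def eventually_inf_principal by simp
  then show False using p eventually_nhds_x_imp_x by fastforce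
 qed
 have evF: "eventually P F" if "!!q. q \<in> S ==> P q" for P unfolding F_def eventually_inf_principal using that by simp
 have "Limsup F g <= ereal B" unfolding g_def by (rule Limsup_bounded, rule evF) (use B abs_le_iff in auto)
 moreover have "ereal (- B) <= Limsup F g"
 proof -
  have "ereal (- B) <= Liminf F g" unfolding g_def
  proof (rule Liminf_bounded, rule evF)
  show "ereal (- B) <= ereal (f q)" if "q \<in> S" for q using B[OF that] by simp
  qed
  also have "... <= Limsup F g" by (rule Liminf_le_Limsup[OF F])
  finally show ?thesis .
 qed
 \<comment> \<open>Boundedness makes the extended real limit finite; an infinite one would be sent
   to 0 by \<open>real_of_ereal\<close>.\<close>
 ultimately have fin: "ereal (usc_env S f p) = Limsup F g" unfolding usc_env_def F_def[symmetric] g_def[symmetric]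
  by (cases "Limsup F g") auto
 show ge: "f p <= usc_env S f p"
 proof (rule ccontr)
  assume "\<not> ?thesis"
  then have "Limsup F g < ereal (f p)" unfolding fin[symmetric] by simp
  then have "eventually (%q. g q < ereal (f p)) F" by (rule Limsup_lessD)
  then have "\<forall>\<^sub>F q in nhds p. q \<in> S --> f q < f p" unfolding F_def eventually_inf_principal g_def by simp
  then show False using p eventually_nhds_x_imp_x by fastforce
 qed
 show "\<exists>U. open U & p \<in> U & (\<forall>q\<in>U \<inter> S. f q < c)" if "usc_env S f p < c"
 proof -
  have "Limsup F g < ereal c" unfolding fin[symmetric] using that by simp
  then have "eventually (%q. g q < ereal c) F" by (rule Limsup_lessD)
  then have "\<forall>\<^sub>F q in nhds p. q \<in> S --> f q < c" unfolding F_def eventually_inf_principal g_def by simp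
  then show ?thesis unfolding eventually_nhds by auto
 qed
 show "usc_env S f p <= c" if "open U" "p \<in> U" "!!q. q \<in> U ==> q \<in> S ==> f q <= c"
 proof -
  have "\<forall>\<^sub>F q in nhds p. q \<in> S --> f q <= c" unfolding eventually_nhds using that by blast
  then have "Limsup F g <= ereal c" unfolding F_def g_def by (intro Limsup_bounded) (simp add: eventually_inf_principal)
  then show ?thesis unfolding fin[symmetric] by simp
 qed
 have "Limsup F (%q. ereal (- f q)) = - Liminf F g" unfolding g_def using ereal_Limsup_uminus[of F "%q. ereal (f q)"] by simp
 then show "lsc_env S f p = - usc_env S (%q. - f q) p" unfolding lsc_env_def usc_env_def F_def[symmetric] g_def[symmetric] by simp
qed

lemma usc_env_abs_le:
 fixes f :: "'a::topological_space => real"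
 assumes "p \<in> S" "!!q. q \<in> S ==> \<bar>f q\<bar> <= B" shows "\<bar>usc_env S f p\<bar> <= B"
proof -
 have "usc_env S f p <= B"
 proof (rule usc_env_le[OF assms open_UNIV UNIV_I])
  show "f q <= B" if "q \<in> S" for q using assms(2)[OF that] by linarith
 qed
 moreover have "f p <= usc_env S f p" by (rule usc_env_ge[OF assms])
 ultimately show ?thesis using assms(2)[OF assms(1)] by linarith
qed

lemma usc_env_continuous:
 fixes f :: "'a::topological_space => real"
 assumes p: "p \<in> S" and B: "!!q. q \<in> S ==> \<bar>f q\<bar> <= B"
  and c: "!!e. 0 < e ==> \<exists>U. open U & p \<in> U & (\<forall>q\<in>U \<inter> S. f q <= f p+e)" shows "usc_env S f p = f p"
proof (rule antisym)
 show "usc_env S f p <= f p"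
 proof (rule field_le_epsilon)
  fix e :: real assume "0 < e"
  then obtain U where "open U" "p \<in> U" "\<forall>q\<in>U \<inter> S. f q <= f p+e" using c by blast
  then show "usc_env S f p <= f p+e" by (intro usc_env_le[OF p B, where U = U]) auto
 qed
qed (rule usc_env_ge[OF p B])

lemma usc_env_cont_on:
 fixes f :: "'a::topological_space => real"
 assumes "p \<in> S" "!!q. q \<in> S ==> \<bar>f q\<bar> <= B" "continuous_on S f" shows "usc_env S f p = f p"
proof (rule usc_env_continuous[OF assms(1,2)])
 fix e :: real assume "0 < e"
 then have "open {..<f p+e}" "f p \<in> {..<f p+e}" by auto
 with assms(1,3) obtain A where "open A" "p \<in> A" "\<forall>y\<in>S. y \<in> A --> f y \<in> {..<f p+e}"
  unfolding continuous_on_topological by blast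
 then show "\<exists>U. open U & p \<in> U & (\<forall>q\<in>U \<inter> S. f q <= f p+e)" by (intro exI[of _ A]) auto
qed

section \<open>Passing from supersolutions to subsolutions by a change of sign\<close>

lemma C2_on_closed_slices:
 assumes T: "0 < T" and t: "t \<in> {0..T}" and phi: "C2_on (Qbar T) phi"
 obtains fx fxx ft where "C2d (%y. phi (y, t)) fx fxx"
  "!!x. ((%r. phi (x, r)) has_real_derivative ft x) (at t within {0..T})"
proof (rule C2_onE[OF phi])
 fix fx ft fxx fxt ftx ftt
 assume d: "has_jet (Qbar T) phi fx ft fxx fxt ftx ftt" and c: "continuous_on (Qbar T) fxx"
 have inQ: "(x, t) \<in> Qbar T" for x using t by (simp add: Qbar_def)
 have slice_x: "((%y. k (y, t)) has_real_derivative a) (at x)"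
  if "(k has_derivative (%(u, w). a*u+b*w)) (at (x, t) within Qbar T)" for k a b x
 proof -
  have "((%y. (y, t)) has_derivative (%u. (u, 0))) (at x)" by (auto intro!: derivative_eq_intros)
  moreover have "(k has_derivative (%(u, w). a*u+b*w)) (at (x, t) within (%y. (y, t)) ` UNIV)"
  by (rule has_derivative_subset[OF that]) (use inQ in auto)
  ultimately have "((%y. k (y, t)) has_derivative (%u. a*u)) (at x)"
  using has_derivative_in_compose[of "%y. (y, t)" "%u. (u, 0)" x UNIV k "%(u, w). a*u+b*w"] by simp
  then show ?thesis unfolding has_field_derivative_def .
 qed
 have slice_t: "((%r. phi (x, r)) has_real_derivative ft (x, t)) (at t within {0..T})" for x
 proof -
  have "((%r. (x, r)) has_derivative (%w. (0, w))) (at t within {0..T})" by (auto intro!: derivative_eq_intros)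
  moreover have "(phi has_derivative (%(u, w). fx (x, t)*u+ft (x, t)*w)) (at (x, t) within (%r. (x, r)) ` {0..T})"
  by (rule has_derivative_subset[of _ _ _ "Qbar T"]) (use d inQ in \<open>auto simp: Qbar_def\<close>)
  ultimately have "((%r. phi (x, r)) has_derivative (%u. ft (x, t)*u)) (at t within {0..T})"
  using has_derivative_in_compose[of "%r. (x, r)" "%w. (0, w)" t "{0..T}" phi "%(u, w). fx (x, t)*u+ft (x, t)*w"] by simp
  then show ?thesis unfolding has_field_derivative_def .
 qed
 show thesis
 proof (rule that[of "%y. fx (y, t)" "%y. fxx (y, t)" "%x. ft (x, t)"])
  show "C2d (%y. phi (y, t)) (%y. fx (y, t)) (%y. fxx (y, t))" unfolding C2d_def
  proof (intro conjI allI)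
  show "((%y. phi (y, t)) has_real_derivative fx (x, t)) (at x)" for x by (rule slice_x[OF d[THEN bspec, OF inQ, THEN conjunct1]])
  show "((%y. fx (y, t)) has_real_derivative fxx (x, t)) (at x)" for x
  by (rule slice_x[OF d[THEN bspec, OF inQ, THEN conjunct2, THEN conjunct1]])
  show "continuous_on UNIV (%y. fxx (y, t))" by (intro continuous_on_compose2[OF c] continuous_intros) (use inQ in auto)
  qed
 qed (rule slice_t)
qed

lemma eq_op_uminus_closed:
 assumes s: "0 < s" "s < 1" and T: "0 < T" and t: "t \<in> {0..T}" and phi: "C2_on (Qbar T) phi" "Cb_on (Qbar T) phi"
 shows "eq_op m s T (%p. - phi p) x t = - eq_op m s T phi x t"
proof (rule C2_on_closed_slices[OF T t phi(1)])
 fix fx fxx ft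
 assume C: "C2d (%y. phi (y, t)) fx fxx" and d: "!!x. ((%r. phi (x, r)) has_real_derivative ft x) (at t within {0..T})"
 have dt: "dt T psi x t = a" if "((%r. psi (x, r)) has_real_derivative a) (at t within {0..T})" for psi a
  unfolding dt_def using vector_derivative_within_closed_interval[OF T t] that
  unfolding has_real_derivative_iff_has_vector_derivative by blast
 have b: "bounded (range (%y. phi (y, t)))"
  by (rule bounded_subset[of "phi ` Qbar T"]) (use phi t in \<open>auto simp: Cb_on_def Qbar_def\<close>)
 have b': "bounded (range (%y. - phi (y, t)))" using b unfolding bounded_iff by auto
 have C': "C2d (%y. - phi (y, t)) (%y. - fx y) (%y. - fxx y)" using C2d_cmult[OF C, of "-1"] by simp
 have D: "((%y. phi (y, t)) has_real_derivative fx x) (at x)" using C unfolding C2d_def by blast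
 have dx: "dx phi x t = fx x" "dx (%p. - phi p) x t = - fx x"
  unfolding dx_def by (rule DERIV_imp_deriv, rule D) (rule DERIV_imp_deriv, rule DERIV_minus, rule D)
 have "sdiff (%y. - phi (y, t)) x = (%y. - sdiff (%y. phi (y, t)) x y)" by (rule ext) (simp add: sdiff_def)
 then show ?thesis unfolding eq_op_def dx dt[OF d] dt[of "%p. - phi p", OF DERIV_minus[OF d]]
  frac_lap_eq[OF s C2_realI[OF C] b] frac_lap_eq[OF s C2_realI[OF C'] b'] by (simp add: fl_minus)
qed

lemma C2_on_uminus:
 assumes "C2_on S f" shows "C2_on S (%p. - f p)"
proof (rule C2_onE[OF assms])
 fix fx ft fxx fxt ftx ftt
 assume dd: "has_jet S f fx ft fxx fxt ftx ftt"
  and c: "continuous_on S fxx" "continuous_on S fxt" "continuous_on S ftx" "continuous_on S ftt"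
 note d = dd[THEN bspec, THEN conjunct1] dd[THEN bspec, THEN conjunct2, THEN conjunct1]
  dd[THEN bspec, THEN conjunct2, THEN conjunct2]
 have n: "((%p. - k p) has_derivative (%(u, w). (- a)*u+(- b)*w)) (at p within S)"
  if "(k has_derivative (%(u, w). a*u+b*w)) (at p within S)" for k a b p
  using has_derivative_minus[OF that] by (simp add: case_prod_unfold)
 show ?thesis unfolding C2_on_def by (rule exI[of _ "%p. - fx p"], rule exI[of _ "%p. - ft p"], rule exI[of _ "%p. - fxx p"],
  rule exI[of _ "%p. - fxt p"], rule exI[of _ "%p. - ftx p"], rule exI[of _ "%p. - ftt p"])
  (intro conjI ballI n d continuous_on_minus c)
qed

lemma Cb_on_uminus: "Cb_on S f ==> Cb_on S (%p. - f p)"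
proof -
 assume f: "Cb_on S f"
 have "(%p. - f p) ` S = uminus ` (f ` S)" by auto
 then show ?thesis using f unfolding Cb_on_def by (auto intro!: continuous_on_minus bounded_uminus[THEN iffD2])
qed

lemma bounded_realE:
 assumes "bounded (f ` S)" obtains B :: real where "!!x. x \<in> S ==> \<bar>f x\<bar> <= B" using assms unfolding bounded_iff by auto

lemma visc_supersol_uminus:
 assumes s: "0 < s" "s < 1" and T: "0 < T" and v0: "!!x. \<bar>v0 x\<bar> <= B" and v: "visc_supersol m s T v0 v"
 shows "visc_subsol m s T (%x. - v0 x) (%p. - v p)" unfolding visc_subsol_def
proof (intro conjI allI impI)
 have "bounded (v ` Qbar T)" using v unfolding visc_supersol_def by blast
 then obtain C where C: "!!p. p \<in> Qbar T ==> \<bar>v p\<bar> <= C" by (rule bounded_realE) blast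
 then show "bounded ((%p. - v p) ` Qbar T)" unfolding bounded_iff by (intro exI[of _ C]) auto
 have l: "lsc_on (Qbar T) v" using v unfolding visc_supersol_def by blast
 show "usc_on (Qbar T) (%p. - v p)" unfolding usc_on_def
 proof (intro ballI allI impI)
  fix p c assume "p \<in> Qbar T" "- v p < c"
  then have "\<forall>\<^sub>F q in at p within Qbar T. - c < v q" using l unfolding lsc_on_def by auto
  then show "\<forall>\<^sub>F q in at p within Qbar T. - v q < c" by eventually_elim simp
 qed
 have "int_super m s T v" using v unfolding visc_supersol_def int_super_def by blast
 then have isub: "int_sub m s T (%p. - v p)" unfolding int_super_iff[OF s] .
 show "eq_op m s T phi x0 t0 <= 0"
  if "C2_on (Q T) phi & Cb_on (Q T) phi & max_point (Q T) (%p. - v p - phi p) (x0, t0)" for phi x0 t0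
  using isub that unfolding int_sub_def by blast
 show "min (- v (x0, 0) - usc_env UNIV (%x. - v0 x) x0) (eq_op m s T phi x0 0) <= 0"
  if a: "C2_on (Qbar T) phi & Cb_on (Qbar T) phi & max_point (Qbar T) (%p. - v p - phi p) (x0, 0)" for phi x0
 proof -
  have "min_point (Qbar T) (%p. v p - - phi p) (x0, 0)" using a unfolding max_point_def min_point_def by (auto simp: algebra_simps)
  then have "0 <= max (v (x0, 0) - lsc_env UNIV v0 x0) (eq_op m s T (%p. - phi p) x0 0)"
  using v C2_on_uminus Cb_on_uminus a unfolding visc_supersol_def by blast
  moreover have "eq_op m s T (%p. - phi p) x0 0 = - eq_op m s T phi x0 0" by (rule eq_op_uminus_closed[OF s T]) (use a T in auto)
  moreover have "lsc_env UNIV v0 x0 = - usc_env UNIV (%x. - v0 x) x0" by (rule lsc_env_eq[of x0 UNIV v0 B]) (use v0 in auto)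
  ultimately show ?thesis by (auto simp: le_max_iff_disj min_le_iff_disj)
 qed
qed

lemma BUC_on_uminus: "BUC_on S f ==> BUC_on S (%p. - f p)"
proof -
 assume f: "BUC_on S f"
 have "(%p. - f p) ` S = uminus ` (f ` S)" by auto
 moreover have "uniformly_continuous_on S (%p. - f p)"
  using f unfolding BUC_on_def uniformly_continuous_on_def by (simp add: dist_minus)
 ultimately show ?thesis using f unfolding BUC_on_def by (auto intro!: bounded_uminus[THEN iffD2])
qed

lemma comparison_super:
 assumes s: "0 < s" "s < 1" and m: "m \<ge> 2" and T: "0 < T" and v0: "!!x. \<bar>v0 x\<bar> <= B"
  and u: "visc_supersol m s T v0 u" and W: "int_sub m s T W" and WB: "BUC_on (Qbar T) W"
  and init: "!!x. W (x, 0) <= lsc_env UNIV v0 x" and t1: "0 <= t1" "t1 < T" shows "W (x1, t1) <= u (x1, t1)"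
proof -
 have "int_super m s T (%p. - W p)" unfolding int_super_iff[OF s] using W by simp
 moreover have "usc_env UNIV (%x. - v0 x) x <= - W (x, 0)" for x using init[of x] lsc_env_eq[of x UNIV v0 B] v0 by simp
 ultimately have "- u (x1, t1) <= - W (x1, t1)"
  by (intro comparison[OF s m T visc_supersol_uminus[OF s T v0 u] _ BUC_on_uminus[OF WB] _ t1])
 then show ?thesis by simp
qed

text \<open>The limit superior for \<open>h\<close> tending to 0, obtained as the infimum of all
  eventual upper bounds, in the form that the hypotheses of \<open>half_relaxed_sub\<close> ask
  for.\<close>

lemma ex_upper_limit:
 fixes g :: "real => real"
 assumes "NEAR h. \<bar>g h\<bar> <= M"
 shows "\<exists>u. (\<forall>c>u. NEAR h. g h < c) & (\<forall>c<u. \<exists>\<^sub>F h in at_right 0. c < g h)"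
proof -
 define S where "S = {c. NEAR h. g h < c}"
 have ne: "M+1 \<in> S" unfolding S_def mem_Collect_eq using assms by eventually_elim linarith
 have bd: "- M <= c" if "c \<in> S" for c
 proof -
  have "NEAR h. g h < c" using that by (simp add: S_def)
  with assms have "\<forall>\<^sub>F h in at_right (0::real). - M <= c" by eventually_elim linarith
  then show ?thesis by simp
 qed
 have bb: "bdd_below S" using bd by (rule bdd_belowI)
 show ?thesis
 proof (intro exI[of _ "Inf S"] conjI allI impI)
  fix c assume "Inf S < c"
  then obtain c' where "c' \<in> S" "c' < c" using cInf_less_iff[of S c] ne bb by auto
  then have "NEAR h. g h < c'" by (simp add: S_def)
  then show "NEAR h. g h < c" by eventually_elim (use \<open>c' < c\<close> in linarith)
 next
  fix c assume c: "c < Inf S"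
  define c' where "c' = (c+Inf S)/2"
  have c': "c < c'" "c' < Inf S" using c by (simp_all add: c'_def)
  then have "c' \<notin> S" using cInf_lower[OF _ bb] by fastforce
  then have "\<exists>\<^sub>F h in at_right 0. c' <= g h" unfolding S_def frequently_def by (simp add: not_le)
  then show "\<exists>\<^sub>F h in at_right 0. c < g h" by (rule frequently_elim1) (use c' in linarith)
 qed
qed

text \<open>A modulus of continuity in additive form: the slope \<open>K\<close> may depend on the
  error \<open>gam\<close>. The discrete functions satisfy such estimates for small \<open>h\<close>
  although they jump in time, and the form survives pointwise limits.\<close>

definition equi :: "(real \<times> real => real) => bool" where
 "equi W \<longleftrightarrow> (\<forall>gam>0. \<exists>K\<ge>0. \<forall>x y t r. 0 <= t --> 0 <= r --> W (x, t) <= W (y, r)+gam+K*ell1 x y t r)"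

lemma equi_uniform:
 assumes "equi W" "0 < e" shows "\<exists>d>0. \<forall>p q. 0 <= snd p --> 0 <= snd q --> dist p q < d --> \<bar>W p - W q\<bar> < e"
proof -
 obtain K where K: "K \<ge> 0" "!!x y t r. 0 <= t ==> 0 <= r ==> W (x, t) <= W (y, r)+e/2+K*ell1 x y t r"
  using assms unfolding equi_def by (meson half_gt_zero)
 define d where "d = e/(4*(K+1))"
 have d: "d > 0" using assms K by (simp add: d_def)
 have "\<bar>W p - W q\<bar> < e" if h: "0 <= snd p" "0 <= snd q" "dist p q < d" for p q
 proof -
  obtain x t y r where pq: "p = (x, t)" "q = (y, r)" by (metis prod.collapse)
  have "\<bar>x - y\<bar> < d" "\<bar>t - r\<bar> < d"
  using h(3) dist_fst_le[of p q] dist_snd_le[of p q] by (auto simp: pq dist_real_def)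
  then have "K*ell1 x y t r <= K*(2*d)" using K by (intro mult_left_mono) auto
  also have "... < (K+1)*(2*d)" using d by simp
  also have "... = e/2" using K by (simp add: d_def field_simps)
  finally have "K*ell1 x y t r < e/2" .
  then show ?thesis using K(2)[of t r x y] K(2)[of r t y x] h pq by (auto simp: abs_less_iff abs_minus_commute)
 qed
 then show ?thesis using d by blast
qed

lemma equi_BUC:
 assumes "equi W" "!!x t. 0 <= t ==> \<bar>W (x, t)\<bar> <= M" shows "BUC_on (Qbar T) W" unfolding BUC_on_def
proof
 show "bounded (W ` Qbar T)" unfolding bounded_iff using assms(2) by (intro exI[of _ M]) (auto simp: Qbar_def)
 show "uniformly_continuous_on (Qbar T) W" unfolding uniformly_continuous_on_def
 proof (intro allI impI)
  fix e :: real assume "0 < e"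
  from equi_uniform[OF assms(1) this] obtain d where d: "d > 0"
  "!!p q. 0 <= snd p ==> 0 <= snd q ==> dist p q < d ==> \<bar>W p - W q\<bar> < e" by blast
  show "\<exists>d>0. \<forall>x\<in>Qbar T. \<forall>x'\<in>Qbar T. dist x' x < d --> dist (W x') (W x) < e"
  using d by (intro exI[of _ d]) (auto simp: Qbar_def dist_real_def)
 qed
qed

lemma interpolant_uminus: "interpolant h tau (%j i. - V j i) p = - interpolant h tau V p"
 unfolding interpolant_def Let_def by (simp add: case_prod_unfold)

lemma BUC_cont: "BUC_on S f ==> bounded (f ` S)" "BUC_on S f ==> continuous_on S f"
 by (auto simp: BUC_on_def uniformly_continuous_imp_continuous)

lemma visc_subsolI:
 assumes "bounded (u ` Qbar T)" "usc_on (Qbar T) u" "int_sub m s T u" "!!x. u (x, 0) <= usc_env UNIV v0 x"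
 shows "visc_subsol m s T v0 u" unfolding visc_subsol_def
proof (intro conjI allI impI assms(1,2))
 show "eq_op m s T phi x0 t0 <= 0"
  if "C2_on (Q T) phi & Cb_on (Q T) phi & max_point (Q T) (%p. u p - phi p) (x0, t0)" for phi x0 t0
  using assms(3) that unfolding int_sub_def by blast
 show "min (u (x0, 0) - usc_env UNIV v0 x0) (eq_op m s T phi x0 0) <= 0" for phi x0
  using assms(4)[of x0] by (simp add: min_le_iff_disj)
qed

lemma visc_supersolI:
 assumes "bounded (u ` Qbar T)" "lsc_on (Qbar T) u" "int_super m s T u" "!!x. lsc_env UNIV v0 x <= u (x, 0)"
 shows "visc_supersol m s T v0 u" unfolding visc_supersol_def
proof (intro conjI allI impI assms(1,2))
 show "0 <= eq_op m s T phi x0 t0"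
  if "C2_on (Q T) phi & Cb_on (Q T) phi & min_point (Q T) (%p. u p - phi p) (x0, t0)" for phi x0 t0
  using assms(3) that unfolding int_super_def by blast
 show "0 <= max (u (x0, 0) - lsc_env UNIV v0 x0) (eq_op m s T phi x0 0)" for phi x0
  using assms(4)[of x0] by (simp add: le_max_iff_disj)
qed

lemma continuous_on_usc: "continuous_on S f ==> usc_on S f" and continuous_on_lsc: "continuous_on S f ==> lsc_on S f"
 unfolding usc_on_def lsc_on_def continuous_on_def by (auto intro: order_tendstoD)

section \<open>Equicontinuity of the scheme\<close>

locale approximation = discretization +
 fixes tau Lam :: "real => real" and M :: real
 assumes ev_cfl: "NEAR h. cfl m (om h) h (tau h) (Lam h) M" and tau0: "(tau \<longlongrightarrow> 0) (at_right 0)"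
begin

text \<open>Continuity is left out on purpose, so that the jump datum is admissible as well. The
  last conjunct puts the samples of \<open>f\<close> into \<open>gclass\<close> for small
  \<open>h\<close>.\<close>

definition adm :: "(real => real) => bool" where
 "adm f \<longleftrightarrow> mono f & (\<forall>x. \<bar>f x\<bar> <= M) & (NEAR h. \<forall>x. f (x+h) - f x <= Lam h*h)"

definition Vb :: "(real => real) => real => real \<times> real => real" where
 "Vb f h = interpolant h (tau h) (scheme m (om h) h (tau h) f)"

definition gr :: "(real => real) => real => int => real" where "gr f h i = f (of_int i*h)"

lemma scheme_gr: "scheme m (om h) h (tau h) f j = (step m (om h) h (tau h) ^^ j) (gr f h)" unfolding scheme_eq gr_def[abs_def] ..

lemma ev_gr:
 assumes "adm f" shows "NEAR h. cfl m (om h) h (tau h) (Lam h) M & 0 < h & 0 < tau h & 0 <= Lam h & weights (om h) &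
  gr f h \<in> gclass (Lam h) M h"
proof -
 have f: "mono f" "!!x. \<bar>f x\<bar> <= M" "NEAR h. \<forall>x. f (x+h) - f x <= Lam h*h" using assms unfolding adm_def by auto
 show ?thesis using ev_cfl f(3)
 proof eventually_elim
  case (elim h)
  then have h: "0 < h" "0 < tau h" "0 <= Lam h" "weights (om h)" unfolding cfl_def by auto
  have "of_int (i+1)*h = of_int i*h+h" for i by (simp add: algebra_simps)
  then have "gr f h \<in> gclass (Lam h) M h" unfolding gclass_def gr_def using f(1,2) elim(2) h by (auto simp: mono_def)
  then show ?case using elim h by simp
 qed
qed

lemma Vb_comparison:
 assumes "adm f" "adm g" "!!x. f x <= g x+c" shows "NEAR h. \<forall>q. Vb f h q <= Vb g h q+c"
 using ev_gr[OF assms(1)] ev_gr[OF assms(2)]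
proof eventually_elim
 case (elim h)
 show ?case
 proof
  fix q
  show "Vb f h q <= Vb g h q+c" unfolding Vb_def
  proof (rule interpolant_le)
  fix j i
  show "scheme m (om h) h (tau h) f j i <= scheme m (om h) h (tau h) g j i+c" unfolding scheme_gr
  by (rule iter_comparison[OF m2, where Lam = "Lam h" and M = M]) (use elim assms(3) in \<open>auto simp: gr_def\<close>)
  qed (use elim in simp)
 qed
qed

lemma Vb_bound:
 assumes "adm f" shows "NEAR h. \<forall>q. \<bar>Vb f h q\<bar> <= M" using ev_gr[OF assms]
proof eventually_elim
 case (elim h)
 have W: "scheme m (om h) h (tau h) f j \<in> gclass (Lam h) M h" for j
  unfolding scheme_gr by (rule iter_gclass[OF m2]) (use elim in auto)
 show ?case
 proof
  fix q :: "real \<times> real"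
  obtain x t where q: "q = (x, t)" by (cases q)
  have "\<bar>scheme m (om h) h (tau h) f j i\<bar> <= M" for j i by (rule gclassD(3)[OF W])
  then have b: "- M <= scheme m (om h) h (tau h) f j i" "scheme m (om h) h (tau h) f j i <= M" for j i
  by (simp_all add: abs_le_iff minus_le_iff)
  have "- M <= Vb f h q" "Vb f h q <= M" unfolding Vb_def q
  using interpolant_between[where V = "scheme m (om h) h (tau h) f", of h t "tau h" x] gclassD(1)[OF W] b elim by (meson order_trans)+
  then show "\<bar>Vb f h q\<bar> <= M" by simp
 qed
qed

text \<open>The discrete Laplacian of C2 data is bounded independently of \<open>h\<close>, by
  \<open>qsum\<close> at scale 1, so the first step moves the grid function by at most
  \<open>K * tau h\<close>; comparison carries this bound, like the slope bound, to all later
  times.\<close>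

lemma smooth_Lipschitz:
 assumes G: "C2d G G1 G2" "!!x. \<bar>G1 x\<bar> <= C" "!!x. \<bar>G2 x\<bar> <= C" and a: "adm G"
 shows "\<exists>K\<ge>0. NEAR h. \<forall>x y t r. 0 <= t --> 0 <= r -->
  Vb G h (x, t) <= Vb G h (y, r)+K*(\<bar>x - y\<bar>+2*h)+K*(\<bar>t - r\<bar>+tau h)"
proof -
 have C0: "0 <= C" using G(2)[of 0] by linarith
 have GM: "!!x. \<bar>G x\<bar> <= M" using a by (simp add: adm_def)
 define A where "A = 2*max (4*M) C"
 have A0: "0 <= A" using C0 by (simp add: A_def)
 define L where "L = fl s qf"
 have L: "0 <= L" unfolding L_def by (rule fl_qf_nonneg[OF s01])
 define K where "K = C powr (m - 1)*(A*(2*L+1))+C"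
 have K: "0 <= C powr (m - 1)*(A*(2*L+1))" "C <= K" "0 <= K" using C0 A0 L by (auto simp: K_def)
 have "((%h. qsum (om h) h 1) \<longlongrightarrow> 2*(1/1) powr (2 * s)*L) (at_right 0)" unfolding L_def by (rule qsum_tendsto) simp
 then have qs: "NEAR h. qsum (om h) h 1 < 2*L+1" by (rule order_tendstoD(2)) simp
 have "NEAR h. \<forall>x y t r. 0 <= t --> 0 <= r -->
  Vb G h (x, t) <= Vb G h (y, r)+K*(\<bar>x - y\<bar>+2*h)+K*(\<bar>t - r\<bar>+tau h)" using ev_gr[OF a] qs
 proof eventually_elim
  case (elim h)
  define V where "V = (%j. (step m (om h) h (tau h) ^^ j) (gr G h))"
  have c: "cfl m (om h) h (tau h) (Lam h) M" and gG: "gr G h \<in> gclass (Lam h) M h" and h: "0 < h" "0 < tau h"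
  and w: "weights (om h)" using elim by auto
  have V: "V j \<in> gclass (Lam h) M h" for j unfolding V_def by (rule iter_gclass[OF m2 c gG])
  have step1: "G (x+h) - G x <= C*h" for x
  proof -
  obtain z where "G (x+h) - G x = (x+h - x)*G1 z" using MVT2[of x "x+h" G G1] G(1) h unfolding C2d_def by auto
  moreover have "h*G1 z <= h * C" using G(2)[of z] h by (intro mult_left_mono) (auto simp: abs_le_iff)
  ultimately show ?thesis by (simp add: mult.commute)
  qed
  have gs: "gr G h (i+1) <= gr G h i+C*h" for i using step1[of "of_int i*h"] by (simp add: gr_def algebra_simps)
  have xl: "V j (i+1) - V j i <= C*h" for j i
  proof -
  have "(step m (om h) h (tau h) ^^ j) (%i. gr G h (i+1)) i <= V j i+C*h" unfolding V_def
  by (rule iter_comparison[OF m2 c shift_gclass[OF gG] gG gs])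
  then show ?thesis unfolding iter_shift V_def by simp
  qed
  have lapb: "\<bar>lap_grid (om h) (gr G h) i\<bar> <= A*(2*L+1)" for i
  proof -
  have "\<bar>lap_h (om h) h G (of_int i*h) - lap_h (om h) h (%x. 0) 0\<bar> <= A*qsum (om h) h 1+0*qsum (om h) h 1"
  proof (rule lap_h_diff_bound[OF w GM, of _ 0])
  fix y
  have "\<bar>sdiff G (of_int i*h) y\<bar> <= max (4*M) C*min 1 (y\<^sup>2)" by (rule sdiff_min_bound[OF G(1) GM G(3)])
  also have "... <= max (4*M) C*(2*qf y)" using C0 by (intro mult_left_mono min_le_qf) auto
  finally show "\<bar>sdiff G (of_int i*h) y - sdiff (%x. 0) 0 y\<bar> <= A*qf y+0*qf (y/1)" by (simp add: A_def sdiff_def)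
  qed simp
  also have "... <= A*(2*L+1)" using elim(2) A0 by (simp add: mult_left_mono less_imp_le)
  finally show ?thesis unfolding lap_h_grid by (simp add: gr_def[abs_def] lap_h_def)
  qed
  have stepb: "\<bar>step m (om h) h (tau h) (gr G h) k - gr G h k\<bar> <= K*tau h" for k
  proof -
  have "D_h (om h) h (gr G h) k <= C" using gs[of k] gs[of "k - 1"] h by (auto simp: D_h_def divide_le_eq)
  then have "ppow m (D_h (om h) h (gr G h) k) <= C powr (m - 1)" using m2 C0 by (intro ppow_le) auto
  then have "ppow m (D_h (om h) h (gr G h) k)*\<bar>lap_grid (om h) (gr G h) k\<bar> <= C powr (m - 1)*(A*(2*L+1))"
  using lapb ppow_nonneg by (intro mult_mono) auto
  also have "... <= K" using C0 by (simp add: K_def)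
  finally have "tau h*(ppow m (D_h (om h) h (gr G h) k)*\<bar>lap_grid (om h) (gr G h) k\<bar>) <= tau h*K"
  using h by (intro mult_left_mono) auto
  then show ?thesis unfolding step_eq using h ppow_nonneg[of m] by (simp add: abs_mult mult_ac)
  qed
  show ?case
  proof (intro allI impI)
  fix x y t r :: real assume t: "0 <= t" "0 <= r"
  have "interpolant h (tau h) V (x, t) <= interpolant h (tau h) V (y, r)+K*(\<bar>x - y\<bar>+2*h)+K*(\<bar>t - r\<bar>+tau h)"
  proof (rule interpolant_Lipschitz[OF h])
  show "V j i <= V j (i+1)" for j i by (rule gclassD(1)[OF V])
  show "V j (i+1) - V j i <= K*h" for j i using xl[of j i] mult_right_mono[OF K(2), of h] h by linarith
  show "\<bar>V (j+n) i - V j i\<bar> <= real n*(K*tau h)" for j n i unfolding V_def by (rule iter_time[OF m2 c gG stepb])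
  qed (use K t in auto)
  then show "Vb G h (x, t) <= Vb G h (y, r)+K*(\<bar>x - y\<bar>+2*h)+K*(\<bar>t - r\<bar>+tau h)" unfolding Vb_def V_def scheme_gr .
  qed
 qed
 then show ?thesis using K by blast
qed

text \<open>The smoothed datum differs by \<open>gam/4\<close>, which comparison preserves in both
  directions, and the mesh terms of \<open>smooth_Lipschitz\<close> are eventually below another
  \<open>gam/4\<close>.\<close>

lemma equicontinuity:
 assumes f: "adm f" "uniformly_continuous_on UNIV f" and gam: "0 < gam"
 shows "\<exists>K\<ge>0. NEAR h. \<forall>x y t r. 0 <= t --> 0 <= r -->
  Vb f h (x, t) <= Vb f h (y, r)+gam+K*ell1 x y t r"
proof -
 have fM: "!!x. \<bar>f x\<bar> <= M" and fm: "mono f"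
  and fd: "NEAR h. \<forall>x. f (x+h) - f x <= Lam h*h" using f(1) unfolding adm_def by auto
 have g4: "0 < gam/4" using gam by simp
 show ?thesis
 proof (rule smoothing_UC[OF f(2) g4 fM])
  fix G G1 G2 C
  assume G: "C2d G G1 G2" "!!x. \<bar>G x - f x\<bar> <= gam/4" "!!x. \<bar>G x\<bar> <= M"
  "!!x. \<bar>G1 x\<bar> <= C" "!!x. \<bar>G2 x\<bar> <= C"
  "!!x c. \<exists>xi. G (x+c) - G x = f (xi+c) - f xi"
  have aG: "adm G" unfolding adm_def
  proof (intro conjI allI)
  show "mono G"
  proof (rule monoI)
  fix x y :: real assume xy: "x <= y"
  obtain xi where "G (x+(y - x)) - G x = f (xi+(y - x)) - f xi" using G(6) by blast
  moreover have "f xi <= f (xi+(y - x))" using xy by (intro monoD[OF fm]) simp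
  ultimately show "G x <= G y" by simp
  qed
  show "\<bar>G x\<bar> <= M" for x by (rule G(3))
  show "NEAR h. \<forall>x. G (x+h) - G x <= Lam h*h" using fd
  proof eventually_elim
  case (elim h)
  show ?case
  proof
  fix x
  obtain xi where "G (x+h) - G x = f (xi+h) - f xi" using G(6) by blast
  then show "G (x+h) - G x <= Lam h*h" using elim by simp
  qed
  qed
  qed
  obtain K where K: "0 <= K" "NEAR h. \<forall>x y t r. 0 <= t --> 0 <= r -->
  Vb G h (x, t) <= Vb G h (y, r)+K*(\<bar>x - y\<bar>+2*h)+K*(\<bar>t - r\<bar>+tau h)" using smooth_Lipschitz[OF G(1,4,5) aG] by blast
  have le: "f x <= G x+gam/4" "G x <= f x+gam/4" for x using G(2)[of x] by linarith+
  have "((%h. K*(2*h)+K*tau h) \<longlongrightarrow> K*(2*0)+K*0) (at_right 0)" by (intro tendsto_intros tau0)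
  then have small: "NEAR h. K*(2*h)+K*tau h < gam/4" by (rule order_tendstoD(2)) (use gam in simp)
  have "NEAR h. \<forall>x y t r. 0 <= t --> 0 <= r -->
  Vb f h (x, t) <= Vb f h (y, r)+gam+K*ell1 x y t r" using K(2) small Vb_comparison[OF f(1) aG le(1)] Vb_comparison[OF aG f(1) le(2)]
  proof eventually_elim
  case (elim h)
  show ?case
  proof (intro allI impI)
  fix x y t r :: real assume t: "0 <= t" "0 <= r"
  have "Vb G h (x, t) <= Vb G h (y, r)+K*(\<bar>x - y\<bar>+2*h)+K*(\<bar>t - r\<bar>+tau h)" using elim(1) t by blast
  moreover have "K*(\<bar>x - y\<bar>+2*h)+K*(\<bar>t - r\<bar>+tau h) = K*ell1 x y t r+(K*(2*h)+K*tau h)" by (simp add: algebra_simps)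
  ultimately show "Vb f h (x, t) <= Vb f h (y, r)+gam+K*ell1 x y t r"
  using elim(2) elim(3)[rule_format, of "(x, t)"] elim(4)[rule_format, of "(y, r)"] gam by linarith
  qed
  qed
  then show ?thesis using K(1) by blast
 qed
qed

lemma Vb_initial:
 assumes f: "adm f" "uniformly_continuous_on UNIV f" shows "((%h. Vb f h (x, 0)) \<longlongrightarrow> f x) (at_right 0)"
proof (rule tendstoI)
 fix e :: real assume e: "0 < e"
 then obtain d where d: "d > 0" "!!x y. \<bar>y - x\<bar> < d ==> \<bar>f y - f x\<bar> < e"
  using f(2) unfolding uniformly_continuous_on_def dist_real_def by (metis UNIV_I)
 have "NEAR h. h < d" using order_tendstoD(2)[OF tendsto_ident_at d(1)] .
 with ev_gr[OF f(1)] show "NEAR h. dist (Vb f h (x, 0)) (f x) < e"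
 proof eventually_elim
  case (elim h)
  have h: "0 < h" "0 < tau h" "h < d" using elim by auto
  define a where "a = \<lfloor>x/h\<rfloor>"
  have "of_int a <= x/h" "x/h < of_int a+1" unfolding a_def by linarith+
  then have a: "of_int a*h <= x" "x < of_int a*h+h" using h by (auto simp: le_divide_eq divide_less_eq algebra_simps)
  have b: "f (of_int a*h) <= Vb f h (x, 0)" "Vb f h (x, 0) <= f (of_int (a+1)*h)"
  using interpolant_between[where V = "scheme m (om h) h (tau h) f" and t = 0, of h "tau h" x]
  gclassD(1)[of "gr f h" "Lam h" M h] elim unfolding Vb_def a_def by (auto simp: gr_def)
  have "of_int (a+1)*h = of_int a*h+h" by (simp add: algebra_simps)
  then have "\<bar>f (of_int a*h) - f x\<bar> < e" "\<bar>f (of_int (a+1)*h) - f x\<bar> < e" using a h by (auto intro!: d(2))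
  then show ?case using b by (simp add: dist_real_def abs_less_iff)
 qed
qed

end

section \<open>Existence of the limit\<close>

context discretization
begin

text \<open>By equicontinuity the pointwise limit superior already has the locally uniform
  properties of the half-relaxed one, and it inherits the modulus and the initial values.\<close>

lemma relaxed_limit:
 assumes sig: "sig = 1 | sig = -1" and ev: "NEAR h. 0 < tau h & 0 <= Lam h & grid_sub sig m (om h) h (tau h) (Lam h) M (V h)"
  and tauz: "(tau \<longlongrightarrow> 0) (at_right 0)" and Z: "!!h. Z h = interpolant h (tau h) (V h)"
  and bd: "NEAR h. \<forall>q. \<bar>Z h q\<bar> <= M"
  and eq: "!!gam. 0 < gam ==> \<exists>K\<ge>0. NEAR h. \<forall>x y t r. 0 <= t --> 0 <= r -->
  Z h (x, t) <= Z h (y, r)+gam+K*ell1 x y t r" and ini: "!!x. ((%h. Z h (x, 0)) \<longlongrightarrow> g x) (at_right 0)"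
 shows "\<exists>u. equi u & (\<forall>p. \<bar>u p\<bar> <= M) & (\<forall>x. u (x, 0) = g x) & (\<forall>T>0. int_sub m s T u) &
  (\<forall>p. \<forall>c>u p. NEAR h. Z h p < c)"
proof -
 have "\<exists>v. (\<forall>c>v. NEAR h. Z h p < c) & (\<forall>c<v. \<exists>\<^sub>F h in at_right 0. c < Z h p)" for p
 proof (rule ex_upper_limit[of _ M])
  show "NEAR h. \<bar>Z h p\<bar> <= M" using bd by (rule eventually_mono) blast
 qed
 then obtain u where u1: "!!p c. u p < c ==> NEAR h. Z h p < c"
  and u2: "!!p c. c < u p ==> \<exists>\<^sub>F h in at_right 0. c < Z h p" by metis
 have ub: "u p <= c" if "NEAR h. Z h p <= c" for p c
 proof (rule ccontr)
  assume "\<not> u p <= c"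
  then have "\<exists>\<^sub>F h in at_right 0. c < Z h p" using u2 by simp
  moreover have "NEAR h. \<not> c < Z h p" using that by eventually_elim simp
  ultimately show False unfolding frequently_def by blast
 qed
 have lb: "c <= u p" if "NEAR h. c <= Z h p" for p c
 proof (rule ccontr)
  assume "\<not> c <= u p"
  then have "NEAR h. Z h p < c" using u1 by simp
  with that have "\<forall>\<^sub>F h in at_right (0::real). False" by eventually_elim simp
  then show False by simp
 qed
 have ue: "u (x, t) <= u (y, r)+gam+K*ell1 x y t r"
  if K: "NEAR h. \<forall>x y t r. 0 <= t --> 0 <= r -->
  Z h (x, t) <= Z h (y, r)+gam+K*ell1 x y t r" and t: "0 <= t" "0 <= r" for gam K x y t r
 proof (rule field_le_epsilon)
  fix e :: real assume "0 < e"
  then have "u (y, r) < u (y, r)+e" by simp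
  from u1[OF this] K have "NEAR h. Z h (x, t) <= u (y, r)+gam+K*ell1 x y t r+e"
  proof eventually_elim
  case (elim h)
  have "Z h (x, t) <= Z h (y, r)+gam+K*ell1 x y t r" using elim(2) t by blast
  then show ?case using elim(1) by linarith
  qed
  then show "u (x, t) <= u (y, r)+gam+K*ell1 x y t r+e" by (rule ub)
 qed
 have "equi u" unfolding equi_def
 proof (intro allI impI)
  fix gam :: real assume "0 < gam"
  from eq[OF this] show "\<exists>K\<ge>0. \<forall>x y t r. 0 <= t --> 0 <= r --> u (x, t) <= u (y, r)+gam+K*ell1 x y t r"
  using ue by blast
 qed
 moreover have "\<bar>u p\<bar> <= M" for p
 proof -
  have b: "NEAR h. \<bar>Z h p\<bar> <= M" using bd by (rule eventually_mono) blast
  have "u p <= M" by (rule ub, rule eventually_mono[OF b]) linarith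
  moreover have "- M <= u p" by (rule lb, rule eventually_mono[OF b]) linarith
  ultimately show ?thesis by simp
 qed
 moreover have "u (x, 0) = g x" for x
 proof (rule antisym)
  show "u (x, 0) <= g x"
  proof (rule field_le_epsilon)
  fix e :: real assume "0 < e"
  then have "NEAR h. Z h (x, 0) < g x+e" by (intro order_tendstoD(2)[OF ini]) simp
  then show "u (x, 0) <= g x+e" by (intro ub) (auto elim!: eventually_mono)
  qed
  show "g x <= u (x, 0)"
  proof (rule field_le_epsilon)
  fix e :: real assume "0 < e"
  then have "NEAR h. g x - e < Z h (x, 0)" by (intro order_tendstoD(1)[OF ini]) simp
  then have "g x - e <= u (x, 0)" by (intro lb) (auto elim!: eventually_mono)
  then show "g x <= u (x, 0)+e" by simp
  qed
 qed
 moreover have "int_sub m s T u" if T: "0 < T" for T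
 proof (rule half_relaxed_sub[OF sig T ev tauz, of u])
  fix p c assume p: "p \<in> Q T" "u p < c"
  define e where "e = (c - u p)/4"
  have e: "e > 0" using p by (simp add: e_def)
  obtain K where K: "K \<ge> 0" "NEAR h. \<forall>x y t r. 0 <= t --> 0 <= r -->
  Z h (x, t) <= Z h (y, r)+e+K*ell1 x y t r" using eq[OF e] by blast
  define d where "d = e/(2*(K+1))"
  have d: "d > 0" using e K by (simp add: d_def)
  have "u p < u p+e" using e by simp
  from u1[OF this] K(2) have "NEAR h. \<forall>q\<in>ball p d \<inter> Q T. interpolant h (tau h) (V h) q < c"
  proof eventually_elim
  case (elim h)
  show ?case
  proof
  fix q assume q: "q \<in> ball p d \<inter> Q T"
  obtain x t y r where pq: "q = (x, t)" "p = (y, r)" by (metis prod.collapse)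
  have "\<bar>x - y\<bar> < d" "\<bar>t - r\<bar> < d"
  using q dist_fst_le[of q p] dist_snd_le[of q p] by (auto simp: pq dist_real_def dist_commute)
  then have "K*ell1 x y t r <= K*(2*d)" using K by (intro mult_left_mono) auto
  also have "... <= (K+1)*(2*d)" using d by simp
  also have "... = e" using K(1) by (simp add: d_def field_simps)
  finally have "K*ell1 x y t r <= e" .
  moreover have "Z h q <= Z h p+e+K*ell1 x y t r" using elim(2) q p(1) unfolding pq by (auto simp: Q_def)
  moreover have "u p+e+e+e < c" using e unfolding e_def by (simp add: field_simps)
  ultimately show "interpolant h (tau h) (V h) q < c" using elim(1) unfolding Z by linarith
  qed
  qed
  then show "\<exists>A. open A & p \<in> A & (NEAR h. \<forall>q\<in>A \<inter> Q T. interpolant h (tau h) (V h) q < c)"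
  using d by (intro exI[of _ "ball p d"]) auto
 next
  fix p c A assume p: "p \<in> Q T" "c < u p" "open A" "p \<in> A"
  show "\<exists>\<^sub>F h in at_right 0. \<exists>q\<in>A \<inter> Q T. c < interpolant h (tau h) (V h) q"
  using u2[OF p(2)] by (rule frequently_elim1) (use p Z in auto)
 qed
 ultimately show ?thesis using u1 by blast
qed

end

context approximation
begin

text \<open>No horizon occurs, since the discrete functions are defined for all times:
  \<open>W\<close> solves the equation on every strip. Rescaling in time and comparison at any given
  time rely on this.\<close>

definition solves :: "(real => real) => (real \<times> real => real) => bool" where
 "solves f W \<longleftrightarrow> equi W & (\<forall>p. \<bar>W p\<bar> <= M) & (\<forall>x. W (x, 0) = f x) &
  (\<forall>T>0. int_sub m s T W & int_super m s T W) &
  (\<forall>p. 0 <= snd p --> ((%h. Vb f h p) \<longlongrightarrow> W p) (at_right 0))"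

text \<open>The upper limit \<open>u\<close> and the lower limit \<open>- l\<close> are ordered by
  construction. Comparison of the subsolution \<open>u\<close> with the supersolution
  \<open>- l\<close> gives the converse order, so the whole family converges.\<close>

theorem existence:
 assumes f: "adm f" "uniformly_continuous_on UNIV f" shows "\<exists>W. solves f W"
proof -
 define V where "V h = scheme m (om h) h (tau h) f" for h
 have Vj: "V h j = (step m (om h) h (tau h) ^^ j) (gr f h)" for h j unfolding V_def scheme_gr ..
 have ev: "NEAR h. 0 < tau h & 0 <= Lam h & grid_sub 1 m (om h) h (tau h) (Lam h) M (V h)" using ev_gr[OF f(1)]
 proof eventually_elim
  case (elim h)
  then show ?case using grid_sub_scheme(1)[OF m2, of "om h" h "tau h" "Lam h" M "gr f h"] unfolding Vj[symmetric] by simp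
 qed
 have ev': "NEAR h. 0 < tau h & 0 <= Lam h & grid_sub (-1) m (om h) h (tau h) (Lam h) M (%j i. - V h j i)" using ev_gr[OF f(1)]
 proof eventually_elim
  case (elim h)
  then show ?case using grid_sub_scheme(2)[OF m2, of "om h" h "tau h" "Lam h" M "gr f h"] unfolding Vj[symmetric] by simp
 qed
 have Z: "Vb f h = interpolant h (tau h) (V h)" for h unfolding Vb_def V_def ..
 have Z': "(%p. - Vb f h p) = interpolant h (tau h) (%j i. - V h j i)" for h unfolding Z by (rule ext) (simp add: interpolant_uminus)
 have bd': "NEAR h. \<forall>q. \<bar>- Vb f h q\<bar> <= M" using Vb_bound[OF f(1)] by simp
 have eq': "\<exists>K\<ge>0. NEAR h. \<forall>x y t r. 0 <= t --> 0 <= r -->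
  - Vb f h (x, t) <= - Vb f h (y, r)+gam+K*ell1 x y t r" if g0: "0 < gam" for gam
 proof -
  obtain K where K: "K \<ge> 0" "NEAR h. \<forall>x y t r. 0 <= t --> 0 <= r -->
  Vb f h (x, t) <= Vb f h (y, r)+gam+K*ell1 x y t r" using equicontinuity[OF f g0] by blast
  have "NEAR h. \<forall>x y t r. 0 <= t --> 0 <= r -->
  - Vb f h (x, t) <= - Vb f h (y, r)+gam+K*ell1 x y t r" using K(2)
  proof eventually_elim
  case (elim h)
  show ?case
  proof (intro allI impI)
  fix x y t r :: real assume "0 <= t" "0 <= r"
  then have "Vb f h (y, r) <= Vb f h (x, t)+gam+K*(\<bar>y - x\<bar>+\<bar>r - t\<bar>)" using elim by blast
  then show "- Vb f h (x, t) <= - Vb f h (y, r)+gam+K*ell1 x y t r" by (simp add: abs_minus_commute)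
  qed
  qed
  then show ?thesis using K(1) by blast
 qed
 obtain u where u: "equi u" "!!p. \<bar>u p\<bar> <= M" "!!x. u (x, 0) = f x" "!!T. 0 < T ==> int_sub m s T u"
  "!!p c. u p < c ==> NEAR h. Vb f h p < c"
  using relaxed_limit[OF _ ev tau0 Z Vb_bound[OF f(1)] equicontinuity[OF f] Vb_initial[OF f]] by blast
 obtain l where l: "equi l" "!!p. \<bar>l p\<bar> <= M" "!!x. l (x, 0) = - f x" "!!T. 0 < T ==> int_sub m s T l"
  "!!p c. l p < c ==> NEAR h. - Vb f h p < c" using relaxed_limit[OF _ ev' tau0 Z' bd' eq' tendsto_minus[OF Vb_initial[OF f]]] by blast
 have fM: "!!x. \<bar>f x\<bar> <= M" using f(1) by (simp add: adm_def)
 have env: "usc_env UNIV f x = f x" for x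
  by (rule usc_env_cont_on[of x UNIV f M]) (use fM uniformly_continuous_imp_continuous[OF f(2)] in auto)
 have ul: "u (x, t) <= - l (x, t)" if t: "0 <= t" for x t
 proof -
  \<comment> \<open>Comparison holds strictly below the horizon, so a later horizon is
    taken.\<close>
  define T where "T = t+1"
  have T: "0 < T" "t < T" using t by (simp_all add: T_def)
  have uB: "BUC_on (Qbar T) u" using u(1,2) by (intro equi_BUC)
  have "visc_subsol m s T f u" by (rule visc_subsolI[OF BUC_cont(1)[OF uB] continuous_on_usc[OF BUC_cont(2)[OF uB]] u(4)[OF T(1)]])
  (simp add: env u(3))
  moreover have "int_super m s T (%p. - l p)" unfolding int_super_iff[OF s01] using l(4)[OF T(1)] by simp
  moreover have "BUC_on (Qbar T) (%p. - l p)" using l(1,2) by (intro BUC_on_uminus equi_BUC)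
  moreover have "usc_env UNIV f x <= - l (x, 0)" for x unfolding env l(3) by simp
  ultimately show ?thesis using comparison[OF s01 m2 T(1) _ _ _ _ t T(2)] by blast
 qed
 have lim: "((%h. Vb f h p) \<longlongrightarrow> u p) (at_right 0)" if "0 <= snd p" for p
 proof (rule order_tendstoI)
  fix a assume "a < u p"
  then have "l p < - a" using ul[OF that, of "fst p"] by simp
  then have "NEAR h. - Vb f h p < - a" by (rule l(5))
  then show "NEAR h. a < Vb f h p" by eventually_elim simp
 qed (rule u(5))
 have ule: "u p = - l p" if "0 <= snd p" for p
 proof (rule antisym)
  show "u p <= - l p" using ul[OF that, of "fst p"] by simp
  show "- l p <= u p"
  proof (rule ccontr)
  assume "\<not> - l p <= u p"
  then have c: "u p < (u p - l p)/2" "l p < - ((u p - l p)/2)" by (simp_all add: field_simps)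
  from u(5)[OF c(1)] l(5)[OF c(2)] have "\<forall>\<^sub>F h in at_right (0::real). False" by eventually_elim simp
  then show False by simp
  qed
 qed
 have "int_super m s T u" if "0 < T" for T unfolding int_super_iff[OF s01] int_sub_def
 proof (intro allI impI)
  fix phi x0 t0 assume "C2_on (Q T) phi & Cb_on (Q T) phi & max_point (Q T) (%p. - u p - phi p) (x0, t0)"
  moreover have "- u q = l q" if "q \<in> Q T" for q using ule[of q] that by (auto simp: Q_def)
  ultimately have "C2_on (Q T) phi & Cb_on (Q T) phi & max_point (Q T) (%p. l p - phi p) (x0, t0)" unfolding max_point_def by auto
  then show "eq_op m s T phi x0 t0 <= 0" using l(4)[OF \<open>0 < T\<close>] unfolding int_sub_def by blast
 qed
 then show ?thesis unfolding solves_def using u lim by blast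
qed

end

section \<open>Locally uniform convergence and uniqueness\<close>

lemma uniform_limit_locally:
 fixes l :: "'a::topological_space => 'b::metric_space"
 assumes "compact K"
  and loc: "!!p e. p \<in> K ==> 0 < e ==> \<exists>A. open A & p \<in> A & (\<forall>\<^sub>F h in F. \<forall>q\<in>A \<inter> K. dist (g h q) (l q) < e)"
 shows "uniform_limit K g l F" unfolding uniform_limit_iff
proof (intro allI impI)
 fix e :: real assume e: "0 < e"
 have "\<forall>p\<in>K. \<exists>A. open A & p \<in> A & (\<forall>\<^sub>F h in F. \<forall>q\<in>A \<inter> K. dist (g h q) (l q) < e)"
  using loc e by blast
 from bchoice[OF this] obtain A where A: "\<forall>p\<in>K. open (A p) & p \<in> A p & (\<forall>\<^sub>F h in F. \<forall>q\<in>A p \<inter> K. dist (g h q) (l q) < e)"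
  by blast
 obtain C where C: "C \<subseteq> K" "finite C" "K \<subseteq> (\<Union>p\<in>C. A p)"
 proof (rule compactE_image[OF assms(1), of K A])
  show "open (A p)" if "p \<in> K" for p using A that by blast
  show "K \<subseteq> (\<Union>p\<in>K. A p)" using A by blast
 qed (rule that)
 have "\<forall>\<^sub>F h in F. \<forall>p\<in>C. \<forall>q\<in>A p \<inter> K. dist (g h q) (l q) < e"
  using C(1,2) A by (intro eventually_ball_finite) blast+
 then show "\<forall>\<^sub>F h in F. \<forall>q\<in>K. dist (g h q) (l q) < e" by eventually_elim (use C(3) in blast)
qed

lemma lsc_env_cont_on:
 fixes f :: "'a::topological_space => real"
 assumes "p \<in> S" "!!q. q \<in> S ==> \<bar>f q\<bar> <= B" "continuous_on S f" shows "lsc_env S f p = f p"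
proof -
 have "usc_env S (%q. - f q) p = - f p"
  by (rule usc_env_cont_on[OF assms(1)]) (use assms in \<open>auto intro: continuous_on_minus\<close>)
 then show ?thesis using lsc_env_eq[OF assms(1,2)] by simp
qed

lemma Qbar_final_time:
 assumes T: "0 < T" and w: "continuous_on (Qbar T) w" "continuous_on (Qbar T) v"
  and eq: "!!x t. 0 <= t ==> t < T ==> w (x, t) = v (x, t)" and p: "p \<in> Qbar T" shows "w p = (v p :: real)"
proof -
 obtain x t where xt: "p = (x, t)" by (cases p)
 show ?thesis
 proof (cases "t < T")
  case True then show ?thesis using eq p xt by (auto simp: Qbar_def)
 next
  case False
  then have t: "t = T" using p xt by (auto simp: Qbar_def)
  define r where "r n = T - T/real (n+2)" for n :: nat
  have rin: "0 <= r n" "r n < T" for n using T by (auto simp: r_def field_simps)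
  have "(%n. T/real (n+2)) \<longlonglongrightarrow> 0" by (rule LIMSEQ_ignore_initial_segment[OF lim_const_over_n])
  then have "r \<longlonglongrightarrow> T - 0" unfolding r_def[abs_def] by (intro tendsto_diff tendsto_const)
  then have lim: "(%n. (x, r n)) \<longlonglongrightarrow> p" unfolding xt t by (intro tendsto_Pair tendsto_const) simp
  have ev: "\<forall>\<^sub>F n in sequentially. (x, r n) \<in> Qbar T" using rin by (auto simp: Qbar_def less_imp_le)
  have "(%n. w (x, r n)) \<longlonglongrightarrow> w p" by (rule continuous_on_tendsto_compose[OF w(1) lim p ev])
  moreover have "(%n. v (x, r n)) \<longlonglongrightarrow> v p" by (rule continuous_on_tendsto_compose[OF w(2) lim p ev])
  moreover have "w (x, r n) = v (x, r n)" for n using eq rin by blast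
  ultimately show ?thesis using LIMSEQ_unique by simp
 qed
qed

context approximation
begin

lemma solves_locally_uniform:
 assumes f: "adm f" "uniformly_continuous_on UNIV f" and W: "solves f W" and p: "0 <= snd p" and e: "0 < e"
 shows "\<exists>A. open A & p \<in> A & (NEAR h. \<forall>q\<in>A. 0 <= snd q --> \<bar>Vb f h q - W p\<bar> < e & \<bar>W q - W p\<bar> < e)"
proof -
 have e4: "0 < e/4" using e by simp
 obtain K where K: "K \<ge> 0" "NEAR h. \<forall>x y t r. 0 <= t --> 0 <= r -->
  Vb f h (x, t) <= Vb f h (y, r)+e/4+K*ell1 x y t r" using equicontinuity[OF f e4] by blast
 have eW: "equi W" using W by (simp add: solves_def)
 obtain d1 where d1: "d1 > 0" "!!p q. 0 <= snd p ==> 0 <= snd q ==> dist p q < d1 ==> \<bar>W p - W q\<bar> < e"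
  using equi_uniform[OF eW e] by blast
 define d where "d = min d1 (e/(8*(K+1)))"
 have d: "d > 0" "d <= d1" "d <= e/(8*(K+1))" using d1 e K by (auto simp: d_def)
 have Kd: "K*(2*d) <= e/4"
 proof -
  have "K*(2*d) <= (K+1)*(2*(e/(8*(K+1))))" using K d by (intro mult_mono) auto
  also have "... = e/4" using K(1) by (simp add: field_simps)
  finally show ?thesis .
 qed
 have "((%h. Vb f h p) \<longlongrightarrow> W p) (at_right 0)" using W p unfolding solves_def by blast
 from tendstoD[OF this e4] K(2)
 have "NEAR h. \<forall>q\<in>ball p d. 0 <= snd q --> \<bar>Vb f h q - W p\<bar> < e & \<bar>W q - W p\<bar> < e"
 proof eventually_elim
  case (elim h)
  show ?case
  proof (intro ballI impI)
  fix q assume q: "q \<in> ball p d" "0 <= snd q"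
  obtain x t y r where pq: "q = (x, t)" "p = (y, r)" by (metis prod.collapse)
  have "\<bar>x - y\<bar> < d" "\<bar>t - r\<bar> < d"
  using q dist_fst_le[of q p] dist_snd_le[of q p] by (auto simp: pq dist_real_def dist_commute)
  then have "K*ell1 x y t r <= K*(2*d)" using K by (intro mult_left_mono) auto
  then have Kb: "K*ell1 x y t r <= e/4" using Kd by linarith
  have "Vb f h q <= Vb f h p+e/4+K*ell1 x y t r"
  "Vb f h p <= Vb f h q+e/4+K*(\<bar>y - x\<bar>+\<bar>r - t\<bar>)" using elim(2) q p unfolding pq by auto
  then have "Vb f h q <= Vb f h p+e/4+e/4" "Vb f h p <= Vb f h q+e/4+e/4"
  using Kb by (simp_all only: abs_minus_commute[of y x] abs_minus_commute[of r t])
  then have "\<bar>Vb f h q - Vb f h p\<bar> <= e/2" by linarith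
  moreover have "\<bar>Vb f h p - W p\<bar> < e/4" using elim(1) by (simp add: dist_real_def)
  ultimately have "\<bar>Vb f h q - W p\<bar> < e" using e by linarith
  moreover have "\<bar>W q - W p\<bar> < e" using q p d by (intro d1(2)) (auto simp: dist_commute)
  ultimately show "\<bar>Vb f h q - W p\<bar> < e & \<bar>W q - W p\<bar> < e" by simp
  qed
 qed
 then show ?thesis using d by (intro exI[of _ "ball p d"]) auto
qed

lemma solves_BUC: "solves f W ==> BUC_on (Qbar T) W" unfolding solves_def by (intro equi_BUC[of W M]) auto

theorem solves_main:
 assumes f: "adm f" "uniformly_continuous_on UNIV f" and W: "solves f W" and T: "0 < T"
 shows "loc_unif_conv (Qbar T) (Vb f) W" "visc_sol m s T f W"
  "!!w p. visc_sol m s T f w ==> p \<in> Qbar T ==> w p = W p"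
proof -
 have B: "BUC_on (Qbar T) W" by (rule solves_BUC[OF W])
 have fM: "!!x. \<bar>f x\<bar> <= M" using f(1) by (simp add: adm_def)
 have fc: "continuous_on UNIV f" by (rule uniformly_continuous_imp_continuous[OF f(2)])
 have env: "usc_env UNIV f x = f x" "lsc_env UNIV f x = f x" for x by (rule usc_env_cont_on[of x UNIV f M], auto simp: fM fc)
  (rule lsc_env_cont_on[of x UNIV f M], auto simp: fM fc)
 have W0: "W (x, 0) = f x" for x using W by (simp add: solves_def)
 have isol: "int_sub m s T W" "int_super m s T W" using W T by (auto simp: solves_def)
 show "loc_unif_conv (Qbar T) (Vb f) W" unfolding loc_unif_conv_def
 proof (intro allI impI)
  fix K assume K: "compact K & K \<subseteq> Qbar T"
  show "uniform_limit K (Vb f) W (at_right 0)"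
  proof (rule uniform_limit_locally)
  fix p e assume p: "p \<in> K" and e: "0 < (e::real)"
  have "0 <= snd p" using p K by (auto simp: Qbar_def)
  from solves_locally_uniform[OF f W this, of "e/2"] e obtain A where A: "open A" "p \<in> A"
  "NEAR h. \<forall>q\<in>A. 0 <= snd q --> \<bar>Vb f h q - W p\<bar> < e/2 & \<bar>W q - W p\<bar> < e/2" by auto
  from A(3) have "NEAR h. \<forall>q\<in>A \<inter> K. dist (Vb f h q) (W q) < e"
  proof eventually_elim
  case (elim h)
  show ?case
  proof
  fix q assume q: "q \<in> A \<inter> K"
  then have "0 <= snd q" using K by (auto simp: Qbar_def)
  then have "\<bar>Vb f h q - W p\<bar> < e/2" "\<bar>W q - W p\<bar> < e/2" using elim q by auto
  then show "dist (Vb f h q) (W q) < e" unfolding dist_real_def by linarith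
  qed
  qed
  then show "\<exists>A. open A & p \<in> A & (NEAR h. \<forall>q\<in>A \<inter> K. dist (Vb f h q) (W q) < e)" using A by blast
  qed (use K in simp)
 qed
 show "visc_sol m s T f W" unfolding visc_sol_def Cb_on_def
  by (intro conjI BUC_cont[OF B] visc_subsolI visc_supersolI continuous_on_usc continuous_on_lsc isol)
  (simp_all add: env W0)
 fix w p assume w: "visc_sol m s T f w" and p: "p \<in> Qbar T"
 have "w (x, t) = W (x, t)" if t: "0 <= t" "t < T" for x t
 proof (rule antisym)
  show "w (x, t) <= W (x, t)"
  by (rule comparison[OF s01 m2 T _ isol(2) B _ t]) (use w in \<open>auto simp: visc_sol_def env W0\<close>)
  show "W (x, t) <= w (x, t)"
  by (rule comparison_super[OF s01 m2 T fM _ isol(1) B _ t]) (use w in \<open>auto simp: visc_sol_def env W0\<close>)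
 qed
 moreover have "continuous_on (Qbar T) w" using w by (simp add: visc_sol_def Cb_on_def)
 ultimately show "w p = W p" using Qbar_final_time[OF T _ BUC_cont(2)[OF B] _ p] by blast
qed

end

section \<open>From the two CFL conditions to the monotonicity condition\<close>

lemma lap_grid_abs_le:
 assumes w: "weights w" and u: "!!i. \<bar>u i\<bar> <= M" shows "\<bar>lap_grid w u i\<bar> <= 2*M*wsum w"
proof -
 have M0: "0 <= M" using u[of 0] by linarith
 have d: "\<bar>u i - u (i+k)\<bar> <= 2*M" for k using u[of i] u[of "i+k"] by linarith
 have "lap_grid w u i <= lap_grid w (%i. 0) i+2*M*wsum w" by (rule lap_grid_le[OF w u, of _ 0]) (use d abs_le_iff in auto)
 moreover have "lap_grid w (%i. 0) i <= lap_grid w u i+2*M*wsum w"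
 proof (rule lap_grid_le[OF w _ u, of _ 0])
  show "0 - 0 <= u i - u (i+k)+2*M" for k using d[of k] by linarith
 qed simp
 ultimately show ?thesis by (simp add: abs_le_iff)
qed

context discretization
begin

lemma Cs_pos: "0 < Cs" using Am by (simp add: A_m_def)

lemma ev_moments: "NEAR h. 0 < h & weights (om h) & wsum (om h) <= Cs*h powr (- (2 * s)) &
  (\<Sum>\<^sub>\<infinity>k\<in>{k. \<bar>of_int k*h\<bar> > 1}. om h k) <= Cs &
  (\<Sum>k\<in>{k. 0 < \<bar>of_int k*h\<bar> & \<bar>of_int k*h\<bar> <= 1}. \<bar>h * of_int k\<bar> * om h k) <= Cs*rho s h"
proof -
 have "NEAR h.
  om h summable_on (UNIV - {0}) &
  (\<Sum>\<^sub>\<infinity>k\<in>UNIV - {0}. om h k) <= Cs*h powr (- (2 * s)) &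
  (\<Sum>\<^sub>\<infinity>k\<in>{k. \<bar>of_int k*h\<bar> > 1}. om h k) <= Cs &
  (\<Sum>k\<in>{k. 0 < \<bar>of_int k*h\<bar> & \<bar>of_int k*h\<bar> <= 1}. \<bar>h * of_int k\<bar> * om h k) <= Cs*rho s h"
  using Am unfolding A_m_def by blast
 with ev_weights show ?thesis by eventually_elim (simp add: wsum_def)
qed

text \<open>For grid functions with values in \<open>[- M, M]\<close> the slope bound is
  \<open>2 * M / h\<close>. With the crude bound \<open>2 * M * wsum\<close> for the Laplacian, the
  two terms of \<open>cfl\<close> are \<open>m - 1\<close> times and once
  \<open>Lam powr (m - 1) * wsum\<close>, whence the factor \<open>m\<close> in (CFL1).\<close>

lemma approximation_CFL1:
 assumes M: "0 < M" and tau: "NEAR h. 0 < tau h" and cfl1: "NEAR h. (Cs*m*(2*M) powr (m - 1))*tau h <= h powr (2 * s+m - 1)"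
 shows "approximation s m Cs om tau (%h. 2*M/h) M"
proof
 define c where "c = Cs*m*(2*M) powr (m - 1)"
 have c: "0 < c" using Cs_pos m2 M by (simp add: c_def)
 show "NEAR h. cfl m (om h) h (tau h) (2*M/h) M" using ev_moments tau cfl1
 proof eventually_elim
  case (elim h)
  then have h: "0 < h" "0 < tau h" "weights (om h)" by auto
  define S where "S = wsum (om h)"
  have S: "0 <= S" "S <= Cs*h powr (- (2 * s))" using elim wsum_nonneg by (auto simp: S_def)
  define La where "La = 2*M/h"
  have La: "0 < La" using M h by (simp add: La_def)
  have "tau h*((m - 1)*La powr (m - 2)*\<bar>lap_grid (om h) u i\<bar>/h+La powr (m - 1)*S) <= 1"
  if u: "u \<in> gclass La M h" for u i
  proof -
  have "\<bar>lap_grid (om h) u i\<bar> <= 2*M*S" unfolding S_def by (rule lap_grid_abs_le[OF h(3)]) (rule gclassD(3)[OF u])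
  then have "(m - 1)*La powr (m - 2)*\<bar>lap_grid (om h) u i\<bar>/h <= (m - 1)*La powr (m - 2)*(2*M*S)/h"
  using m2 h by (intro divide_right_mono mult_left_mono) auto
  also have "... = (m - 1)*(La powr (m - 2)*La)*S" by (simp add: La_def)
  also have "La powr (m - 2)*La = La powr (m - 1)" using La powr_mult_base[of La "m - 2"] by (simp add: mult.commute)
  finally have "(m - 1)*La powr (m - 2)*\<bar>lap_grid (om h) u i\<bar>/h+La powr (m - 1)*S <= m*La powr (m - 1)*S"
  by (simp add: algebra_simps)
  also have "... <= m*La powr (m - 1)*(Cs*h powr (- (2 * s)))" using S m2 by (intro mult_left_mono) auto
  also have "... = c*h powr (- (2 * s+m - 1))"
  proof -
  have "La powr (m - 1) = (2*M) powr (m - 1)*h powr (- (m - 1))"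
  using h M unfolding La_def by (simp add: powr_divide powr_minus_divide del: minus_diff_eq)
  moreover have "h powr (- (m - 1))*h powr (- (2 * s)) = h powr (- (2 * s+m - 1))" by (simp add: powr_add[symmetric] algebra_simps)
  ultimately show ?thesis unfolding c_def by (simp add: mult_ac)
  qed
  finally have "tau h*((m - 1)*La powr (m - 2)*\<bar>lap_grid (om h) u i\<bar>/h+La powr (m - 1)*S)
  <= tau h*(c*h powr (- (2 * s+m - 1)))" using h by (intro mult_left_mono) auto
  also have "... = (c*tau h)*h powr (- (2 * s+m - 1))" by simp
  also have "... <= h powr (2 * s+m - 1)*h powr (- (2 * s+m - 1))" using elim unfolding c_def by (intro mult_right_mono) auto
  also have "... = 1" using h by (simp add: powr_add[symmetric])
  finally show ?thesis .
  qed
  then show ?case unfolding cfl_def La_def S_def using h La unfolding La_def by auto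
 qed
 show "(tau \<longlongrightarrow> 0) (at_right 0)"
 proof (rule tendsto_sandwich[of "%h. 0" _ _ "%h. h powr (2 * s+m - 1)/c"])
  show "NEAR h. 0 <= tau h" using tau by eventually_elim simp
  show "NEAR h. tau h <= h powr (2 * s+m - 1)/c"
  using cfl1 by eventually_elim (use c in \<open>simp add: c_def le_divide_eq mult.commute\<close>)
  have "((%h. h powr (2 * s+m - 1)/c) \<longlongrightarrow> 0/c) (at_right 0)"
  by (intro tendsto_divide tendsto_const tendsto_zero_powrI[where b = "2 * s+m - 1"] tendsto_ident_at)
  (use s0 m2 c in \<open>auto simp: eventually_at_right_field intro!: exI[of _ 1]\<close>)
  then show "((%h. h powr (2 * s+m - 1)/c) \<longlongrightarrow> 0) (at_right 0)" by simp
 qed simp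
qed

text \<open>For nondecreasing \<open>u\<close> the second difference is a difference of two
  nonnegative increments, so it is bounded by the larger one and not by their sum. The constant of
  (CFL2) relies on the factor 2 that this saves.\<close>

lemma lap_grid_class_bound:
 assumes h: "0 < h" and w: "weights w" and u: "u \<in> gclass L M h" and L: "0 <= L"
 shows "\<bar>lap_grid w u i\<bar> <= (L*(\<Sum>k\<in>{k. 0 < \<bar>of_int k*h\<bar> & \<bar>of_int k*h\<bar> <= 1}. \<bar>h * of_int k\<bar>*w k)
  + 2*M*(\<Sum>\<^sub>\<infinity>k\<in>{k. \<bar>of_int k*h\<bar> > 1}. w k))/2"
proof -
 define A where "A = {k::int. 0 < \<bar>of_int k*h\<bar> & \<bar>of_int k*h\<bar> <= 1}"
 define B where "B = {k::int. \<bar>of_int k*h\<bar> > 1}"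
 have AB: "A \<inter> B = {}" "A \<union> B = UNIV - {0}" using h by (auto simp: A_def B_def not_le)
 have fA: "finite A"
 proof (rule finite_subset)
  show "A \<subseteq> {- \<lceil>1/h\<rceil>..\<lceil>1/h\<rceil>}"
  proof
  fix k assume "k \<in> A"
  then have "\<bar>of_int k :: real\<bar> <= 1/h" using h by (simp add: A_def abs_mult le_divide_eq)
  then show "k \<in> {- \<lceil>1/h\<rceil>..\<lceil>1/h\<rceil>}" unfolding atLeastAtMost_iff by linarith
  qed
 qed simp
 have wB: "w summable_on B" by (rule summable_on_subset_banach[OF weightsD(1)[OF w]]) (use AB in auto)
 define d where "d k = 2*u i - u (i+k) - u (i - k)" for k
 have up: "u j <= u (j+int n)" "u (j+int n) <= u j+real n*(L*h)" for j n
 proof (induction n)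
  case (Suc n)
  have "u (j+int n) <= u (j+int n+1)" "u (j+int n+1) - u (j+int n) <= L*h" by (rule gclassD[OF u])+
  moreover have "j+int (Suc n) = j+int n+1" by simp
  ultimately show "u j <= u (j+int (Suc n))" "u (j+int (Suc n)) <= u j+real (Suc n)*(L*h)"
  using Suc by (simp_all only: of_nat_Suc distrib_right)
 qed simp_all
 have db0: "\<bar>d k\<bar> <= L*\<bar>h * of_int k\<bar> & \<bar>d k\<bar> <= 2*M" if "0 <= k" for k
 proof -
  define n where "n = nat k"
  have k: "k = int n" using that by (simp add: n_def)
  have a: "u i <= u (i+k)" "u (i+k) <= u i+real n*(L*h)" unfolding k by (rule up)+
  have b: "u (i - k) <= u i" "u i <= u (i - k)+real n*(L*h)" using up[of "i - k" n] unfolding k by simp_all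
  have "real n*(L*h) = L*\<bar>h * of_int k\<bar>" using h unfolding k by (simp add: abs_mult)
  then have "\<bar>d k\<bar> <= L*\<bar>h * of_int k\<bar>" using a b unfolding d_def by linarith
  moreover have "\<bar>d k\<bar> <= 2*M"
  using a b gclassD(3)[OF u, of i] gclassD(3)[OF u, of "i+k"] gclassD(3)[OF u, of "i - k"] unfolding d_def by linarith
  ultimately show ?thesis by simp
 qed
 have db: "\<bar>d k\<bar> <= L*\<bar>h * of_int k\<bar>" "\<bar>d k\<bar> <= 2*M" for k
 proof -
  have "d (- k) = d k" by (simp add: d_def)
  then show "\<bar>d k\<bar> <= L*\<bar>h * of_int k\<bar>" "\<bar>d k\<bar> <= 2*M"
  using db0[of k] db0[of "- k"] by (cases "0 <= k"; simp add: abs_mult)+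
 qed
 \<comment> \<open>A step function on the line, sampled with mesh 1, so that
   \<open>lap_h_sdiff\<close> can symmetrise the sum over the grid.\<close>
 define phi where "phi x = u (\<lfloor>x\<rfloor>+i)" for x :: real
 have phiB: "\<bar>phi x\<bar> <= M" for x unfolding phi_def by (rule gclassD(3)[OF u])
 have l1: "lap_grid w u i = lap_h w 1 phi 0" unfolding lap_h_def lap_grid_def phi_def by (simp add: add.commute)
 have l2: "sdiff phi 0 (of_int k*1) = d k" for k
 proof -
  have "\<lfloor>- real_of_int k\<rfloor> = - k" by (metis floor_of_int of_int_minus)
  then show ?thesis unfolding sdiff_def phi_def d_def by (simp add: add.commute)
 qed
 have le: "lap_grid w u i = (\<Sum>\<^sub>\<infinity>k\<in>UNIV - {0}. d k*w k)/2" and sd: "(%k. d k*w k) summable_on (UNIV - {0})"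
  using lap_h_sdiff[where phi = phi and h = 1 and x = 0, OF w phiB] unfolding l2 l1 by auto
 have sdm: "(%k. - (d k*w k)) summable_on (UNIV - {0})" unfolding summable_on_uminus by (rule sd)
 define e where "e k = (if k \<in> A then L*(\<bar>h * of_int k\<bar>*w k) else 2*M*w k)" for k
 have eA: "e summable_on A" using fA by (rule summable_on_finite)
 have eB: "e summable_on B"
 proof -
  have "(%k. 2*M*w k) summable_on B" by (rule summable_on_cmult_right[OF wB])
  moreover have "e k = 2*M*w k" if "k \<in> B" for k using that AB by (auto simp: e_def)
  ultimately show ?thesis using summable_on_cong[of B e "%k. 2*M*w k"] by blast
 qed
 have es: "e summable_on (UNIV - {0})" unfolding AB(2)[symmetric] by (rule summable_on_Un_disjoint[OF eA eB AB(1)])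
 have "infsum e (UNIV - {0}) = infsum e A+infsum e B" unfolding AB(2)[symmetric] by (rule infsum_Un_disjoint[OF eA eB AB(1)])
 also have "infsum e A = L*(\<Sum>k\<in>A. \<bar>h * of_int k\<bar>*w k)" using fA by (simp add: e_def sum_distrib_left)
 also have "infsum e B = (\<Sum>\<^sub>\<infinity>k\<in>B. 2*M*w k)" by (rule infsum_cong) (use AB in \<open>auto simp: e_def\<close>)
 also have "... = 2*M*infsum w B" by (rule infsum_cmult_right')
 finally have E: "infsum e (UNIV - {0}) = L*(\<Sum>k\<in>A. \<bar>h * of_int k\<bar>*w k)+2*M*infsum w B" .
 have b: "\<bar>d k*w k\<bar> <= e k" if "k \<in> UNIV - {0}" for k
 proof -
  have "0 <= w k" using weightsD(2)[OF w] that by simp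
  then show ?thesis using db[of k] mult_right_mono[of "\<bar>d k\<bar>" _ "w k"] by (simp add: e_def abs_mult mult.assoc[symmetric])
 qed
 have "infsum (%k. d k*w k) (UNIV - {0}) <= infsum e (UNIV - {0})" by (rule infsum_mono[OF sd es]) (use b abs_le_iff in blast)
 moreover have "infsum (%k. - (d k*w k)) (UNIV - {0}) <= infsum e (UNIV - {0})"
  by (rule infsum_mono[OF sdm es]) (use b abs_le_iff in blast)
 ultimately have "\<bar>lap_grid w u i\<bar> <= infsum e (UNIV - {0})/2" unfolding le infsum_uminus by (simp add: abs_le_iff)
 then show ?thesis unfolding E A_def B_def .
qed

lemma approximation_CFL2:
 assumes L: "0 < L" and M: "0 <= M" and tau: "NEAR h. 0 < tau h" and cfl2: "NEAR h.
  (Cs*m*(if m = 2 then 1 else L powr (m - 2))*max L (2*M))*tau h <= h powr (max (2 * s) 1)*f_cfl s h"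
 shows "approximation s m Cs om tau (%h. L) M"
proof
 define A where "A = max L (2*M)"
 define P where "P = L powr (m - 2)"
 define c where "c = Cs*m*P*A"
 have A: "0 < A" "L <= A" "2*M <= A" using L by (auto simp: A_def)
 have P: "0 < P" using L by (simp add: P_def)
 have c: "0 < c" using Cs_pos m2 A P by (simp add: c_def)
 \<comment> \<open>For \<open>L > 0\<close> the case distinction at \<open>m = 2\<close> disappears,
   as \<open>L powr 0 = 1\<close>.\<close>
 have ce: "Cs*m*(if m = 2 then 1 else L powr (m - 2))*max L (2*M) = c" unfolding c_def A_def P_def using L by simp
 \<comment> \<open>Below \<open>exp (- 1)\<close> one has \<open>1 <= \<bar>ln h\<bar>\<close>,
   which tames \<open>rho\<close> and \<open>f_cfl\<close> in the critical case
   \<open>s = 1/2\<close>.\<close>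
 have small: "\<forall>\<^sub>F h in at_right (0::real). h < exp (- 1)" by (rule order_tendstoD(2)[OF tendsto_ident_at]) simp
 have lnh: "1 <= \<bar>ln h\<bar>" "h < 1" "ln h <= - 1" if "0 < h" "h < exp (- 1)" for h :: real
 proof -
  have "ln h < ln (exp (- 1))" using that by (subst ln_less_cancel_iff) auto
  then show "ln h <= - 1" by simp
  then show "1 <= \<bar>ln h\<bar>" by simp
  have "exp (- 1) < (1::real)" by simp
  then show "h < 1" using that by linarith
 qed
 show "NEAR h. cfl m (om h) h (tau h) L M" using ev_moments tau cfl2 small
 proof eventually_elim
  case (elim h)
  then have h: "0 < h" "0 < tau h" "weights (om h)" "h < exp (- 1)" by auto
  \<comment> \<open>The reciprocal of the power of \<open>h\<close> allowed by (CFL2). In each of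
    the three ranges of \<open>s\<close> it dominates both the total mass of the weights, up to
    \<open>Cs\<close>, and the bound on the grid Laplacian divided by \<open>h\<close>, up to
    \<open>A * Cs\<close>.\<close>
  define X where "X = 1/(h powr (max (2 * s) 1)*f_cfl s h)"
  have fpos: "0 < f_cfl s h" using lnh[OF h(1,4)] by (auto simp: f_cfl_def)
  have h1: "h < 1" by (rule lnh(2)[OF h(1,4)])
  have hm: "1 <= h powr (- a)" if "0 <= a" for a using powr_mono'[of "- a" 0 h] that h h1 by simp
  have X1: "h powr (- (2 * s)) <= X" and X2: "(rho s h+1)/(2*h) <= X"
  proof -
  consider "s < 1/2" | "s = 1/2" | "1/2 < s" by linarith
  then have "h powr (- (2 * s)) <= X & (rho s h+1)/(2*h) <= X"
  proof cases
  case 1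
  then have "X = 1/h" using h by (simp add: X_def f_cfl_def max_def)
  moreover have "h powr (- (2 * s)) <= h powr (- 1)" using h h1 1 by (intro powr_mono') auto
  moreover have "h powr (- 1) = 1/h" using h by (simp add: powr_minus divide_inverse)
  ultimately show ?thesis using 1 h by (simp add: rho_def)
  next
  case 2
  then have mx: "max (2 * s) 1 = 1" by simp
  have f: "f_cfl s h = 1/\<bar>ln h\<bar>" using 2 by (simp add: f_cfl_def)
  have X: "X = \<bar>ln h\<bar>/h" unfolding X_def mx f using h by simp
  have e: "2 * s = 1" using 2 by simp
  have r: "rho s h = \<bar>ln h\<bar>" using 2 by (simp add: rho_def)
  have "h powr (- (2 * s)) = 1/h" unfolding e using h by (simp add: powr_minus divide_inverse)
  also have "... <= X" unfolding X using lnh[OF h(1,4)] h by (intro divide_right_mono) auto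
  finally have 1: "h powr (- (2 * s)) <= X" .
  have "(rho s h+1)/(2*h) <= (2*\<bar>ln h\<bar>)/(2*h)" unfolding r using lnh[OF h(1,4)] h by (intro divide_right_mono) auto
  also have "... = X" unfolding X by simp
  finally show ?thesis using 1 by simp
  next
  case 3
  have mx: "max (2 * s) 1 = 2 * s" and f: "f_cfl s h = 1" using 3 by (simp_all add: f_cfl_def)
  have X: "X = h powr (- (2 * s))" unfolding X_def mx f by (simp add: powr_minus_divide)
  have r: "rho s h = h powr (1 - 2 * s)" using 3 by (simp add: rho_def)
  have "1 <= rho s h" using hm[of "2 * s - 1"] 3 unfolding r by simp
  then have "(rho s h+1)/(2*h) <= (2*rho s h)/(2*h)" using h by (intro divide_right_mono) auto
  also have "... = h powr (- (2 * s))"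
  proof -
  have "rho s h = h*h powr (- (2 * s))" unfolding r using powr_mult_base[of h "- (2 * s)"] h by simp
  then show ?thesis using h by simp
  qed
  finally show ?thesis unfolding X by simp
  qed
  then show "h powr (- (2 * s)) <= X" "(rho s h+1)/(2*h) <= X" by auto
  qed
  have "tau h*((m - 1)*P*\<bar>lap_grid (om h) u i\<bar>/h+L powr (m - 1)*wsum (om h)) <= 1"
  if u: "u \<in> gclass L M h" for u i
  proof -
  have "\<bar>lap_grid (om h) u i\<bar> <= (L*(Cs*rho s h)+2*M * Cs)/2"
  proof -
  have "L*(\<Sum>k\<in>{k. 0 < \<bar>of_int k*h\<bar> & \<bar>of_int k*h\<bar> <= 1}. \<bar>h * of_int k\<bar> * om h k) <= L*(Cs*rho s h)"
  "2*M*(\<Sum>\<^sub>\<infinity>k\<in>{k. \<bar>of_int k*h\<bar> > 1}. om h k) <= 2*M * Cs"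
  using elim L M by (auto intro!: mult_left_mono)
  then have "(L*(\<Sum>k\<in>{k. 0 < \<bar>of_int k*h\<bar> & \<bar>of_int k*h\<bar> <= 1}. \<bar>h * of_int k\<bar> * om h k)
  + 2*M*(\<Sum>\<^sub>\<infinity>k\<in>{k. \<bar>of_int k*h\<bar> > 1}. om h k))/2 <= (L*(Cs*rho s h)+2*M * Cs)/2"
  by (intro divide_right_mono add_mono) auto
  with lap_grid_class_bound[OF h(1,3) u less_imp_le[OF L], of i] show ?thesis by (rule order_trans)
  qed
  also have "... <= (A*(Cs*rho s h)+A * Cs)/2"
  proof -
  have "0 <= rho s h" by (auto simp: rho_def)
  then show ?thesis using A Cs_pos by (intro divide_right_mono add_mono mult_right_mono) auto
  qed
  also have "... = A * Cs*((rho s h+1)/2)" by (simp add: algebra_simps add_divide_distrib)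
  finally have "\<bar>lap_grid (om h) u i\<bar>/h <= (A * Cs*((rho s h+1)/2))/h" using h by (intro divide_right_mono) auto
  also have "... = A * Cs*((rho s h+1)/(2*h))" by simp
  also have "... <= A * Cs*X" using X2 A Cs_pos by (intro mult_left_mono) auto
  finally have 1: "(m - 1)*P*(\<bar>lap_grid (om h) u i\<bar>/h) <= (m - 1)*P*(A * Cs*X)" using m2 P by (intro mult_left_mono) auto
  have X0: "0 <= X" using X1 powr_ge_zero[of h "- (2 * s)"] by linarith
  have "L powr (m - 1)*wsum (om h) <= (P*A)*(Cs*X)"
  proof (intro mult_mono)
  have "L powr (m - 1) = P*L" unfolding P_def using L powr_mult_base[of L "m - 2"] by (simp add: mult.commute)
  then show "L powr (m - 1) <= P*A" using A P by (simp add: mult_left_mono)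
  have "wsum (om h) <= Cs*h powr (- (2 * s))" using elim by simp
  also have "... <= Cs*X" using X1 Cs_pos by (intro mult_left_mono) auto
  finally show "wsum (om h) <= Cs*X" .
  qed (use A P wsum_nonneg[OF h(3)] in auto)
  with 1 have "(m - 1)*P*\<bar>lap_grid (om h) u i\<bar>/h+L powr (m - 1)*wsum (om h) <= c*X"
  unfolding c_def by (simp add: algebra_simps)
  then have "tau h*((m - 1)*P*\<bar>lap_grid (om h) u i\<bar>/h+L powr (m - 1)*wsum (om h)) <= tau h*(c*X)"
  using h by (intro mult_left_mono) auto
  also have "... = (c*tau h)*X" by simp
  also have "... <= (h powr (max (2 * s) 1)*f_cfl s h)*X" using elim X0 unfolding ce by (intro mult_right_mono) auto
  also have "... = 1" unfolding X_def using h fpos by simp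
  finally show ?thesis .
  qed
  then show ?case unfolding cfl_def P_def using h L by auto
 qed
 show "(tau \<longlongrightarrow> 0) (at_right 0)"
 proof (rule tendsto_sandwich[of "%h. 0" _ _ "%h. h powr (max (2 * s) 1)/c"])
  show "NEAR h. 0 <= tau h" using tau by eventually_elim simp
  show "NEAR h. tau h <= h powr (max (2 * s) 1)/c" using cfl2 small eventually_at_right_less[of "0::real"]
  proof eventually_elim
  case (elim h)
  have "f_cfl s h <= 1" using lnh(1)[of h] elim by (auto simp: f_cfl_def divide_le_eq)
  then have "h powr (max (2 * s) 1)*f_cfl s h <= h powr (max (2 * s) 1)*1" by (intro mult_left_mono) auto
  then have "c*tau h <= h powr (max (2 * s) 1)" using elim(1) unfolding ce by linarith
  then show ?case using c by (simp add: le_divide_eq mult.commute)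
  qed
  have "((%h. h powr (max (2 * s) 1)/c) \<longlongrightarrow> 0/c) (at_right 0)"
  by (intro tendsto_divide tendsto_const tendsto_zero_powrI[where b = "max (2 * s) 1"] tendsto_ident_at)
  (use c in \<open>auto simp: eventually_at_right_field intro!: exI[of _ 1]\<close>)
  then show "((%h. h powr (max (2 * s) 1)/c) \<longlongrightarrow> 0) (at_right 0)" by simp
 qed simp
qed

end

section \<open>Jump data\<close>

lemma C2_on_affine:
 assumes f: "C2_on S f" and sub: "!!p. p \<in> S' ==> (al*fst p+bet, kap * snd p) \<in> S"
 shows "C2_on S' (%p. f (al*fst p+bet, kap * snd p))"
proof (rule C2_onE[OF f])
 fix fx ft fxx fxt ftx ftt
 assume d: "has_jet S f fx ft fxx fxt ftx ftt"
  and c: "continuous_on S fxx" "continuous_on S fxt" "continuous_on S ftx" "continuous_on S ftt"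
 define I where "I = (%p::real \<times> real. (al*fst p+bet, kap * snd p))"
 have ID: "(I has_derivative (%p. (al*fst p, kap * snd p))) (at p within S')" for p
  unfolding I_def by (auto intro!: derivative_eq_intros)
 have Ic: "continuous_on S' I" unfolding I_def by (intro continuous_intros)
 have IS: "I ` S' \<subseteq> S" using sub by (auto simp: I_def)
 have chain: "((%p. z * k (I p)) has_derivative (%(u, w). (z*al*A)*u+(z * kap*B)*w)) (at p within S')"
  if "(k has_derivative (%(u, w). A*u+B*w)) (at (I p) within S)" for k A B z p
 proof -
  have "(k has_derivative (%(u, w). A*u+B*w)) (at (I p) within I ` S')" by (rule has_derivative_subset[OF that IS])
  from has_derivative_mult_right[OF has_derivative_in_compose[OF ID this], of z]
  show ?thesis by (simp add: case_prod_unfold algebra_simps)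
 qed
 have cc: "continuous_on S' (%p. z * k (I p))" if "continuous_on S k" for k and z :: real
  by (intro continuous_intros continuous_on_compose2[OF that Ic IS])
 have inS: "I p \<in> S" if "p \<in> S'" for p using IS that by auto
 have "C2_on S' (%p. 1*f (I p))" unfolding C2_on_def by (rule exI[of _ "%p. (1*al)*fx (I p)"], rule exI[of _ "%p. (1 * kap)*ft (I p)"],
  rule exI[of _ "%p. ((1*al)*al)*fxx (I p)"], rule exI[of _ "%p. ((1*al) * kap)*fxt (I p)"],
  rule exI[of _ "%p. ((1 * kap)*al)*ftx (I p)"], rule exI[of _ "%p. ((1 * kap) * kap)*ftt (I p)"])
  (intro conjI ballI chain cc c d[THEN bspec, OF inS, THEN conjunct1]
  d[THEN bspec, OF inS, THEN conjunct2, THEN conjunct1] d[THEN bspec, OF inS, THEN conjunct2, THEN conjunct2])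
 then show ?thesis by (simp add: I_def)
qed

text \<open>Stretching by \<open>ro\<close> contributes \<open>ro powr (m - 1)\<close> through the
  slope and \<open>ro powr (2 * s)\<close> through the nonlocal term; the time factor
  \<open>mu\<close> compensates both.\<close>

lemma int_sub_affine:
 assumes s: "0 < s" "s < 1" and ro: "0 < ro" and mu: "mu = ro powr (m - 1+2 * s)" and u: "int_sub m s (mu*T) u"
 shows "int_sub m s T (%p. u (ro*fst p+b, mu * snd p))" unfolding int_sub_def
proof (intro allI impI, elim conjE)
 fix phi x0 t0
 assume phi: "C2_on (Q T) phi" "Cb_on (Q T) phi" and mx: "max_point (Q T) (%p. u (ro*fst p+b, mu * snd p) - phi p) (x0, t0)"
 have mu0: "0 < mu" using ro by (simp add: mu)
 have t0: "0 < t0" "t0 < T" using mx by (auto simp: max_point_def Q_def)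
 define y0 where "y0 = ro*x0+b"
 have r0: "0 < mu*t0" "mu*t0 < mu*T" using t0 mu0 by simp_all
 define psi where "psi = (%p. phi ((1/ro)*fst p+(- b/ro), (1/mu) * snd p))"
 have inQ: "((1/ro)*fst p+(- b/ro), (1/mu) * snd p) \<in> Q T" if "p \<in> Q (mu*T)" for p
  using that mu0 by (auto simp: Q_def field_simps)
 have psiC: "C2_on (Q (mu*T)) psi" unfolding psi_def by (rule C2_on_affine[OF phi(1) inQ])
 have psib: "Cb_on (Q (mu*T)) psi" unfolding Cb_on_def
 proof
  show "bounded (psi ` Q (mu*T))"
  by (rule bounded_subset[of "phi ` Q T"]) (use phi(2) inQ in \<open>auto simp: Cb_on_def psi_def\<close>)
  have "continuous_on (Q T) phi" using phi(2) by (simp add: Cb_on_def)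
  then show "continuous_on (Q (mu*T)) psi" unfolding psi_def
  by (rule continuous_on_compose2) (intro continuous_intros, rule image_subsetI, rule inQ)
 qed
 have inv: "(1/ro)*(ro*x+b)+(- b/ro) = x" "(1/mu)*(mu*t) = t"
  "ro*((1/ro)*x+(- b/ro))+b = x" "mu*((1/mu)*t) = t" for x t using ro mu0 by (simp_all add: field_simps)
 have "max_point (Q (mu*T)) (%p. u p - psi p) (y0, mu*t0)" unfolding max_point_def
 proof (intro conjI ballI)
  show "(y0, mu*t0) \<in> Q (mu*T)" using r0 by (simp add: Q_def)
  fix q assume q: "q \<in> Q (mu*T)"
  obtain y r where yr: "q = (y, r)" by (cases q)
  have "u (ro*fst p+b, mu * snd p) - phi p <= u (ro*x0+b, mu*t0) - phi (x0, t0)" if "p \<in> Q T" for p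
  using mx that unfolding max_point_def by auto
  from this[OF inQ[OF q]] show "u q - psi q <= u (y0, mu*t0) - psi (y0, mu*t0)" unfolding yr psi_def y0_def fst_conv snd_conv inv .
 qed
 then have le: "eq_op m s (mu*T) psi y0 (mu*t0) <= 0" using u psiC psib unfolding int_sub_def by blast
 show "eq_op m s T phi x0 t0 <= 0"
 proof (rule C2_on_Q[OF phi(1)])
  fix fx ft fxx
  assume f: "!!x t. 0 < t ==> t < T ==> C2d (%y. phi (y, t)) (%y. fx (y, t)) (%y. fxx (y, t))"
  "!!x t. 0 < t ==> t < T ==> ((%r. phi (x, r)) has_real_derivative ft (x, t)) (at t)"
  have bphi: "bounded (range (%y. phi (y, t0)))"
  by (rule bounded_subset[of "phi ` Q T"]) (use phi(2) t0 in \<open>auto simp: Cb_on_def Q_def\<close>)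
  have e1: "(%y. psi (y, mu*t0)) = (%y. phi ((1/ro)*y+(- b/ro), t0))" unfolding psi_def fst_conv snd_conv inv ..
  have Cpsi: "C2d (%y. psi (y, mu*t0)) (%y. (1/ro)*fx ((1/ro)*y+(- b/ro), t0))
  (%y. (1/ro)\<^sup>2*fxx ((1/ro)*y+(- b/ro), t0))" unfolding e1 by (rule C2d_affine[OF f(1)[OF t0]])
  have bpsi: "bounded (range (%y. psi (y, mu*t0)))" unfolding e1 by (rule bounded_subset[OF bphi]) auto
  have "((%r. phi (x0, (1/mu)*r+0)) has_real_derivative (1/mu)*ft (x0, t0)) (at (mu*t0))"
  by (rule DERIV_affine[where g = "%r. phi (x0, r)"]) (use f(2)[OF t0] mu0 in simp)
  moreover have "(%r. psi (y0, r)) = (%r. phi (x0, (1/mu)*r+0))" unfolding psi_def y0_def fst_conv snd_conv inv by simp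
  ultimately have dpsi: "((%r. psi (y0, r)) has_real_derivative (1/mu)*ft (x0, t0)) (at (mu*t0))" by simp
  have "sdiff (%y. psi (y, mu*t0)) y0 = (%z. sdiff (%y. phi (y, t0)) x0 ((1/ro)*z))"
  proof (rule ext)
  fix z
  have e: "(1/ro)*(y0+z)+(- b/ro) = x0+(1/ro)*z" "(1/ro)*(y0 - z)+(- b/ro) = x0 - (1/ro)*z"
  "(1/ro)*y0+(- b/ro) = x0" using ro unfolding y0_def by (simp_all add: field_simps)
  show "sdiff (%y. psi (y, mu*t0)) y0 z = sdiff (%y. phi (y, t0)) x0 ((1/ro)*z)" unfolding e1 sdiff_def e ..
  qed
  then have fle: "fl s (sdiff (%y. psi (y, mu*t0)) y0) = (1/ro) powr (2 * s)*fl s (sdiff (%y. phi (y, t0)) x0)"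
  using fl_scale[of "1/ro" s] ro by simp
  have x0e: "(1/ro)*y0+(- b/ro) = x0" unfolding y0_def by (rule inv)
  define F where "F = fl s (sdiff (%y. phi (y, t0)) x0)"
  define P where "P = \<bar>fx (x0, t0)\<bar> powr (m - 1)"
  have "eq_op m s (mu*T) psi y0 (mu*t0) = (1/mu)*ft (x0, t0)+\<bar>(1/ro)*fx (x0, t0)\<bar> powr (m - 1)*((1/ro) powr (2 * s)*F)"
  using eq_op_C2[where phi = psi and x = y0, OF s r0 Cpsi bpsi dpsi] unfolding fle x0e F_def .
  also have "\<bar>(1/ro)*fx (x0, t0)\<bar> powr (m - 1) = (1/ro) powr (m - 1)*P"
  using ro by (simp add: P_def abs_mult powr_mult powr_divide)
  also have "(1/mu)*ft (x0, t0)+(1/ro) powr (m - 1)*P*((1/ro) powr (2 * s)*F)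
  = (1/mu)*ft (x0, t0)+((1/ro) powr (m - 1)*(1/ro) powr (2 * s))*(P*F)" by simp
  also have "(1/ro) powr (m - 1)*(1/ro) powr (2 * s) = 1/mu" using ro unfolding mu powr_add[symmetric] by (simp add: powr_divide)
  also have "(1/mu)*ft (x0, t0)+(1/mu)*(P*F) = (1/mu)*(ft (x0, t0)+P*F)" by (simp add: algebra_simps)
  finally have "(1/mu)*(ft (x0, t0)+P*F) <= 0" using le by simp
  then have "ft (x0, t0)+P*F <= 0" using mu0 by (simp add: divide_le_0_iff)
  moreover have "eq_op m s T phi x0 t0 = ft (x0, t0)+P*F" unfolding P_def F_def
  by (rule eq_op_C2[OF s t0 f(1)[OF t0] bphi f(2)[OF t0]])
  ultimately show ?thesis by simp
 qed
qed

lemma int_super_affine: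
 assumes s: "0 < s" "s < 1" and ro: "0 < ro" and mu: "mu = ro powr (m - 1+2 * s)" and u: "int_super m s (mu*T) u"
 shows "int_super m s T (%p. u (ro*fst p+b, mu * snd p))"
 using int_sub_affine[OF s ro mu, of T "%p. - u p" b] u unfolding int_super_iff[OF s] by simp

lemma equi_affine:
 assumes "equi W" "0 < ro" "0 < mu" shows "equi (%p. W (ro*fst p+b, mu * snd p))" unfolding equi_def
proof (intro allI impI)
 fix gam :: real assume "0 < gam"
 then obtain K where K: "K \<ge> 0" "!!x y t r. 0 <= t ==> 0 <= r ==> W (x, t) <= W (y, r)+gam+K*ell1 x y t r"
  using assms(1) unfolding equi_def by blast
 have "W (ro*x+b, mu*t) <= W (ro*y+b, mu*r)+gam+K*(ro+mu)*ell1 x y t r"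
  if t: "0 <= t" "0 <= r" for x y t r
 proof -
  have "\<bar>(ro*x+b) - (ro*y+b)\<bar> = ro*\<bar>x - y\<bar>" "\<bar>mu*t - mu*r\<bar> = mu*\<bar>t - r\<bar>"
  using assms by (simp_all add: abs_mult right_diff_distrib[symmetric])
  moreover have "ro*\<bar>x - y\<bar> <= (ro+mu)*\<bar>x - y\<bar>" "mu*\<bar>t - r\<bar> <= (ro+mu)*\<bar>t - r\<bar>"
  using assms by (auto intro!: mult_right_mono)
  ultimately have "\<bar>(ro*x+b) - (ro*y+b)\<bar>+\<bar>mu*t - mu*r\<bar> <= (ro+mu)*ell1 x y t r" by (simp add: distrib_left)
  then have "K*(\<bar>(ro*x+b) - (ro*y+b)\<bar>+\<bar>mu*t - mu*r\<bar>) <= K*((ro+mu)*ell1 x y t r)"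
  using K(1) by (rule mult_left_mono)
  then show ?thesis using K(2)[of "mu*t" "mu*r" "ro*x+b" "ro*y+b"] t assms by (simp add: mult.assoc)
 qed
 then show "\<exists>K\<ge>0. \<forall>x y t r. 0 <= t --> 0 <= r --> W (ro*fst (x, t)+b, mu * snd (x, t)) <= W (ro*fst (y, r)+b, mu * snd (y, r))+gam+K*ell1 x y t r"
  using K(1) assms by (intro exI[of _ "K*(ro+mu)"]) auto
qed

lemma equi_comparison:
 assumes s: "0 < s" "s < 1" and m: "2 <= m" and U: "equi U" "!!p. \<bar>U p\<bar> <= M" "!!T. 0 < T ==> int_sub m s T U"
  and W: "equi W" "!!p. \<bar>W p\<bar> <= M" "!!T. 0 < T ==> int_super m s T W" and le: "!!x. U (x, 0) <= W (x, 0)" and t: "0 <= t"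
 shows "U (x, t) <= W (x, t)"
proof -
 define T where "T = t+1"
 have T: "0 < T" "t < T" using t by (simp_all add: T_def)
 have B: "BUC_on (Qbar T) U" "BUC_on (Qbar T) W" by (rule equi_BUC[OF U(1) U(2)] equi_BUC[OF W(1) W(2)])+
 have uc: "uniformly_continuous_on UNIV (%x. W (x, 0))" by (rule UC_slice[of T]) (use B(2) T in \<open>auto simp: BUC_on_def\<close>)
 have env: "usc_env UNIV (%x. W (x, 0)) x = W (x, 0)" for x
  by (rule usc_env_cont_on[of x UNIV "%x. W (x, 0)" M]) (use W(2) uniformly_continuous_imp_continuous[OF uc] in auto)
 have "visc_subsol m s T (%x. W (x, 0)) U"
  by (rule visc_subsolI[OF BUC_cont(1)[OF B(1)] continuous_on_usc[OF BUC_cont(2)[OF B(1)]] U(3)[OF T(1)]])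
  (simp add: env le)
 from comparison[OF s m T(1) this W(3)[OF T(1)] B(2) _ t T(2)] show ?thesis by (simp add: env)
qed

text \<open>For test functions that are constant along the curves on which a self-similar function
  is constant: contact along one time slice is then contact at all times, and no control of a time
  derivative has to be assumed.\<close>

lemma C2_on_similarity:
 assumes psi: "C2d psi psi1 psi2"
  and k: "!!t. 0 < t ==> (k has_real_derivative k1 t) (at t)" "!!t. 0 < t ==> (k1 has_real_derivative k2 t) (at t)"
  "continuous_on {0<..} k2" shows "C2_on (Q T) (%p. psi (a+(fst p - a) * k (snd p)))"
proof -
 define X where "X = (%p. a+(fst p - a) * k (snd p))"
 have pos: "0 < snd p" if "p \<in> Q T" for p using that by (auto simp: Q_def)
 have kd: "((%p. k (snd p)) has_derivative (%(u, w). 0*u+k1 (snd p)*w)) (at p within Q T)"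
  "((%p. k1 (snd p)) has_derivative (%(u, w). 0*u+k2 (snd p)*w)) (at p within Q T)" if "p \<in> Q T" for p
  by (rule has_derivative_snd_comp[OF k(1)[OF pos[OF that]]], rule has_derivative_snd_comp[OF k(2)[OF pos[OF that]]])
 have xd: "((%p. fst p - a) has_derivative (%(u, w). 1*u+0*w)) (at p within Q T)" for p
  by (auto intro!: derivative_eq_intros simp: case_prod_unfold)
 have prod: "((%p. f p*g p) has_derivative (%(u, w). (A*g p+f p * C)*u+(B*g p+f p*D)*w)) (at p within Q T)"
  if "(f has_derivative (%(u, w). A*u+B*w)) (at p within Q T)"
  "(g has_derivative (%(u, w). C*u+D*w)) (at p within Q T)" for f g A B C D p
  using has_derivative_mult[OF that] by (simp add: case_prod_unfold algebra_simps)
 have Xd: "(X has_derivative (%(u, w). k (snd p)*u+(fst p - a) * k1 (snd p)*w)) (at p within Q T)" if "p \<in> Q T" for p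
  using has_derivative_add[OF has_derivative_const prod[OF xd kd(1)[OF that]], of a] unfolding X_def by (simp add: case_prod_unfold)
 have comp: "((%p. f (X p)) has_derivative (%(u, w). f' (X p) * k (snd p)*u+f' (X p)*((fst p - a) * k1 (snd p))*w)) (at p within Q T)"
  if "!!x. (f has_real_derivative f' x) (at x)" "p \<in> Q T" for f f' p
 proof -
  have "(f has_derivative (*) (f' (X p))) (at (X p))" using that(1) unfolding has_field_derivative_def .
  from has_derivative_compose[OF Xd[OF that(2)] this] show ?thesis by (simp add: case_prod_unfold algebra_simps)
 qed
 have d: "!!x. (psi has_real_derivative psi1 x) (at x)" "!!x. (psi1 has_real_derivative psi2 x) (at x)"
  using psi unfolding C2d_def by blast+
 have kc: "continuous_on (Q T) (%p. k (snd p))" "continuous_on (Q T) (%p. k1 (snd p))"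
  by (rule has_derivative_continuous_on, erule kd)+
 have k2c: "continuous_on (Q T) (%p. k2 (snd p))"
  by (rule continuous_on_compose2[OF k(3)]) (use pos in \<open>auto intro: continuous_intros\<close>)
 have Xc: "continuous_on (Q T) X" using Xd by (rule has_derivative_continuous_on)
 have psic: "continuous_on (Q T) (%p. psi1 (X p))" "continuous_on (Q T) (%p. psi2 (X p))"
  by (rule continuous_on_compose2[OF C2d_cont(2)[OF psi] Xc], simp) (rule continuous_on_compose2[OF C2d_cont(3)[OF psi] Xc], simp)
 show ?thesis unfolding C2_on_def X_def[symmetric]
 proof (rule exI[of _ "%p. psi1 (X p) * k (snd p)"], rule exI[of _ "%p. psi1 (X p)*((fst p - a) * k1 (snd p))"],
  rule exI[of _ "%p. psi2 (X p) * k (snd p) * k (snd p)+psi1 (X p)*0"],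
  rule exI[of _ "%p. psi2 (X p)*((fst p - a) * k1 (snd p)) * k (snd p)+psi1 (X p) * k1 (snd p)"],
  rule exI[of _ "%p. psi2 (X p) * k (snd p)*((fst p - a) * k1 (snd p))+psi1 (X p)*(1 * k1 (snd p)+(fst p - a)*0)"],
  rule exI[of _ "%p. psi2 (X p)*((fst p - a) * k1 (snd p))*((fst p - a) * k1 (snd p))+psi1 (X p)*(0 * k1 (snd p)+(fst p - a) * k2 (snd p))"],
  intro conjI ballI)
  fix p assume p: "p \<in> Q T"
  have "(%p. psi (a+(fst p - a) * k (snd p))) = (%p. psi (X p))" by (simp add: X_def)
  then show "((%p. psi (a+(fst p - a) * k (snd p))) has_derivative
  (%(u, w). psi1 (X p) * k (snd p)*u+psi1 (X p)*((fst p - a) * k1 (snd p))*w)) (at p within Q T)" using comp[OF d(1) p] by simp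
  show "((%p. psi1 (X p) * k (snd p)) has_derivative
  (%(u, w). (psi2 (X p) * k (snd p) * k (snd p)+psi1 (X p)*0)*u+(psi2 (X p)*((fst p - a) * k1 (snd p)) * k (snd p)+psi1 (X p) * k1 (snd p))*w)) (at p within Q T)"
  by (rule prod[OF comp[OF d(2) p] kd(1)[OF p]])
  show "((%p. psi1 (X p)*((fst p - a) * k1 (snd p))) has_derivative
  (%(u, w). (psi2 (X p) * k (snd p)*((fst p - a) * k1 (snd p))+psi1 (X p)*(1 * k1 (snd p)+(fst p - a)*0))*u +
  (psi2 (X p)*((fst p - a) * k1 (snd p))*((fst p - a) * k1 (snd p))+psi1 (X p)*(0 * k1 (snd p)+(fst p - a) * k2 (snd p)))*w)) (at p within Q T)"
  by (rule prod[OF comp[OF d(2) p] prod[OF xd kd(2)[OF p]]])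
 qed (intro continuous_intros kc k2c psic)+
qed

section \<open>Exclusion of jumps at positive times\<close>

definition hbump :: "real => real" where "hbump y = 1 - inverse (1+max (- y - 1) 0 ^ 3)"

lemma hbump_bounds: "0 <= hbump y" "hbump y <= 1" "- 1 <= y ==> hbump y = 0" "y <= - 2 ==> 1/2 <= hbump y"
proof -
 define w where "w = max (- y - 1) 0 ^ 3"
 have w: "0 <= w" by (simp add: w_def)
 then have "inverse (1+w) <= 1" "0 <= inverse (1+w)" by (simp_all add: inverse_le_1_iff)
 then show "0 <= hbump y" "hbump y <= 1" unfolding hbump_def w_def[symmetric] by auto
 show "- 1 <= y ==> hbump y = 0" by (simp add: hbump_def max_def)
 assume "y <= - 2"
 then have "1 ^ 3 <= w" unfolding w_def by (intro power_mono) auto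
 then have "inverse (1+w) <= inverse 2" by (intro le_imp_inverse_le) auto
 then show "1/2 <= hbump y" unfolding hbump_def w_def[symmetric] by simp
qed

text \<open>The third power is the lowest integer one for which the positive part is C2; it lets
  \<open>hbump\<close> leave 0 smoothly at \<open>- 1\<close>.\<close>

lemma C2d_cube_plus: "C2d (%z. max z 0 ^ 3) (%z. 3*max z 0 ^ 2) (%z. 6*max z (0::real))"
proof -
 have D: "((%z. max z 0 ^ Suc n) has_real_derivative real (Suc n)*max x 0 ^ n) (at x)" if n: "0 < n" for n and x :: real
 proof -
  consider "x < 0" | "x = 0" | "0 < x" by linarith
  then show ?thesis
  proof cases
  case 1
  have "((%z::real. 0) has_real_derivative 0) (at x)" by simp
  then have "((%z. max z 0 ^ Suc n) has_real_derivative 0) (at x)" by (rule DERIV_cong_ev[THEN iffD1, rotated -1])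
  (use 1 in \<open>auto simp: eventually_nhds intro!: exI[of _ "{..<0}"]\<close>)
  moreover have "real (Suc n)*max x 0 ^ n = 0" using 1 n by (simp add: max_def)
  ultimately show ?thesis by metis
  next
  case 3
  have "((%z::real. z ^ Suc n) has_real_derivative real (Suc n)*x ^ n) (at x)" using DERIV_pow[of "Suc n" x UNIV] by simp
  then have "((%z. max z 0 ^ Suc n) has_real_derivative real (Suc n)*x ^ n) (at x)" by (rule DERIV_cong_ev[THEN iffD1, rotated -1])
  (use 3 in \<open>auto simp: eventually_nhds intro!: exI[of _ "{0<..}"]\<close>)
  then show ?thesis using 3 by simp
  next
  case 2
  have "((%h::real. max h 0 ^ Suc n/h) \<longlongrightarrow> 0) (at 0)"
  proof (rule Lim_null_comparison)
  show "\<forall>\<^sub>F h in at 0. norm (max h 0 ^ Suc n/h) <= \<bar>h\<bar> ^ n"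
  proof (intro always_eventually allI)
  fix h :: real
  show "norm (max h 0 ^ Suc n/h) <= \<bar>h\<bar> ^ n" by (cases "h <= 0") (auto simp: max_def)
  qed
  have "((%h::real. \<bar>h\<bar> ^ n) \<longlongrightarrow> \<bar>0\<bar> ^ n) (at 0)" by (intro tendsto_intros)
  then show "((%h::real. \<bar>h\<bar> ^ n) \<longlongrightarrow> 0) (at 0)" unfolding abs_zero zero_power[OF n] .
  qed
  moreover have z: "real (Suc n)*max x 0 ^ n = 0" using 2 n by (simp add: max_def)
  ultimately show ?thesis unfolding DERIV_def z using 2 by simp
  qed
 qed
 have "((%z. 3*max z 0 ^ 2) has_real_derivative 6*max x 0) (at x)" for x :: real
  using DERIV_cmult[OF D[of 1 x], of 3] by (simp add: numeral_2_eq_2)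
 moreover have "((%z. max z 0 ^ 3) has_real_derivative 3*max x 0 ^ 2) (at x)" for x :: real
  using D[of 2 x] by (simp add: numeral_3_eq_3)
 ultimately show ?thesis unfolding C2d_def by (auto intro!: continuous_intros)
qed

lemma C2d_hbump: "\<exists>b1 b2. C2d hbump b1 b2 & b1 0 = 0"
proof -
 have nz: "1+max (- 1*y+- 1) 0 ^ 3 ~= (0::real)" for y :: real
 proof -
  have "0 <= max (- 1*y+- 1) (0::real) ^ 3" by simp
  then show ?thesis by linarith
 qed
 note D = C2d_add[OF C2d_const[of 1] C2d_cmult[OF C2d_inverse[OF C2d_add[OF C2d_const[of 1] C2d_affine[OF C2d_cube_plus, of "-1" "-1"]] nz], of "-1"]]
 define b1 where "b1 = (%x::real. 0+- 1*(- (0+- 1*(3*(max (- 1*x+- 1) 0)\<^sup>2))/(1+max (- 1*x+- 1) 0 ^ 3)\<^sup>2))"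
 have "\<exists>b2. C2d (%x. 1+- 1*inverse (1+max (- 1*x+- 1) 0 ^ 3)) b1 b2" unfolding b1_def by (rule exI, rule D)
 then obtain b2 where "C2d (%x. 1+- 1*inverse (1+max (- 1*x+- 1) 0 ^ 3)) b1 b2" by (elim exE)
 then have "C2d hbump b1 b2" by (rule C2d_cong1) (simp_all add: hbump_def)
 moreover have "b1 0 = 0" by (simp add: b1_def)
 ultimately show ?thesis by (intro exI[of _ b1] exI[of _ b2] conjI)
qed

text \<open>\<open>hbump\<close> attains its minimum 0 at 0, so its second differences there are at
  most 0; that it is at least 1/2 to the left of \<open>- 2\<close> makes the integral strictly
  negative.\<close>

lemma fl_hbump_pos:
 assumes s: "0 < s" "s < 1" shows "kint s (sdiff hbump 0)" "fl s (sdiff hbump 0) < 0"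
proof -
 obtain b1 b2 where b: "C2d hbump b1 b2" using C2d_hbump by blast
 have bb: "bounded (range hbump)" by (rule bounded_rangeI[of _ 1]) (use hbump_bounds in \<open>simp add: abs_of_nonneg\<close>)
 show k: "kint s (sdiff hbump 0)" by (rule kint_sdiff[OF s C2_realI[OF b] bb])
 define I where "I = (%y::real. (1/2)*indicator {2..3} y :: real)"
 have kI: "kint s I"
 proof (rule kint_bound[OF s, of I "1/2"])
  show "I \<in> borel_measurable borel" unfolding I_def by measurable
  show "\<bar>I y\<bar> <= 1/2*min 1 (y\<^sup>2)" for y
  proof (cases "y \<in> {2..3}")
  case True
  then have "1 <= y\<^sup>2" by (simp add: one_le_power)
  then show ?thesis using True by (simp add: I_def)
  qed (simp add: I_def)
 qed
 have le: "I y <= - sdiff hbump 0 y" for y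
 proof -
  have "sdiff hbump 0 y = - (hbump y+hbump (- y))" using hbump_bounds(3)[of 0] by (simp add: sdiff_def)
  then show ?thesis using hbump_bounds(1)[of y] hbump_bounds(1)[of "- y"] hbump_bounds(4)[of "- y"] by (auto simp: I_def indicator_def)
 qed
 have "fl s I <= - fl s (sdiff hbump 0)" using fl_mono[OF s kI kint_minus[OF k] le] unfolding fl_minus .
 moreover have "0 < fl s I"
 proof -
  have k3: "kern s 3 <= kern s y" if "y \<in> {2..3}" for y unfolding kern_def using that s by (intro divide_left_mono powr_mono2) auto
  have "(LINT y|lborel. (1/2 * kern s 3)*indicator {2..3::real} y) <= (LINT y|lborel. I y * kern s y)"
  proof (rule integral_mono)
  show "integrable lborel (%y. (1/2 * kern s 3)*indicator {2..3::real} y)" by simp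
  show "integrable lborel (%y. I y * kern s y)" using kI unfolding kint_def .
  show "(1/2 * kern s 3)*indicator {2..3} y <= I y * kern s y" for y using k3[of y] by (auto simp: I_def indicator_def)
  qed
  moreover have "(LINT y|lborel. (1/2 * kern s 3)*indicator {2..3::real} y) = 1/2 * kern s 3" by simp
  moreover have "0 < kern s 3" by (simp add: kern_def)
  ultimately show ?thesis unfolding fl_def using c1_pos[OF s] by simp
 qed
 ultimately show "fl s (sdiff hbump 0) < 0" by linarith
qed

text \<open>Before \<open>hbump\<close> is subtracted, the profile lies above the line
  \<open>th * y\<close> up to \<open>y = 2\<close> and above \<open>th\<close> from
  \<open>y = 1\<close> on, so it majorises a function that is touched with slope \<open>th\<close>
  and rises by at most \<open>th\<close>. The subtraction follows the jump downwards on the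
  left.\<close>

definition jbump :: "real => real => real" where
 "jbump th y = th*(rf y+2*qf y) - hbump y"

lemma rf_qf_eq: "rf y+2*qf y = (y+2*y\<^sup>2)/(1+y\<^sup>2)" by (simp add: rf_def qf_def add_divide_distrib)

lemma rf_qf_ge:
 "y <= - 1 ==> 0 <= rf y+2*qf y" "- 1 <= rf y+2*qf y"
 "y <= 2 ==> y <= rf y+2*qf y" "1 <= y ==> 1 <= rf y+2*qf y"
proof -
 have d: "0 < 1+y\<^sup>2" by (rule one_plus_sq_pos)
 show "- 1 <= rf y+2*qf y" using rf_bound[of y] qf_nonneg[of y] by linarith
 show "0 <= rf y+2*qf y" if "y <= - 1"
 proof -
  have "0 <= (- y)*(- 1 - 2*y)" using that by (intro mult_nonneg_nonneg) auto
  then have "0 <= y+2*y\<^sup>2" by (simp add: algebra_simps power2_eq_square)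
  then show ?thesis unfolding rf_qf_eq using d by simp
 qed
 show "y <= rf y+2*qf y" if "y <= 2"
 proof -
  have "0 <= y\<^sup>2*(2 - y)" using that by simp
  then have "y*(1+y\<^sup>2) <= y+2*y\<^sup>2" by (simp add: algebra_simps power2_eq_square)
  then show ?thesis unfolding rf_qf_eq using d by (simp add: le_divide_eq)
 qed
 show "1 <= rf y+2*qf y" if "1 <= y"
 proof -
  have "y <= y*y" using that by simp
  then have "1+y\<^sup>2 <= y+2*y\<^sup>2" using that unfolding power2_eq_square by linarith
  then show ?thesis unfolding rf_qf_eq using d by (simp add: le_divide_eq)
 qed
qed

text \<open>The point \<open>xp\<close> maximises \<open>F\<close> minus a steep line just right of
  the jump. As \<open>F\<close> rises by at most \<open>th*J\<close> there, \<open>xp\<close> is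
  within \<open>E\<close> of \<open>x0\<close>; hence points more than \<open>E\<close> to its left
  are past the jump, where the drop by \<open>J\<close> pays for \<open>hbump\<close>. The term with
  \<open>R\<close> takes care of points to the right of the region where maximality is
  known.\<close>

lemma jump_touching:
 assumes F: "mono F" "!!x. \<bar>F x\<bar> <= M" and jump: "!!x. x < x0 ==> F x <= F x0 - J"
  and J: "0 < J" and th: "0 < th" "th <= 1" and E: "0 < E" "E <= R" and xp: "x0 <= xp" "xp <= x0+2 * R"
  and mx: "!!x. x0 <= x ==> x <= x0+2 * R ==> F x - th*J/E*(x - x0) <= F xp - th*J/E*(xp - x0)"
  and right: "!!x. x0 <= x ==> x <= x0+2 * R ==> F x <= F x0+th*J" shows "F z <= F xp+(J*jbump th ((z - xp)/E)+4*M*qf ((z - xp)/R))"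
proof -
 define p where "p = th*J/E"
 define y where "y = (z - xp)/E"
 have R: "0 < R" and thJ: "0 < th*J" and p0: "0 < p" using E J th by (auto simp: p_def)
 have pE: "p*E = th*J" using E by (simp add: p_def)
 have zy: "z - xp = E*y" using E by (simp add: y_def)
 have M: "0 <= M" using F(2)[of 0] by linarith
 have q: "0 <= 4*M*qf ((z - xp)/R)" using M qf_nonneg by simp
 have xp0: "F x0 <= F xp" by (rule monoD[OF F(1) xp(1)])
 have "p*(xp - x0) <= p*E" using mx[of x0] right[OF xp] R pE unfolding p_def[symmetric] by simp
 then have dE: "xp - x0 <= E" using p0 by simp
 note hb = hbump_bounds(1,2,3)[of y]
 note J1 = mult_left_mono[OF _ less_imp_le[OF J]]
 note T1 = mult_left_mono[OF _ less_imp_le[OF th(1)]]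
 note TJ = mult_left_mono[OF _ less_imp_le[OF thJ]]
 have jb: "J*jbump th y = th*J*(rf y+2*qf y) - J*hbump y" by (simp add: jbump_def algebra_simps)
 have Jh: "J*hbump y <= J*1" by (rule J1[OF hb(2)])
 have "F z <= F xp+J*jbump th y" if zR: "z < xp + R"
 proof (cases "z < x0")
  case True
  have Fz: "F z <= F xp - J" using jump[OF True] xp0 by linarith
  show ?thesis
  proof (cases "y <= - 1")
  case y: True
  have "th*J*0 <= th*J*(rf y+2*qf y)" by (rule TJ[OF rf_qf_ge(1)[OF y]])
  then show ?thesis using Fz Jh unfolding jb by linarith
  next
  case False
  have "th*J*(- 1) <= th*J*(rf y+2*qf y)" by (rule TJ[OF rf_qf_ge(2)])
  moreover have "th*J <= 1*J" using th J by (intro mult_right_mono) auto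
  moreover have "hbump y = 0" using False by (intro hb(3)) simp
  ultimately show ?thesis using Fz unfolding jb by simp
  qed
 next
  case False
  then have zx: "x0 <= z" by simp
  have z2: "z <= x0+2 * R" using zR dE E by linarith
  have "E*(- 1) <= E*y" using zx dE unfolding zy[symmetric] by linarith
  then have "- 1 <= y" using E by (simp only: mult_le_cancel_left_pos)
  then have h0: "hbump y = 0" by (rule hb(3))
  show ?thesis
  proof (cases "y <= 2")
  case True
  have "F z <= F xp+p*(z - xp)" using mx[OF zx z2] unfolding p_def[symmetric] by (simp add: algebra_simps)
  also have "p*(z - xp) = th*J*y" unfolding zy pE[symmetric] by simp
  also have "... <= th*J*(rf y+2*qf y)" by (rule TJ[OF rf_qf_ge(3)[OF True]])
  finally show ?thesis unfolding jb h0 by simp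
  next
  case y: False
  have "th*J*1 <= th*J*(rf y+2*qf y)" by (rule TJ[OF rf_qf_ge(4)]) (use y in simp)
  then show ?thesis using right[OF zx z2] xp0 unfolding jb h0 by linarith
  qed
 qed
 moreover have "F z <= F xp+(J*jbump th y+4*M*qf ((z - xp)/R))" if zR: "xp + R <= z"
 proof -
  have "E*1 <= E*y" using zR E unfolding zy[symmetric] by linarith
  then have y1: "1 <= y" using E by (simp only: mult_le_cancel_left_pos)
  have "hbump y = 0" using y1 by (intro hb(3)) simp
  moreover have "th*J*1 <= th*J*(rf y+2*qf y)" by (rule TJ[OF rf_qf_ge(4)[OF y1]])
  ultimately have "0 <= J*jbump th y" using thJ unfolding jb by simp
  moreover have "1 <= (z - xp)/R" using zR R by (simp add: le_divide_eq)
  then have "1 ^ 2 <= ((z - xp)/R)\<^sup>2" by (intro power_mono) auto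
  then have "1 <= 2*qf ((z - xp)/R)" using min_le_qf[of "(z - xp)/R"] by simp
  then have "2*M*1 <= 2*M*(2*qf ((z - xp)/R))" using M by (intro mult_left_mono) auto
  ultimately show ?thesis using F(2)[of z] F(2)[of xp] by (simp add: abs_le_iff)
 qed
 ultimately show ?thesis using q unfolding y_def[symmetric] by fastforce
qed

lemma C2d_jbump: "\<exists>j1 j2. C2d (jbump th) j1 j2 & j1 0 = th"
proof -
 obtain r1 r2 where r: "C2d rf r1 r2" "r1 0 = 1" using C2d_rf by (elim exE conjE)
 obtain q2 where q: "C2d qf (%z. 2*z/(1+z\<^sup>2)\<^sup>2) q2" using C2d_qf by (elim exE conjE)
 obtain b1 b2 where b: "C2d hbump b1 b2" "b1 0 = 0" using C2d_hbump by (elim exE conjE)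
 note D = C2d_add[OF C2d_cmult[OF C2d_add[OF r(1) C2d_cmult[OF q, of 2]], of th] C2d_cmult[OF b(1), of "- 1"]]
 define j1 where "j1 = (%x. th*(r1 x+2*(2*x/(1+x\<^sup>2)\<^sup>2))+- 1*b1 x)"
 have "\<exists>j2. C2d (%x. th*(rf x+2*qf x)+- 1*hbump x) j1 j2" unfolding j1_def by (rule exI, rule D)
 then obtain j2 where "C2d (%x. th*(rf x+2*qf x)+- 1*hbump x) j1 j2" by (elim exE)
 then have "C2d (jbump th) j1 j2" by (rule C2d_cong1) (simp_all add: jbump_def)
 moreover have "j1 0 = th" by (simp add: j1_def r b)
 ultimately show ?thesis by (intro exI[of _ j1] exI[of _ j2] conjI)
qed

lemma jbump_abs_le: "0 <= th ==> th <= 1 ==> \<bar>jbump th y\<bar> <= 4"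
proof -
 assume t: "0 <= th" "th <= 1"
 have "\<bar>rf y+2*qf y\<bar> <= 3" using rf_bound[of y] qf_less1[of y] qf_nonneg[of y] by linarith
 then have "\<bar>th\<bar>*\<bar>rf y+2*qf y\<bar> <= 1*3" using t by (intro mult_mono) auto
 then show ?thesis using hbump_bounds(1,2)[of y] unfolding jbump_def abs_mult[symmetric] by linarith
qed

lemma sdiff_jbump: "sdiff (jbump th) 0 y = (- (4*th))*qf y+(- 1) * sdiff hbump 0 y"
 by (simp add: sdiff_def jbump_def rf_def algebra_simps)

text \<open>The fractional Laplacian of the test function at the touching point is of order
 \<open>E\<close> to the power \<open>- 2 s\<close> and positive, since the test function follows the jump downwards
 on the left.\<close>

lemma no_jump:
 assumes s: "0 < s" "s < 1" and m: "2 <= m" and t0: "0 < t0" and sub: "int_sub m s (2*t0) u" and M: "!!p. \<bar>u p\<bar> <= M"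
  and sim: "!!x t. 0 < t ==> t < 2*t0 ==> u (x, t) = u (a+(x - a)*(t0/t) powr bet, t0)"
  and mono: "mono (%x. u (x, t0))" and usc: "usc_on UNIV (%x. u (x, t0))"
  and jump: "!!x. x < x0 ==> u (x, t0) <= u (x0, t0) - J" and J: "0 < J" and bet: "0 <= bet" shows False
proof -
 define F where "F = (%x. u (x, t0))"
 have M0: "0 <= M" using M[of 0] by linarith
 define qs where "qs = fl s qf"
 have qs: "0 <= qs" unfolding qs_def by (rule fl_qf_nonneg[OF s])
 define b where "b = - fl s (sdiff hbump 0)"
 have b: "0 < b" using fl_hbump_pos(2)[OF s] by (simp add: b_def)
 \<comment> \<open>Small enough that the smooth part of \<open>jbump\<close> spends at most half of
   the gain \<open>b\<close> of \<open>hbump\<close>.\<close>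
 define th where "th = min 1 (b/(8*qs+1))"
 have th: "0 < th" "th <= 1" using b qs by (auto simp: th_def)
 have thq: "4*th*qs <= b/2"
 proof -
  have "th*(8*qs+1) <= b/(8*qs+1)*(8*qs+1)" using qs by (intro mult_right_mono) (auto simp: th_def)
  also have "... = b" using qs by simp
  finally show ?thesis using th by (simp add: algebra_simps)
 qed
 define e where "e = th*J"
 have e: "0 < e" using th J by (simp add: e_def)
 have "\<exists>U. open U & x0 \<in> U & (\<forall>x\<in>U \<inter> UNIV. F x < F x0+e)" using usc e unfolding usc_on_iff F_def by simp
 then obtain U where U: "open U" "x0 \<in> U" "!!x. x \<in> U ==> F x < F x0+e" by auto
 then obtain dl where dl: "0 < dl" "ball x0 dl \<subseteq> U" by (auto simp: open_contains_ball)
 define R where "R = dl/4"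
 have R: "0 < R" using dl by (simp add: R_def)
 have right: "F x <= F x0+e" if "x0 <= x" "x <= x0+2 * R" for x using U(3)[of x] dl that by (force simp: R_def dist_real_def)
 \<comment> \<open>With slope \<open>p\<close> the jump contributes
   \<open>A * p powr (2 * s)\<close> to the nonlocal term, the tail penalty costs \<open>B\<close>,
   and the time derivative is at least \<open>- C * p\<close>. \<open>X\<close> stands for
   \<open>p powr (2 * s)\<close>; it is chosen so that the gain exceeds \<open>B + C\<close> by 1
   and the scale \<open>E\<close> stays below \<open>R\<close>.\<close>
 define A where "A = J*(b/2)*(1/e) powr (2 * s)"
 define B where "B = 8*M*(1/R) powr (2 * s)*qs"
 define C where "C = bet/t0*(\<bar>x0 - a\<bar>+2 * R)"
 have A: "0 < A" using J b e by (simp add: A_def)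
 have BC: "0 <= B" "0 <= C" using M0 qs bet t0 R by (auto simp: B_def C_def)
 define X where "X = 1+(e/R) powr (2 * s)+(B+C+1)/A"
 have X: "1 <= X" "(e/R) powr (2 * s) <= X" "(B+C+1)/A <= X" using A BC by (auto simp: X_def)
 define p where "p = X powr (1/(2 * s))"
 have p1: "1 <= p" unfolding p_def using X s by (intro ge_one_powr_ge_zero) auto
 have ps: "p powr (2 * s) = X" unfolding p_def powr_powr using s X by simp
 have "e/R = ((e/R) powr (2 * s)) powr (1/(2 * s))" unfolding powr_powr using s e R by simp
 also have "... <= p" unfolding p_def using X s by (intro powr_mono2) auto
 finally have pR: "e/R <= p" .
 define E where "E = e/p"
 have E: "0 < E" "E <= R" using e p1 pR R by (auto simp: E_def field_simps)
 have pE: "th*J/E = p" using e p1 unfolding E_def e_def[symmetric] by simp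
 have "usc_on UNIV F" using usc unfolding F_def .
 then have "usc_on {x0..x0+2 * R} (%x. F x+- (p*(x - x0)))"
  by (rule usc_on_add_cont[OF usc_on_subset[OF _ subset_UNIV]]) (intro continuous_intros)
 then obtain xp where xp: "xp \<in> {x0..x0+2 * R}"
  and mx: "!!x. x \<in> {x0..x0+2 * R} ==> F x+- (p*(x - x0)) <= F xp+- (p*(xp - x0))"
  using usc_attains_max[of "{x0..x0+2 * R}" "%x. F x+- (p*(x - x0))"] R by auto
 have touch: "F z <= F xp+(J*jbump th ((z - xp)/E)+4*M*qf ((z - xp)/R))" for z
 proof (rule jump_touching[where ?x0.0 = x0])
  show "mono F" using mono by (simp add: F_def)
  show "\<bar>F x\<bar> <= M" for x using M by (simp add: F_def)
  show "F x <= F x0 - J" if "x < x0" for x using jump that by (simp add: F_def)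
  show "F x - th*J/E*(x - x0) <= F xp - th*J/E*(xp - x0)" if "x0 <= x" "x <= x0+2 * R" for x using mx[of x] that unfolding pE by simp
  show "F x <= F x0+th*J" if "x0 <= x" "x <= x0+2 * R" for x using right that by (simp add: e_def)
 qed (use J th E xp in auto)
 define c where "c = 1/E"
 define d where "d = 1/R"
 have cd: "0 < c" "0 < d" using E R by (auto simp: c_def d_def)
 define psi where "psi = (%z. J*jbump th (c*z+- (c*xp))+4*M*qf (d*z+- (d*xp)))"
 have psie: "psi z = J*jbump th ((z - xp)/E)+4*M*qf ((z - xp)/R)" for z by (simp add: psi_def c_def d_def diff_divide_distrib)
 have psi0: "psi xp = 0" using hbump_bounds(3)[of 0] by (simp add: psie jbump_def rf_def)
 have psib: "\<bar>psi z\<bar> <= J*4+4*M" for z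
 proof -
  have "\<bar>J*jbump th ((z - xp)/E)\<bar> <= J*4" using jbump_abs_le[of th "(z - xp)/E"] th J by (simp add: abs_mult)
  moreover have "\<bar>4*M*qf ((z - xp)/R)\<bar> <= 4*M*1"
  unfolding abs_mult using M0 qf_nonneg qf_less1 by (intro mult_mono) (auto simp: less_imp_le)
  ultimately show ?thesis unfolding psie by linarith
 qed
 obtain j1 j2 where j: "C2d (jbump th) j1 j2" "j1 0 = th" using C2d_jbump[of th] by (elim exE conjE)
 obtain q2 where q: "C2d qf (%z. 2*z/(1+z\<^sup>2)\<^sup>2) q2" using C2d_qf by (elim exE conjE)
 define psi1 where "psi1 = (%z. J*(c*j1 (c*z+- (c*xp)))+4*M*(d*(2*(d*z+- (d*xp))/(1+(d*z+- (d*xp))\<^sup>2)\<^sup>2)))"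
 have "\<exists>psi2. C2d psi psi1 psi2" unfolding psi_def psi1_def
  by (rule exI, rule C2d_add[OF C2d_cmult[OF C2d_affine[OF j(1)]] C2d_cmult[OF C2d_affine[OF q]]])
 then obtain psi2 where C: "C2d psi psi1 psi2" by (elim exE)
 have Jc: "J * c*th = p" using pE by (simp add: c_def mult_ac)
 have psi1: "psi1 xp = p" using Jc by (simp add: psi1_def j)
 define k where "k = (%t. t0 powr bet*t powr (- bet))"
 define k1 where "k1 = (%t. t0 powr bet*(- bet*t powr (- bet - 1)))"
 define k2 where "k2 = (%t. t0 powr bet*(- bet*((- bet - 1)*t powr (- bet - 1 - 1))))"
 have kd: "(k has_real_derivative k1 t) (at t)" "(k1 has_real_derivative k2 t) (at t)" if "0 < t" for t
  unfolding k_def k1_def k2_def using that by (intro DERIV_cmult has_real_derivative_powr, assumption)+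
 have k2c: "continuous_on {0<..} k2" unfolding k2_def by (intro continuous_intros) auto
 have kt: "k t = (t0/t) powr bet" if "0 < t" for t using that t0 by (simp add: k_def powr_divide powr_minus_divide)
 have k0: "k t0 = 1" using kt[OF t0] t0 by simp
 have "t0 powr bet*t0 powr (- bet - 1) = t0 powr (- 1)" unfolding powr_add[symmetric] by simp
 also have "... = 1/t0" using t0 by (simp add: powr_minus_divide)
 finally have k10: "k1 t0 = - bet/t0" unfolding k1_def by (simp add: mult.left_commute)
 define phi where "phi = (%p. psi (a+(fst p - a) * k (snd p)))"
 have phiC: "C2_on (Q (2*t0)) phi" unfolding phi_def by (rule C2_on_similarity[OF C kd k2c])
 have kc: "continuous_on {0<..} k" unfolding k_def by (intro continuous_intros) auto
 have psicont: "continuous_on UNIV psi" by (rule C2d_cont(1)[OF C])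
 have kcQ: "continuous_on (Q (2*t0)) (%p. k (snd p))"
  by (rule continuous_on_compose2[OF kc]) (auto intro!: continuous_intros simp: Q_def)
 have phib: "Cb_on (Q (2*t0)) phi" unfolding Cb_on_def
 proof
  show "bounded (phi ` Q (2*t0))" unfolding bounded_iff by (intro exI[of _ "J*4+4*M"]) (use psib in \<open>auto simp: phi_def\<close>)
  show "continuous_on (Q (2*t0)) phi" unfolding phi_def
  by (rule continuous_on_compose2[OF psicont]) (intro continuous_intros kcQ, simp)
 qed
 have phit0: "phi (x, t0) = psi x" for x by (simp add: phi_def k0)
 have "max_point (Q (2*t0)) (%p. u p - phi p) (xp, t0)" unfolding max_point_def
 proof (intro conjI ballI)
  show "(xp, t0) \<in> Q (2*t0)" using t0 by (simp add: Q_def)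
  fix q :: "real \<times> real" assume q: "q \<in> Q (2*t0)"
  obtain x t where xt: "q = (x, t)" by (cases q)
  have t: "0 < t" "t < 2*t0" using q by (auto simp: xt Q_def)
  \<comment> \<open>By self-similarity the values at time \<open>t\<close> are those at time
    \<open>t0\<close> at the transported point, so touching at time \<open>t0\<close> bounds the
    difference on the whole strip.\<close>
  have "u q - phi q = F (a+(x - a) * k t) - psi (a+(x - a) * k t)" unfolding xt phi_def F_def using sim[OF t, of x] kt[OF t(1)] by simp
  also have "... <= F xp" using touch[of "a+(x - a) * k t"] unfolding psie by linarith
  finally show "u q - phi q <= u (xp, t0) - phi (xp, t0)" by (simp add: phit0 psi0 F_def)
 qed
 then have le: "eq_op m s (2*t0) phi xp t0 <= 0" using sub phiC phib unfolding int_sub_def by blast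
 have dphix: "((%r. phi (xp, r)) has_real_derivative p*((xp - a) * k1 t0)) (at t0)"
 proof -
  have "((%r. a+(xp - a) * k r) has_real_derivative (xp - a) * k1 t0) (at t0)" by (auto intro!: derivative_eq_intros kd(1)[OF t0])
  moreover have "(psi has_real_derivative psi1 (a+(xp - a) * k t0)) (at (a+(xp - a) * k t0))" using C unfolding C2d_def by blast
  ultimately show ?thesis unfolding phi_def fst_conv snd_conv
  using DERIV_chain2[of psi "psi1 (a+(xp - a) * k t0)" "%r. a+(xp - a) * k r" t0 "(xp - a) * k1 t0" UNIV] by (simp add: k0 psi1)
 qed
 have eqn: "p*((xp - a) * k1 t0)+\<bar>p\<bar> powr (m - 1)*fl s (sdiff psi xp) <= 0"
 proof -
  have e: "(%y. phi (y, t0)) = psi" using phit0 by auto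
  have t2: "t0 < 2*t0" using t0 by simp
  have "eq_op m s (2*t0) phi xp t0 = p*((xp - a) * k1 t0)+\<bar>psi1 xp\<bar> powr (m - 1)*fl s (sdiff (%y. phi (y, t0)) xp)"
  by (rule eq_op_C2[OF s t0 t2 _ _ dphix, of _ psi2]) (unfold e, rule C, rule bounded_rangeI, rule psib)
  then show ?thesis using le unfolding psi1 e by simp
 qed
 have sd: "sdiff psi xp = (%y. (- (4*J*th))*qf (c*y)+((- J) * sdiff hbump 0 (c*y)+(- (8*M))*qf (d*y)))"
 proof (rule ext)
  fix y
  have "sdiff psi xp y = J * sdiff (jbump th) 0 (c*y)+4*M * sdiff qf 0 (d*y)" by (simp add: sdiff_def psi_def algebra_simps)
  then show "sdiff psi xp y = (- (4*J*th))*qf (c*y)+((- J) * sdiff hbump 0 (c*y)+(- (8*M))*qf (d*y))"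
  unfolding sdiff_jbump by (simp add: sdiff_def algebra_simps)
 qed
 have "fl s (sdiff psi xp) = (- (4*J*th))*(c powr (2 * s)*qs)+((- J)*(c powr (2 * s)*(- b))+(- (8*M))*(d powr (2 * s)*qs))"
  unfolding sd by (simp only: fl_add fl_cmult fl_scale[OF cd(1)] fl_scale[OF cd(2)] kint_cmult kint_add
  kint_scale[OF kint_qf[OF s] cd(1)] kint_scale[OF kint_qf[OF s] cd(2)] kint_scale[OF fl_hbump_pos(1)[OF s] cd(1)] b_def qs_def minus_minus)
 also have "... = J * c powr (2 * s)*(b - 4*th*qs) - 8*M*d powr (2 * s)*qs" by (simp add: algebra_simps)
 also have "... \<ge> J * c powr (2 * s)*(b/2) - 8*M*d powr (2 * s)*qs" using thq J by (intro diff_right_mono mult_left_mono) auto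
 finally have fl1: "J * c powr (2 * s)*(b/2) - B <= fl s (sdiff psi xp)" by (simp add: B_def d_def)
 have "c = p*(1/e)" using e p1 by (simp add: c_def E_def)
 then have "c powr (2 * s) = X*(1/e) powr (2 * s)" using ps e p1 by (simp only: powr_mult)
 then have "A*X - B <= fl s (sdiff psi xp)" using fl1 unfolding A_def by (simp add: mult_ac)
 moreover have "B+C+1 <= A*X" using X(3) A by (simp add: divide_le_eq mult.commute)
 ultimately have flC: "C+1 <= fl s (sdiff psi xp)" by linarith
 have "\<bar>xp - a\<bar> <= \<bar>x0 - a\<bar>+2 * R" using xp by auto
 then have "(bet/t0)*(xp - a) <= C" unfolding C_def using bet t0 by (intro mult_left_mono) auto
 moreover have "(xp - a) * k1 t0 = - ((bet/t0)*(xp - a))" unfolding k10 by (simp add: algebra_simps)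
 ultimately have "p*(- C) <= p*((xp - a) * k1 t0)" using p1 by (intro mult_left_mono) auto
 moreover have "p*(C+1) <= \<bar>p\<bar> powr (m - 1)*fl s (sdiff psi xp)"
 proof (rule mult_mono)
  \<comment> \<open>Here \<open>m >= 2\<close> enters: a slope \<open>p >= 1\<close> is raised to a
    power at least 1, so the nonlocal term grows at least as fast as the transport term.\<close>
  have "p powr 1 <= p powr (m - 1)" using p1 m by (intro powr_mono) auto
  then show "p <= \<bar>p\<bar> powr (m - 1)" using p1 by simp
 qed (use flC BC p1 in auto)
 moreover have "p*(- C)+p*(C+1) = p" by (simp add: algebra_simps)
 ultimately show False using eqn p1 by linarith
qed

lemma scheme_const: "scheme m w h tau (%x. c) j = (%i. c)" by (induction j) (simp_all add: L_h_def)

lemma interpolant_const: "0 < h ==> interpolant h tau (%j i. c) p = c"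
 using interpolant_between[of h "%j i. c" "snd p" tau "fst p"] by simp

lemma int_sub_cong: "int_sub m s T u ==> (!!p. p \<in> Q T ==> u p = v p) ==> int_sub m s T v"
 unfolding int_sub_def max_point_def by simp

lemma usc_on_env:
 assumes "!!q. q \<in> S ==> \<bar>f q\<bar> <= B" shows "usc_on S (usc_env S f)" unfolding usc_on_iff
proof (intro ballI allI impI)
 fix p c assume p: "p \<in> S" and c: "usc_env S f p < c"
 then obtain d where d: "usc_env S f p < d" "d < c" using dense by blast
 obtain U where U: "open U" "p \<in> U" "\<forall>q\<in>U \<inter> S. f q < d" using usc_env_less[OF p assms d(1)] by blast
 have "usc_env S f q < c" if "q \<in> U \<inter> S" for q
 proof -
  have "usc_env S f q <= d" by (rule usc_env_le[OF _ assms U(1)]) (use that U(3) less_imp_le in auto)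
  then show ?thesis using d by simp
 qed
 then show "\<exists>U. open U & p \<in> U & (\<forall>q\<in>U \<inter> S. usc_env S f q < c)" using U by blast
qed

lemma visc_subsol_uminus_super:
 assumes s: "0 < s" "s < 1" and v: "!!q. q \<in> Qbar T ==> \<bar>v q\<bar> <= B" and v0: "!!x. \<bar>v0 x\<bar> <= B"
  and sub: "int_sub m s T (usc_env (Qbar T) (%p. - v p))"
  and init: "!!x. usc_env (Qbar T) (%p. - v p) (x, 0) <= usc_env UNIV (%x. - v0 x) x" and T: "0 < T"
 shows "visc_supersol m s T v0 (lsc_env (Qbar T) v)"
proof -
 define z where "z = usc_env (Qbar T) (%p. - v p)"
 have nv: "\<bar>- v q\<bar> <= B" if "q \<in> Qbar T" for q using v[OF that] by simp
 have e: "lsc_env (Qbar T) v p = - z p" if "p \<in> Qbar T" for p unfolding z_def by (rule lsc_env_eq[OF that v])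
 have u: "usc_on (Qbar T) z" unfolding z_def by (rule usc_on_env[OF nv])
 show ?thesis
 proof (rule visc_supersolI)
  show "bounded (lsc_env (Qbar T) v ` Qbar T)" unfolding bounded_iff
  proof (intro exI[of _ B] ballI)
  fix y assume "y \<in> lsc_env (Qbar T) v ` Qbar T"
  then obtain p where p: "p \<in> Qbar T" "y = - z p" using e by auto
  then show "norm y <= B" using usc_env_abs_le[OF p(1) nv] unfolding z_def by simp
  qed
  show "lsc_on (Qbar T) (lsc_env (Qbar T) v)" unfolding lsc_on_def
  proof (intro ballI allI impI)
  fix p c assume p: "p \<in> Qbar T" and c: "c < lsc_env (Qbar T) v p"
  then have "z p < - c" using e by simp
  then have "\<forall>\<^sub>F q in at p within Qbar T. z q < - c" using u p unfolding usc_on_def by blast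
  moreover have "\<forall>\<^sub>F q in at p within Qbar T. q \<in> Qbar T" by (simp add: eventually_at_filter)
  ultimately show "\<forall>\<^sub>F q in at p within Qbar T. c < lsc_env (Qbar T) v q" by eventually_elim (simp add: e)
  qed
  have "int_sub m s T (%p. - lsc_env (Qbar T) v p)"
  by (rule int_sub_cong[OF sub]) (use e in \<open>auto simp: z_def Q_def Qbar_def\<close>)
  then show "int_super m s T (lsc_env (Qbar T) v)" unfolding int_super_iff[OF s] .
  fix x
  have "(x, 0) \<in> Qbar T" using T by (simp add: Qbar_def)
  then show "lsc_env UNIV v0 x <= lsc_env (Qbar T) v (x, 0)" using init[of x] lsc_env_eq[of x UNIV v0 B] v0 e unfolding z_def by simp
 qed
qed

text \<open>The rescaled \<open>W\<close> solves the same equation, so an order between the rescaled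
  datum and \<open>g\<close> passes to the solutions. Translation is the case
  \<open>ro = 1\<close>.\<close>

lemma (in approximation) solves_affine:
 assumes W: "solves f W" and Y: "solves g Y" and ro: "0 < ro" "mu = ro powr (m - 1+2 * s)" and t: "0 <= t"
 shows "(!!x. f (ro*x+b) <= g x) ==> W (ro*x+b, mu*t) <= Y (x, t)" and "(!!x. g x <= f (ro*x+b)) ==> Y (x, t) <= W (ro*x+b, mu*t)"
proof -
 have mu0: "0 < mu" using ro by simp
 define Z where "Z = (%p. W (ro*fst p+b, mu * snd p))"
 have Z: "equi Z" "\<bar>Z p\<bar> <= M" "Z (x, 0) = f (ro*x+b)" for p x
  using W equi_affine[of W ro mu b] ro(1) mu0 unfolding solves_def Z_def by auto
 have WT: "int_sub m s (mu*T) W" "int_super m s (mu*T) W" if "0 < T" for T using W that mu0 unfolding solves_def by auto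
 have ZT: "int_sub m s T Z" "int_super m s T Z" if "0 < T" for T
  unfolding Z_def by (rule int_sub_affine[OF s01 ro WT(1)[OF that]], rule int_super_affine[OF s01 ro WT(2)[OF that]])
 have Y': "equi Y" "\<bar>Y p\<bar> <= M" "Y (x, 0) = g x" for p x using Y unfolding solves_def by blast+
 have YT: "int_sub m s T Y" "int_super m s T Y" if "0 < T" for T using Y that by (auto simp: solves_def)
 show "W (ro*x+b, mu*t) <= Y (x, t)" if "!!x. f (ro*x+b) <= g x"
 proof -
  have "Z (x, t) <= Y (x, t)" by (rule equi_comparison[OF s01 m2 Z(1,2) ZT(1) Y'(1,2) YT(2) _ t]) (simp_all add: Z Y' that)
  then show ?thesis by (simp add: Z_def)
 qed
 show "Y (x, t) <= W (ro*x+b, mu*t)" if "!!x. g x <= f (ro*x+b)"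
 proof -
  have "Y (x, t) <= Z (x, t)" by (rule equi_comparison[OF s01 m2 Y'(1,2) YT(1) Z(1,2) ZT(2) _ t]) (simp_all add: Z Y' that)
  then show ?thesis by (simp add: Z_def)
 qed
qed

lemma (in approximation) solves_shift:
 assumes "solves f W" "solves g Y" "0 <= t" shows "(!!x. f (x+b) <= g x) ==> W (x+b, t) <= Y (x, t)"
  and "(!!x. g x <= f (x+b)) ==> Y (x, t) <= W (x+b, t)" using solves_affine[OF assms(1,2), of 1 1 t b x] assms(3) by simp_all

section \<open>Ramp data and the limit for the jump\<close>

locale jump = approximation s m Cs om tau "%h. 2*M/h" M for s m Cs om tau M +
 fixes a :: real
 assumes M: "0 < M"
begin

definition H :: "real => real" where "H x = (if x < a then 0 else M)"

text \<open>Rises linearly from 0 at \<open>a - eps\<close> to \<open>M\<close> at \<open>a\<close>,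
  so that it lies above the jump while its translate to the right by \<open>eps\<close> lies
  below.\<close>

definition ramp :: "real => real => real" where "ramp eps x = M*min 1 (max 0 ((x - a)/eps+1))"

lemma adm_range: "mono f ==> (!!x. 0 <= f x) ==> (!!x. f x <= M) ==> adm f" unfolding adm_def
proof (intro conjI allI)
 assume f: "mono f" "!!x. 0 <= f x" "!!x. f x <= M"
 show "\<bar>f x\<bar> <= M" for x using f(2,3)[of x] by simp
 show "NEAR h. \<forall>x. f (x+h) - f x <= 2*M/h*h" using eventually_at_right_less[of 0]
 proof eventually_elim
  case (elim h)
  show ?case
  proof
  fix x show "f (x+h) - f x <= 2*M/h*h" using f(3)[of "x+h"] f(2)[of x] elim M by simp
  qed
 qed
qed

lemma ramp_range: "0 <= ramp eps x" "ramp eps x <= M" using M by (simp_all add: ramp_def mult_left_le)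

lemma ramp_mono: "0 < eps ==> x <= y ==> ramp eps x <= ramp eps y" unfolding ramp_def using M
 by (intro mult_left_mono min.mono max.mono add_right_mono divide_right_mono) auto

lemma ramp_adm: assumes "0 < eps" shows "adm (%x. ramp eps (x+b))" by (intro adm_range monoI ramp_mono ramp_range) (use assms in auto)

lemma ramp_uc: assumes "0 < eps" shows "uniformly_continuous_on UNIV (%x. ramp eps (x+b))"
proof (rule lipschitz_on_uniformly_continuous, rule lipschitz_onI)
 fix x y
 have "\<bar>min 1 (max 0 ((x+b - a)/eps+1)) - min 1 (max 0 ((y+b - a)/eps+1))\<bar> <= \<bar>((x+b - a)/eps+1) - ((y+b - a)/eps+1)\<bar>"
  by linarith
 also have "((x+b - a)/eps+1) - ((y+b - a)/eps+1) = (x - y)/eps" by (simp add: diff_divide_distrib add_divide_distrib)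
 finally have "M*\<bar>min 1 (max 0 ((x+b - a)/eps+1)) - min 1 (max 0 ((y+b - a)/eps+1))\<bar> <= M*\<bar>(x - y)/eps\<bar>"
  using M by (intro mult_left_mono) auto
 also have "... = M/eps*dist x y" using assms by (simp add: dist_real_def)
 finally have "M*\<bar>min 1 (max 0 ((x+b - a)/eps+1)) - min 1 (max 0 ((y+b - a)/eps+1))\<bar> <= M/eps*dist x y" .
 moreover have "dist (ramp eps (x+b)) (ramp eps (y+b)) = M*\<bar>min 1 (max 0 ((x+b - a)/eps+1)) - min 1 (max 0 ((y+b - a)/eps+1))\<bar>"
  unfolding dist_real_def ramp_def right_diff_distrib[symmetric] abs_mult using M by simp
 ultimately show "dist (ramp eps (x+b)) (ramp eps (y+b)) <= M/eps*dist x y" by (simp only:)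
qed (use assms M in simp)

lemma ramp_ge_H: "0 < eps ==> H x <= ramp eps x" using M ramp_range(1)[of eps x] by (auto simp: H_def ramp_def)

lemma ramp_le_H: "0 < eps ==> ramp eps (x - eps) <= H x"
 using M ramp_range(2)[of eps "x - eps"] by (auto simp: H_def ramp_def diff_divide_distrib divide_less_cancel)

lemma ramp_eps_mono: "0 < eps ==> eps <= eps' ==> ramp eps x <= ramp eps' x"
proof (cases "x < a")
 case True
 assume e: "0 < eps" "eps <= eps'"
 then have "(x - a)/eps <= (x - a)/eps'" using True by (intro divide_left_mono_neg) auto
 then show ?thesis unfolding ramp_def using M by (intro mult_left_mono) auto
next
 case False
 assume e: "0 < eps" "eps <= eps'"
 then show ?thesis using False M by (simp add: ramp_def)
qed

lemma ramp_scale: "0 < ro ==> ramp eps (ro*x+(a - ro*a)) = ramp (eps/ro) x"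
proof -
 assume "0 < ro"
 moreover have "ro*x+(a - ro*a) - a = (x - a)*ro" by (simp add: algebra_simps)
 ultimately show ?thesis unfolding ramp_def by simp
qed

lemma H_adm: "adm H" by (rule adm_range) (use M in \<open>auto simp: H_def mono_def\<close>)

definition W :: "real => real \<times> real => real" where "W eps = (SOME W. solves (ramp eps) W)"

lemma W: "0 < eps ==> solves (ramp eps) (W eps)"
 unfolding W_def using existence[OF ramp_adm[of eps 0] ramp_uc[of eps 0]] unfolding add_0_right by (rule someI_ex)

lemma W0: "0 < eps ==> W eps (x, 0) = ramp eps x" using W by (simp add: solves_def)

lemma W_eps_mono: "0 < eps ==> eps <= eps' ==> 0 <= t ==> W eps (x, t) <= W eps' (x, t)"
 using solves_shift(1)[OF W W, of eps eps' t 0 x] ramp_eps_mono[of eps eps'] by simp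

lemma W_mono: "0 < eps ==> x <= y ==> 0 <= t ==> W eps (x, t) <= W eps (y, t)"
 using solves_shift(2)[OF W W, of eps eps t "y - x" x] ramp_mono[of eps] by simp

lemma W_sandwich: "0 < eps ==> 0 < eps' ==> 0 <= t ==> W eps (x - eps, t) <= W eps' (x, t)"
 using solves_shift(1)[OF W W, of eps eps' t "- eps" x] order_trans[OF ramp_le_H ramp_ge_H, of eps eps'] by simp

text \<open>Rescaling about \<open>a\<close> maps ramps to ramps; this is the source of the
  self-similarity of \<open>up\<close>.\<close>

lemma W_scale:
 assumes "0 < ro" "0 < eps" "0 <= t" shows "W eps (ro*x+(a - ro*a), ro powr (m - 1+2 * s)*t) = W (eps/ro) (x, t)"
 using solves_affine[OF W[OF assms(2)] W[of "eps/ro"] assms(1) refl assms(3), of "a - ro*a" x] assms ramp_scale by (intro antisym) auto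

lemma W_shift_solves: "0 < eps ==> \<exists>Y. solves (%x. ramp eps (x - eps)) Y & (\<forall>x t. 0 <= t --> Y (x, t) = W eps (x - eps, t))"
proof -
 assume e: "0 < eps"
 obtain Y where Y: "solves (%x. ramp eps (x - eps)) Y" using existence[OF ramp_adm[of eps "- eps"] ramp_uc[of eps "- eps"]] e by auto
 have "Y (x, t) = W eps (x - eps, t)" if "0 <= t" for x t using solves_shift[OF W[OF e] Y that, of "- eps" x] by (intro antisym) auto
 then show ?thesis using Y by blast
qed

lemma W_nonneg: "0 < eps ==> 0 <= t ==> 0 <= W eps (x, t)"
proof -
 assume e: "0 < eps" "0 <= t"
 have z: "adm (%x. 0)" by (rule adm_range) (use M in \<open>auto simp: mono_def\<close>)
 have "((%h. Vb (ramp eps) h (x, t)) \<longlongrightarrow> W eps (x, t)) (at_right 0)" using W[OF e(1)] e(2) by (simp add: solves_def)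
 moreover have "NEAR h. 0 <= Vb (ramp eps) h (x, t)"
  using Vb_comparison[OF z ramp_adm[OF e(1), of 0], of 0, unfolded add_0_right, OF ramp_range(1)] eventually_at_right_less[of 0]
 proof eventually_elim
  case (elim h)
  have "Vb (%x. 0) h (x, t) = 0" unfolding Vb_def using interpolant_const[of h "tau h" 0] elim(2) by (simp add: scheme_const[abs_def])
  then show ?case using elim(1)[rule_format, of "(x, t)"] by simp
 qed
 ultimately show ?thesis by (rule tendsto_lowerbound) simp
qed

text \<open>The solutions decrease as \<open>eps\<close> decreases, so this is also their limit for
  \<open>eps\<close> tending to 0; as an infimum of continuous functions it is upper
  semicontinuous.\<close>

definition up :: "real \<times> real => real" where "up p = (INF eps\<in>{0<..}. W eps p)"

lemma W_le_M: "0 < eps ==> \<bar>W eps p\<bar> <= M" using W[of eps] unfolding solves_def by blast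

lemma up_le: "0 < eps ==> up p <= W eps p"
 unfolding up_def by (rule cINF_lower[OF bdd_belowI2[where m = "- M"]]) (use W_le_M in \<open>auto simp: abs_le_iff minus_le_iff\<close>)

lemma up_ge: "(!!eps. 0 < eps ==> c <= W eps p) ==> c <= up p" unfolding up_def by (rule cINF_greatest) (auto intro: exI[of _ 1])

lemma up_less: "up p < c ==> \<exists>eps>0. W eps p < c" using up_ge[of c p] by (meson not_less)

lemma up_ge_shift: "0 < eps ==> 0 <= t ==> W eps (x - eps, t) <= up (x, t)" by (rule up_ge) (rule W_sandwich)

lemma up_range: "0 <= t ==> 0 <= up (x, t)" "\<bar>up p\<bar> <= M"
proof -
 show "0 <= up (x, t)" if "0 <= t" using W_nonneg that by (intro up_ge) auto
 have "- M <= up p" using W_le_M by (intro up_ge) (auto simp: abs_le_iff minus_le_iff)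
 moreover have "up p <= M" using up_le[of 1 p] W_le_M[of 1 p] by simp
 ultimately show "\<bar>up p\<bar> <= M" by simp
qed

lemma up_mono: assumes "0 <= t" shows "mono (%x. up (x, t))"
proof (rule monoI, rule up_ge)
 fix x y eps :: real assume "x <= y" "0 < eps"
 then show "up (x, t) <= W eps (y, t)" using up_le[of eps "(x, t)"] W_mono[of eps x y t] assms by linarith
qed

lemma up_scale:
 assumes ro: "0 < ro" and t: "0 <= t" shows "up (ro*x+(a - ro*a), ro powr (m - 1+2 * s)*t) = up (x, t)"
proof (rule antisym; rule up_ge)
 fix eps :: real assume e: "0 < eps"
 have "up (ro*x+(a - ro*a), ro powr (m - 1+2 * s)*t) <= W (ro*eps) (ro*x+(a - ro*a), ro powr (m - 1+2 * s)*t)"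
  using ro e by (intro up_le) simp
 also have "... = W eps (x, t)" using W_scale[OF ro, of "ro*eps" t x] e ro t by simp
 finally show "up (ro*x+(a - ro*a), ro powr (m - 1+2 * s)*t) <= W eps (x, t)" .
 have "up (x, t) <= W (eps/ro) (x, t)" using ro e by (intro up_le) simp
 then show "up (x, t) <= W eps (ro*x+(a - ro*a), ro powr (m - 1+2 * s)*t)" using W_scale[OF ro e t] by simp
qed

lemma up_similar:
 assumes "0 < t" "0 < t0" shows "up (x, t) = up (a+(x - a)*(t0/t) powr (1/(m - 1+2 * s)), t0)"
proof -
 define ro where "ro = (t0/t) powr (1/(m - 1+2 * s))"
 have "0 < m - 1+2 * s" using m2 s01 by simp
 then have "ro powr (m - 1+2 * s) = t0/t" using assms by (simp add: ro_def powr_powr)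
 then have e: "ro powr (m - 1+2 * s)*t = t0" using assms by simp
 have ro: "0 < ro" using assms by (simp add: ro_def)
 have x: "ro*x+(a - ro*a) = a+(x - a)*ro" by (simp add: algebra_simps)
 show ?thesis using up_scale[OF ro, of t x] assms(1) unfolding e x ro_def[symmetric] by simp
qed

lemma up_usc: assumes "0 <= t" shows "usc_on UNIV (%x. up (x, t))" unfolding usc_on_iff
proof (intro ballI allI impI)
 fix x c assume c: "up (x, t) < c"
 obtain eps where e: "0 < eps" "W eps (x, t) < c" using up_less[OF c] by blast
 have "continuous_on (Qbar t) (W eps)" by (rule BUC_cont(2)[OF solves_BUC[OF W[OF e(1)]]])
 then have "continuous_on UNIV (%x. W eps (x, t))"
  by (rule continuous_on_compose2) (use assms in \<open>auto intro!: continuous_intros simp: Qbar_def\<close>)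
 then have "open {x. W eps (x, t) < c}" by (intro open_Collect_less continuous_on_const)
 moreover have "up (y, t) < c" if "y \<in> {x. W eps (x, t) < c}" for y using up_le[OF e(1), of "(y, t)"] that by simp
 ultimately show "\<exists>U. open U & x \<in> U & (\<forall>y\<in>U \<inter> UNIV. up (y, t) < c)" using e(2)
  by (intro exI[of _ "{x. W eps (x, t) < c}"]) auto
qed

text \<open>Continuity of \<open>up\<close> is not yet known. Both the scheme and \<open>up\<close>
  are squeezed between a ramp solution and its translate, which are continuous, so bounds at
  \<open>p\<close> extend to a neighbourhood.\<close>

lemma Vb_H_bounds:
 assumes e: "0 < eps" and p: "0 <= snd p" and eta: "0 < eta"
 shows "\<exists>A. open A & p \<in> A & (NEAR h. \<forall>q\<in>A. 0 <= snd q -->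
  Vb H h q < W eps p+eta & W eps (fst p - eps, snd p) - eta < Vb H h q &
  up q < W eps p+eta & W eps (fst p - eps, snd p) - eta < up q)"
proof -
 obtain Y where Y: "solves (%x. ramp eps (x - eps)) Y" "!!x t. 0 <= t ==> Y (x, t) = W eps (x - eps, t)"
  using W_shift_solves[OF e] by blast
 have ad: "adm (ramp eps)" "adm (%x. ramp eps (x - eps))"
  and uc: "uniformly_continuous_on UNIV (ramp eps)" "uniformly_continuous_on UNIV (%x. ramp eps (x - eps))"
  using ramp_adm[OF e, of 0] ramp_adm[OF e, of "- eps"] ramp_uc[OF e, of 0] ramp_uc[OF e, of "- eps"] by simp_all
 obtain A where A: "open A" "p \<in> A" "NEAR h. \<forall>q\<in>A. 0 <= snd q --> \<bar>Vb (ramp eps) h q - W eps p\<bar> < eta & \<bar>W eps q - W eps p\<bar> < eta"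
  using solves_locally_uniform[OF ad(1) uc(1) W[OF e] p eta] by blast
 obtain B where B: "open B" "p \<in> B" "NEAR h. \<forall>q\<in>B. 0 <= snd q --> \<bar>Vb (%x. ramp eps (x - eps)) h q - Y p\<bar> < eta & \<bar>Y q - Y p\<bar> < eta"
  using solves_locally_uniform[OF ad(2) uc(2) Y(1) p eta] by blast
 have Yp: "Y q = W eps (fst q - eps, snd q)" if "0 <= snd q" for q using Y(2)[OF that, of "fst q"] by simp
 have c1: "NEAR h. \<forall>q. Vb H h q <= Vb (ramp eps) h q+0" by (rule Vb_comparison[OF H_adm ad(1)]) (use ramp_ge_H[OF e] in simp)
 have c2: "NEAR h. \<forall>q. Vb (%x. ramp eps (x - eps)) h q <= Vb H h q+0"
  by (rule Vb_comparison[OF ad(2) H_adm]) (use ramp_le_H[OF e] in simp)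
 from A(3) B(3) c1 c2 have "NEAR h. \<forall>q\<in>A \<inter> B. 0 <= snd q -->
  Vb H h q < W eps p+eta & W eps (fst p - eps, snd p) - eta < Vb H h q &
  up q < W eps p+eta & W eps (fst p - eps, snd p) - eta < up q"
 proof eventually_elim
  case (elim h)
  show ?case
  proof (intro ballI impI)
  fix q assume q: "q \<in> A \<inter> B" "0 <= snd q"
  have 1: "\<bar>Vb (ramp eps) h q - W eps p\<bar> < eta" "\<bar>W eps q - W eps p\<bar> < eta" using elim(1) q by auto
  have 2: "\<bar>Vb (%x. ramp eps (x - eps)) h q - Y p\<bar> < eta" "\<bar>Y q - Y p\<bar> < eta" using elim(2) q by auto
  have 3: "Vb H h q <= Vb (ramp eps) h q" "Vb (%x. ramp eps (x - eps)) h q <= Vb H h q"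
  using elim(3)[rule_format, of q] elim(4)[rule_format, of q] by simp_all
  have 4: "up q <= W eps q" "Y q <= up q" using up_le[OF e, of q] up_ge_shift[OF e q(2), of "fst q"] Yp[OF q(2)] by auto
  show "Vb H h q < W eps p+eta & W eps (fst p - eps, snd p) - eta < Vb H h q &
  up q < W eps p+eta & W eps (fst p - eps, snd p) - eta < up q" using 1 2 3 4 unfolding Yp[OF p] by (intro conjI) linarith+
  qed
 qed
 then show ?thesis using A(1,2) B(1,2) by (intro exI[of _ "A \<inter> B"]) auto
qed

text \<open>Only the upper half of the limit is available at this stage. It suffices for the
  subsolution property, which in turn excludes jumps.\<close>

lemma up_int_sub: assumes T: "0 < T" shows "int_sub m s T up"
proof (rule half_relaxed_sub[where sig = 1 and tau = tau and Lam = "%h. 2*M/h" and M = M and V = "%h. scheme m (om h) h (tau h) H"])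
 show "NEAR h. 0 < tau h & 0 <= 2*M/h & grid_sub 1 m (om h) h (tau h) (2*M/h) M (scheme m (om h) h (tau h) H)" using ev_gr[OF H_adm]
 proof eventually_elim
  case (elim h)
  have "scheme m (om h) h (tau h) H = (%j. (step m (om h) h (tau h) ^^ j) (gr H h))" by (rule ext) (rule scheme_gr)
  then show ?case using grid_sub_scheme(1)[OF m2] elim by simp
 qed
 show "\<exists>A. open A & p \<in> A & (NEAR h. \<forall>q\<in>A \<inter> Q T. interpolant h (tau h) (scheme m (om h) h (tau h) H) q < c)"
  if "p \<in> Q T" "up p < c" for p c
 proof -
  obtain eps where e: "0 < eps" "W eps p < c" using up_less \<open>up p < c\<close> by blast
  have "0 <= snd p" "0 < c - W eps p" using \<open>p \<in> Q T\<close> e by (auto simp: Q_def)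
  from Vb_H_bounds[OF e(1) this] obtain A where A: "open A" "p \<in> A" and
  ev: "NEAR h. \<forall>q\<in>A. 0 <= snd q -->
  Vb H h q < W eps p+(c - W eps p) & W eps (fst p - eps, snd p) - (c - W eps p) < Vb H h q &
  up q < W eps p+(c - W eps p) & W eps (fst p - eps, snd p) - (c - W eps p) < up q" by (elim exE conjE)
  from ev have "NEAR h. \<forall>q\<in>A \<inter> Q T. interpolant h (tau h) (scheme m (om h) h (tau h) H) q < c"
  by eventually_elim (auto simp: Q_def Vb_def)
  then show ?thesis using A by (intro exI[of _ A] conjI)
 qed
 show "\<exists>\<^sub>F h in at_right 0. \<exists>q\<in>A \<inter> Q T. c < interpolant h (tau h) (scheme m (om h) h (tau h) H) q"
  if p: "p \<in> Q T" and c: "c < up p" and A: "open A" "p \<in> A" for p c A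
 proof (rule eventually_frequently)
  obtain d where d: "0 < d" "ball p d \<subseteq> A" using A by (auto simp: open_contains_ball)
  define eps where "eps = d/2"
  have e: "0 < eps" using d by (simp add: eps_def)
  \<comment> \<open>The lower barrier at \<open>q\<close> is the ramp solution at \<open>p\<close>,
    which exceeds \<open>c\<close>; at \<open>p\<close> itself no such lower bound is at
    hand.\<close>
  define q where "q = (fst p+eps, snd p)"
  have "dist p q = eps" using e by (simp add: q_def dist_prod_def dist_real_def)
  then have q: "q \<in> A \<inter> Q T" using d p by (auto simp: eps_def q_def Q_def intro!: subsetD[OF d(2)])
  have q0: "0 <= snd q" using p by (auto simp: q_def Q_def)
  have fq: "(fst q - eps, snd q) = p" by (simp add: q_def)
  have eta: "0 < W eps p - c" using c up_le[OF e, of p] by simp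
  from Vb_H_bounds[OF e q0 eta] obtain B where B: "q \<in> B" and
  ev: "NEAR h. \<forall>r\<in>B. 0 <= snd r -->
  Vb H h r < W eps q+(W eps p - c) & W eps (fst q - eps, snd q) - (W eps p - c) < Vb H h r &
  up r < W eps q+(W eps p - c) & W eps (fst q - eps, snd q) - (W eps p - c) < up r" by (elim exE conjE)
  from ev show "NEAR h. \<exists>q\<in>A \<inter> Q T. c < interpolant h (tau h) (scheme m (om h) h (tau h) H) q"
  proof eventually_elim
  case (elim h)
  show ?case using elim[rule_format, OF B q0] q unfolding fq Vb_def by (intro bexI[of _ q]) auto
  qed
 qed simp
qed (use T tau0 in auto)

text \<open>At positive times this is the absence of jumps: \<open>no_jump\<close> yields a point
  left of \<open>x0\<close> at which \<open>up\<close> has nearly the same value, and the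
  translation is taken no longer than the distance to it.\<close>

lemma W_close:
 assumes p: "p ~= (a, 0)" "0 <= snd p" and eta: "0 < eta" shows "\<exists>eps>0. W eps p - W eps (fst p - eps, snd p) < eta"
proof -
 obtain x0 t0 where xt: "p = (x0, t0)" by (cases p)
 show ?thesis
 proof (cases "t0 = 0")
  case True
  then have "x0 ~= a" using p xt by auto
  \<comment> \<open>At time 0 the ramp of exactly this width and its translate both agree with the
    jump datum at \<open>x0\<close>.\<close>
  define eps where "eps = \<bar>x0 - a\<bar>"
  have e: "0 < eps" using \<open>x0 ~= a\<close> by (simp add: eps_def)
  have "ramp eps x0 = ramp eps (x0 - eps)"
  proof (cases "x0 < a")
  case True
  then have "(x0 - a)/eps = - 1" unfolding eps_def by (simp add: divide_eq_eq)
  then have "ramp eps x0 = 0" by (simp add: ramp_def)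
  moreover have "ramp eps (x0 - eps) <= ramp eps x0" using e by (intro ramp_mono) auto
  ultimately show ?thesis using ramp_range(1)[of eps "x0 - eps"] by simp
  next
  case False
  then have "x0 - eps = a" by (simp add: eps_def)
  moreover have "ramp eps a <= ramp eps x0" using False e by (intro ramp_mono) auto
  moreover have "ramp eps a = M" by (simp add: ramp_def)
  ultimately show ?thesis using ramp_range(2)[of eps x0] by simp
  qed
  then show ?thesis using e eta unfolding xt True by (intro exI[of _ eps]) (simp add: W0)
 next
  case False
  then have t0: "0 < t0" using p xt by simp
  have "\<not> (\<forall>x<x0. up (x, t0) <= up (x0, t0) - eta/2)"
  proof
  assume j: "\<forall>x<x0. up (x, t0) <= up (x0, t0) - eta/2"
  show False
  proof (rule no_jump[OF s01 m2 t0 up_int_sub up_range(2)])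
  show "up (x, t) = up (a+(x - a)*(t0/t) powr (1/(m - 1+2 * s)), t0)" if "0 < t" for x t by (rule up_similar[OF that t0])
  show "up (x, t0) <= up (x0, t0) - eta/2" if "x < x0" for x using j that by simp
  qed (use t0 eta m2 s01 in \<open>auto intro: up_mono up_usc\<close>)
  qed
  then obtain x where x: "x < x0" "up (x0, t0) - eta/2 < up (x, t0)" by (auto simp: not_le)
  obtain eps where e: "0 < eps" "W eps (x0, t0) < up (x0, t0)+eta/2" using up_less[of "(x0, t0)" "up (x0, t0)+eta/2"] eta by auto
  define dl where "dl = min eps (x0 - x)"
  have d: "0 < dl" "dl <= eps" "dl <= x0 - x" using e x by (auto simp: dl_def)
  have "W dl (x0, t0) <= W eps (x0, t0)" using d t0 by (intro W_eps_mono) auto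
  moreover have "up (x, t0) <= up (x0 - dl, t0)" using up_mono[of t0] d t0 by (auto simp: mono_def)
  moreover have "up (x0 - dl, t0) <= W dl (x0 - dl, t0)" by (rule up_le[OF d(1)])
  ultimately show ?thesis using d(1) e(2) x(2) unfolding xt by (intro exI[of _ dl]) auto
 qed
qed

lemma up_locally_uniform:
 assumes p: "p ~= (a, 0)" "0 <= snd p" and eta: "0 < eta"
 shows "\<exists>A. open A & p \<in> A & (NEAR h. \<forall>q\<in>A. 0 <= snd q --> \<bar>Vb H h q - up q\<bar> < eta & \<bar>up q - up p\<bar> < eta)"
proof -
 have eta4: "0 < eta/4" using eta by simp
 obtain eps where e: "0 < eps" "W eps p - W eps (fst p - eps, snd p) < eta/4" using W_close[OF p eta4] by blast
 from Vb_H_bounds[OF e(1) p(2) eta4] obtain A where A: "open A" "p \<in> A" and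
  ev: "NEAR h. \<forall>q\<in>A. 0 <= snd q -->
  Vb H h q < W eps p+eta/4 & W eps (fst p - eps, snd p) - eta/4 < Vb H h q &
  up q < W eps p+eta/4 & W eps (fst p - eps, snd p) - eta/4 < up q" by (elim exE conjE)
 from ev have "NEAR h. \<forall>q\<in>A. 0 <= snd q --> \<bar>Vb H h q - up q\<bar> < eta & \<bar>up q - up p\<bar> < eta"
 proof eventually_elim
  case (elim h)
  show ?case
  proof (intro ballI impI)
  fix q assume q: "q \<in> A" "0 <= snd q"
  note a = elim[rule_format, OF q] elim[rule_format, OF A(2) p(2)]
  have "\<bar>Vb H h q - up q\<bar> < eta" using a e by (elim conjE) linarith
  moreover have "\<bar>up q - up p\<bar> < eta" using a e by (elim conjE) linarith
  ultimately show "\<bar>Vb H h q - up q\<bar> < eta & \<bar>up q - up p\<bar> < eta" ..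
  qed
 qed
 then show ?thesis using A by (intro exI[of _ A] conjI)
qed

lemma up_continuous:
 assumes p: "p ~= (a, 0)" "0 <= snd p" and eta: "0 < eta"
 shows "\<exists>A. open A & p \<in> A & (a, 0) \<notin> A & (\<forall>q\<in>A. 0 <= snd q --> \<bar>up q - up p\<bar> < eta)"
proof -
 obtain A where A: "open A" "p \<in> A" and
  ev: "NEAR h. \<forall>q\<in>A. 0 <= snd q --> \<bar>Vb H h q - up q\<bar> < eta & \<bar>up q - up p\<bar> < eta"
  using up_locally_uniform[OF p eta] by (elim exE conjE)
 from eventually_happens[OF ev] have "\<forall>q\<in>A. 0 <= snd q --> \<bar>up q - up p\<bar> < eta" by auto
 then show ?thesis using A p by (intro exI[of _ "A - {(a, 0)}"]) auto
qed

text \<open>Once \<open>up\<close> is continuous off \<open>(a, 0)\<close> and the scheme converges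
  locally uniformly there, the negatives satisfy the hypotheses of \<open>half_relaxed_sub\<close>
  as well.\<close>

lemma up_int_super: assumes T: "0 < T" shows "int_super m s T up" unfolding int_super_iff[OF s01]
proof (rule half_relaxed_sub[where sig = "- 1" and tau = tau and Lam = "%h. 2*M/h" and M = M and V = "%h j i. - scheme m (om h) h (tau h) H j i"])
 show "NEAR h. 0 < tau h & 0 <= 2*M/h & grid_sub (- 1) m (om h) h (tau h) (2*M/h) M (%j i. - scheme m (om h) h (tau h) H j i)"
  using ev_gr[OF H_adm]
 proof eventually_elim
  case (elim h)
  then show ?case using grid_sub_scheme(2)[OF m2, of "om h" h "tau h" "2*M/h" M "gr H h"] unfolding scheme_gr by simp
 qed
 have loc: "\<exists>A. open A & p \<in> A & (NEAR h. \<forall>q\<in>A. 0 <= snd q --> \<bar>Vb H h q - up p\<bar> < eta)"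
  if "p \<in> Q T" "0 < eta" for p eta
 proof -
  have p: "p ~= (a, 0)" "0 <= snd p" and eta: "0 < eta/2" using that by (auto simp: Q_def)
  obtain A where A: "open A" "p \<in> A" and
  ev: "NEAR h. \<forall>q\<in>A. 0 <= snd q --> \<bar>Vb H h q - up q\<bar> < eta/2 & \<bar>up q - up p\<bar> < eta/2"
  using up_locally_uniform[OF p eta] by (elim exE conjE)
  from ev have "NEAR h. \<forall>q\<in>A. 0 <= snd q --> \<bar>Vb H h q - up p\<bar> < eta"
  proof eventually_elim
  case (elim h)
  show ?case
  proof (intro ballI impI)
  fix q assume q: "q \<in> A" "0 <= snd q"
  show "\<bar>Vb H h q - up p\<bar> < eta" using elim[rule_format, OF q] by linarith
  qed
  qed
  then show ?thesis using A by (intro exI[of _ A] conjI)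
 qed
 show "\<exists>A. open A & p \<in> A & (NEAR h. \<forall>q\<in>A \<inter> Q T. interpolant h (tau h) (%j i. - scheme m (om h) h (tau h) H j i) q < c)"
  if p: "p \<in> Q T" and c: "- up p < c" for p c
 proof -
  have "0 < c+up p" using c by simp
  from loc[OF p this] obtain A where A: "open A" "p \<in> A" and
  ev: "NEAR h. \<forall>q\<in>A. 0 <= snd q --> \<bar>Vb H h q - up p\<bar> < c+up p" by (elim exE conjE)
  from ev have "NEAR h. \<forall>q\<in>A \<inter> Q T. interpolant h (tau h) (%j i. - scheme m (om h) h (tau h) H j i) q < c"
  proof eventually_elim
  case (elim h)
  show ?case
  proof
  fix q assume q: "q \<in> A \<inter> Q T"
  then have "\<bar>Vb H h q - up p\<bar> < c+up p" using elim by (auto simp: Q_def)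
  then show "interpolant h (tau h) (%j i. - scheme m (om h) h (tau h) H j i) q < c" unfolding interpolant_uminus Vb_def by linarith
  qed
  qed
  then show ?thesis using A by (intro exI[of _ A] conjI)
 qed
 show "\<exists>\<^sub>F h in at_right 0. \<exists>q\<in>A \<inter> Q T. c < interpolant h (tau h) (%j i. - scheme m (om h) h (tau h) H j i) q"
  if p: "p \<in> Q T" and c: "c < - up p" and A: "open A" "p \<in> A" for p c A
 proof (rule eventually_frequently)
  have "0 < - up p - c" using c by simp
  from loc[OF p this] obtain B where B: "p \<in> B" and
  ev: "NEAR h. \<forall>q\<in>B. 0 <= snd q --> \<bar>Vb H h q - up p\<bar> < - up p - c" by (elim exE conjE)
  have p0: "0 <= snd p" using p by (auto simp: Q_def)
  from ev show "NEAR h. \<exists>q\<in>A \<inter> Q T. c < interpolant h (tau h) (%j i. - scheme m (om h) h (tau h) H j i) q"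
  proof eventually_elim
  case (elim h)
  have "c < - Vb H h p" using elim[rule_format, OF B p0] by linarith
  then show ?case using A p unfolding interpolant_uminus Vb_def by (intro bexI[of _ p]) auto
  qed
 qed simp
qed (use T tau0 in auto)

lemma up_initial: "x ~= a ==> up (x, 0) = H x"
proof (rule antisym)
 assume x: "x ~= a"
 define eps where "eps = \<bar>x - a\<bar>"
 have e: "0 < eps" using x by (simp add: eps_def)
 have "up (x, 0) <= ramp eps x" using up_le[OF e, of "(x, 0)"] by (simp add: W0 e)
 also have "ramp eps x <= H x"
 proof (cases "x < a")
  case True
  then have "(x - a)/eps = - 1" unfolding eps_def by (simp add: divide_eq_eq)
  then show ?thesis using M by (simp add: ramp_def H_def)
 next
  case False then show ?thesis using ramp_range(2) by (simp add: H_def)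
 qed
 finally show "up (x, 0) <= H x" .
 show "H x <= up (x, 0)" using ramp_ge_H by (intro up_ge) (simp add: W0)
qed

lemma H_env: "H x <= usc_env UNIV H x" "usc_env UNIV (%x. - H x) x = - lsc_env UNIV H x"
 "lsc_env UNIV H x <= H x" "lsc_env UNIV H a <= 0"
proof -
 have HM: "\<bar>H x\<bar> <= M" "\<bar>- H x\<bar> <= M" for x using M by (auto simp: H_def)
 show "H x <= usc_env UNIV H x" by (rule usc_env_ge[OF UNIV_I HM(1)])
 show e: "usc_env UNIV (%x. - H x) x = - lsc_env UNIV H x" for x using lsc_env_eq[of x UNIV H M, OF UNIV_I HM(1)] by simp
 show "lsc_env UNIV H x <= H x" using usc_env_ge[of x UNIV "%x. - H x" M] HM(2) unfolding e by simp
 show "lsc_env UNIV H a <= 0"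
 proof (rule ccontr)
  assume "\<not> ?thesis"
  then have "usc_env UNIV (%x. - H x) a < 0" unfolding e by simp
  then obtain U where U: "open U" "a \<in> U" "\<forall>q\<in>U \<inter> UNIV. - H q < 0"
  using usc_env_less[of a UNIV "%x. - H x" M 0] HM(2) by auto
  then obtain d where d: "0 < d" "ball a d \<subseteq> U" by (auto simp: open_contains_ball)
  then have "a - d/2 \<in> U" by (intro subsetD[OF d(2)]) (simp add: dist_real_def)
  then show False using U(3) d by (auto simp: H_def)
 qed
qed

text \<open>Away from \<open>(a, 0)\<close> the envelopes are \<open>up\<close> and its negative by
  continuity. At \<open>(a, 0)\<close> only the bounds 0 and \<open>M\<close> enter, and the
  envelopes of \<open>H\<close> at \<open>a\<close> reach these, hence every value \<open>c\<close>
  between them is allowed.\<close>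

lemma up_disc_sol:
 assumes T: "0 < T" and c: "0 <= c" "c <= M" shows "disc_visc_sol m s T H (up((a, 0) := c))"
proof -
 define v where "v = up((a, 0) := c)"
 have vM: "\<bar>v p\<bar> <= M" "\<bar>- v p\<bar> <= M" for p using up_range(2)[of p] c by (auto simp: v_def)
 have v0: "0 <= v p" if "p \<in> Qbar T" for p using up_range(1)[of "snd p" "fst p"] c that by (auto simp: v_def Qbar_def)
 have HM: "\<bar>H x\<bar> <= M" for x using M by (auto simp: H_def)
 have bv: "bounded (v ` Qbar T)" unfolding bounded_iff by (intro exI[of _ M]) (use vM in auto)
 have env: "usc_env (Qbar T) v p = up p" "usc_env (Qbar T) (%p. - v p) p = - up p"
  if p: "p \<in> Qbar T" "p ~= (a, 0)" for p
 proof -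
  have p0: "0 <= snd p" using p by (auto simp: Qbar_def)
  have U: "\<exists>U. open U & p \<in> U & (\<forall>q\<in>U \<inter> Qbar T. \<bar>v q - v p\<bar> <= e)" if e: "0 < e" for e
  proof -
  obtain A where A: "open A" "p \<in> A" "(a, 0) \<notin> A" "\<forall>q\<in>A. 0 <= snd q --> \<bar>up q - up p\<bar> < e"
  using up_continuous[OF p(2) p0 e] by blast
  have "\<bar>v q - v p\<bar> <= e" if "q \<in> A \<inter> Qbar T" for q
  proof -
  have "q ~= (a, 0)" "0 <= snd q" using that A by (auto simp: Qbar_def)
  then show ?thesis using A(4) that p by (auto simp: v_def less_imp_le)
  qed
  then show ?thesis using A by blast
  qed
  have vp: "v p = up p" using p by (simp add: v_def)
  show "usc_env (Qbar T) v p = up p" unfolding vp[symmetric]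
  proof (rule usc_env_continuous[OF p(1) vM(1)])
  fix e :: real assume "0 < e"
  from U[OF this] obtain U where U: "open U" "p \<in> U" "\<forall>q\<in>U \<inter> Qbar T. \<bar>v q - v p\<bar> <= e" by blast
  have "v q <= v p+e" if "q \<in> U \<inter> Qbar T" for q using bspec[OF U(3) that] by linarith
  then show "\<exists>U. open U & p \<in> U & (\<forall>q\<in>U \<inter> Qbar T. v q <= v p+e)" using U(1,2) by blast
  qed
  show "usc_env (Qbar T) (%p. - v p) p = - up p" unfolding vp[symmetric]
  proof (rule usc_env_continuous[OF p(1) vM(2)])
  fix e :: real assume "0 < e"
  from U[OF this] obtain U where U: "open U" "p \<in> U" "\<forall>q\<in>U \<inter> Qbar T. \<bar>v q - v p\<bar> <= e" by blast
  have "- v q <= - v p+e" if "q \<in> U \<inter> Qbar T" for q using bspec[OF U(3) that] by linarith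
  then show "\<exists>U. open U & p \<in> U & (\<forall>q\<in>U \<inter> Qbar T. - v q <= - v p+e)" using U(1,2) by blast
  qed
 qed
 have inQ: "(x, 0) \<in> Qbar T" for x using T by (simp add: Qbar_def)
 have QQ: "p \<in> Qbar T & p ~= (a, 0)" if "p \<in> Q T" for p using that by (auto simp: Q_def Qbar_def)
 have "visc_subsol m s T H (usc_env (Qbar T) v)"
 proof (rule visc_subsolI)
  show "bounded (usc_env (Qbar T) v ` Qbar T)" unfolding bounded_iff
  by (intro exI[of _ M]) (use usc_env_abs_le[of _ "Qbar T" v M] vM(1) in auto)
  show "usc_on (Qbar T) (usc_env (Qbar T) v)" by (rule usc_on_env[OF vM(1)])
  show "int_sub m s T (usc_env (Qbar T) v)" by (rule int_sub_cong[OF up_int_sub[OF T]]) (use env QQ in auto)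
  fix x
  show "usc_env (Qbar T) v (x, 0) <= usc_env UNIV H x"
  proof (cases "x = a")
  case True
  have "usc_env (Qbar T) v (x, 0) <= M" using usc_env_abs_le[of "(x, 0)" "Qbar T" v M] inQ vM(1) by (simp add: abs_le_iff)
  also have "M = H x" using True by (simp add: H_def)
  finally show ?thesis using H_env(1)[of x] by simp
  next
  case False
  then show ?thesis using H_env(1)[of x] env(1)[OF inQ] up_initial[OF False] by simp
  qed
 qed
 moreover have "visc_supersol m s T H (lsc_env (Qbar T) v)"
 proof (rule visc_subsol_uminus_super[OF s01 vM(1) HM])
  show "int_sub m s T (usc_env (Qbar T) (%p. - v p))"
  by (rule int_sub_cong[OF up_int_super[OF T, unfolded int_super_iff[OF s01]]]) (use env QQ in auto)
  fix x
  show "usc_env (Qbar T) (%p. - v p) (x, 0) <= usc_env UNIV (%x. - H x) x"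
  proof (cases "x = a")
  case True
  have "usc_env (Qbar T) (%p. - v p) (x, 0) <= 0" by (rule usc_env_le[OF inQ vM(2) open_UNIV]) (use v0 in auto)
  then show ?thesis using H_env(4) True unfolding H_env(2) by simp
  next
  case False
  then show ?thesis using H_env(3)[of x] env(2)[OF inQ] up_initial[OF False] unfolding H_env(2) by simp
  qed
 qed (rule T)
 ultimately show ?thesis unfolding disc_visc_sol_def v_def[symmetric] using bv by simp
qed

text \<open>The envelopes of \<open>H\<close> lie between the translate of a ramp and the ramp, so
  comparison puts every discontinuous solution between the corresponding solutions, and
  \<open>W_close\<close> makes these meet.\<close>

lemma up_unique:
 assumes T: "0 < T" and w: "disc_visc_sol m s T H w" and p: "p \<in> Qbar T" "p ~= (a, 0)" "snd p < T" shows "w p = up p"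
proof -
 obtain x t where xt: "p = (x, t)" by (cases p)
 have t: "0 <= t" "t < T" using p xt by (auto simp: Qbar_def)
 have HM: "\<bar>H x\<bar> <= M" for x using M by (auto simp: H_def)
 obtain B where B: "!!q. q \<in> Qbar T ==> \<bar>w q\<bar> <= B" using w unfolding disc_visc_sol_def bounded_iff by auto
 have Bn: "\<bar>- w q\<bar> <= B" if "q \<in> Qbar T" for q using B[OF that] by simp
 have sub: "visc_subsol m s T H (usc_env (Qbar T) w)" and super: "visc_supersol m s T H (lsc_env (Qbar T) w)"
  using w by (simp_all add: disc_visc_sol_def)
 have isol: "int_sub m s T (W eps)" "int_super m s T (W eps)" "BUC_on (Qbar T) (W eps)" if "0 < eps" for eps
  using W[OF that] T solves_BUC[OF W[OF that]] by (auto simp: solves_def)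
 have "w p <= up p"
 proof (rule up_ge)
  fix eps :: real assume e: "0 < eps"
  have env: "usc_env UNIV (ramp eps) y = ramp eps y" for y by (rule usc_env_cont_on[of y UNIV "ramp eps" M])
  (use ramp_uc[OF e, of 0] ramp_adm[OF e, of 0] in \<open>auto simp: adm_def uniformly_continuous_imp_continuous\<close>)
  have cr: "continuous_on UNIV (ramp eps)" using uniformly_continuous_imp_continuous[OF ramp_uc[OF e, of 0]] by simp
  have "usc_env UNIV H y <= ramp eps y" for y
  proof (rule field_le_epsilon)
  fix d :: real assume d: "0 < d"
  have "open {z. ramp eps z < ramp eps y+d}" using cr by (intro open_Collect_less continuous_on_const)
  moreover have "H z <= ramp eps y+d" if "z \<in> {z. ramp eps z < ramp eps y+d}" for z using ramp_ge_H[OF e, of z] that by simp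
  ultimately show "usc_env UNIV H y <= ramp eps y+d"
  by (intro usc_env_le[OF UNIV_I HM, where U = "{z. ramp eps z < ramp eps y+d}"]) (use d in auto)
  qed
  then have "usc_env (Qbar T) w (x, t) <= W eps (x, t)" by (intro comparison[OF s01 m2 T sub isol(2,3)[OF e] _ t]) (simp add: W0 e)
  then show "w p <= W eps p" using usc_env_ge[where f = w, OF p(1) B] xt by simp
 qed
 moreover have "up p <= w p"
 proof (rule field_le_epsilon)
  fix eta :: real assume eta: "0 < eta"
  have p0: "0 <= snd p" using t xt by simp
  obtain eps where e: "0 < eps" "W eps p - W eps (fst p - eps, snd p) < eta" using W_close[OF p(2) p0 eta] by blast
  obtain Y where Y: "solves (%x. ramp eps (x - eps)) Y" "!!x t. 0 <= t ==> Y (x, t) = W eps (x - eps, t)"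
  using W_shift_solves[OF e(1)] by blast
  have Yi: "int_sub m s T Y" "BUC_on (Qbar T) Y" using Y(1) T solves_BUC[OF Y(1)] by (auto simp: solves_def)
  have cr: "continuous_on UNIV (%x. - ramp eps (x - eps))"
  using uniformly_continuous_imp_continuous[OF ramp_uc[OF e(1), of "- eps"]] by (simp add: continuous_on_minus)
  have "usc_env UNIV (%x. - H x) y <= - ramp eps (y - eps)" for y
  proof (rule field_le_epsilon)
  fix d :: real assume d: "0 < d"
  have "open {z. - ramp eps (z - eps) < - ramp eps (y - eps)+d}" using cr by (intro open_Collect_less continuous_on_const)
  moreover have "- H z <= - ramp eps (y - eps)+d" if "z \<in> {z. - ramp eps (z - eps) < - ramp eps (y - eps)+d}" for z
  using ramp_le_H[OF e(1), of z] that by simp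
  ultimately show "usc_env UNIV (%x. - H x) y <= - ramp eps (y - eps)+d"
  by (intro usc_env_le[of y UNIV "%x. - H x" M, where U = "{z. - ramp eps (z - eps) < - ramp eps (y - eps)+d}"]) (use d HM in auto)
  qed
  then have "ramp eps (y - eps) <= lsc_env UNIV H y" for y unfolding H_env(2) by (simp add: minus_le_iff)
  then have "Y (x, t) <= lsc_env (Qbar T) w (x, t)" by (intro comparison_super[OF s01 m2 T HM super Yi _ t]) (simp add: Y(2) W0 e)
  moreover have "lsc_env (Qbar T) w p <= w p"
  using usc_env_ge[where f = "%q. - w q", OF p(1) Bn] lsc_env_eq[where f = w, OF p(1) B] by simp
  moreover have "up p <= W eps p" by (rule up_le[OF e(1)])
  ultimately show "up p <= w p+eta" using e(2) Y(2)[OF t(1)] unfolding xt by simp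
 qed
 ultimately show ?thesis by simp
qed

theorem jump_main:
 assumes T: "0 < T" shows "Cb_on (Qbar T - {(a, 0)}) up" "loc_unif_conv (Qbar T - {(a, 0)}) (Vb H) up"
  "!!c. c \<in> {0..M} ==> disc_visc_sol m s T H (up((a, 0) := c))"
  "!!w p. disc_visc_sol m s T H w ==> p \<in> Qbar T - {(a, 0)} ==>
  snd p < T | continuous (at p within Qbar T) w ==> w p = up p"
proof -
 have q0: "0 <= snd q" if "q \<in> Qbar T" for q using that by (auto simp: Qbar_def)
 show "Cb_on (Qbar T - {(a, 0)}) up" unfolding Cb_on_def
 proof
  show "bounded (up ` (Qbar T - {(a, 0)}))" unfolding bounded_iff by (intro exI[of _ M]) (use up_range(2) in auto)
  show "continuous_on (Qbar T - {(a, 0)}) up" unfolding continuous_on_topological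
  proof (intro ballI allI impI)
  fix p B assume p: "p \<in> Qbar T - {(a, 0)}" and B: "open B" "up p \<in> B"
  obtain d where d: "0 < d" "ball (up p) d \<subseteq> B" using B by (auto simp: open_contains_ball)
  obtain A where A: "open A" "p \<in> A" "\<forall>q\<in>A. 0 <= snd q --> \<bar>up q - up p\<bar> < d"
  using up_continuous[of p d] p q0 d by blast
  have "\<forall>q\<in>Qbar T - {(a, 0)}. q \<in> A --> up q \<in> B"
  using A(3) d(2) q0 by (auto simp: subset_eq dist_real_def abs_minus_commute)
  then show "\<exists>A. open A & p \<in> A & (\<forall>q\<in>Qbar T - {(a, 0)}. q \<in> A --> up q \<in> B)" using A by blast
  qed
 qed
 show "loc_unif_conv (Qbar T - {(a, 0)}) (Vb H) up" unfolding loc_unif_conv_def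
 proof (intro allI impI)
  fix K assume K: "compact K & K \<subseteq> Qbar T - {(a, 0)}"
  show "uniform_limit K (Vb H) up (at_right 0)"
  proof (rule uniform_limit_locally)
  fix p e assume p: "p \<in> K" and e: "0 < (e::real)"
  have "p \<in> Qbar T - {(a, 0)}" using p K by blast
  then have p': "p ~= (a, 0)" "0 <= snd p" using q0 by auto
  obtain A where A: "open A" "p \<in> A" and
  ev: "NEAR h. \<forall>q\<in>A. 0 <= snd q --> \<bar>Vb H h q - up q\<bar> < e & \<bar>up q - up p\<bar> < e"
  using up_locally_uniform[OF p' e] by (elim exE conjE)
  from ev have "NEAR h. \<forall>q\<in>A \<inter> K. dist (Vb H h q) (up q) < e"
  by eventually_elim (use K q0 in \<open>auto simp: dist_real_def\<close>)
  then show "\<exists>A. open A & p \<in> A & (NEAR h. \<forall>q\<in>A \<inter> K. dist (Vb H h q) (up q) < e)"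
  using A by (intro exI[of _ A] conjI)
  qed (use K in simp)
 qed
 show "disc_visc_sol m s T H (up((a, 0) := c))" if "c \<in> {0..M}" for c using up_disc_sol[OF T, of c] that by simp
 fix w p assume w: "disc_visc_sol m s T H w" and p: "p \<in> Qbar T - {(a, 0)}" and c: "snd p < T | continuous (at p within Qbar T) w"
 show "w p = up p"
 proof (cases "snd p < T")
  case True then show ?thesis using up_unique[OF T w] p by auto
 next
  case False
  obtain x t where xt: "p = (x, t)" by (cases p)
  have t: "t = T" using False p xt by (auto simp: Qbar_def)
  have cw: "continuous (at p within Qbar T) w" using c False by simp
  \<comment> \<open>At the final time comparison is silent. The value is recovered along earlier
    times, where \<open>w = up\<close>, from the continuity of \<open>w\<close> and of
    \<open>up\<close> at \<open>p\<close>.\<close>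
  define r where "r n = T - T/real (n+2)" for n :: nat
  have rin: "0 <= r n" "r n < T" "0 < r n" for n
  using T mult_nonneg_nonneg[of T "real n"] by (auto simp: r_def field_simps intro: add_pos_nonneg)
  have "(%n. T/real (n+2)) \<longlonglongrightarrow> 0" by (rule LIMSEQ_ignore_initial_segment[OF lim_const_over_n])
  then have "r \<longlonglongrightarrow> T - 0" unfolding r_def[abs_def] by (intro tendsto_diff tendsto_const)
  then have lim: "(%n. (x, r n)) \<longlonglongrightarrow> p" unfolding xt t by (intro tendsto_Pair tendsto_const) simp
  have rQ: "(x, r n) \<in> Qbar T" "(x, r n) ~= (a, 0)" "(x, r n) ~= p" for n using rin[of n] by (auto simp: Qbar_def xt t)
  have eq: "w (x, r n) = up (x, r n)" for n by (rule up_unique[OF T w rQ(1,2)]) (use rin in simp)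
  have "(%n. w (x, r n)) \<longlonglongrightarrow> w p"
  using cw[unfolded continuous_within_sequentially, rule_format, of "%n. (x, r n)"] lim rQ(1) by (simp add: o_def)
  moreover have "(%n. up (x, r n)) \<longlonglongrightarrow> up p"
  proof (rule tendstoI)
  fix e :: real assume e: "0 < e"
  obtain A where A: "open A" "p \<in> A" "\<forall>q\<in>A. 0 <= snd q --> \<bar>up q - up p\<bar> < e"
  using up_continuous[of p e] p q0 e by blast
  have "\<forall>\<^sub>F n in sequentially. (x, r n) \<in> A" using lim A(1,2) by (rule topological_tendstoD)
  then show "\<forall>\<^sub>F n in sequentially. dist (up (x, r n)) (up p) < e"
  by eventually_elim (use A(3) rin in \<open>auto simp: dist_real_def\<close>)
  qed
  ultimately show ?thesis unfolding eq by (rule LIMSEQ_unique)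
 qed
qed

end

section \<open>Weak derivatives in space\<close>

text \<open>A hat on \<open>[0, 1]\<close> with integral 1. It is continuous, so that its primitive
  \<open>ramp2\<close>, which climbs from 0 to 1, is C1 and may be used in a test function.\<close>

definition tent :: "real => real" where
 "tent u = 4*(max u 0 - 2*max (u - 1/2) 0+max (u - 1) 0)"

definition ramp2 :: "real => real" where
 "ramp2 u = 2*(max u 0 ^ 2 - 2*max (u - 1/2) 0 ^ 2+max (u - 1) 0 ^ 2)"

lemma tent_simps: "0 <= tent u" "u <= 0 | 1 <= u ==> tent u = 0" "tent u <= 4" by (auto simp: tent_def max_def)

lemma ramp2_simps: "u <= 0 ==> ramp2 u = 0" "1 <= u ==> ramp2 u = 1" by (auto simp: ramp2_def max_def power2_eq_square algebra_simps)

lemma tent_cont: "continuous_on S tent" unfolding tent_def by (intro continuous_intros)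

lemma ramp2_deriv: "(ramp2 has_real_derivative tent u) (at u)"
proof -
 have "((%z. 3*max z 0 ^ 2) has_real_derivative 6*max x 0) (at x)" for x :: real using C2d_cube_plus unfolding C2d_def by blast
 then have "((%z. (1/3)*(3*max z 0 ^ 2)) has_real_derivative (1/3)*(6*max x 0)) (at x)" for x :: real by (rule DERIV_cmult)
 then have sq: "((%z. max z 0 ^ 2) has_real_derivative 2*max x 0) (at x)" for x :: real by simp
 have sh: "((%z. max (z - c) 0 ^ 2) has_real_derivative 2*max (u - c) 0) (at u)" for c
 proof -
  have "((%z. z - c) has_real_derivative 1) (at u)" by (auto intro!: derivative_eq_intros)
  from DERIV_chain2[where f = "%z. max z 0 ^ 2" and g = "%z. z - c", OF sq this] show ?thesis by simp
 qed
 have "(ramp2 has_real_derivative 2*(2*max (u - 0) 0 - 2*(2*max (u - 1/2) 0)+2*max (u - 1) 0)) (at u)"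
  unfolding ramp2_def using sh[of 0] sh[of "1/2"] sh[of 1] by (intro DERIV_cmult DERIV_add DERIV_diff) simp_all
 then show ?thesis by (simp add: tent_def algebra_simps)
qed

lemma ramp2_mono: "u <= w ==> ramp2 u <= ramp2 w" by (rule DERIV_nonneg_imp_nondecreasing) (use ramp2_deriv tent_simps in blast)+

lemma ramp2_range: "0 <= ramp2 u" "ramp2 u <= 1"
 using ramp2_mono[of "min u 0" u] ramp2_mono[of u "max u 1"] ramp2_simps(1)[of "min u 0"] ramp2_simps(2)[of "max u 1"] by simp_all

lemma tent_integral: "integrable lborel tent" "(LINT u|lborel. tent u) = 1"
proof -
 have e: "tent = (%u. tent u*indicator {0..1} u)"
 proof
  fix u show "tent u = tent u*indicator {0..1} u" using tent_simps(2)[of u] by (cases "u \<in> {0..1}") auto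
 qed
 have "has_bochner_integral lborel (%u. tent u*indicator {0..1} u) (ramp2 1 - ramp2 0)"
  by (rule has_bochner_integral_FTC_Icc_real) (use ramp2_deriv tent_cont[of UNIV] in \<open>auto simp: continuous_on_eq_continuous_at\<close>)
 then have "has_bochner_integral lborel tent 1" unfolding e[symmetric] by (simp add: ramp2_simps)
 then show "integrable lborel tent" "(LINT u|lborel. tent u) = 1" by (simp_all add: has_bochner_integral_iff)
qed

lemma tent_average:
 assumes f: "mono f" "!!x. \<bar>f x\<bar> <= B" and d: "0 < dl" shows "integrable lborel (%z. f z*(tent ((z - c)/dl)/dl))"
  and "f c <= (LINT z|lborel. f z*(tent ((z - c)/dl)/dl))" and "(LINT z|lborel. f z*(tent ((z - c)/dl)/dl)) <= f (c+dl)"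
proof -
 define k where "k = (%z. tent ((z - c)/dl)/dl)"
 have k0: "0 <= k z" for z using tent_simps(1) d by (simp add: k_def)
 have kz: "k z = 0" if "z \<notin> {c..c+dl}" for z
  using that d tent_simps(2)[of "(z - c)/dl"] by (auto simp: k_def divide_le_0_iff le_divide_eq)
 have e: "(z - c)/dl = - c/dl+(1/dl)*z" for z by (simp add: diff_divide_distrib)
 have ki: "integrable lborel k" and k1: "(LINT z|lborel. k z) = 1"
 proof -
  have "integrable lborel (%z. tent (- c/dl+(1/dl)*z))" by (rule lborel_integrable_real_affine[OF tent_integral(1)]) (use d in simp)
  then show "integrable lborel k" unfolding k_def e by (intro integrable_divide_zero)
  have "(LINT z|lborel. tent z) = \<bar>1/dl\<bar> *\<^sub>R (LINT z|lborel. tent (- c/dl+(1/dl)*z))"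
  using d by (intro lborel_integral_real_affine) simp
  then show "(LINT z|lborel. k z) = 1" unfolding k_def e tent_integral(2) using d by simp
 qed
 have fm: "f \<in> borel_measurable borel" by (rule borel_measurable_mono[OF f(1)])
 have km: "k \<in> borel_measurable borel" unfolding k_def
  by (intro borel_measurable_divide borel_measurable_const measurable_compose[OF _ borel_measurable_continuous_onI[OF tent_cont]]) measurable
 have i: "integrable lborel (%z. f z * k z)"
 proof (rule Bochner_Integration.integrable_bound[of lborel "%z. B * k z"])
  show "integrable lborel (%z. B * k z)" using ki by simp
  show "(%z. f z * k z) \<in> borel_measurable lborel" using fm km by simp
  have B: "0 <= B" using f(2)[of 0] by linarith
  show "AE x in lborel. norm (f x * k x) <= norm (B * k x)" using f(2) k0 B by (auto simp: abs_mult intro!: mult_right_mono)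
 qed
 then show "integrable lborel (%z. f z*(tent ((z - c)/dl)/dl))" by (simp only: k_def)
 have "(LINT z|lborel. f c * k z) <= (LINT z|lborel. f z * k z)"
 proof (rule integral_mono)
  show "f c * k z <= f z * k z" for z
  using kz[of z] k0[of z] monoD[OF f(1), of c z] by (cases "z \<in> {c..c+dl}") (auto intro!: mult_right_mono)
 qed (use ki i in auto)
 then show "f c <= (LINT z|lborel. f z*(tent ((z - c)/dl)/dl))" using k1 by (simp add: k_def)
 have "(LINT z|lborel. f z * k z) <= (LINT z|lborel. f (c+dl) * k z)"
 proof (rule integral_mono)
  show "f z * k z <= f (c+dl) * k z" for z
  using kz[of z] k0[of z] monoD[OF f(1), of z "c+dl"] by (cases "z \<in> {c..c+dl}") (auto intro!: mult_right_mono)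
 qed (use ki i in auto)
 then show "(LINT z|lborel. f z*(tent ((z - c)/dl)/dl)) <= f (c+dl)" using k1 by (simp add: k_def)
qed

text \<open>The weak derivative is tested with a C1 plateau that climbs just before \<open>x\<close>
  and descends just after \<open>y\<close>. For monotone \<open>f\<close> the averages over these
  margins err in the favourable direction, so the estimate holds at every pair of points and not
  only almost everywhere.\<close>

lemma W1inf_deriv_Lipschitz:
 assumes f: "mono f" "!!x. \<bar>f x\<bar> <= B" and g: "W1inf_deriv f g" "AE x in lborel. \<bar>g x\<bar> <= L" and xy: "x <= y"
 shows "0 <= L" "f y - f x <= L*(y - x)"
proof -
 show L: "0 <= L"
 proof (rule ccontr)
  assume "\<not> 0 <= L"
  with g(2) have "AE x in (lborel :: real measure). False" by (auto elim!: eventually_mono)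
  then have "emeasure lborel (UNIV :: real set) = 0" by (simp add: AE_iff_null null_sets_def)
  then show False by simp
 qed
 have gm: "g \<in> borel_measurable borel" using g(1) by (simp add: W1inf_deriv_def Linf_def)
 have est: "f y - f x <= L*(y - x)+dl*(2*L)" if d: "0 < dl" for dl
 proof -
  define phi where "phi = (%z. ramp2 ((z - (x - dl))/dl) - ramp2 ((z - y)/dl))"
  define phi1 where "phi1 = (%z. tent ((z - (x - dl))/dl)/dl - tent ((z - y)/dl)/dl)"
  have sc: "((%z. ramp2 ((z - c)/dl)) has_real_derivative tent ((z - c)/dl)/dl) (at z)" for c z
  proof -
  have "((%z. (z - c)/dl) has_real_derivative 1/dl) (at z)" using d by (auto intro!: derivative_eq_intros)
  from DERIV_chain2[where f = ramp2, OF ramp2_deriv this] show ?thesis by simp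
  qed
  have phid: "(phi has_real_derivative phi1 z) (at z)" for z unfolding phi_def phi1_def by (intro DERIV_diff sc)
  have dphi: "deriv phi = phi1" using phid DERIV_imp_deriv by blast
  have phi1c: "continuous_on UNIV phi1" unfolding phi1_def
  by (intro continuous_intros continuous_on_compose2[OF tent_cont[of UNIV]]) (use d in auto)
  have phiout: "phi z = 0" if "z \<notin> {x - dl..y+dl}" for z
  proof (cases "z < x - dl")
  case True
  then show ?thesis using ramp2_simps(1)[of "(z - (x - dl))/dl"] ramp2_simps(1)[of "(z - y)/dl"] d xy
  by (simp add: phi_def divide_le_0_iff)
  next
  case False
  then have "y+dl < z" using that by simp
  then show ?thesis using ramp2_simps(2)[of "(z - (x - dl))/dl"] ramp2_simps(2)[of "(z - y)/dl"] d xy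
  by (simp add: phi_def le_divide_eq)
  qed
  have phib: "0 <= phi z" "phi z <= 1" for z
  proof -
  have "(z - y)/dl <= (z - (x - dl))/dl" using d xy by (intro divide_right_mono) auto
  then show "0 <= phi z" using ramp2_mono unfolding phi_def by simp
  show "phi z <= 1" using ramp2_range(2)[of "(z - (x - dl))/dl"] ramp2_range(1)[of "(z - y)/dl"] unfolding phi_def by linarith
  qed
  have "test_fun phi" unfolding test_fun_def
  proof (intro conjI allI)
  show "phi differentiable at z" for z using phid real_differentiable_def by blast
  show "continuous_on UNIV (deriv phi)" unfolding dphi by (rule phi1c)
  show "\<exists>R. \<forall>z. R < \<bar>z\<bar> --> phi z = 0"
  by (rule exI[of _ "\<bar>x\<bar>+\<bar>y\<bar>+dl"]) (auto intro!: phiout)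
  qed
  then have weak: "(LINT z|lborel. f z*phi1 z) = - (LINT z|lborel. g z*phi z)"
  using g(1) unfolding W1inf_deriv_def dphi[symmetric] by blast
  have "(LINT z|lborel. f z*phi1 z) = (LINT z|lborel. f z*(tent ((z - (x - dl))/dl)/dl)) - (LINT z|lborel. f z*(tent ((z - y)/dl)/dl))"
  unfolding phi1_def right_diff_distrib by (rule Bochner_Integration.integral_diff[OF tent_average(1)[OF f d] tent_average(1)[OF f d]])
  also have "... <= f (x - dl+dl) - f y" by (intro diff_mono tent_average[OF f d])
  finally have "f y - f x <= (LINT z|lborel. g z*phi z)" using weak by simp
  also have "... <= (LINT z|lborel. L*indicator {x - dl..y+dl} z)"
  proof (rule integral_mono_AE)
  have phic: "continuous_on UNIV phi" using phid DERIV_isCont by (simp add: continuous_on_eq_continuous_at) blast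
  show "integrable lborel (%z. g z*phi z)"
  proof (rule integrableI_bounded_set[where A = "{x - dl..y+dl}" and B = L])
  show "(%z. g z*phi z) \<in> borel_measurable lborel" using gm borel_measurable_continuous_onI[OF phic] by simp
  show "AE z in lborel. z \<in> {x - dl..y+dl} --> norm (g z*phi z) <= L" using g(2)
  proof eventually_elim
  case (elim z)
  have "\<bar>g z\<bar>*\<bar>phi z\<bar> <= L*1" using elim phib[of z] L by (intro mult_mono) auto
  then show ?case by (simp add: abs_mult)
  qed
  qed (use phiout d xy in auto)
  show "integrable lborel (%z. L*indicator {x - dl..y+dl} z)"
  using d xy by (intro integrable_mult_right integrable_real_indicator) auto
  show "AE z in lborel. g z*phi z <= L*indicator {x - dl..y+dl} z" using g(2)
  proof eventually_elim
  case (elim z)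
  show ?case
  proof (cases "z \<in> {x - dl..y+dl}")
  case True
  have "g z*phi z <= \<bar>g z\<bar>*phi z" using phib by (intro mult_right_mono) auto
  also have "... <= L*1" using elim phib[of z] L by (intro mult_mono) auto
  finally show ?thesis using True by simp
  next
  case False then show ?thesis using phiout by simp
  qed
  qed
  qed
  also have "... = L*(y - x)+dl*(2*L)" using d xy by (simp add: algebra_simps)
  finally show ?thesis .
 qed
 show "f y - f x <= L*(y - x)"
 proof (rule field_le_epsilon)
  fix e :: real assume e: "0 < e"
  define dl where "dl = e/(2*L+1)"
  have d: "0 < dl" using e L by (simp add: dl_def)
  have "dl*(2*L) <= dl*(2*L+1)" using d by (intro mult_left_mono) auto
  also have "... = e" using L by (simp add: dl_def)
  finally show "f y - f x <= L*(y - x)+e" using est[OF d] by linarith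
 qed
qed

section \<open>Densities of nondecreasing Lipschitz functions\<close>

lemma Int_stable_Ioc: "Int_stable (range (%(a, b). {a <.. b::real}))"
proof (rule Int_stableI)
 fix A B assume "A \<in> range (%(a, b). {a <.. b::real})" "B \<in> range (%(a, b). {a <.. b::real})"
 then obtain a b c d where "A = {a<..b}" "B = {c<..d}" by auto
 then have "A \<inter> B = (%(a, b). {a <.. b}) (max a c, min b d)" by auto
 then show "A \<inter> B \<in> range (%(a, b). {a <.. b::real})" by blast
qed

text \<open>The Stieltjes measures of \<open>F\<close> and of \<open>L*x - F x\<close> add up to
  \<open>L\<close> times Lebesgue measure. Both are therefore absolutely continuous, and their
  Radon-Nikodym densities add up to \<open>L\<close>, which bounds the first by
  \<open>L\<close>.\<close>

lemma Lipschitz_density: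
 fixes F :: "real => real"
 assumes F: "mono F" "!!x y. x <= y ==> F y - F x <= L*(y - x)" and L: "0 < L"
 shows "\<exists>g. g \<in> borel_measurable borel & (\<forall>x. 0 <= g x & g x <= L) &
  (\<forall>a b. a <= b --> (LINT x|lborel. indicator {a<..b} x*g x) = F b - F a)"
proof -
 define G where "G = (%x. L*x - F x)"
 define mu where "mu = interval_measure F"
 define nu where "nu = interval_measure G"
 have Fc: "continuous_on UNIV F"
 proof (rule uniformly_continuous_imp_continuous[OF lipschitz_on_uniformly_continuous], rule lipschitz_onI)
  fix x y
  show "dist (F x) (F y) <= L*dist x y" using F(2)[of x y] F(2)[of y x] monoD[OF F(1), of x y] monoD[OF F(1), of y x]
  by (cases "x <= y") (auto simp: dist_real_def)
 qed (use L in simp)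
 have Gc: "continuous_on UNIV G" unfolding G_def by (intro continuous_intros Fc)
 have Gm: "G x <= G y" if "x <= y" for x y using F(2)[OF that] by (simp add: G_def algebra_simps)
 have "emeasure mu {a<..b} = ennreal (if a <= b then F b - F a else 0)" for a b unfolding mu_def
  using F(1) Fc by (subst emeasure_interval_measure_Ioc_eq) (auto simp: mono_def continuous_on_eq_continuous_at continuous_at_imp_continuous_within)
 then have muI: "emeasure mu {a<..b} = ennreal (F b - F a)" if "a <= b" for a b using that by simp
 have "emeasure nu {a<..b} = ennreal (if a <= b then G b - G a else 0)" for a b unfolding nu_def
  using Gm Gc by (subst emeasure_interval_measure_Ioc_eq) (auto simp: continuous_on_eq_continuous_at continuous_at_imp_continuous_within)
 then have nuI: "emeasure nu {a<..b} = ennreal (G b - G a)" if "a <= b" for a b using that by simp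
 have smu: "sets mu = sets borel" "sets nu = sets borel" by (simp_all add: mu_def nu_def)
 \<comment> \<open>The sum of the two measures divided by \<open>L\<close>, made into a measure so
   that it can be identified with \<open>lborel\<close> on half-open intervals.\<close>
 define m where "m = (%A. (emeasure mu A+emeasure nu A)*ennreal (1/L))"
 define K where "K = measure_of (UNIV :: real set) (sets borel) m"
 have sK: "sets K = sets borel" unfolding K_def by (simp add: sets.sigma_sets_eq[of borel, simplified])
 have ca: "countably_additive (sets borel) m" unfolding countably_additive_def
 proof (intro allI impI)
  fix A :: "nat => real set" assume A: "range A \<subseteq> sets borel" "disjoint_family A"
  have "(\<Sum>i. m (A i)) = (\<Sum>i. emeasure mu (A i)+emeasure nu (A i))*ennreal (1/L)" unfolding m_def by simp
  also have "(\<Sum>i. emeasure mu (A i)+emeasure nu (A i)) = (\<Sum>i. emeasure mu (A i))+(\<Sum>i. emeasure nu (A i))"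
  by (rule suminf_add[symmetric]) auto
  also have "... = emeasure mu (\<Union>i. A i)+emeasure nu (\<Union>i. A i)" using A smu by (simp add: suminf_emeasure)
  finally show "(\<Sum>i. m (A i)) = m (\<Union>i. A i)" by (simp add: m_def)
 qed
 have eK: "emeasure K A = m A" if "A \<in> sets borel" for A
  by (rule emeasure_measure_of[OF K_def]) (use that ca sK in \<open>auto simp: positive_def m_def\<close>)
 have Km: "K = lborel"
 proof (rule measure_eqI_generator_eq[OF Int_stable_Ioc, of UNIV _ _ "%i. {- real i<..real i}"])
  show "emeasure K X = emeasure lborel X" if Xr: "X \<in> range (%(a, b). {a<..b::real})" for X
  proof -
  obtain a b where X: "X = {a<..b}" using Xr by auto
  show ?thesis
  proof (cases "a <= b")
  case True
  have 1: "0 <= F b - F a" "0 <= G b - G a" using monoD[OF F(1) True] Gm[OF True] by simp_all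
  have "F b - F a+(G b - G a) = L*(b - a)" by (simp add: G_def algebra_simps)
  then have "emeasure mu X+emeasure nu X = ennreal (L*(b - a))"
  unfolding X muI[OF True] nuI[OF True] ennreal_plus[OF 1, symmetric] by simp
  then have "m X = ennreal (L*(b - a)*(1/L))" unfolding m_def using L True by (simp add: ennreal_mult[symmetric])
  also have "L*(b - a)*(1/L) = b - a" using L by simp
  finally show ?thesis using eK[of X] True by (simp add: X)
  next
  case False
  then have "X = {}" by (simp add: X)
  then show ?thesis by simp
  qed
  qed
  show "sets K = sigma_sets UNIV (range (%(a, b). {a<..b::real}))" "sets lborel = sigma_sets UNIV (range (%(a, b). {a<..b::real}))"
  unfolding sK by (simp_all add: borel_sigma_sets_Ioc)
  show "emeasure K {- real i<..real i} ~= \<infinity>" for i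
  using eK[of "{- real i<..real i}"] muI[of "- real i" "real i"] nuI[of "- real i" "real i"]
  by (simp add: m_def ennreal_mult_eq_top_iff)
  show "(\<Union>i. {- real i<..real i}) = UNIV"
  proof -
  have "\<exists>i. x \<in> {- real i<..real i}" for x
  proof -
  obtain i where "\<bar>x\<bar> < real i" using reals_Archimedean2 by blast
  then have "x \<in> {- real i<..real i}" by auto
  then show ?thesis by blast
  qed
  then show ?thesis by blast
  qed
 qed auto
 have Leb: "emeasure lborel A = (emeasure mu A+emeasure nu A)*ennreal (1/L)" if "A \<in> sets borel" for A
  using eK[OF that] unfolding Km m_def .
 have "absolutely_continuous lborel mu" "absolutely_continuous lborel nu"
  unfolding absolutely_continuous_def null_sets_def using Leb L smu by auto
 then have d: "density lborel (RN_deriv lborel mu) = mu" "density lborel (RN_deriv lborel nu) = nu"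
  using smu by (auto intro!: sigma_finite_measure.density_RN_deriv[OF lborel.sigma_finite_measure_axioms])
 define p where "p = RN_deriv lborel mu"
 define q where "q = RN_deriv lborel nu"
 have pm [measurable]: "p \<in> borel_measurable borel" and qm [measurable]: "q \<in> borel_measurable borel"
  unfolding p_def q_def using borel_measurable_RN_deriv[of lborel] by auto
 have pI: "(\<integral>\<^sup>+x. p x*indicator A x \<partial>lborel) = emeasure mu A" and qI: "(\<integral>\<^sup>+x. q x*indicator A x \<partial>lborel) = emeasure nu A"
  if "A \<in> sets borel" for A
  using emeasure_density[of p lborel A] emeasure_density[of q lborel A] that d unfolding p_def[symmetric] q_def[symmetric] by simp_all
 have "density lborel (%x. p x+q x) = density lborel (%x. ennreal L)"
 proof (rule measure_eqI)
  fix A assume "A \<in> sets (density lborel (%x. p x+q x))"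
  then have A: "A \<in> sets borel" by simp
  have "emeasure (density lborel (%x. p x+q x)) A = (\<integral>\<^sup>+x. p x*indicator A x+q x*indicator A x \<partial>lborel)"
  using A by (simp add: emeasure_density distrib_right)
  also have "... = emeasure mu A+emeasure nu A" using A by (subst nn_integral_add) (simp_all add: pI qI)
  also have "... = (emeasure mu A+emeasure nu A)*(ennreal (1/L)*ennreal L)" using L by (simp add: ennreal_mult[symmetric])
  also have "... = ennreal L*emeasure lborel A" using Leb[OF A] by (simp add: mult_ac)
  finally show "emeasure (density lborel (%x. p x+q x)) A = emeasure (density lborel (%x. ennreal L)) A"
  using A by (simp add: emeasure_density nn_integral_cmult_indicator)
 qed simp
 then have "AE x in lborel. p x+q x = ennreal L"
  by (intro sigma_finite_measure.density_unique[OF lborel.sigma_finite_measure_axioms]) auto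
 then have pL: "AE x in lborel. p x <= ennreal L" by eventually_elim (metis le_add_same_cancel1 zero_le le_iff_add)
 \<comment> \<open>The minimum makes the bound by \<open>L\<close> hold everywhere and not just
   almost everywhere.\<close>
 define g where "g = (%x. min L (enn2real (p x)))"
 have gm: "g \<in> borel_measurable borel" unfolding g_def by measurable
 have gp: "AE x in lborel. ennreal (g x) = p x" using pL
 proof eventually_elim
  case (elim x)
  then have "enn2real (p x) <= enn2real (ennreal L)" by (intro enn2real_mono) auto
  then have "g x = enn2real (p x)" using L by (simp add: g_def)
  moreover have "p x < top" using elim by (rule order_le_less_trans) simp
  ultimately show ?case by simp
 qed
 have "(LINT x|lborel. indicator {a<..b} x*g x) = F b - F a" if ab: "a <= b" for a b
 proof -
  have "(LINT x|lborel. indicator {a<..b} x*g x) = enn2real (\<integral>\<^sup>+x. ennreal (indicator {a<..b} x*g x) \<partial>lborel)"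
  using gm L by (intro integral_eq_nn_integral) (auto simp: g_def)
  also have "(\<integral>\<^sup>+x. ennreal (indicator {a<..b} x*g x) \<partial>lborel) = (\<integral>\<^sup>+x. p x*indicator {a<..b} x \<partial>lborel)"
  proof (rule nn_integral_cong_AE)
  show "AE x in lborel. ennreal (indicator {a<..b} x*g x) = p x*indicator {a<..b} x"
  using gp by eventually_elim (auto simp: indicator_def)
  qed
  also have "... = ennreal (F b - F a)" using pI[of "{a<..b}"] muI[OF ab] by simp
  finally show ?thesis using monoD[OF F(1) ab] by simp
 qed
 then show ?thesis using gm L by (intro exI[of _ g]) (auto simp: g_def)
qed

text \<open>Integration by parts as Fubini: \<open>g x*deriv phi z\<close> is integrated over
  \<open>- r < x <= z <= r\<close> in both orders.\<close>

lemma density_W1inf_deriv: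
 assumes F: "mono F" "!!x. \<bar>F x\<bar> <= B" and g: "g \<in> borel_measurable borel" "!!x. 0 <= g x" "!!x. g x <= L"
  and I: "!!a b. a <= b ==> (LINT x|lborel. indicator {a<..b} x*g x) = F b - F a" shows "W1inf_deriv F g"
proof -
 have Fm: "F \<in> borel_measurable borel" by (rule borel_measurable_mono[OF F(1)])
 have gL: "\<bar>g x\<bar> <= L" for x using g(2,3)[of x] by simp
 have "Linf F" unfolding Linf_def using Fm F(2) by (intro conjI exI[of _ B]) auto
 moreover have "Linf g" unfolding Linf_def using g(1) gL by (intro conjI exI[of _ L]) auto
 moreover have "(LINT x|lborel. F x*deriv phi x) = - (LINT x|lborel. g x*phi x)" if phi: "test_fun phi" for phi
 proof -
  obtain R where R: "!!x. R < \<bar>x\<bar> ==> phi x = 0" using phi unfolding test_fun_def by blast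
  define r where "r = \<bar>R\<bar>+1"
  have out: "phi x = 0" if "r <= \<bar>x\<bar>" for x using R[of x] that by (simp add: r_def)
  have r: "0 < r" by (simp add: r_def)
  have D: "(phi has_real_derivative deriv phi x) (at x)" for x
  using phi unfolding test_fun_def by (simp add: DERIV_deriv_iff_real_differentiable)
  have dc: "continuous_on UNIV (deriv phi)" using phi by (simp add: test_fun_def)
  have dout: "deriv phi x = 0" if "r < \<bar>x\<bar>" for x
  proof (rule DERIV_imp_deriv)
  have o: "open {z. r < \<bar>z\<bar>}" by (intro open_Collect_less continuous_intros)
  have "((%z. 0) has_real_derivative 0) (at x)" by simp
  then show "(phi has_real_derivative 0) (at x)" by (rule DERIV_cong_ev[THEN iffD1, rotated -1])
  (use that o out in \<open>auto simp: eventually_nhds intro!: exI[of _ "{z. r < \<bar>z\<bar>}"]\<close>)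
  qed
  obtain C where C: "!!x. x \<in> {-r..r} ==> \<bar>deriv phi x\<bar> <= C"
  proof -
  have "bounded (deriv phi ` {-r..r})" by (intro compact_imp_bounded compact_continuous_image continuous_on_subset[OF dc]) auto
  then obtain C where "\<forall>x\<in>{-r..r}. \<bar>deriv phi x\<bar> <= C" unfolding bounded_iff by auto
  then show thesis using that by blast
  qed
  define f where "f = (%x z. if - r < x & x <= z & z <= r then g x*deriv phi z else 0)"
  have dm [measurable]: "deriv phi \<in> borel_measurable borel" by (rule borel_measurable_continuous_onI[OF dc])
  note g(1)[measurable] Fm[measurable]
  have int: "integrable (lborel \<Otimes>\<^sub>M lborel) (case_prod f)"
  proof (rule integrableI_bounded_set[where A = "{-r..r} \<times> {-r..r}" and B = "L * C"])
  show "{-r..r} \<times> {-r..r} \<in> sets (lborel \<Otimes>\<^sub>M lborel)" by simp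
  show "case_prod f \<in> borel_measurable (lborel \<Otimes>\<^sub>M lborel)" unfolding f_def by measurable
  show "emeasure (lborel \<Otimes>\<^sub>M lborel) ({-r..r} \<times> {-r..r}) < \<infinity>"
  by (subst lborel.emeasure_pair_measure_Times) (use r in \<open>auto simp: ennreal_mult_less_top\<close>)
  have C0: "0 <= C" using C[of 0] r by simp
  have L0: "0 <= L" using gL[of 0] by simp
  show "AE p in lborel \<Otimes>\<^sub>M lborel. p \<in> {-r..r} \<times> {-r..r} --> norm (case_prod f p) <= L * C"
  proof (intro AE_I2 impI)
  fix p :: "real \<times> real" assume "p \<in> {-r..r} \<times> {-r..r}"
  then have "\<bar>g (fst p)\<bar>*\<bar>deriv phi (snd p)\<bar> <= L * C" using gL C L0 by (intro mult_mono) auto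
  then show "norm (case_prod f p) <= L * C" using C0 L0 by (simp add: f_def case_prod_unfold abs_mult)
  qed
  show "AE p in lborel \<Otimes>\<^sub>M lborel. p \<notin> {-r..r} \<times> {-r..r} --> case_prod f p = 0"
  by (intro AE_I2) (auto simp: f_def split: if_splits)
  qed
  have 1: "(LINT z|lborel. f x z) = - (g x*phi x)" for x
  proof (cases "- r < x & x <= r")
  case True
  have "(LINT z|lborel. f x z) = (LINT z|lborel. g x*(deriv phi z*indicator {x..r} z))"
  by (rule Bochner_Integration.integral_cong) (use True in \<open>auto simp: f_def indicator_def\<close>)
  also have "... = g x*(LINT z|lborel. deriv phi z*indicator {x..r} z)" by simp
  also have "(LINT z|lborel. deriv phi z*indicator {x..r} z) = phi r - phi x"
  by (rule integral_FTC_Icc_real) (use True D dc in \<open>auto simp: continuous_on_eq_continuous_at\<close>)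
  finally show ?thesis using out[of r] by simp
  next
  case False
  then have "f x z = 0" for z by (auto simp: f_def)
  moreover have "phi x = 0" by (rule out) (use False in linarith)
  ultimately show ?thesis by simp
  qed
  have 2: "(LINT x|lborel. f x z) = F z*deriv phi z - F (- r)*deriv phi z" for z
  proof (cases "- r <= z & z <= r")
  case True
  have "(LINT x|lborel. f x z) = (LINT x|lborel. deriv phi z*(indicator {-r<..z} x*g x))"
  by (rule Bochner_Integration.integral_cong) (use True in \<open>auto simp: f_def indicator_def\<close>)
  also have "... = deriv phi z*(F z - F (- r))" using I[of "- r" z] True by simp
  finally show ?thesis by (simp add: algebra_simps)
  next
  case False
  then have "f x z = 0" for x by (auto simp: f_def)
  moreover have "deriv phi z = 0" by (rule dout) (use False in linarith)
  ultimately show ?thesis by simp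
  qed
  have i1: "integrable lborel (%z. h z*deriv phi z)" if "h \<in> borel_measurable borel" "!!z. \<bar>h z\<bar> <= B" for h
  proof (rule integrableI_bounded_set[where A = "{-r..r}" and B = "B * C"])
  have B0: "0 <= B" using that(2)[of 0] by simp
  show "AE x in lborel. x \<in> {-r..r} --> norm (h x*deriv phi x) <= B * C"
  using that(2) C B0 by (auto simp: abs_mult intro!: mult_mono)
  show "AE x in lborel. x \<notin> {-r..r} --> h x*deriv phi x = 0" using dout by auto
  qed (use that r in auto)
  \<comment> \<open>One order of integration leaves the constant \<open>F (- r)\<close> as a factor
    of \<open>deriv phi\<close>, whose integral is 0.\<close>
  have d0: "(LINT z|lborel. deriv phi z) = 0"
  proof -
  have "(LINT z|lborel. deriv phi z) = (LINT z|lborel. deriv phi z*indicator {-r..r} z)"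
  proof (rule Bochner_Integration.integral_cong[OF refl])
  show "deriv phi z = deriv phi z*indicator {-r..r} z" for z using dout[of z] by (cases "r < \<bar>z\<bar>") (auto simp: abs_le_iff indicator_def)
  qed
  also have "... = phi r - phi (- r)"
  by (rule integral_FTC_Icc_real) (use r D dc in \<open>auto simp: continuous_on_eq_continuous_at\<close>)
  finally show ?thesis using out[of r] out[of "- r"] by simp
  qed
  have "- (LINT x|lborel. g x*phi x) = (LINT x|lborel. (LINT z|lborel. f x z))" unfolding 1 by simp
  also have "... = (LINT z|lborel. (LINT x|lborel. f x z))" by (rule lborel_pair.Fubini_integral[OF int, symmetric])
  also have "... = (LINT z|lborel. F z*deriv phi z) - (LINT z|lborel. F (- r)*deriv phi z)"
  unfolding 2 by (rule Bochner_Integration.integral_diff[OF i1[OF Fm F(2)] i1[of "%_. F (- r)", OF _ F(2)]]) simp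
  also have "(LINT z|lborel. F (- r)*deriv phi z) = 0" using d0 by simp
  finally show ?thesis by simp
 qed
 ultimately show ?thesis unfolding W1inf_deriv_def by blast
qed

text \<open>The functions \<open>h\<close> with continuous pairing include the indicators of
  intervals and are closed under linear combinations and, as \<open>G\<close> is bounded uniformly
  in \<open>t\<close>, under dominated limits. A pi-lambda argument reaches Borel sets, and
  induction all integrable functions.\<close>

lemma weak_star_continuous:
 fixes G :: "'t::topological_space => real => real"
 assumes G: "!!t. G t \<in> borel_measurable borel" "!!t x. \<bar>G t x\<bar> <= L"
  and I: "!!a b. a <= b ==> continuous_on S (%t. LINT x|lborel. indicator {a<..b} x*G t x)" and h: "integrable lborel h"
 shows "continuous_on S (%t. LINT x|lborel. h x*G t x)"
proof -
 define P where "P h \<longleftrightarrow> continuous_on S (%t. LINT x|lborel. h x*G t x)" for h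
 have L0: "0 <= L" using G(2)[of undefined 0] by linarith
 have hG: "integrable lborel (%x. h x*G t x)" if "integrable lborel h" for h t
 proof (rule Bochner_Integration.integrable_bound[of lborel "%x. L*h x"])
  show "AE x in lborel. norm (h x*G t x) <= norm (L*h x)"
  proof (intro AE_I2)
  fix x have "\<bar>h x\<bar>*\<bar>G t x\<bar> <= \<bar>h x\<bar>*L" using G(2) by (intro mult_left_mono) auto
  then show "norm (h x*G t x) <= norm (L*h x)" using L0 by (simp add: abs_mult mult_ac)
  qed
 qed (use that G(1) in auto)
 have lim: "P f" if s: "!!i. integrable lborel (s i)" "!!i. P (s i)" "!!x. (%i. s i x) \<longlonglongrightarrow> f x"
  "!!i x. \<bar>s i x\<bar> <= w x" and w: "integrable lborel w" and f: "integrable lborel f" for s :: "nat => real => real" and f w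
 proof -
  have "(%i. LINT x|lborel. \<bar>s i x - f x\<bar>) \<longlonglongrightarrow> (LINT (x::real)|lborel. 0)"
  proof (rule integral_dominated_convergence[where w = "%x. w x+\<bar>f x\<bar>"])
  show "AE x in lborel. (%i. \<bar>s i x - f x\<bar>) \<longlonglongrightarrow> 0"
  proof (intro AE_I2)
  fix x
  have "(%i. \<bar>s i x - f x\<bar>) \<longlonglongrightarrow> \<bar>f x - f x\<bar>" by (intro tendsto_intros s(3))
  then show "(%i. \<bar>s i x - f x\<bar>) \<longlonglongrightarrow> 0" by simp
  qed
  show "AE x in lborel. norm \<bar>s i x - f x\<bar> <= w x+\<bar>f x\<bar>" for i
  proof (intro AE_I2)
  fix x show "norm \<bar>s i x - f x\<bar> <= w x+\<bar>f x\<bar>" using s(4)[of i x] by simp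
  qed
  qed (use s(1) f w in auto)
  then have z: "(%i. L*(LINT x|lborel. \<bar>s i x - f x\<bar>)) \<longlonglongrightarrow> L*0" by (intro tendsto_mult_left) simp
  have "uniform_limit S (%i t. LINT x|lborel. s i x*G t x) (%t. LINT x|lborel. f x*G t x) sequentially" unfolding uniform_limit_iff
  proof (intro allI impI)
  fix e :: real assume "0 < e"
  then have "\<forall>\<^sub>F i in sequentially. L*(LINT x|lborel. \<bar>s i x - f x\<bar>) < e" by (intro order_tendstoD(2)[OF z]) simp
  then show "\<forall>\<^sub>F i in sequentially. \<forall>t\<in>S. dist (LINT x|lborel. s i x*G t x) (LINT x|lborel. f x*G t x) < e"
  proof eventually_elim
  case (elim i)
  show ?case
  proof
  fix t
  have sf: "integrable lborel (%x. s i x - f x)" using s(1) f by simp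
  have "(LINT x|lborel. s i x*G t x) - (LINT x|lborel. f x*G t x) = (LINT x|lborel. (s i x - f x)*G t x)"
  unfolding left_diff_distrib by (rule Bochner_Integration.integral_diff[OF hG[OF s(1)] hG[OF f], symmetric])
  also have "\<bar>...\<bar> <= (LINT x|lborel. \<bar>(s i x - f x)*G t x\<bar>)" by (rule integral_abs_bound)
  also have "... <= (LINT x|lborel. L*\<bar>s i x - f x\<bar>)"
  proof (rule integral_mono)
  show "\<bar>(s i x - f x)*G t x\<bar> <= L*\<bar>s i x - f x\<bar>" for x
  unfolding abs_mult using mult_left_mono[OF G(2)[of t x] abs_ge_zero[of "s i x - f x"]] by (simp add: mult.commute)
  qed (use hG[OF sf] sf in auto)
  also have "... = L*(LINT x|lborel. \<bar>s i x - f x\<bar>)" by simp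
  finally show "dist (LINT x|lborel. s i x*G t x) (LINT x|lborel. f x*G t x) < e" using elim by (simp add: dist_real_def)
  qed
  qed
  qed
  then show ?thesis unfolding P_def by (rule uniform_limit_theorem[rotated]) (use s(2) in \<open>auto simp: P_def\<close>)
 qed
 have add: "P (%x. f x+g x)" if "integrable lborel f" "P f" "integrable lborel g" "P g" for f g
  using that(2,4) unfolding P_def distrib_right
  by (subst Bochner_Integration.integral_add[OF hG[OF that(1)] hG[OF that(3)]]) (rule continuous_on_add)
 have cm: "P (%x. c*f x)" if "P f" for c f
  using continuous_on_mult_left[OF that[unfolded P_def], of c] unfolding P_def mult.assoc by simp
 \<comment> \<open>Sets are intersected with bounded intervals so that complements keep finite
   measure.\<close>
 define J where "J n = {- real n<..real n}" for n
 have iJ: "integrable lborel (%x. indicator (A \<inter> J n) x :: real)" if "A \<in> sets borel" for A n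
 proof (rule integrable_real_indicator)
  have "emeasure lborel (A \<inter> J n) <= emeasure lborel (J n)" using that by (intro emeasure_mono) (auto simp: J_def)
  also have "... < \<infinity>" by (simp add: J_def)
  finally show "emeasure lborel (A \<inter> J n) < \<infinity>" .
 qed (use that in \<open>auto simp: J_def\<close>)
 have PI: "P (indicator {a<..b})" for a b :: real using I[of a b] unfolding P_def by (cases "a <= b") auto
 have PJ: "P (indicator (A \<inter> J n))" if A: "A \<in> sets borel" for A n
 proof -
  have "A \<in> sigma_sets UNIV (range (%(a, b). {a <.. b::real}))" using A by (simp add: borel_sigma_sets_Ioc)
  with Int_stable_Ioc subset_UNIV[of "range (%(a, b). {a <.. b::real})", folded Pow_UNIV] show ?thesis
  proof (induction rule: sigma_sets_induct_disjoint)
  case (basic A)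
  then obtain a b where "A = {a<..b}" by auto
  then have "A \<inter> J n = {max a (- real n)<..min b (real n)}" by (auto simp: J_def)
  then show ?case using PI by simp
  next
  case empty
  then show ?case by (simp add: P_def)
  next
  case (compl A)
  then have A: "A \<in> sets borel" by (simp add: borel_sigma_sets_Ioc)
  have "P (%x. indicator (UNIV \<inter> J n) x+(- 1)*indicator (A \<inter> J n) x)"
  by (rule add) (use iJ[OF A] iJ[of UNIV] cm[OF compl(2), of "- 1"] PI in \<open>auto simp: J_def\<close>)
  also have "(%x. indicator (UNIV \<inter> J n) x+(- 1)*indicator (A \<inter> J n) x) = (indicator ((UNIV - A) \<inter> J n) :: real => real)"
  by (auto simp: indicator_def fun_eq_iff)
  finally show ?case .
  next
  case (union A)
  then have A: "A i \<in> sets borel" for i by (auto simp: borel_sigma_sets_Ioc)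
  have U: "(\<Union>i. A i) \<in> sets borel" "(\<Union>i<k. A i) \<in> sets borel" for k using A by auto
  show ?case
  proof (rule lim[where s = "%k. indicator ((\<Union>i<k. A i) \<inter> J n)" and w = "indicator (UNIV \<inter> J n)"])
  show "P (indicator ((\<Union>i<k. A i) \<inter> J n))" for k
  proof (induction k)
  case 0 then show ?case by (simp add: P_def)
  next
  case (Suc k)
  have dis: "x \<notin> A i" if "x \<in> A k" "i < k" for x i
  using union(1) that unfolding disjoint_family_on_def by (metis IntI UNIV_I empty_iff less_irrefl)
  have e: "(indicator ((\<Union>i<Suc k. A i) \<inter> J n) :: real => real) = (%x. indicator ((\<Union>i<k. A i) \<inter> J n) x+indicator (A k \<inter> J n) x)"
  proof
  fix x
  show "indicator ((\<Union>i<Suc k. A i) \<inter> J n) x = (indicator ((\<Union>i<k. A i) \<inter> J n) x+indicator (A k \<inter> J n) x :: real)"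
  using dis[of x] by (cases "x \<in> A k") (auto simp: indicator_def lessThan_Suc)
  qed
  show ?case unfolding e by (rule add[OF iJ[OF U(2)] Suc iJ[OF A] union(3)])
  qed
  show "(%k. indicator ((\<Union>i<k. A i) \<inter> J n) x) \<longlonglongrightarrow> (indicator ((\<Union>i. A i) \<inter> J n) x :: real)" for x
  unfolding indicator_inter_arith by (intro tendsto_mult tendsto_const LIMSEQ_indicator_UN)
  show "integrable lborel (indicator ((\<Union>i<k. A i) \<inter> J n) :: real => real)" for k by (rule iJ[OF U(2)])
  show "integrable lborel (indicator (UNIV \<inter> J n) :: real => real)" by (rule iJ) simp
  show "integrable lborel (indicator ((\<Union>i. A i) \<inter> J n) :: real => real)" by (rule iJ[OF U(1)])
  show "\<bar>indicator ((\<Union>i<k. A i) \<inter> J n) x\<bar> <= (indicator (UNIV \<inter> J n) x :: real)" for k x by (simp add: indicator_def)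
  qed
  qed
 qed
 from h have "P h"
 proof (induction rule: integrable_induct)
  case (base A c)
  have A: "A \<in> sets borel" using base by simp
  have iA: "integrable lborel (%x. indicator A x :: real)" using base by (intro integrable_real_indicator) auto
  have "P (%x. c*indicator A x)"
  proof (rule lim[where s = "%n x. c*indicator (A \<inter> J n) x" and w = "%x. \<bar>c\<bar>*indicator A x"])
  show "(%n. c*indicator (A \<inter> J n) x) \<longlonglongrightarrow> c*indicator A x" for x
  proof (rule tendsto_eventually)
  obtain N where N: "\<bar>x\<bar> < real N" using reals_Archimedean2 by blast
  show "\<forall>\<^sub>F n in sequentially. c*indicator (A \<inter> J n) x = c*indicator A x" using eventually_ge_at_top[of N]
  proof eventually_elim
  case (elim n)
  then have "x \<in> J n" using N by (auto simp: J_def abs_less_iff)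
  then show ?case by (simp add: indicator_def)
  qed
  qed
  show "P (%x. c*indicator (A \<inter> J n) x)" for n by (rule cm[OF PJ[OF A]])
  show "\<bar>c*indicator (A \<inter> J n) x\<bar> <= \<bar>c\<bar>*indicator A x" for n x by (simp add: abs_mult indicator_def)
  qed (use iJ[OF A] iA in auto)
  then show ?case by (simp add: mult.commute)
 next
  case (add f g)
  show ?case by (rule \<open>!!g f. integrable lborel f ==> P f ==> integrable lborel g ==> P g ==> P (%x. f x+g x)\<close>) (use add in auto)
 next
  case (lim f s)
  show ?case by (rule \<open>!!s f w. (!!i. integrable lborel (s i)) ==> (!!i. P (s i)) ==> (!!x. (%i. s i x) \<longlonglongrightarrow> f x) ==>
  (!!i x. \<bar>s i x\<bar> <= w x) ==> integrable lborel w ==> integrable lborel f ==> P f\<close>[where s = s and w = "%x. 2*\<bar>f x\<bar>"])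
  (use lim in auto)
 qed
 then show ?thesis unfolding P_def .
qed

text \<open>The densities are chosen separately for each \<open>t\<close>, with no regularity in
  \<open>t\<close>. Continuity enters through their integrals over intervals, which are increments
  of \<open>v\<close>.\<close>

lemma C_W1infI:
 assumes v: "BUC_on (Qbar T) v" and T: "0 < T" and L: "0 < L" and mono: "!!t. t \<in> {0..T} ==> mono (%x. v (x, t))"
  and Lip: "!!x y t. t \<in> {0..T} ==> x <= y ==> v (y, t) - v (x, t) <= L*(y - x)" shows "C_W1inf T v" unfolding C_W1inf_def
proof (intro conjI ballI)
 fix t0 assume t0: "t0 \<in> {0..T}"
 show "uniform_limit UNIV (%t x. v (x, t)) (%x. v (x, t0)) (at t0 within {0..T})" unfolding uniform_limit_iff
 proof (intro allI impI)
  fix e :: real assume "0 < e"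
  then obtain d where d: "0 < d" "!!p q. p \<in> Qbar T ==> q \<in> Qbar T ==> dist q p < d ==> dist (v q) (v p) < e"
  using v unfolding BUC_on_def uniformly_continuous_on_def by metis
  show "\<forall>\<^sub>F t in at t0 within {0..T}. \<forall>x\<in>UNIV. dist (v (x, t)) (v (x, t0)) < e" unfolding eventually_at
  proof (intro exI[of _ d] conjI ballI impI)
  fix t x assume "t \<in> {0..T}" "t ~= t0 & dist t t0 < d"
  then show "dist (v (x, t)) (v (x, t0)) < e" using t0 by (intro d(2)) (auto simp: Qbar_def dist_prod_def)
  qed (rule d(1))
 qed
next
 obtain B where B: "!!p. p \<in> Qbar T ==> \<bar>v p\<bar> <= B" using v unfolding BUC_on_def bounded_iff by auto
 have "\<forall>t. \<exists>g. t \<in> {0..T} --> g \<in> borel_measurable borel & (\<forall>x. 0 <= g x & g x <= L) &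
  (\<forall>a b. a <= b --> (LINT x|lborel. indicator {a<..b} x*g x) = v (b, t) - v (a, t))"
 proof
  fix t
  show "\<exists>g. t \<in> {0..T} --> g \<in> borel_measurable borel & (\<forall>x. 0 <= g x & g x <= L) &
  (\<forall>a b. a <= b --> (LINT x|lborel. indicator {a<..b} x*g x) = v (b, t) - v (a, t))"
  proof (cases "t \<in> {0..T}")
  case True
  show ?thesis by (rule exE[OF Lipschitz_density[where F = "%x. v (x, t)", OF mono[OF True] Lip[OF True] L]], assumption)
  (rule exI, rule impI, assumption)
  qed (intro exI[of _ undefined] impI, simp)
 qed
 from choice[OF this] obtain g where g: "!!t. t \<in> {0..T} ==> g t \<in> borel_measurable borel & (\<forall>x. 0 <= g t x & g t x <= L) &
  (\<forall>a b. a <= b --> (LINT x|lborel. indicator {a<..b} x*g t x) = v (b, t) - v (a, t))" by blast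
 \<comment> \<open>Set to 0 outside the time interval, so that the bounds hold for all
   \<open>t\<close>.\<close>
 define G where "G t = (if t \<in> {0..T} then g t else (%x. 0))" for t
 have G: "G t \<in> borel_measurable borel" "0 <= G t x" "G t x <= L" for t x using g[of t] L by (auto simp: G_def)
 have GI: "(LINT x|lborel. indicator {a<..b} x*G t x) = v (b, t) - v (a, t)" if "t \<in> {0..T}" "a <= b" for t a b
  using g[OF that(1)] that by (simp add: G_def)
 have GL: "\<bar>G t x\<bar> <= L" for t x using G(2,3)[of t x] by simp
 show "\<exists>vx C. (\<forall>t\<in>{0..T}. W1inf_deriv (%x. v (x, t)) (%x. vx (x, t)) & (AE x in lborel. \<bar>vx (x, t)\<bar> <= C)) &
  (\<forall>g. integrable lborel g --> continuous_on {0..T} (%t. LINT x|lborel. g x * vx (x, t)))"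
 proof (intro exI[of _ "%(x, t). G t x"] exI[of _ L] conjI ballI allI impI)
  fix t assume t: "t \<in> {0..T}"
  have "W1inf_deriv (%x. v (x, t)) (G t)"
  by (rule density_W1inf_deriv[OF mono[OF t] _ G GI[OF t], of B]) (use t B in \<open>auto simp: Qbar_def\<close>)
  then show "W1inf_deriv (%x. v (x, t)) (%x. case (x, t) of (x, t) => G t x)" by simp
  show "AE x in lborel. \<bar>case (x, t) of (x, t) => G t x\<bar> <= L" using GL by simp
 next
  fix h :: "real => real" assume h: "integrable lborel h"
  have "continuous_on {0..T} (%t. LINT x|lborel. h x*G t x)"
  proof (rule weak_star_continuous[OF G(1) GL _ h])
  fix a b :: real assume ab: "a <= b"
  have vc: "continuous_on {0..T} (%t. v (x, t))" for x
  by (rule continuous_on_compose2[OF BUC_cont(2)[OF v]]) (auto intro!: continuous_intros simp: Qbar_def)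
  have "continuous_on {0..T} (%t. v (b, t) - v (a, t))" by (intro continuous_intros vc)
  then show "continuous_on {0..T} (%t. LINT x|lborel. indicator {a<..b} x*G t x)" by (rule continuous_on_eq) (simp add: GI ab)
  qed
  then show "continuous_on {0..T} (%t. LINT x|lborel. h x*(case (x, t) of (x, t) => G t x))" by simp
 qed
qed

lemma loc_unif_conv_cong:
 assumes l: "loc_unif_conv S f l" and e: "!!h q. 0 < h ==> q \<in> S ==> g h q = f h q" shows "loc_unif_conv S g l"
 unfolding loc_unif_conv_def
proof (intro allI impI)
 fix K assume K: "compact K & K \<subseteq> S"
 have "NEAR h. \<forall>q\<in>K. g h q = f h q" using eventually_at_right_less[of 0] by eventually_elim (use e K in blast)
 then have "uniform_limit K g l (at_right 0) \<longleftrightarrow> uniform_limit K f l (at_right 0)" by (rule uniform_limit_cong) simp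
 then show "uniform_limit K g l (at_right 0)" using l K unfolding loc_unif_conv_def by blast
qed

section \<open>Monotonicity and slopes of the limit, and the case of constant data\<close>

context approximation
begin

lemma solves_mono:
 assumes f: "adm f" and W: "solves f W" and t: "0 <= t" shows "mono (%x. W (x, t))"
proof (rule monoI)
 fix x y :: real assume "x <= y"
 then have "f z <= f (z+(y - x))" for z using f by (simp add: adm_def mono_def)
 from solves_shift(2)[OF W W t, of "y - x" x, OF this] show "W (x, t) <= W (y, t)" by simp
qed

text \<open>The datum translated by \<open>b\<close> is at most the datum plus \<open>L*b\<close>.
  This is compared on the level of the scheme, which commutes with adding constants, and then passed
  to the limit.\<close>

lemma solves_Lipschitz:
 assumes f: "adm f" "uniformly_continuous_on UNIV f" and W: "solves f W" and t: "0 <= t"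
  and Lip: "!!x y. x <= y ==> f y - f x <= L*(y - x)" and xy: "x <= y" shows "W (y, t) - W (x, t) <= L*(y - x)"
proof -
 define b where "b = y - x"
 have b: "0 <= b" using xy by (simp add: b_def)
 define fb where "fb = (%z. f (z+b))"
 have ev: "NEAR h. \<forall>x. fb (x+h) - fb x <= Lam h*h"
 proof -
  have "NEAR h. \<forall>x. f (x+h) - f x <= Lam h*h" using f(1) by (simp add: adm_def)
  then show ?thesis
  proof eventually_elim
  case (elim h)
  show ?case
  proof
  fix x show "fb (x+h) - fb x <= Lam h*h" using elim[rule_format, of "x+b"] by (simp add: fb_def add_ac)
  qed
  qed
 qed
 have afb: "adm fb" unfolding adm_def
 proof (intro conjI ev allI)
  show "mono fb" using f(1) by (simp add: adm_def fb_def mono_def)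
  show "\<bar>fb x\<bar> <= M" for x using f(1) by (simp add: adm_def fb_def)
 qed
 have ufb: "uniformly_continuous_on UNIV fb" unfolding uniformly_continuous_on_def fb_def
 proof (intro allI impI)
  fix e :: real assume "0 < e"
  then have "\<exists>d>0. \<forall>x\<in>UNIV. \<forall>x'\<in>UNIV. dist x' x < d --> dist (f x') (f x) < e"
  using f(2) unfolding uniformly_continuous_on_def by simp
  then obtain d where d: "0 < d" "!!x x'. dist x' x < d ==> dist (f x') (f x) < e" by auto
  have "dist (f (x'+b)) (f (x+b)) < e" if "dist x' x < d" for x x' by (rule d(2)) (use that in simp)
  then show "\<exists>d>0. \<forall>x\<in>UNIV. \<forall>x'\<in>UNIV. dist x' x < d --> dist (f (x'+b)) (f (x+b)) < e" using d(1) by blast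
 qed
 obtain Y where Y: "solves fb Y" using existence[OF afb ufb] by blast
 have "Y (x, t) = W (x+b, t)" using solves_shift[OF W Y t, of b x] by (intro antisym) (auto simp: fb_def)
 moreover have "Y (x, t) <= W (x, t)+L*b"
 proof (rule tendsto_le[of "at_right 0"])
  show "((%h. Vb fb h (x, t)) \<longlongrightarrow> Y (x, t)) (at_right 0)" using Y t by (simp add: solves_def)
  show "((%h. Vb f h (x, t)+L*b) \<longlongrightarrow> W (x, t)+L*b) (at_right 0)"
  using W t by (intro tendsto_add tendsto_const) (simp add: solves_def)
  have "fb z <= f z+L*b" for z using Lip[of z "z+b"] b by (simp add: fb_def)
  from Vb_comparison[OF afb f(1) this] show "NEAR h. Vb fb h (x, t) <= Vb f h (x, t)+L*b" by eventually_elim blast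
 qed simp
 ultimately show ?thesis by (simp add: b_def)
qed

lemma main:
 assumes f: "adm f" "uniformly_continuous_on UNIV f" and T: "0 < T" and Z: "\<forall>h>0. Z h = Vb f h"
 shows "\<exists>W. solves f W & BUC_on (Qbar T) W & loc_unif_conv (Qbar T) Z W & visc_sol m s T f W &
  (\<forall>w. visc_sol m s T f w --> (\<forall>p\<in>Qbar T. w p = W p))"
proof -
 obtain W where W: "solves f W" using existence[OF f] by blast
 have "loc_unif_conv (Qbar T) Z W" by (rule loc_unif_conv_cong[OF solves_main(1)[OF f W T]]) (simp add: Z)
 then show ?thesis by (intro exI[of _ W] conjI allI impI ballI W solves_BUC[OF W] solves_main(2)[OF f W T] solves_main(3)[OF f W T])
qed

end

text \<open>For constant data the (CFL) conditions may degenerate, and \<open>tau h\<close> need not tend to \<open>0\<close>. Since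
 the scheme is then stationary whatever its time step, another time step can be used.\<close>

lemma (in discretization) constant_data:
 assumes T: "0 < T" and Z: "!!h. 0 < h ==> Z h = interpolant h (tau h) (scheme m (om h) h (tau h) (%x. c))"
 shows "\<exists>v. BUC_on (Qbar T) v & C_W1inf T v & loc_unif_conv (Qbar T) Z v & visc_sol m s T (%x. c) v &
  (\<forall>w. visc_sol m s T (%x. c) w --> (\<forall>p\<in>Qbar T. w p = v p))"
proof -
 \<comment> \<open>Positive even for \<open>c = 0\<close>, so that (CFL1) for the substitute time
   step does not degenerate.\<close>
 define M where "M = \<bar>c\<bar>+1"
 have M: "0 < M" by (simp add: M_def)
 define C where "C = Cs*m*(2*M) powr (m - 1)"
 have C: "0 < C" using Cs_pos m2 M by (simp add: C_def)
 \<comment> \<open>The largest time step that (CFL1) with this \<open>M\<close> permits.\<close>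
 define tau' where "tau' h = h powr (2 * s+m - 1)/C" for h
 have t1: "NEAR h. 0 < tau' h" using eventually_at_right_less[of 0] by eventually_elim (use C in \<open>simp add: tau'_def\<close>)
 have t2: "NEAR h. (Cs*m*(2*M) powr (m - 1))*tau' h <= h powr (2 * s+m - 1)" unfolding C_def[symmetric] using C by (simp add: tau'_def)
 interpret A: approximation s m Cs om tau' "%h. 2*M/h" M by (rule approximation_CFL1[OF M t1 t2])
 have f: "A.adm (%x. c)" unfolding A.adm_def
 proof (intro conjI allI)
  show "mono (%x::real. c)" by (simp add: mono_def)
  show "\<bar>c\<bar> <= M" by (simp add: M_def)
  show "NEAR h. \<forall>x::real. c - c <= 2*M/h*h" using eventually_at_right_less[of 0] by eventually_elim (use M in simp)
 qed
 have Vc: "A.Vb (%x. c) h q = c" if "0 < h" for h q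
  unfolding A.Vb_def using interpolant_const[OF that, of "tau' h" c q] by (simp add: scheme_const[abs_def])
 have Zc: "Z h q = c" if "0 < h" for h q
  unfolding Z[OF that] using interpolant_const[OF that, of "tau h" c q] by (simp add: scheme_const[abs_def])
 have ZV: "\<forall>h>0. Z h = A.Vb (%x. c) h" using Zc Vc by auto
 have uc: "uniformly_continuous_on UNIV (%x::real. c)" by (rule uniformly_continuous_on_const)
 from A.main[where Z = Z, OF f uc T ZV] obtain W where W: "A.solves (%x. c) W" "BUC_on (Qbar T) W" "loc_unif_conv (Qbar T) Z W"
  "visc_sol m s T (%x. c) W" "\<forall>w. visc_sol m s T (%x. c) w --> (\<forall>p\<in>Qbar T. w p = W p)" by (elim exE conjE)
 have "C_W1inf T W"
 proof (rule C_W1infI[OF W(2) T zero_less_one])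
  fix t assume t: "t \<in> {0..T}"
  then show "mono (%x. W (x, t))" using A.solves_mono[OF f W(1)] by simp
  show "W (y, t) - W (x, t) <= 1*(y - x)" if "x <= y" for x y using A.solves_Lipschitz[OF f uc W(1), of t 1 x y] t that by simp
 qed
 then show ?thesis using W by (intro exI[of _ W] conjI)
qed

theorem theorem3p2:
  fixes s m T Cs M L :: real
    and v0 :: "real \<Rightarrow> real"
    and \<omega> :: "real \<Rightarrow> int \<Rightarrow> real"
    and J :: "real \<Rightarrow> nat"
    and \<tau> :: "real \<Rightarrow> real"
    and V :: "real \<Rightarrow> nat \<Rightarrow> int \<Rightarrow> real"
    and Vbar :: "real \<Rightarrow> real \<times> real \<Rightarrow> real"
  assumes "0 < s" "s < 1" "m \<ge> 2" "T > 0"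
    and "mono v0"
    and "\<And>h. h > 0 \<Longrightarrow> J h > 0"
    and "\<And>h. h > 0 \<Longrightarrow> \<tau> h = T / real (J h)"
    and "\<And>h k. h > 0 \<Longrightarrow> k \<noteq> 0 \<Longrightarrow> \<omega> h k = \<omega> h (- k) \<and> \<omega> h k \<ge> 0"
    and "A_c s \<omega>"
    and "A_m s Cs \<omega>"
    and "\<And>h. h > 0 \<Longrightarrow> V h = scheme m (\<omega> h) h (\<tau> h) v0"
    and "\<And>h. h > 0 \<Longrightarrow> Vbar h = interpolant h (\<tau> h) (V h)"
  shows
    "(BUC_on UNIV v0 \<and> CFL1 m s Cs M v0 \<tau> \<longrightarrow>
       (\<exists>v. BUC_on (Qbar T) v \<and> loc_unif_conv (Qbar T) Vbar v \<and>
            visc_sol m s T v0 v \<and>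
            (\<forall>w. visc_sol m s T v0 w \<longrightarrow> (\<forall>p\<in>Qbar T. w p = v p))))
     \<and>
     (W1inf v0 \<and> CFL2 m s Cs M L v0 \<tau> \<longrightarrow>
       (\<exists>v. C_W1inf T v \<and> loc_unif_conv (Qbar T) Vbar v \<and>
            visc_sol m s T v0 v \<and>
            (\<forall>w. visc_sol m s T v0 w \<longrightarrow> (\<forall>p\<in>Qbar T. w p = v p))))
     \<and>
     (\<forall>a. M > 0 \<and> (\<forall>x. v0 x = (if x < a then 0 else M)) \<and> CFL1 m s Cs M v0 \<tau> \<longrightarrow>
       (\<exists>v. Cb_on (Qbar T - {(a, 0)}) v \<and> loc_unif_conv (Qbar T - {(a, 0)}) Vbar v \<and>
            (\<forall>c\<in>{0..M}. disc_visc_sol m s T v0 (v((a, 0) := c))) \<and>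
            (\<forall>w. disc_visc_sol m s T v0 w \<longrightarrow>
               (\<forall>p\<in>Qbar T - {(a, 0)}.
                  snd p < T \<or> continuous (at p within Qbar T) w \<longrightarrow> w p = v p))))"
proof -
 note v0 = \<open>mono v0\<close> and T = \<open>T > 0\<close>
 interpret discretization s m Cs \<omega> by unfold_locales (rule assms(1,2,3,9,10) | (rule assms(8); assumption))+
 have \<tau>0: "0 < \<tau> h" if "0 < h" for h using assms(6,7)[OF that] T by simp
 have ev\<tau>: "NEAR h. 0 < \<tau> h" using eventually_at_right_less[of 0] by eventually_elim (rule \<tau>0)
 have Vbar: "Vbar h = interpolant h (\<tau> h) (scheme m (\<omega> h) h (\<tau> h) v0)" if "0 < h" for h
  using assms(11,12)[OF that] by simp
 show ?thesis
 proof (intro conjI impI allI)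
  assume A: "BUC_on UNIV v0 & CFL1 m s Cs M v0 \<tau>"
  then have M: "\<bar>v0 x\<bar> <= M" for x by (simp add: CFL1_def)
  have cfl: "NEAR h. (Cs*m*(2*M) powr (m - 1))*\<tau> h <= h powr (2 * s+m - 1)" using A by (simp add: CFL1_def)
  show "\<exists>v. BUC_on (Qbar T) v & loc_unif_conv (Qbar T) Vbar v & visc_sol m s T v0 v &
  (\<forall>w. visc_sol m s T v0 w --> (\<forall>p\<in>Qbar T. w p = v p))"
  proof (cases "0 < M")
  case True
  interpret A: approximation s m Cs \<omega> \<tau> "%h. 2*M/h" M by (rule approximation_CFL1[OF True ev\<tau> cfl])
  have f: "A.adm v0" unfolding A.adm_def
  proof (intro conjI allI v0 M)
  show "NEAR h. \<forall>x. v0 (x+h) - v0 x <= 2*M/h*h" using eventually_at_right_less[of 0]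
  proof eventually_elim
  case (elim h)
  show ?case
  proof
  fix x show "v0 (x+h) - v0 x <= 2*M/h*h" using M[of "x+h"] M[of x] elim by (simp add: abs_le_iff)
  qed
  qed
  qed
  have uc: "uniformly_continuous_on UNIV v0" using A by (simp add: BUC_on_def)
  have ZV: "\<forall>h>0. Vbar h = A.Vb v0 h" unfolding A.Vb_def using Vbar by simp
  from A.main[where Z = Vbar, OF f uc T ZV] show ?thesis by (elim exE conjE) (intro exI conjI)
  next
  \<comment> \<open>Here \<open>M = 0\<close>: the coefficient in (CFL1) is 0 and does not force
    \<open>\<tau>\<close> to tend to 0, but the datum is constant.\<close>
  case False
  then have "v0 = (%x. 0)" using M by (intro ext) (smt (verit))
  with constant_data[OF T, of Vbar \<tau> 0] Vbar show ?thesis by auto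
  qed
 next
  assume A: "W1inf v0 & CFL2 m s Cs M L v0 \<tau>"
  then have M: "\<bar>v0 x\<bar> <= M" for x by (simp add: CFL2_def)
  obtain g where g: "W1inf_deriv v0 g" "AE x in lborel. \<bar>g x\<bar> <= L" using A unfolding CFL2_def by blast
  have cfl: "NEAR h.
  (Cs*m*(if m = 2 then 1 else L powr (m - 2))*max L (2*M))*\<tau> h <= h powr (max (2 * s) 1)*f_cfl s h"
  using A unfolding CFL2_def by blast
  have L0: "0 <= L" by (rule W1inf_deriv_Lipschitz(1)[OF v0 M g order_refl])
  \<comment> \<open>(CFL2) bounds only the weak derivative; monotonicity of the datum turns this
    into the pointwise slope bound that the grid sees.\<close>
  have Lip: "v0 y - v0 x <= L*(y - x)" if "x <= y" for x y by (rule W1inf_deriv_Lipschitz(2)[OF v0 M g that])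
  have M0: "0 <= M" using M[of 0] by linarith
  show "\<exists>v. C_W1inf T v & loc_unif_conv (Qbar T) Vbar v & visc_sol m s T v0 v &
  (\<forall>w. visc_sol m s T v0 w --> (\<forall>p\<in>Qbar T. w p = v p))"
  proof (cases "L = 0")
  case False
  then have L: "0 < L" using L0 by simp
  interpret A: approximation s m Cs \<omega> \<tau> "%h. L" M by (rule approximation_CFL2[OF L M0 ev\<tau> cfl])
  have f: "A.adm v0" unfolding A.adm_def
  proof (intro conjI allI v0 M)
  show "NEAR h. \<forall>x. v0 (x+h) - v0 x <= L*h" using eventually_at_right_less[of 0]
  proof eventually_elim
  case (elim h)
  show ?case
  proof
  fix x show "v0 (x+h) - v0 x <= L*h" using Lip[of x "x+h"] elim by simp
  qed
  qed
  qed
  have uc: "uniformly_continuous_on UNIV v0"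
  proof (rule lipschitz_on_uniformly_continuous, rule lipschitz_onI)
  fix x y show "dist (v0 x) (v0 y) <= L*dist x y" using Lip[of x y] Lip[of y x] monoD[OF v0, of x y] monoD[OF v0, of y x]
  by (cases "x <= y") (auto simp: dist_real_def)
  qed (rule L0)
  have ZV: "\<forall>h>0. Vbar h = A.Vb v0 h" unfolding A.Vb_def using Vbar by simp
  from A.main[where Z = Vbar, OF f uc T ZV] obtain W where W: "A.solves v0 W" "BUC_on (Qbar T) W" "loc_unif_conv (Qbar T) Vbar W"
  "visc_sol m s T v0 W" "\<forall>w. visc_sol m s T v0 w --> (\<forall>p\<in>Qbar T. w p = W p)" by (elim exE conjE)
  have "C_W1inf T W"
  proof (rule C_W1infI[OF W(2) T L])
  fix t assume t: "t \<in> {0..T}"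
  then show "mono (%x. W (x, t))" using A.solves_mono[OF f W(1)] by simp
  show "W (y, t) - W (x, t) <= L*(y - x)" if "x <= y" for x y by (rule A.solves_Lipschitz[OF f uc W(1) _ Lip that]) (use t in auto)
  qed
  then show ?thesis using W by (intro exI[of _ W] conjI)
  next
  \<comment> \<open>Slope 0 makes the datum constant; for \<open>m > 2\<close> the coefficient in
    (CFL2) is then 0 as well.\<close>
  case True
  have "v0 x = v0 0" for x using Lip[of x 0] Lip[of 0 x] monoD[OF v0, of x 0] monoD[OF v0, of 0 x] True by (cases "x <= 0") auto
  then have "v0 = (%x. v0 0)" by (intro ext)
  then obtain c where c: "v0 = (%x. c)" by blast
  with constant_data[OF T, of Vbar \<tau> c] Vbar show ?thesis by auto
  qed
 next
  fix a assume A: "M > 0 & (\<forall>x. v0 x = (if x < a then 0 else M)) & CFL1 m s Cs M v0 \<tau>"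
  then have M: "0 < M" by blast
  have cfl: "NEAR h. (Cs*m*(2*M) powr (m - 1))*\<tau> h <= h powr (2 * s+m - 1)" using A by (simp add: CFL1_def)
  interpret A: approximation s m Cs \<omega> \<tau> "%h. 2*M/h" M by (rule approximation_CFL1[OF M ev\<tau> cfl])
  interpret A: jump s m Cs \<omega> \<tau> M a by unfold_locales (rule M)
  have H: "v0 = A.H" using A by (intro ext) (simp add: A.H_def)
  have "loc_unif_conv (Qbar T - {(a, 0)}) Vbar A.up" by (rule loc_unif_conv_cong[OF A.jump_main(2)[OF T]]) (simp add: Vbar A.Vb_def H)
  then show "\<exists>v. Cb_on (Qbar T - {(a, 0)}) v & loc_unif_conv (Qbar T - {(a, 0)}) Vbar v &
  (\<forall>c\<in>{0..M}. disc_visc_sol m s T v0 (v((a, 0) := c))) &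
  (\<forall>w. disc_visc_sol m s T v0 w -->
  (\<forall>p\<in>Qbar T - {(a, 0)}.
  snd p < T | continuous (at p within Qbar T) w --> w p = v p))" unfolding H
  by (intro exI[of _ A.up] conjI ballI allI impI A.jump_main(1)[OF T] A.jump_main(3)[OF T] A.jump_main(4)[OF T])
 qed
qed

end
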